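(* Fix a level $k\in\mathbb{C}$ and a conformal weight $\Delta\in\mathbb{C}$; all modules below have level $k$ and ground states of conformal weight $\Delta$. Let $\lambda\in\mathfrak{h}^*/\mathbb{Z}\alpha$ and $q,\sigma\in\mathbb{C}$. (1) The relaxed highest-weight $\widehat{\mathfrak{sl}}_2$-module $\widehat{\mathcal E}_{\lambda;q}$ is stringy and its string functions are given by $$\mathrm{s}_\nu[\widehat{\mathcal E}_{\lambda;q}]=\lim_{m\to\infty}\mathrm{s}_{-\mu-m\alpha}[\widehat{\mathcal L}^+_{-\mu-\alpha}],\qquad\text{for all }\nu\in\lambda,$$ where $\mu$ denotes any solution in $\mathfrak{h}^*$ of $(\mu,\mu+\alpha)=q$, if $\sqrt{1+2q}\notin\mathbb{Z}$, and the maximal such solution (with respect to the real part of its Dynkin label $\mu(h)$), if $\sqrt{1+2q}\in\mathbb{Z}$. (2) The Neveu–Schwarz relaxed highest-weight $\widehat{\mathfrak{osp}}(1|2)$-module ${}^{NS}\widehat{\mathcal E}_{\lambda;\sigma}$ is stringy. For $\sigma\notin\mathbb{Z}+\frac12$, its string functions are given by $$\mathrm{s}_\nu[{}^{NS}\widehat{\mathcal E}_{\lambda;\sigma}]=\lim_{m\to\infty}\mathrm{s}_{-\mu-m\omega}[{}^{NS}\widehat{\mathcal L}^+_{-\mu-\omega}],\qquad\text{for all }\nu\in\lambda\cup(\lambda+\omega),$$ where $\mu=(\sigma-\frac12)\omega$. This identity also holds for $\sigma\in\mathbb{Z}+\frac12$ when $\sigma>0$. When $\sigma\in\mathbb{Z}+\frac12$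 and $\sigma<0$, the string function under the limit on the right-hand side must be replaced by $\mathrm{s}_{\mu-m\omega}[{}^{NS}\widehat{\mathcal L}^+_{\mu}]$. (3) The Ramond relaxed highest-weight $\widehat{\mathfrak{osp}}(1|2)$-module ${}^{R}\widehat{\mathcal E}_{\lambda;q}$ is R-stringy and its string functions are given by $$\mathrm{s}_\nu[{}^{R}\widehat{\mathcal E}_{\lambda;q}]=\begin{cases}\lim_{m\to\infty}\mathrm{s}_{-\mu-2m\omega}[{}^{R}\widehat{\mathcal L}^+_{-\mu-2\omega}], & \text{for all }\nu\in\lambda,\\ \lim_{m\to\infty}\mathrm{s}_{-\mu-(2m+1)\omega}[{}^{R}\widehat{\mathcal L}^+_{-\mu-2\omega}], & \text{for all }\nu\in\lambda+\omega,\end{cases}$$ where $\mu$ denotes any solution of $(\mu,\mu+2\omega)=q$, if $\sqrt{1+2q}\notin\mathbb{Z}$, and the maximal such solution, if $\sqrt{1+2q}\in\mathbb{Z}$.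
   Context: **Finite-dimensional algebras.** $\mathfrak{sl}_2$ (over $\mathbb{C}$) has basis $e,h,f$ with $[h,e]=2e$, $[e,f]=h$, $[h,f]=-2f$. $\mathfrak{osp}(1|2)$ has even part $\mathfrak{sl}_2=\langle e,h,f\rangle$ and odd basis elements $x,y$ with $[e,x]=0$, $[h,x]=x$, $[f,x]=-y$, $[e,y]=-x$, $[h,y]=-y$, $[f,y]=0$, $\{x,x\}=2e$, $\{x,y\}=h$, $\{y,y\}=-2f$. The invariant form has non-zero entries $\kappa(h,h)=2$, $\kappa(e,f)=\kappa(f,e)=1$ and $\kappa(x,y)=-\kappa(y,x)=2$. $\mathfrak{h}=\mathbb{C}h$; $(\cdot,\cdot)$ is the induced form on $\mathfrak{h}^*$. $\alpha$ is the root of $e$ (simple root of $\mathfrak{sl}_2$, highest root of $\mathfrak{osp}(1|2)$) and $\omega=\alpha/2$ (the odd simple root of $\mathfrak{osp}(1|2)$), so $(\alpha,\alpha)=2$ and $\mu(h)=(\mu,\alpha)$. **Affine algebras.** $\widehat{\mathfrak g}=\mathfrak g\otimes\mathbb{C}[t,t^{-1}]\oplus\mathbb{C}K\oplus\mathbb{C}L_0$, with $a_n=a\otimes t^n$, $[a_m,b_n]=[a,b]_{m+n}+m\,\delta_{m+n,0}\,\kappa(a,b)K$ (super-bracket), $K$ central and $[L_0,a_n]=-na_n$. The Ramond (twisted) version of $\widehat{\mathfrak{osp}}(1|2)$ has the same relations, but the indices of $x_n,y_n$ lie in $\mathbb{Z}+\frac12$; Neveu–Schwarz (NS) means the untwisted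 algebra. $\mathfrak{osp}$- and $\widehat{\mathfrak{osp}}$-modules are $\mathbb{Z}_2$-graded by parity. Level $k$ means that $K$ acts as $k$. **Dense modules.** For $\lambda\in\mathfrak{h}^*/\mathbb{Z}\alpha$ and $q\in\mathbb{C}$, the $\mathfrak{sl}_2$-module $\mathcal R_{\lambda;q}$ has basis $v_\mu$, $\mu\in\lambda$, with $ev_\mu=\frac12[q-(\mu,\mu+\alpha)]v_{\mu+\alpha}$, $hv_\mu=(\mu,\alpha)v_\mu$, $fv_\mu=v_{\mu-\alpha}$. For $\sigma\in\mathbb{C}$, the $\mathfrak{osp}(1|2)$-module $\mathcal R'_{\lambda;\sigma}$ has basis $v_\mu$, with $v_\mu$ even for $\mu\in\lambda$ and odd for $\mu\in\lambda+\omega$, and action $hv_\mu=(\mu,\alpha)v_\mu$, $yv_\mu=v_{\mu-\omega}$, $xv_\mu=\beta_\mu v_{\mu+\omega}$, where $\beta_\mu=\frac12[(\mu,\alpha)-(-1)^{p}\sigma+\frac12]$ and $p\in\{0,1\}$ is the parity of $v_\mu$; $e$ and $f$ act as $x^2$ and $-y^2$. **Relaxed modules.** Extend a module over the algebra of finite zero modes ($\mathfrak{sl}_2$ for $\widehat{\mathfrak{sl}}_2$ and for the Ramond sector, where the ground states are taken to be even; $\mathfrak{osp}(1|2)$ for the NS sector) by letting $K$ and $L_0$ act as $k$ and $\Delta$ and all modes of positive index act as $0$, then induce to the affine algebra. From $\mathcal R_{\lambda;q}$, $\mathcal R'_{\lambda;\sigma}$, $\mathcal R_{\lambda;q}$ one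 obtains the relaxed Verma modules $\widehat{\mathcal R}_{\lambda;q}$, ${}^{NS}\widehat{\mathcal R}_{\lambda;\sigma}$, ${}^{R}\widehat{\mathcal R}_{\lambda;q}$. The modules $\widehat{\mathcal E}_{\lambda;q}$, ${}^{NS}\widehat{\mathcal E}_{\lambda;\sigma}$, ${}^{R}\widehat{\mathcal E}_{\lambda;q}$ are their respective quotients by the sum of all submodules having zero intersection with the space of ground states (the $L_0$-eigenspace of eigenvalue $\Delta$). $\widehat{\mathcal L}^+_\mu$, ${}^{NS}\widehat{\mathcal L}^+_\mu$, ${}^{R}\widehat{\mathcal L}^+_\mu$ are the simple highest-weight $\widehat{\mathfrak{sl}}_2$-, NS and Ramond modules of level $k$ generated by an (even) highest-weight vector of $h_0$-weight $\mu$ and conformal weight ($L_0$-eigenvalue) $\Delta$; this vector is annihilated by all positive modes, by $e_0$ and (NS) by $x_0$. **String functions.** $\widehat{\mathcal M}(\mu,n)$ is the weight space of $\mathfrak h$-weight $\mu$ and conformal weight $n$; $\mathrm{s}_\mu[\widehat{\mathcal M}](\mathsf q)=\sum_{n\in\mathbb{C}}\dim\widehat{\mathcal M}(\mu,n)\,\mathsf q^n$. Limits of generalised formal power series are coefficientwise. $\widehat{\mathcal M}$ is stringy if its non-zero string functions all coincide. A Ramond module is R-stringy if its non-zero string functions $\mathrm{s}_\mu$ depend only on whether $\mu$ lies in its even or its odd weight support (the set of weights of even, respectively odd, vectors). *)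

theory Defs
  imports
    Complex_Main
    "HOL-Algebra.Module"
    "HOL-Algebra.AbelCoset"
    "HOL-Library.Poly_Mapping"
    "HOL-Library.Extended_Real"
begin

section \<open>Weights\<close>

text \<open>
  A weight \<open>\<mu>\<close> in the dual of the one-dimensional Cartan subalgebra spanned by \<open>h\<close> is identified
  with its Dynkin label, the complex number \<open>\<mu>(h)\<close>.  As \<open>\<mu>(h) = (\<mu>, \<alpha>)\<close> and \<open>(\<alpha>, \<alpha>) = 2\<close>, the
  label of \<open>\<alpha>\<close> is 2 and the induced form is \<open>(\<mu>, \<nu>) = \<mu> * \<nu> / 2\<close>.
\<close>

definition alpha :: complex where "alpha = 2"

definition omega :: complex where "omega = alpha / 2"

definition wform :: "complex \<Rightarrow> complex \<Rightarrow> complex" where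
  "wform \<mu> \<nu> = \<mu> * \<nu> / 2"

definition weight_cosets :: "complex set set" where
  "weight_cosets = UNIV // {(\<mu>, \<nu>). \<exists>j::int. \<nu> - \<mu> = of_int j * alpha}"

definition shift :: "complex \<Rightarrow> complex set \<Rightarrow> complex set" where
  "shift \<theta> \<Lambda> = (\<lambda>\<mu>. \<mu> + \<theta>) ` \<Lambda>"


section \<open>Lie superalgebras given by a homogeneous basis, and their modules\<close>

text \<open>
  A Lie superalgebra is recorded by a basis of homogeneous elements, the parity of these elements
  and their super-bracket.  A representation records the operators by which the basis elements act
  (only the values of \<open>act\<close> on basis elements and on the carrier are meaningful).  The ring
  multiplication and unit inherited from the record \<open>module\<close> play no role.
\<close>

record 'g salg =
  basis :: "'g set"
  is_odd :: "'g \<Rightarrow> bool"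
  bracket :: "'g \<Rightarrow> 'g \<Rightarrow> ('g \<Rightarrow>\<^sub>0 complex)"

record ('g, 'v) rep = "(complex, 'v) module" +
  act :: "'g \<Rightarrow> 'v \<Rightarrow> 'v"
  evens :: "'v set"
  odds :: "'v set"

definition complex_ring :: "complex ring" where
  "complex_ring = \<lparr>carrier = UNIV, mult = (*), one = 1, zero = 0, add = (+)\<rparr>"

definition super_sign :: "'g salg \<Rightarrow> 'g \<Rightarrow> 'g \<Rightarrow> complex" where
  "super_sign A a b = (if is_odd A a \<and> is_odd A b then -1 else 1)"

definition super_module :: "'g salg \<Rightarrow> ('g, 'v) rep \<Rightarrow> bool" where
  "super_module A M \<longleftrightarrow>
     Module.module complex_ring M \<and>
     submodule (evens M) complex_ring M \<and> submodule (odds M) complex_ring M \<and>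
     evens M \<inter> odds M = {\<zero>\<^bsub>M\<^esub>} \<and> evens M <+>\<^bsub>M\<^esub> odds M = carrier M \<and>
     (\<forall>a\<in>basis A.
        (\<forall>v\<in>carrier M. act M a v \<in> carrier M) \<and>
        (\<forall>v\<in>carrier M. \<forall>w\<in>carrier M. act M a (v \<oplus>\<^bsub>M\<^esub> w) = act M a v \<oplus>\<^bsub>M\<^esub> act M a w) \<and>
        (\<forall>c. \<forall>v\<in>carrier M. act M a (c \<odot>\<^bsub>M\<^esub> v) = c \<odot>\<^bsub>M\<^esub> act M a v) \<and>
        (\<forall>v\<in>evens M. act M a v \<in> (if is_odd A a then odds M else evens M)) \<and>
        (\<forall>v\<in>odds M. act M a v \<in> (if is_odd A a then evens M else odds M))) \<and>
     (\<forall>a\<in>basis A. \<forall>b\<in>basis A. \<forall>v\<in>carrier M.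
        act M a (act M b v) \<ominus>\<^bsub>M\<^esub> super_sign A a b \<odot>\<^bsub>M\<^esub> act M b (act M a v) =
        (\<Oplus>\<^bsub>M\<^esub>c\<in>Poly_Mapping.keys (bracket A a b). Poly_Mapping.lookup (bracket A a b) c \<odot>\<^bsub>M\<^esub> act M c v))"

definition subrep :: "'g salg \<Rightarrow> ('g, 'v) rep \<Rightarrow> 'v set \<Rightarrow> bool" where
  "subrep A M N \<longleftrightarrow> submodule N complex_ring M \<and> (\<forall>a\<in>basis A. \<forall>v\<in>N. act M a v \<in> N)"

definition graded_subrep :: "'g salg \<Rightarrow> ('g, 'v) rep \<Rightarrow> 'v set \<Rightarrow> bool" where
  "graded_subrep A M N \<longleftrightarrow> subrep A M N \<and> N = (N \<inter> evens M) <+>\<^bsub>M\<^esub> (N \<inter> odds M)"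

definition subspace_sum :: "('g, 'v) rep \<Rightarrow> 'v set set \<Rightarrow> 'v set" where
  "subspace_sum M \<N> = \<Inter> {N. submodule N complex_ring M \<and> \<Union>\<N> \<subseteq> N}"

definition quotient_rep :: "('g, 'v) rep \<Rightarrow> 'v set \<Rightarrow> ('g, 'v set) rep" where
  "quotient_rep M N =
     \<lparr>carrier = a_rcosets\<^bsub>M\<^esub> N, mult = undefined, one = undefined,
      zero = N, add = set_add M,
      smult = (\<lambda>c C. \<Union>v\<in>C. N +>\<^bsub>M\<^esub> (c \<odot>\<^bsub>M\<^esub> v)),
      act = (\<lambda>a C. \<Union>v\<in>C. N +>\<^bsub>M\<^esub> act M a v),
      evens = (\<lambda>v. N +>\<^bsub>M\<^esub> v) ` evens M,
      odds = (\<lambda>v. N +>\<^bsub>M\<^esub> v) ` odds M\<rparr>"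

definition lin_indep :: "('g, 'v) rep \<Rightarrow> 'v set \<Rightarrow> bool" where
  "lin_indep M B \<longleftrightarrow>
     (\<forall>F c. finite F \<and> F \<subseteq> B \<and> (\<Oplus>\<^bsub>M\<^esub>v\<in>F. c v \<odot>\<^bsub>M\<^esub> v) = \<zero>\<^bsub>M\<^esub> \<longrightarrow> (\<forall>v\<in>F. c v = 0))"

definition subspace_dim :: "('g, 'v) rep \<Rightarrow> 'v set \<Rightarrow> enat" where
  "subspace_dim M W = (SUP B \<in> {B. finite B \<and> B \<subseteq> W \<and> lin_indep M B}. enat (card B))"

definition eigenspace :: "('g, 'v) rep \<Rightarrow> 'g \<Rightarrow> complex \<Rightarrow> 'v set" where
  "eigenspace M a c = {v \<in> carrier M. act M a v = c \<odot>\<^bsub>M\<^esub> v}"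


section \<open>Free vector spaces and induced modules\<close>

definition scale :: "complex \<Rightarrow> ('i \<Rightarrow>\<^sub>0 complex) \<Rightarrow> ('i \<Rightarrow>\<^sub>0 complex)" where
  "scale c u = Poly_Mapping.map (\<lambda>z. c * z) u"

definition lin_ext :: "('i \<Rightarrow> ('j \<Rightarrow>\<^sub>0 complex)) \<Rightarrow> ('i \<Rightarrow>\<^sub>0 complex) \<Rightarrow> ('j \<Rightarrow>\<^sub>0 complex)" where
  "lin_ext b u = (\<Sum>i\<in>Poly_Mapping.keys u. scale (Poly_Mapping.lookup u i) (b i))"

definition bvec :: "'i \<Rightarrow> ('i \<Rightarrow>\<^sub>0 complex)" where
  "bvec i = Poly_Mapping.single i 1"

definition span_of :: "'i set \<Rightarrow> ('i \<Rightarrow>\<^sub>0 complex) set" where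
  "span_of I = {u. Poly_Mapping.keys u \<subseteq> I}"

text \<open>
  The module induced to \<open>A\<close> from a module \<open>V\<close> over the subalgebra with basis \<open>P\<close>, that is
  \<open>U(A) \<otimes> V\<close> over \<open>U(P)\<close>, by generators and relations: the pair \<open>(w, v)\<close> of a word \<open>w\<close> in the
  basis of \<open>A\<close> and a vector \<open>v\<close> of \<open>V\<close> stands for \<open>w \<otimes> v\<close>, and \<open>A\<close> acts by prepending letters.
  The relations are stated for words without prefix, as the submodule they generate
  is closed under the action.  In \<open>free_rep\<close>, the two parity parts consist of the combinations of
  pairs with \<open>v\<close> homogeneous; they become complementary only after passing to the quotient.
\<close>

definition odd_word :: "'g salg \<Rightarrow> 'g list \<Rightarrow> bool" where
  "odd_word A w \<longleftrightarrow> odd (length (filter (is_odd A) w))"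

definition free_rep ::
  "'g salg \<Rightarrow> ('g, 'v) rep \<Rightarrow> ('g, ('g list \<times> 'v) \<Rightarrow>\<^sub>0 complex) rep" where
  "free_rep A V =
     \<lparr>carrier = span_of (lists (basis A) \<times> carrier V), mult = undefined, one = undefined,
      zero = 0, add = (+), smult = scale,
      act = (\<lambda>a. lin_ext (\<lambda>(w, v). bvec (a # w, v))),
      evens = span_of {(w, v). w \<in> lists (basis A) \<and> v \<in> (if odd_word A w then odds V else evens V)},
      odds = span_of {(w, v). w \<in> lists (basis A) \<and> v \<in> (if odd_word A w then evens V else odds V)}\<rparr>"

definition induction_relations ::
  "'g salg \<Rightarrow> 'g set \<Rightarrow> ('g, 'v) rep \<Rightarrow> (('g list \<times> 'v) \<Rightarrow>\<^sub>0 complex) set" where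
  "induction_relations A P V =
     {bvec ([], v \<oplus>\<^bsub>V\<^esub> v') - bvec ([], v) - bvec ([], v') | v v'. v \<in> carrier V \<and> v' \<in> carrier V} \<union>
     {bvec ([], c \<odot>\<^bsub>V\<^esub> v) - scale c (bvec ([], v)) | c v. v \<in> carrier V} \<union>
     {bvec ([a], v) - bvec ([], act V a v) | a v. a \<in> P \<and> v \<in> carrier V} \<union>
     {bvec (a # b # w, v) - scale (super_sign A a b) (bvec (b # a # w, v))
        - lin_ext (\<lambda>c. bvec (c # w, v)) (bracket A a b) | a b w v.
        a \<in> basis A \<and> b \<in> basis A \<and> w \<in> lists (basis A) \<and> v \<in> carrier V}"

definition induced_rep ::
  "'g salg \<Rightarrow> 'g set \<Rightarrow> ('g, 'v) rep \<Rightarrow> ('g, (('g list \<times> 'v) \<Rightarrow>\<^sub>0 complex) set) rep" where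
  "induced_rep A P V =
     quotient_rep (free_rep A V)
       (\<Inter> {N. subrep A (free_rep A V) N \<and> induction_relations A P V \<subseteq> N})"


section \<open>The Lie superalgebras\<close>

datatype osp = Ge | Gh | Gf | Gx | Gy

fun odd_osp :: "osp \<Rightarrow> bool" where
  "odd_osp Gx = True"
| "odd_osp Gy = True"
| "odd_osp _ = False"

text \<open>The span of \<open>Ge\<close>, \<open>Gh\<close>, \<open>Gf\<close> is \<open>sl\<^sub>2\<close>, with the same bracket and form.\<close>

fun osp_bracket :: "osp \<Rightarrow> osp \<Rightarrow> (osp \<Rightarrow>\<^sub>0 complex)" where
  "osp_bracket Gh Ge = Poly_Mapping.single Ge 2"
| "osp_bracket Ge Gh = Poly_Mapping.single Ge (-2)"
| "osp_bracket Ge Gf = Poly_Mapping.single Gh 1"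
| "osp_bracket Gf Ge = Poly_Mapping.single Gh (-1)"
| "osp_bracket Gh Gf = Poly_Mapping.single Gf (-2)"
| "osp_bracket Gf Gh = Poly_Mapping.single Gf 2"
| "osp_bracket Gh Gx = Poly_Mapping.single Gx 1"
| "osp_bracket Gx Gh = Poly_Mapping.single Gx (-1)"
| "osp_bracket Gf Gx = Poly_Mapping.single Gy (-1)"
| "osp_bracket Gx Gf = Poly_Mapping.single Gy 1"
| "osp_bracket Ge Gy = Poly_Mapping.single Gx (-1)"
| "osp_bracket Gy Ge = Poly_Mapping.single Gx 1"
| "osp_bracket Gh Gy = Poly_Mapping.single Gy (-1)"
| "osp_bracket Gy Gh = Poly_Mapping.single Gy 1"
| "osp_bracket Gx Gx = Poly_Mapping.single Ge 2"
| "osp_bracket Gx Gy = Poly_Mapping.single Gh 1"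
| "osp_bracket Gy Gx = Poly_Mapping.single Gh 1"
| "osp_bracket Gy Gy = Poly_Mapping.single Gf (-2)"
| "osp_bracket _ _ = 0"

fun osp_form :: "osp \<Rightarrow> osp \<Rightarrow> complex" where
  "osp_form Gh Gh = 2"
| "osp_form Ge Gf = 1"
| "osp_form Gf Ge = 1"
| "osp_form Gx Gy = 2"
| "osp_form Gy Gx = -2"
| "osp_form _ _ = 0"

text \<open>
  \<open>Mode a n\<close> is \<open>a\<^sub>n\<close> (the index is rational to accommodate the Ramond sector) and \<open>Cent\<close>
  is the central element \<open>K\<close>.  The three affine algebras differ only in their bases.
\<close>

datatype mode = Mode osp rat | Cent | L0

fun odd_mode :: "mode \<Rightarrow> bool" where
  "odd_mode (Mode a n) = odd_osp a"
| "odd_mode Cent = False"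
| "odd_mode L0 = False"

fun mode_bracket :: "mode \<Rightarrow> mode \<Rightarrow> (mode \<Rightarrow>\<^sub>0 complex)" where
  "mode_bracket (Mode a m) (Mode b n) =
     lin_ext (\<lambda>c. bvec (Mode c (m + n))) (osp_bracket a b)
     + (if m + n = 0 then Poly_Mapping.single Cent (of_rat m * osp_form a b) else 0)"
| "mode_bracket L0 (Mode a n) = Poly_Mapping.single (Mode a n) (- of_rat n)"
| "mode_bracket (Mode a n) L0 = Poly_Mapping.single (Mode a n) (of_rat n)"
| "mode_bracket _ _ = 0"

definition affine_sl2 :: "mode salg" where
  "affine_sl2 =
     \<lparr>basis = {Mode a n | a n. \<not> odd_osp a \<and> n \<in> \<int>} \<union> {Cent, L0},
      is_odd = odd_mode, bracket = mode_bracket\<rparr>"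

definition affine_NS :: "mode salg" where
  "affine_NS =
     \<lparr>basis = {Mode a n | a n. n \<in> \<int>} \<union> {Cent, L0},
      is_odd = odd_mode, bracket = mode_bracket\<rparr>"

definition affine_R :: "mode salg" where
  "affine_R =
     \<lparr>basis = {Mode a n | a n. (if odd_osp a then n - 1/2 \<in> \<int> else n \<in> \<int>)} \<union> {Cent, L0},
      is_odd = odd_mode, bracket = mode_bracket\<rparr>"


section \<open>Dense modules over the finite-dimensional algebras\<close>

definition dense_sl2_basis_act :: "complex \<Rightarrow> osp \<Rightarrow> complex \<Rightarrow> (complex \<Rightarrow>\<^sub>0 complex)" where
  "dense_sl2_basis_act q a \<mu> =
     (case a of
        Ge \<Rightarrow> scale ((q - wform \<mu> (\<mu> + alpha)) / 2) (bvec (\<mu> + alpha))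
      | Gh \<Rightarrow> scale (wform \<mu> alpha) (bvec \<mu>)
      | Gf \<Rightarrow> bvec (\<mu> - alpha)
      | _ \<Rightarrow> 0)"

definition dense_sl2 :: "complex set \<Rightarrow> complex \<Rightarrow> (osp, complex \<Rightarrow>\<^sub>0 complex) rep" where
  "dense_sl2 \<Lambda> q =
     \<lparr>carrier = span_of \<Lambda>, mult = undefined, one = undefined,
      zero = 0, add = (+), smult = scale,
      act = (\<lambda>a. lin_ext (dense_sl2_basis_act q a)),
      evens = span_of \<Lambda>, odds = {0}\<rparr>"

definition dense_osp_beta :: "complex set \<Rightarrow> complex \<Rightarrow> complex \<Rightarrow> complex" where
  "dense_osp_beta \<Lambda> \<sigma> \<mu> =
     (wform \<mu> alpha - (if \<mu> \<in> \<Lambda> then 1 else -1) * \<sigma> + 1/2) / 2"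

definition dense_osp_x :: "complex set \<Rightarrow> complex \<Rightarrow> (complex \<Rightarrow>\<^sub>0 complex) \<Rightarrow> (complex \<Rightarrow>\<^sub>0 complex)" where
  "dense_osp_x \<Lambda> \<sigma> = lin_ext (\<lambda>\<mu>. scale (dense_osp_beta \<Lambda> \<sigma> \<mu>) (bvec (\<mu> + omega)))"

definition dense_osp_y :: "(complex \<Rightarrow>\<^sub>0 complex) \<Rightarrow> (complex \<Rightarrow>\<^sub>0 complex)" where
  "dense_osp_y = lin_ext (\<lambda>\<mu>. bvec (\<mu> - omega))"

definition dense_osp :: "complex set \<Rightarrow> complex \<Rightarrow> (osp, complex \<Rightarrow>\<^sub>0 complex) rep" where
  "dense_osp \<Lambda> \<sigma> =
     \<lparr>carrier = span_of (\<Lambda> \<union> shift omega \<Lambda>), mult = undefined, one = undefined,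
      zero = 0, add = (+), smult = scale,
      act = (\<lambda>a. case a of
          Ge \<Rightarrow> (\<lambda>v. dense_osp_x \<Lambda> \<sigma> (dense_osp_x \<Lambda> \<sigma> v))
        | Gh \<Rightarrow> lin_ext (\<lambda>\<mu>. scale (wform \<mu> alpha) (bvec \<mu>))
        | Gf \<Rightarrow> (\<lambda>v. - dense_osp_y (dense_osp_y v))
        | Gx \<Rightarrow> dense_osp_x \<Lambda> \<sigma>
        | Gy \<Rightarrow> dense_osp_y),
      evens = span_of \<Lambda>, odds = span_of (shift omega \<Lambda>)\<rparr>"


section \<open>Relaxed and highest-weight modules over the affine algebras\<close>

definition nonneg_modes :: "mode salg \<Rightarrow> mode set" where
  "nonneg_modes A = {Mode a n | a n. Mode a n \<in> basis A \<and> n \<ge> 0} \<union> {Cent, L0}"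

text \<open>The value at modes of negative index is irrelevant: these do not belong to \<open>nonneg_modes\<close>.\<close>

definition extend_rep :: "complex \<Rightarrow> complex \<Rightarrow> (osp, 'v) rep \<Rightarrow> (mode, 'v) rep" where
  "extend_rep k \<Delta> V =
     \<lparr>carrier = carrier V, mult = mult V, one = one V,
      zero = zero V, add = add V, smult = smult V,
      act = (\<lambda>a. case a of
          Mode g n \<Rightarrow> (if n = 0 then act V g else (\<lambda>_. \<zero>\<^bsub>V\<^esub>))
        | Cent \<Rightarrow> smult V k
        | L0 \<Rightarrow> smult V \<Delta>),
      evens = evens V, odds = odds V\<rparr>"

definition relaxed_verma ::
  "mode salg \<Rightarrow> complex \<Rightarrow> complex \<Rightarrow> (osp, 'v) rep \<Rightarrow>
   (mode, ((mode list \<times> 'v) \<Rightarrow>\<^sub>0 complex) set) rep" where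
  "relaxed_verma A k \<Delta> V = induced_rep A (nonneg_modes A) (extend_rep k \<Delta> V)"

definition relaxed_quotient ::
  "mode salg \<Rightarrow> complex \<Rightarrow> complex \<Rightarrow> (osp, 'v) rep \<Rightarrow>
   (mode, ((mode list \<times> 'v) \<Rightarrow>\<^sub>0 complex) set set) rep" where
  "relaxed_quotient A k \<Delta> V =
     (let M = relaxed_verma A k \<Delta> V
      in quotient_rep M
           (subspace_sum M {N. graded_subrep A M N \<and> N \<inter> eigenspace M L0 \<Delta> = {\<zero>\<^bsub>M\<^esub>}}))"

definition E_sl2 where
  "E_sl2 k \<Delta> \<Lambda> q = relaxed_quotient affine_sl2 k \<Delta> (dense_sl2 \<Lambda> q)"

definition E_NS where
  "E_NS k \<Delta> \<Lambda> \<sigma> = relaxed_quotient affine_NS k \<Delta> (dense_osp \<Lambda> \<sigma>)"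

definition E_R where
  "E_R k \<Delta> \<Lambda> q = relaxed_quotient affine_R k \<Delta> (dense_sl2 \<Lambda> q)"

definition simple_rep :: "'g salg \<Rightarrow> ('g, 'v) rep \<Rightarrow> bool" where
  "simple_rep A M \<longleftrightarrow>
     carrier M \<noteq> {\<zero>\<^bsub>M\<^esub>} \<and> (\<forall>N. graded_subrep A M N \<longrightarrow> N = {\<zero>\<^bsub>M\<^esub>} \<or> N = carrier M)"

text \<open>
  These data determine the module up to isomorphism, so results about string functions are
  stated for every realisation \<open>L\<close>.
\<close>

definition simple_hw_rep ::
  "mode salg \<Rightarrow> complex \<Rightarrow> complex \<Rightarrow> complex \<Rightarrow> (mode, 'v) rep \<Rightarrow> bool" where
  "simple_hw_rep A k \<Delta> \<mu> L \<longleftrightarrow>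
     super_module A L \<and> simple_rep A L \<and>
     (\<forall>v\<in>carrier L. act L Cent v = k \<odot>\<^bsub>L\<^esub> v) \<and>
     (\<exists>v\<in>evens L. v \<noteq> \<zero>\<^bsub>L\<^esub> \<and>
        act L (Mode Gh 0) v = \<mu> \<odot>\<^bsub>L\<^esub> v \<and> act L L0 v = \<Delta> \<odot>\<^bsub>L\<^esub> v \<and>
        (\<forall>a n. Mode a n \<in> basis A \<and> n > 0 \<longrightarrow> act L (Mode a n) v = \<zero>\<^bsub>L\<^esub>) \<and>
        act L (Mode Ge 0) v = \<zero>\<^bsub>L\<^esub> \<and>
        (Mode Gx 0 \<in> basis A \<longrightarrow> act L (Mode Gx 0) v = \<zero>\<^bsub>L\<^esub>) \<and>
        (\<forall>N. graded_subrep A L N \<and> v \<in> N \<longrightarrow> N = carrier L))"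


section \<open>String functions\<close>

text \<open>
  A generalised formal power series is given by its coefficients, indexed by the exponent.  The
  coefficients are extended naturals so that an infinite dimension is not confused with 0; a
  sequence of these converges to a finite limit iff it is eventually equal to it.
\<close>

type_synonym qseries = "complex \<Rightarrow> enat"

definition weight_space :: "(mode, 'v) rep \<Rightarrow> complex \<Rightarrow> complex \<Rightarrow> 'v set" where
  "weight_space M \<mu> n = eigenspace M (Mode Gh 0) \<mu> \<inter> eigenspace M L0 n"

definition string_function :: "(mode, 'v) rep \<Rightarrow> complex \<Rightarrow> qseries" where
  "string_function M \<mu> = (\<lambda>n. subspace_dim M (weight_space M \<mu> n))"

definition is_coeff_limit :: "(nat \<Rightarrow> qseries) \<Rightarrow> qseries \<Rightarrow> bool" where
  "is_coeff_limit S s \<longleftrightarrow> (\<forall>n. (\<lambda>m. S m n) \<longlonglongrightarrow> s n)"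

definition stringy :: "(mode, 'v) rep \<Rightarrow> bool" where
  "stringy M \<longleftrightarrow>
     (\<forall>\<mu> \<nu>. string_function M \<mu> \<noteq> (\<lambda>_. 0) \<and> string_function M \<nu> \<noteq> (\<lambda>_. 0)
        \<longrightarrow> string_function M \<mu> = string_function M \<nu>)"

definition even_weights :: "(mode, 'v) rep \<Rightarrow> complex set" where
  "even_weights M = {\<mu>. \<exists>v \<in> evens M \<inter> eigenspace M (Mode Gh 0) \<mu>. v \<noteq> \<zero>\<^bsub>M\<^esub>}"

definition odd_weights :: "(mode, 'v) rep \<Rightarrow> complex set" where
  "odd_weights M = {\<mu>. \<exists>v \<in> odds M \<inter> eigenspace M (Mode Gh 0) \<mu>. v \<noteq> \<zero>\<^bsub>M\<^esub>}"

definition R_stringy :: "(mode, 'v) rep \<Rightarrow> bool" where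
  "R_stringy M \<longleftrightarrow>
     (\<forall>\<mu> \<nu>. string_function M \<mu> \<noteq> (\<lambda>_. 0) \<and> string_function M \<nu> \<noteq> (\<lambda>_. 0) \<and>
        (\<mu> \<in> even_weights M \<and> \<nu> \<in> even_weights M \<or> \<mu> \<in> odd_weights M \<and> \<nu> \<in> odd_weights M)
        \<longrightarrow> string_function M \<mu> = string_function M \<nu>)"

definition admissible_weight :: "complex \<Rightarrow> complex \<Rightarrow> bool" where
  "admissible_weight q \<mu> \<longleftrightarrow>
     wform \<mu> (\<mu> + alpha) = q \<and>
     (csqrt (1 + 2 * q) \<in> \<int> \<longrightarrow> (\<forall>\<mu>'. wform \<mu>' (\<mu>' + alpha) = q \<longrightarrow> Re \<mu>' \<le> Re \<mu>))"

end

theory Submission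
  imports Defs "HOL-Computational_Algebra.Polynomial" "HOL-Library.Function_Algebras"
begin

text \<open>
  The value of a word of modes on the ground states, projected back to the ground states, is a
  polynomial in the weight: it is computed by commuting negative modes to the left, and super-Jacobi
  shows that the result respects the commutation relations (which replaces the
  Poincare-Birkhoff-Witt theorem).  A relaxed module modulo its radical is therefore the free
  module on words and ground states modulo the radical of this pairing, and so is a simple
  highest-weight module whose ground states are a Verma module.  Hence every coefficient of a
  string function is the rank of a finite family of columns with entries polynomial in the weight.
  Such a rank is constant except at finitely many weights, where it is smaller.  Along the string of
  a simple highest-weight module the exceptional weights are eventually avoided, and only
  finitely many columns are cut off by the end of the weight support.  For a relaxed module,
  injectivity of \<open>f\<^sub>0\<close> makes the coefficients weakly increase as the weight is lowered, so they
  equal the generic rank everywhere.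
\<close>

section \<open>Linear functionals on free vector spaces\<close>

text \<open>The obstacle is that both kinds of module are given only indirectly: the induced module
  by generators and relations, the simple one up to isomorphism. They become comparable because the
  ground states used have one basis vector per weight, on which zero modes act by scalars polynomial
  in the weight. In the \<open>sl_2\<close> and Ramond cases t(t+2)/2 is invariant under t -> -t-2,
  so the highest weight -\<mu>-\<alpha> belongs to the same \<open>q\<close> and the same
  polynomials appear, restricted to a half-line of weights. Taking the maximal \<mu> in the integral
  case (in the Neveu-Schwarz sector: choosing by the sign of \<sigma>) prevents the half-line from
  breaking off. In the Neveu-Schwarz sector the scalars also depend on parity through the sign of
  \<sigma>; hence the pairing carries a Boolean label beside the weight. The label of a vector may
  be opposite to its parity, as happens for the highest weight -\<mu>-\<omega>. Generic rank alone
  says nothing at the finitely many exceptional weights, which a coset may contain; therefore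
  injectivity of \<open>f_0\<close> modulo the radical is established separately.\<close>

definition lsum :: "('i \<Rightarrow>\<^sub>0 complex) \<Rightarrow> ('i \<Rightarrow> complex) \<Rightarrow> complex" where
  "lsum u g = (\<Sum>i\<in>Poly_Mapping.keys u. Poly_Mapping.lookup u i * g i)"

lemma lookup_scale [simp]: "Poly_Mapping.lookup (scale c u) i = c * Poly_Mapping.lookup u i"
  unfolding scale_def by (transfer) (simp add: when_def)

lemma lsum_superset:
  "finite S \<Longrightarrow> Poly_Mapping.keys u \<subseteq> S \<Longrightarrow> lsum u g = (\<Sum>i\<in>S. Poly_Mapping.lookup u i * g i)"
  unfolding lsum_def by (rule sum.mono_neutral_left) (auto simp: in_keys_iff)

lemma lsum_zero [simp]: "lsum 0 g = 0"
  by (simp add: lsum_def)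

lemma lsum_single [simp]: "lsum (Poly_Mapping.single i c) g = c * g i"
  by (simp add: lsum_def)

lemma lsum_bvec [simp]: "lsum (bvec i) g = g i"
  by (simp add: bvec_def)

lemma lsum_add: "lsum (u + v) g = lsum u g + lsum v g"
proof -
  let ?S = "Poly_Mapping.keys u \<union> Poly_Mapping.keys v"
  have "Poly_Mapping.keys (u + v) \<subseteq> ?S" by (rule Poly_Mapping.keys_add)
  then show ?thesis
    by (simp add: lsum_superset[of ?S] lookup_add sum.distrib algebra_simps)
qed

lemma keys_scale: "Poly_Mapping.keys (scale c u) \<subseteq> Poly_Mapping.keys u"
  by (auto simp: in_keys_iff)

lemma lsum_scale: "lsum (scale c u) g = c * lsum u g"
  using keys_scale[of c u]
  by (simp add: lsum_superset[of "Poly_Mapping.keys u"] sum_distrib_left mult.assoc)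

lemma lsum_uminus: "lsum (- u) g = - lsum u g"
  by (simp add: lsum_def sum_negf)

lemma lsum_diff: "lsum (u - v) g = lsum u g - lsum v g"
  using lsum_add[of u "- v" g] by (simp add: lsum_uminus)

lemma lsum_sum: "lsum (\<Sum>x\<in>S. f x) g = (\<Sum>x\<in>S. lsum (f x) g)"
  by (induction S rule: infinite_finite_induct) (auto simp: lsum_add)

lemma lsum_lin_ext: "lsum (lin_ext b u) g = lsum u (\<lambda>i. lsum (b i) g)"
  unfolding lin_ext_def lsum_sum lsum_scale by (simp add: lsum_def)

lemma lsum_cong:
  "(\<And>i. i \<in> Poly_Mapping.keys u \<Longrightarrow> f i = g i) \<Longrightarrow> lsum u f = lsum u g"
  unfolding lsum_def by (rule sum.cong) auto

lemma lsum_fun_add: "lsum u (\<lambda>i. f i + g i) = lsum u f + lsum u g"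
  by (simp add: lsum_def sum.distrib algebra_simps)

lemma lsum_fun_mult: "lsum u (\<lambda>i. c * f i) = c * lsum u f"
  by (simp add: lsum_def sum_distrib_left mult.left_commute)

lemma lsum_fun_uminus: "lsum u (\<lambda>i. - f i) = - lsum u f"
  by (simp add: lsum_def sum_negf)

lemma lsum_fun_mult_right: "lsum u (\<lambda>i. f i * c) = lsum u f * c"
  by (simp add: lsum_def sum_distrib_right mult.assoc)

lemma lsum_fun_zero [simp]: "lsum u (\<lambda>i. 0) = 0"
  by (simp add: lsum_def)

lemma lsum_swap: "lsum u (\<lambda>x. lsum v (\<lambda>y. f x y)) = lsum v (\<lambda>y. lsum u (\<lambda>x. f x y))"
  unfolding lsum_def sum_distrib_left
  by (subst sum.swap) (simp add: algebra_simps)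


section \<open>The bracket of modes\<close>

fun osp_wt :: "osp \<Rightarrow> int" where
  "osp_wt Ge = 2" | "osp_wt Gh = 0" | "osp_wt Gf = -2" | "osp_wt Gx = 1" | "osp_wt Gy = -1"

fun mode_wt :: "mode \<Rightarrow> int" where
  "mode_wt (Mode a n) = osp_wt a" | "mode_wt Cent = 0" | "mode_wt L0 = 0"

fun mode_deg :: "mode \<Rightarrow> rat" where
  "mode_deg (Mode a n) = n" | "mode_deg Cent = 0" | "mode_deg L0 = 0"

definition msign :: "mode \<Rightarrow> mode \<Rightarrow> complex" where
  "msign a b = (if odd_mode a \<and> odd_mode b then -1 else 1)"

lemma msign_commute: "msign a b = msign b a"
  by (auto simp: msign_def)

lemma msign_sq [simp]: "msign a b * msign a b = 1" "msign a b * (msign a b * z) = z"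
  by (auto simp: msign_def)

text \<open>The grading by parity is the grading by \<open>h\<close>-weight modulo 2. Parities of
  words and vectors can therefore be read off from weights, on which \<open>even_idx\<close>,
  \<open>parity_words\<close> and \<open>pf\<close> rely.\<close>

lemma even_osp_wt: "even (osp_wt a) \<longleftrightarrow> \<not> odd_osp a"
  by (cases a) auto

lemma even_mode_wt: "even (mode_wt a) \<longleftrightarrow> \<not> odd_mode a"
  by (cases a) (auto simp: even_osp_wt)

lemma lsum_bracket_Mode:
  "lsum (mode_bracket (Mode a m) (Mode b n)) g =
     lsum (osp_bracket a b) (\<lambda>c. g (Mode c (m + n)))
     + (if m + n = 0 then of_rat m * osp_form a b * g Cent else 0)"
  by (simp add: lsum_add lsum_lin_ext)

lemma bracket_Cent [simp]: "mode_bracket Cent a = 0" "mode_bracket a Cent = 0"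
  by (cases a; simp)+

lemma osp_bracket_keys:
  "c \<in> Poly_Mapping.keys (osp_bracket a b) \<Longrightarrow>
     osp_wt c = osp_wt a + osp_wt b \<and> odd_osp c = (odd_osp a \<noteq> odd_osp b)"
  by (cases a; cases b) (auto split: if_splits)

lemma keys_lin_ext: "Poly_Mapping.keys (lin_ext b u) \<subseteq> (\<Union>i\<in>Poly_Mapping.keys u. Poly_Mapping.keys (b i))"
proof
  fix x assume "x \<in> Poly_Mapping.keys (lin_ext b u)"
  then have "(\<Sum>i\<in>Poly_Mapping.keys u. Poly_Mapping.lookup u i * Poly_Mapping.lookup (b i) x) \<noteq> 0"
    by (simp add: in_keys_iff lin_ext_def lookup_sum)
  then obtain i where "i \<in> Poly_Mapping.keys u" "Poly_Mapping.lookup u i * Poly_Mapping.lookup (b i) x \<noteq> 0"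
    by (meson sum.neutral)
  then show "x \<in> (\<Union>i\<in>Poly_Mapping.keys u. Poly_Mapping.keys (b i))"
    by (auto simp: in_keys_iff)
qed

lemma bracket_Mode_keys:
  assumes "e \<in> Poly_Mapping.keys (mode_bracket (Mode a m) (Mode b n))"
  shows "(\<exists>c\<in>Poly_Mapping.keys (osp_bracket a b). e = Mode c (m + n)) \<or>
     (e = Cent \<and> m + n = 0 \<and> m \<noteq> 0 \<and> osp_form a b \<noteq> 0)"
proof -
  let ?u = "lin_ext (\<lambda>c. bvec (Mode c (m + n))) (osp_bracket a b)"
  let ?v = "if m + n = 0 then Poly_Mapping.single Cent (of_rat m * osp_form a b) else 0"
  have "e \<in> Poly_Mapping.keys ?u \<union> Poly_Mapping.keys ?v"
    using assms Poly_Mapping.keys_add[of ?u ?v] by auto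
  then consider "e \<in> Poly_Mapping.keys ?u" | "e \<in> Poly_Mapping.keys ?v" by blast
  then show ?thesis
  proof cases
    case 1
    then show ?thesis
      using keys_lin_ext[of "\<lambda>c. bvec (Mode c (m + n))" "osp_bracket a b"]
      by (auto simp: bvec_def)
  next
    case 2
    then show ?thesis by (auto split: if_splits)
  qed
qed

text \<open>The bracket is homogeneous for weight, parity and degree at once. For the central term
  this holds because the form pairs only opposite weights of equal parity, and the term occurs only
  at total index 0.\<close>

lemma bracket_keys:
  assumes "e \<in> Poly_Mapping.keys (mode_bracket a b)"
  shows "mode_wt e = mode_wt a + mode_wt b" "odd_mode e = (odd_mode a \<noteq> odd_mode b)"
    "mode_deg e = mode_deg a + mode_deg b"
proof -
  have form: "osp_form x y \<noteq> 0 \<Longrightarrow> osp_wt x + osp_wt y = 0 \<and> odd_osp x = odd_osp y" for x y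
    by (cases x; cases y) auto
  have "mode_wt e = mode_wt a + mode_wt b \<and> odd_mode e = (odd_mode a \<noteq> odd_mode b) \<and>
      mode_deg e = mode_deg a + mode_deg b"
  proof (cases a)
    case a: (Mode x m)
    show ?thesis
    proof (cases b)
      case (Mode y n)
      then show ?thesis
        using bracket_Mode_keys[of e x m y n] osp_bracket_keys[of _ x y] form[of x y] assms a by auto
    qed (use assms a in \<open>auto split: if_splits\<close>)
  next
    case L0
    then show ?thesis using assms by (cases b) (auto split: if_splits)
  qed (use assms in auto)
  then show "mode_wt e = mode_wt a + mode_wt b" "odd_mode e = (odd_mode a \<noteq> odd_mode b)"
    "mode_deg e = mode_deg a + mode_deg b" by auto
qed

lemma msign_bracket:
  assumes "e \<in> Poly_Mapping.keys (mode_bracket a b)"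
  shows "msign c e = msign c a * msign c b" "msign e c = msign a c * msign b c"
  using bracket_keys(2)[OF assms] by (auto simp: msign_def)

lemma bracket_skew: "lsum (mode_bracket b a) g = - msign a b * lsum (mode_bracket a b) g"
proof (cases a; cases b)
  fix x m y n assume [simp]: "a = Mode x m" "b = Mode y n"
  have 1: "lsum (osp_bracket y x) h = - msign a b * lsum (osp_bracket x y) h" for h
    by (cases x; cases y) (simp_all add: msign_def)
  have 2: "osp_form y x = msign a b * osp_form x y"
    by (cases x; cases y) (simp_all add: msign_def)
  have 3: "of_rat n = - (of_rat m :: complex)" if "m + n = 0"
    using that by (metis add_eq_0_iff of_rat_minus)
  show ?thesis
    by (simp only: \<open>a = _\<close> \<open>b = _\<close> lsum_bracket_Mode)
      (use 1 2 3 in \<open>auto simp: algebra_simps\<close>)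
qed (auto simp: msign_def)

text \<open>Bracketing from the right by \<open>c\<close> is a super-derivation, checked on all
  triples of basis elements. This arrangement matches \<open>ader\<close>, where a fixed letter is
  bracketed from the right with each letter of a word.\<close>

lemma osp_jacobi:
  fixes g :: "osp \<Rightarrow> complex"
  shows "lsum (osp_bracket b c) (\<lambda>e. lsum (osp_bracket a e) g)
    + (if odd_osp b \<and> odd_osp c then -1 else 1) * lsum (osp_bracket a c) (\<lambda>e. lsum (osp_bracket e b) g)
    = lsum (osp_bracket a b) (\<lambda>e. lsum (osp_bracket e c) g)"
  by (cases a; cases b; cases c) simp_all

text \<open>The two rearrangements of invariance that balance the central terms in the Jacobi
  identity.\<close>

lemma osp_form_invariant:
  "lsum (osp_bracket b c) (osp_form a) = lsum (osp_bracket a b) (\<lambda>e. osp_form e c)"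
  "(if odd_osp b \<and> odd_osp c then -1 else 1) * lsum (osp_bracket a c) (\<lambda>e. osp_form e b)
     = - lsum (osp_bracket a b) (\<lambda>e. osp_form e c)"
  by (cases a; cases b; cases c; simp)+

text \<open>If \<open>L0\<close> occurs, the identity expresses additivity of the degree, as
  \<open>L0\<close> acts by a multiple of it. For three modes the non-central part is
  \<open>osp_jacobi\<close>, and the central part combines invariance of the form with vanishing of
  the total index.\<close>

lemma bracket_jacobi:
  "lsum (mode_bracket b c) (\<lambda>e. lsum (mode_bracket a e) g)
    + msign b c * lsum (mode_bracket a c) (\<lambda>e. lsum (mode_bracket e b) g)
    = lsum (mode_bracket a b) (\<lambda>e. lsum (mode_bracket e c) g)"
proof (cases "a = L0 \<or> b = L0 \<or> c = L0 \<or> a = Cent \<or> b = Cent \<or> c = Cent")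
  case True
  have L: "lsum (mode_bracket L0 d) h = - of_rat (mode_deg d) * h d"
    "lsum (mode_bracket d L0) h = of_rat (mode_deg d) * h d" for d h
    by (cases d; simp)+
  have s: "msign d L0 = 1" "msign L0 d = 1" "msign d Cent = 1" "msign Cent d = 1" for d
    by (auto simp: msign_def)
  have D: "lsum (mode_bracket d d') (\<lambda>e. of_rat (mode_deg e) * h e)
     = (of_rat (mode_deg d) + of_rat (mode_deg d')) * lsum (mode_bracket d d') h" for d d' h
    by (subst lsum_fun_mult[symmetric], rule lsum_cong) (simp add: bracket_keys of_rat_add)
  have D': "lsum (mode_bracket d d') (\<lambda>e. - (of_rat (mode_deg e) * h e))
     = - ((of_rat (mode_deg d) + of_rat (mode_deg d')) * lsum (mode_bracket d d') h)" for d d' h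
    by (simp add: lsum_fun_uminus D)
  consider "a = Cent" | "b = Cent" | "c = Cent" | "a = L0" | "b = L0" | "c = L0" using True by blast
  then show ?thesis
  proof cases
    case 5
    have "lsum (mode_bracket a c) (\<lambda>e. of_rat (mode_deg e) * g e) =
      (of_rat (mode_deg a) + of_rat (mode_deg c)) * lsum (mode_bracket a c) g" by (rule D)
    with 5 show ?thesis by (simp add: L s algebra_simps)
  next
    case 6
    have "lsum (mode_bracket a b) (\<lambda>e. of_rat (mode_deg e) * g e) =
      (of_rat (mode_deg a) + of_rat (mode_deg b)) * lsum (mode_bracket a b) g" by (rule D)
    with 6 show ?thesis by (simp add: L s distrib_right)
  next
    case 4
    have "lsum (mode_bracket b c) (\<lambda>e. lsum (mode_bracket L0 e) g) =
      - ((of_rat (mode_deg b) + of_rat (mode_deg c)) * lsum (mode_bracket b c) g)"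
      by (simp add: L D')
    with 4 show ?thesis using bracket_skew[of c b g]
      by (simp add: L s algebra_simps msign_commute[of b c])
  qed (simp_all add: L s D D' algebra_simps)
next
  case False
  then obtain x m y n z l where [simp]: "a = Mode x m" "b = Mode y n" "c = Mode z l"
    by (metis mode.exhaust)
  let ?s = "if odd_osp y \<and> odd_osp z then -1 else 1 :: complex"
  have s: "msign b c = ?s" by (simp add: msign_def)
  let ?G = "\<lambda>e. g (Mode e (m + n + l))"
  let ?z = "m + n + l = 0"
  have A: "lsum (mode_bracket b c) (\<lambda>e. lsum (mode_bracket a e) g) =
     lsum (osp_bracket y z) (\<lambda>e. lsum (osp_bracket x e) ?G)
     + (if ?z then of_rat m * lsum (osp_bracket y z) (osp_form x) * g Cent else 0)"
    by (simp only: \<open>a = _\<close> \<open>b = _\<close> \<open>c = _\<close> lsum_bracket_Mode)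
      (auto simp: lsum_fun_add lsum_fun_mult_right lsum_fun_mult algebra_simps simp del: mode_bracket.simps)
  have B: "lsum (mode_bracket a c) (\<lambda>e. lsum (mode_bracket e b) g) =
     lsum (osp_bracket x z) (\<lambda>e. lsum (osp_bracket e y) ?G)
     + (if ?z then of_rat (m + l) * lsum (osp_bracket x z) (\<lambda>e. osp_form e y) * g Cent else 0)"
    by (simp only: \<open>a = _\<close> \<open>b = _\<close> \<open>c = _\<close> lsum_bracket_Mode)
      (auto simp: lsum_fun_add lsum_fun_mult_right lsum_fun_mult algebra_simps simp del: mode_bracket.simps)
  have C: "lsum (mode_bracket a b) (\<lambda>e. lsum (mode_bracket e c) g) =
     lsum (osp_bracket x y) (\<lambda>e. lsum (osp_bracket e z) ?G)
     + (if ?z then of_rat (m + n) * lsum (osp_bracket x y) (\<lambda>e. osp_form e z) * g Cent else 0)"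
    by (simp only: \<open>a = _\<close> \<open>b = _\<close> \<open>c = _\<close> lsum_bracket_Mode)
      (auto simp: lsum_fun_add lsum_fun_mult_right lsum_fun_mult algebra_simps simp del: mode_bracket.simps)
  have J: "lsum (osp_bracket y z) (\<lambda>e. lsum (osp_bracket x e) ?G)
     = lsum (osp_bracket x y) (\<lambda>e. lsum (osp_bracket e z) ?G) - ?s * lsum (osp_bracket x z) (\<lambda>e. lsum (osp_bracket e y) ?G)"
    using osp_jacobi[of y z x ?G] by (simp add: algebra_simps)
  have F: "?s * (of_rat (m + l) * lsum (osp_bracket x z) (\<lambda>e. osp_form e y) * g Cent)
     = - of_rat (m + l) * g Cent * lsum (osp_bracket x y) (\<lambda>e. osp_form e z)"
    using arg_cong[OF osp_form_invariant(2)[of y z x], of "\<lambda>v. of_rat (m + l) * g Cent * v"]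
    by (simp add: algebra_simps)
  \<comment> \<open>All central terms are multiples of one value of the invariant form, with
    coefficients m and -(m + l) on one side and m + n on the other; total index 0 makes them
    agree.\<close>
  have r: "of_rat (m + n) = of_rat m - (of_rat (m + l) :: complex)" if ?z
  proof -
    have "m + n = m - (m + l)" using that by (simp add: algebra_simps add_eq_0_iff)
    then show ?thesis by (simp only: of_rat_diff)
  qed
  have "of_rat m * lsum (osp_bracket y z) (osp_form x) * g Cent
      + ?s * (of_rat (m + l) * lsum (osp_bracket x z) (\<lambda>e. osp_form e y) * g Cent)
      = of_rat (m + n) * lsum (osp_bracket x y) (\<lambda>e. osp_form e z) * g Cent" if ?z
    unfolding F r[OF that] osp_form_invariant(1)[of y z x] left_diff_distrib by simp
  then show ?thesis unfolding A B C s J distrib_left by auto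
qed

section \<open>Matrix elements between ground states\<close>

text \<open>
  Words are stored in reverse here: the head of the list is the letter that acts first.  Then
  \<open>ader a w g\<close> is the value of the linear functional \<open>g\<close> on the super-commutator of \<open>w\<close> with \<open>a\<close>.
\<close>

fun ader :: "mode \<Rightarrow> mode list \<Rightarrow> (mode list \<Rightarrow> complex) \<Rightarrow> complex" where
  "ader a [] g = 0"
| "ader a (b # w) g =
     lsum (mode_bracket b a) (\<lambda>e. g (e # w)) + msign b a * ader a w (\<lambda>u. g (b # u))"

lemma ader_fun_add: "ader a w (\<lambda>u. f u + g u) = ader a w f + ader a w g"
  by (induction w arbitrary: f g) (auto simp: lsum_fun_add algebra_simps)

lemma ader_fun_mult: "ader a w (\<lambda>u. c * f u) = c * ader a w f"
  by (induction w arbitrary: f) (auto simp: lsum_fun_mult algebra_simps)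

lemma ader_fun_zero [simp]: "ader a w (\<lambda>u. 0) = 0"
  using ader_fun_mult[of a w 0 "\<lambda>_. 0"] by simp

lemma ader_fun_sum: "ader a w (\<lambda>u. \<Sum>i\<in>S. f i u) = (\<Sum>i\<in>S. ader a w (f i))"
  by (induction S rule: infinite_finite_induct) (auto simp: ader_fun_add)

lemma ader_lsum: "ader a w (\<lambda>u. lsum x (\<lambda>e. f e u)) = lsum x (\<lambda>e. ader a w (f e))"
  by (simp add: lsum_def ader_fun_sum ader_fun_mult)

definition bracket_closed :: "mode set \<Rightarrow> bool" where
  "bracket_closed B \<longleftrightarrow> (\<forall>a\<in>B. \<forall>b\<in>B. Poly_Mapping.keys (mode_bracket a b) \<subseteq> B)"

lemma ader_cong:
  assumes "bracket_closed B" "a \<in> B" "w \<in> lists B"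
    and "\<And>u. u \<in> lists B \<Longrightarrow> length u = length w \<Longrightarrow> f u = g u"
  shows "ader a w f = ader a w g"
  using assms(3,4)
proof (induction w arbitrary: f g rule: list.induct)
  case (Cons b w)
  have "lsum (mode_bracket b a) (\<lambda>e. f (e # w)) = lsum (mode_bracket b a) (\<lambda>e. g (e # w))"
  proof (rule lsum_cong)
    fix i assume "i \<in> Poly_Mapping.keys (mode_bracket b a)"
    then have "i \<in> B" using assms(1,2) Cons.prems(1) by (auto simp: bracket_closed_def)
    then show "f (i # w) = g (i # w)" using Cons.prems(2)[of "i # w"] Cons.prems(1) by simp
  qed
  moreover have "ader a w (\<lambda>u. f (b # u)) = ader a w (\<lambda>u. g (b # u))"
    using Cons.prems by (intro Cons.IH) auto
  ultimately show ?case by simp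
qed simp

lemma ader_cong_length:
  "(\<And>u. length u = length w \<Longrightarrow> f u = g u) \<Longrightarrow> ader a w f = ader a w g"
proof (induction w arbitrary: f g)
  case (Cons b w)
  have "lsum (mode_bracket b a) (\<lambda>e. f (e # w)) = lsum (mode_bracket b a) (\<lambda>e. g (e # w))"
    using Cons.prems by (intro lsum_cong) auto
  moreover have "ader a w (\<lambda>u. f (b # u)) = ader a w (\<lambda>u. g (b # u))"
    using Cons.prems by (intro Cons.IH) auto
  ultimately show ?case by simp
qed simp

text \<open>Supercommuting with fixed letters gives a representation of the algebra on functionals.
  Terms in which two different letters of the word are hit cancel against the reversed order; terms
  in which one letter is hit twice combine by the Jacobi identity.\<close>

lemma ader_commutator:
  "ader a w (\<lambda>u. ader b u g) - msign a b * ader b w (\<lambda>u. ader a u g)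
     = lsum (mode_bracket a b) (\<lambda>e. ader e w g)"
proof (induction w arbitrary: g)
  case (Cons x w)
  \<comment> \<open>The four terms are: both brackets on \<open>x\<close>, one on \<open>x\<close>
    and one on \<open>w\<close> in either order, both on \<open>w\<close>. The mixed terms are those
    that cancel.\<close>
  have expand: "ader c (x # w) (\<lambda>u. ader d u g) =
      lsum (mode_bracket x c) (\<lambda>e. lsum (mode_bracket e d) (\<lambda>f. g (f # w)))
      + msign x d * msign c d * lsum (mode_bracket x c) (\<lambda>e. ader d w (\<lambda>u. g (e # u)))
      + msign x c * lsum (mode_bracket x d) (\<lambda>f. ader c w (\<lambda>u. g (f # u)))
      + msign x c * msign x d * ader c w (\<lambda>u. ader d u (\<lambda>v. g (x # v)))" for c d
  proof -
    have "lsum (mode_bracket x c) (\<lambda>e. msign e d * ader d w (\<lambda>u. g (e # u))) =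
      msign x d * msign c d * lsum (mode_bracket x c) (\<lambda>e. ader d w (\<lambda>u. g (e # u)))"
      unfolding lsum_fun_mult[symmetric] by (rule lsum_cong) (simp add: msign_bracket)
    then show ?thesis
      by (simp add: lsum_fun_add ader_fun_add ader_lsum ader_fun_mult algebra_simps)
  qed
  have J: "lsum (mode_bracket x a) (\<lambda>e. lsum (mode_bracket e b) (\<lambda>f. g (f # w)))
     = lsum (mode_bracket a b) (\<lambda>e. lsum (mode_bracket x e) (\<lambda>f. g (f # w)))
      + msign a b * lsum (mode_bracket x b) (\<lambda>e. lsum (mode_bracket e a) (\<lambda>f. g (f # w)))"
    using bracket_jacobi[of a b x] by simp
  have R: "lsum (mode_bracket a b) (\<lambda>e. ader e (x # w) g) =
      lsum (mode_bracket a b) (\<lambda>e. lsum (mode_bracket x e) (\<lambda>f. g (f # w)))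
      + msign x a * msign x b * lsum (mode_bracket a b) (\<lambda>e. ader e w (\<lambda>u. g (x # u)))"
  proof -
    have "lsum (mode_bracket a b) (\<lambda>e. msign x e * ader e w (\<lambda>u. g (x # u))) =
      msign x a * msign x b * lsum (mode_bracket a b) (\<lambda>e. ader e w (\<lambda>u. g (x # u)))"
      unfolding lsum_fun_mult[symmetric] by (rule lsum_cong) (simp add: msign_bracket)
    then show ?thesis by (simp add: lsum_fun_add)
  qed
  show ?case
    unfolding expand R J Cons.IH[symmetric]
    by (simp add: algebra_simps msign_commute[of b a])
qed simp

text \<open>Only relations with \<open>n\<close> letters besides the exchanged pair are demanded.
  The index permits an induction on word length for \<open>Psi\<close>, whose recursion passes to
  words that are shorter but need not be subwords.\<close>

definition respects_bracket :: "mode set \<Rightarrow> nat \<Rightarrow> (mode list \<Rightarrow> complex) \<Rightarrow> bool" where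
  "respects_bracket B n g \<longleftrightarrow>
     (\<forall>u\<in>lists B. \<forall>w\<in>lists B. \<forall>a\<in>B. \<forall>b\<in>B. length u + length w = n \<longrightarrow>
        g (u @ b # a # w) = msign a b * g (u @ a # b # w) + lsum (mode_bracket a b) (\<lambda>e. g (u @ e # w)))"

lemma respects_bracketD:
  assumes "respects_bracket B n g" "u \<in> lists B" "w \<in> lists B" "a \<in> B" "b \<in> B" "length u + length w = n"
  shows "g (u @ b # a # w) = msign a b * g (u @ a # b # w) + lsum (mode_bracket a b) (\<lambda>e. g (u @ e # w))"
  using assms unfolding respects_bracket_def by blast

lemma respects_bracket_Cons:
  assumes "respects_bracket B (Suc n) g" "x \<in> B"
  shows "respects_bracket B n (\<lambda>u. g (x # u))"
  unfolding respects_bracket_def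
proof (intro ballI impI)
  fix u w a b
  assume "u \<in> lists B" "w \<in> lists B" "a \<in> B" "b \<in> B" "length u + length w = n"
  then show "g (x # u @ b # a # w) =
       msign a b * g (x # u @ a # b # w) + lsum (mode_bracket a b) (\<lambda>e. g (x # u @ e # w))"
    using respects_bracketD[OF assms(1), of "x # u" w a b] assms(2) by simp
qed

text \<open>The supercommutator with \<open>c\<close> is a derivation of the word algebra and maps
  the commutation relations into their own ideal. Where \<open>c\<close> misses the exchanged pair,
  the relation carries over; where \<open>c\<close> meets it, the Jacobi identity is needed.\<close>

lemma respects_bracket_ader:
  assumes B: "bracket_closed B" and g: "respects_bracket B n g" and c: "c \<in> B"
  shows "respects_bracket B n (\<lambda>v. ader c v g)"
proof -
  have "ader c (u @ b # a # w) g =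
      msign a b * ader c (u @ a # b # w) g + lsum (mode_bracket a b) (\<lambda>e. ader c (u @ e # w) g)"
    if "respects_bracket B n g" "u \<in> lists B" "w \<in> lists B" "a \<in> B" "b \<in> B" "length u + length w = n"
    for u w a b n g
    using that
  proof (induction u arbitrary: g n)
    case (Cons x u)
    then obtain m where n: "n = Suc m" by (cases n) auto
    have x: "x \<in> B" "u \<in> lists B" "length u + length w = m" using Cons.prems n by auto
    have 1: "lsum (mode_bracket x c) (\<lambda>e. g (e # u @ b # a # w)) =
       msign a b * lsum (mode_bracket x c) (\<lambda>e. g (e # u @ a # b # w))
       + lsum (mode_bracket a b) (\<lambda>f. lsum (mode_bracket x c) (\<lambda>e. g (e # u @ f # w)))"
    proof -
      have "lsum (mode_bracket x c) (\<lambda>e. g (e # u @ b # a # w)) =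
        lsum (mode_bracket x c) (\<lambda>e. msign a b * g (e # u @ a # b # w)
           + lsum (mode_bracket a b) (\<lambda>f. g (e # u @ f # w)))"
      proof (rule lsum_cong)
        fix e assume "e \<in> Poly_Mapping.keys (mode_bracket x c)"
        then have "e \<in> B" using B x(1) c by (auto simp: bracket_closed_def)
        then show "g (e # u @ b # a # w) = msign a b * g (e # u @ a # b # w)
           + lsum (mode_bracket a b) (\<lambda>f. g (e # u @ f # w))"
          using respects_bracketD[OF Cons.prems(1), of "e # u" w a b] Cons.prems by simp
      qed
      then show ?thesis
        by (simp add: lsum_fun_add lsum_fun_mult lsum_swap[of "mode_bracket x c"])
    qed
    have 2: "ader c (u @ b # a # w) (\<lambda>v. g (x # v)) =
      msign a b * ader c (u @ a # b # w) (\<lambda>v. g (x # v))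
      + lsum (mode_bracket a b) (\<lambda>e. ader c (u @ e # w) (\<lambda>v. g (x # v)))"
      using Cons.prems x n by (intro Cons.IH[of m]) (auto intro: respects_bracket_Cons)
    show ?case using 1 2
      by (simp add: lsum_fun_add lsum_fun_mult algebra_simps)
  next
    case Nil
    have len: "length w = n" and wB: "w \<in> lists B" using Nil by auto
    have rel: "g (b # a # v) = msign a b * g (a # b # v) + lsum (mode_bracket a b) (\<lambda>e. g (e # v))"
      if "v \<in> lists B" "length v = n" "a \<in> B" "b \<in> B" for v a b
      using respects_bracketD[OF Nil.prems(1), of "[]" v a b] that by simp
    have W: "ader c w (\<lambda>v. g (b # a # v)) = msign a b * ader c w (\<lambda>v. g (a # b # v))
      + lsum (mode_bracket a b) (\<lambda>e. ader c w (\<lambda>v. g (e # v)))"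
    proof -
      have "ader c w (\<lambda>v. g (b # a # v)) =
        ader c w (\<lambda>v. msign a b * g (a # b # v) + lsum (mode_bracket a b) (\<lambda>e. g (e # v)))"
        by (rule ader_cong[OF B c wB], rule rel) (simp_all add: len Nil.prems(4,5))
      then show ?thesis by (simp add: ader_fun_add ader_fun_mult ader_lsum)
    qed
    \<comment> \<open>When \<open>c\<close> hits one letter of the pair, the other letter still has
      to be exchanged with the resulting bracket. This produces the double brackets that
      \<open>J\<close> identifies with those coming from the bracket of \<open>a\<close> and
      \<open>b\<close>.\<close>
    have bc: "lsum (mode_bracket b c) (\<lambda>e. g (e # a # w)) =
       msign a b * msign a c * lsum (mode_bracket b c) (\<lambda>e. g (a # e # w))
       + lsum (mode_bracket b c) (\<lambda>e. lsum (mode_bracket a e) (\<lambda>f. g (f # w)))"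
    proof -
      have "lsum (mode_bracket b c) (\<lambda>e. g (e # a # w)) =
        lsum (mode_bracket b c) (\<lambda>e. msign a b * msign a c * g (a # e # w)
          + lsum (mode_bracket a e) (\<lambda>f. g (f # w)))"
      proof (rule lsum_cong)
        fix e assume e: "e \<in> Poly_Mapping.keys (mode_bracket b c)"
        then have "e \<in> B" using B Nil.prems c by (auto simp: bracket_closed_def)
        then show "g (e # a # w) = msign a b * msign a c * g (a # e # w)
          + lsum (mode_bracket a e) (\<lambda>f. g (f # w))"
          using rel[OF wB len Nil.prems(4) \<open>e \<in> B\<close>] msign_bracket(1)[OF e, of a] by simp
      qed
      then show ?thesis by (simp add: lsum_fun_add lsum_fun_mult)
    qed
    have ac: "lsum (mode_bracket a c) (\<lambda>e. g (b # e # w)) =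
       msign a b * msign b c * lsum (mode_bracket a c) (\<lambda>e. g (e # b # w))
       + lsum (mode_bracket a c) (\<lambda>e. lsum (mode_bracket e b) (\<lambda>f. g (f # w)))"
    proof -
      have "lsum (mode_bracket a c) (\<lambda>e. g (b # e # w)) =
        lsum (mode_bracket a c) (\<lambda>e. msign a b * msign b c * g (e # b # w)
          + lsum (mode_bracket e b) (\<lambda>f. g (f # w)))"
      proof (rule lsum_cong)
        fix e assume e: "e \<in> Poly_Mapping.keys (mode_bracket a c)"
        then have "e \<in> B" using B Nil.prems c by (auto simp: bracket_closed_def)
        then show "g (b # e # w) = msign a b * msign b c * g (e # b # w)
          + lsum (mode_bracket e b) (\<lambda>f. g (f # w))"
          using rel[OF wB len \<open>e \<in> B\<close> Nil.prems(5)] msign_bracket(2)[OF e, of b] msign_commute[of c b] by simp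
      qed
      then show ?thesis by (simp add: lsum_fun_add lsum_fun_mult)
    qed
    have ab: "lsum (mode_bracket a b) (\<lambda>e. ader c (e # w) g) =
      lsum (mode_bracket a b) (\<lambda>e. lsum (mode_bracket e c) (\<lambda>f. g (f # w)))
      + msign a c * msign b c * lsum (mode_bracket a b) (\<lambda>e. ader c w (\<lambda>v. g (e # v)))"
    proof -
      have "lsum (mode_bracket a b) (\<lambda>e. msign e c * ader c w (\<lambda>v. g (e # v))) =
        msign a c * msign b c * lsum (mode_bracket a b) (\<lambda>e. ader c w (\<lambda>v. g (e # v)))"
        unfolding lsum_fun_mult[symmetric] by (rule lsum_cong) (simp add: msign_bracket)
      then show ?thesis by (simp add: lsum_fun_add)
    qed
    have J: "lsum (mode_bracket a b) (\<lambda>e. lsum (mode_bracket e c) (\<lambda>f. g (f # w))) =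
      lsum (mode_bracket b c) (\<lambda>e. lsum (mode_bracket a e) (\<lambda>f. g (f # w)))
      + msign b c * lsum (mode_bracket a c) (\<lambda>e. lsum (mode_bracket e b) (\<lambda>f. g (f # w)))"
      using bracket_jacobi[of b c a] by simp
    show ?case
      unfolding append_Nil ab J
      by (simp add: W bc ac algebra_simps)
  qed
  then show ?thesis using g unfolding respects_bracket_def by blast
qed

text \<open>
  The ground states form a weight module: on a vector of weight \<open>t\<close> and parity label \<open>p\<close> the zero
  mode of \<open>g\<close> acts by the scalar \<open>c g p t\<close>, shifting the weight.  The value of \<open>Psi\<close> on a word
  \<open>w\<close> is the coefficient, in the image of such a vector under \<open>w\<close>, of the ground state of
  the appropriate weight.
\<close>

locale current_algebra =
  fixes A :: "mode salg" and k \<Delta> :: complex and c :: "osp \<Rightarrow> bool \<Rightarrow> complex \<Rightarrow> complex"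
  assumes is_odd_A: "is_odd A = odd_mode" and bracket_A: "bracket A = mode_bracket"
    and closed_A: "bracket_closed (basis A)"
    and basis_A: "Cent \<in> basis A" "L0 \<in> basis A" "Mode Gh 0 \<in> basis A" "Mode Gf 0 \<in> basis A" "Mode Ge 0 \<in> basis A"
    and half_int_A: "Mode a n \<in> basis A \<Longrightarrow> 2 * n \<in> \<int>"
    and c_poly: "\<exists>P. \<forall>t. c g p t = poly P t"
    and c_Gh: "c Gh p t = t"
    and c_rel: "Mode g 0 \<in> basis A \<Longrightarrow> Mode h 0 \<in> basis A \<Longrightarrow>
       c g (p \<noteq> odd_osp h) (t + of_int (osp_wt h)) * c h p t
       - (if odd_osp g \<and> odd_osp h then -1 else 1) * (c h (p \<noteq> odd_osp g) (t + of_int (osp_wt g)) * c g p t)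
       = lsum (osp_bracket g h) (\<lambda>e. c e p t)"
begin

abbreviation "B \<equiv> basis A"

definition neg_mode :: "mode \<Rightarrow> bool" where
  "neg_mode a \<longleftrightarrow> mode_deg a < 0"

definition gcoef :: "mode \<Rightarrow> bool \<Rightarrow> complex \<Rightarrow> complex" where
  "gcoef a p t = (case a of Mode g m \<Rightarrow> if m = 0 then c g p t else 0 | Cent \<Rightarrow> k | L0 \<Rightarrow> \<Delta>)"

text \<open>The head is the first operator to act. A negative head moved to the far left leaves an
  image of a negative mode, which has no ground-state component, so only the supercommutator with
  the rest of the word survives. A nonnegative head acts on the ground state by a scalar. The
  recursion runs on the length since \<open>ader\<close> produces words that are not
  subterms.\<close>

primrec psi :: "nat \<Rightarrow> mode list \<Rightarrow> bool \<Rightarrow> complex \<Rightarrow> complex" where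
  "psi 0 w p t = 1"
| "psi (Suc n) w p t =
     (if neg_mode (hd w) then ader (hd w) (tl w) (\<lambda>u. psi n u p t)
      else psi n (tl w) (p \<noteq> odd_mode (hd w)) (t + of_int (mode_wt (hd w))) * gcoef (hd w) p t)"

definition Psi :: "mode list \<Rightarrow> bool \<Rightarrow> complex \<Rightarrow> complex" where
  "Psi w = psi (length w) w"

lemma Psi_Nil [simp]: "Psi [] p t = 1"
  by (simp add: Psi_def)

lemma Psi_neg: "neg_mode a \<Longrightarrow> Psi (a # w) p t = ader a w (\<lambda>u. Psi u p t)"
  unfolding Psi_def by simp (rule ader_cong_length, simp)

lemma Psi_nonneg:
  "\<not> neg_mode a \<Longrightarrow> Psi (a # w) p t = Psi w (p \<noteq> odd_mode a) (t + of_int (mode_wt a)) * gcoef a p t"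
  unfolding Psi_def by simp

lemma neg_bracket_keys:
  assumes "neg_mode a" "neg_mode b" "e \<in> Poly_Mapping.keys (mode_bracket a b)"
  shows "neg_mode e"
  using assms bracket_keys(3)[OF assms(3)] by (auto simp: neg_mode_def)

text \<open>The nonnegative modes act on the ground states as a representation. For two zero modes
  this is \<open>c_rel\<close>; for two currents, one of positive index, every term vanishes, while
  \<open>L0\<close> and \<open>Cent\<close> act by scalars.\<close>

lemma gcoef_rel:
  assumes ab: "a \<in> B" "b \<in> B" "\<not> neg_mode a" "\<not> neg_mode b"
  shows "gcoef a (p \<noteq> odd_mode b) (t + of_int (mode_wt b)) * gcoef b p t
     = msign a b * (gcoef b (p \<noteq> odd_mode a) (t + of_int (mode_wt a)) * gcoef a p t)
       + lsum (mode_bracket a b) (\<lambda>e. gcoef e p t)"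
proof (cases "a = L0 \<or> b = L0 \<or> a = Cent \<or> b = Cent")
  case True
  then show ?thesis
    by (cases a; cases b) (auto simp: gcoef_def msign_def)
next
  case False
  then obtain x m y n where [simp]: "a = Mode x m" "b = Mode y n" by (metis mode.exhaust)
  have mn: "m \<ge> 0" "n \<ge> 0" using ab by (auto simp: neg_mode_def)
  have *: "lsum (mode_bracket a b) (\<lambda>e. gcoef e p t) =
      (if m + n = 0 then lsum (osp_bracket x y) (\<lambda>e. c e p t) else 0)"
    using mn by (simp only: \<open>a = _\<close> \<open>b = _\<close> lsum_bracket_Mode) (auto simp: gcoef_def)
  show ?thesis
  proof (cases "m = 0 \<and> n = 0")
    case True
    then show ?thesis using c_rel[of x y p t] ab
      unfolding * by (simp add: gcoef_def msign_def diff_eq_eq add.commute)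
  next
    case False
    then have "m + n \<noteq> 0" using mn by auto
    with False show ?thesis unfolding * by (auto simp: gcoef_def)
  qed
qed

text \<open>Induction on the length with \<open>p\<close> and \<open>t\<close> free, since a
  nonnegative first letter changes both. If the exchanged pair is not at the head, the head is
  stripped off, using \<open>respects_bracket_ader\<close> when it is negative. At the head, the
  degrees of the pair decide between \<open>ader_commutator\<close>, the recursion itself and
  \<open>gcoef_rel\<close>.\<close>

lemma Psi_rel: "respects_bracket B n (\<lambda>u. Psi u p t)"
proof (induction n arbitrary: p t rule: less_induct)
  case (less n)
  show ?case unfolding respects_bracket_def
  proof (intro ballI impI)
    fix u w a b
    assume H: "u \<in> lists B" "w \<in> lists B" "a \<in> B" "b \<in> B" "length u + length w = n"
    show "Psi (u @ b # a # w) p t =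
       msign a b * Psi (u @ a # b # w) p t + lsum (mode_bracket a b) (\<lambda>e. Psi (u @ e # w) p t)"
    proof (cases u)
      case (Cons x u')
      have x: "x \<in> B" "u' \<in> lists B" "length u' + length w < n" using H Cons by auto
      note IH = less[OF x(3)]
      show ?thesis
      proof (cases "neg_mode x")
        case True
        show ?thesis
          using respects_bracketD[OF respects_bracket_ader[OF closed_A IH x(1)], of u' w a b] H x True Cons
          by (simp add: Psi_neg)
      next
        case False
        show ?thesis
          using respects_bracketD[OF IH, of u' w a b] H x False Cons
          by (simp add: Psi_nonneg lsum_fun_mult_right distrib_right mult.assoc)
      qed
    next
      case Nil
      consider "neg_mode a" "neg_mode b" | "neg_mode a" "\<not> neg_mode b" | "\<not> neg_mode a" "neg_mode b"
        | "\<not> neg_mode a" "\<not> neg_mode b" by blast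
      then show ?thesis
      proof cases
        case 1
        have "lsum (mode_bracket a b) (\<lambda>e. Psi (e # w) p t) =
          lsum (mode_bracket a b) (\<lambda>e. ader e w (\<lambda>u. Psi u p t))"
          by (rule lsum_cong) (simp add: Psi_neg neg_bracket_keys[OF 1])
        then show ?thesis using ader_commutator[of a w b "\<lambda>u. Psi u p t"] 1 Nil
          bracket_skew[of b a "\<lambda>e. Psi (e # w) p t"]
          by (simp add: Psi_neg msign_commute[of b a] algebra_simps)
      next
        \<comment> \<open>With exactly one negative letter, the exchange relation is the recursion
          clause that moves this letter past the other.\<close>
        case 2
        show ?thesis using 2 Nil bracket_skew[of b a "\<lambda>e. Psi (e # w) p t"]
          by (simp add: Psi_neg Psi_nonneg msign_commute[of b a] algebra_simps ader_fun_mult[symmetric])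
      next
        case 3
        show ?thesis using 3 Nil 
          by (simp add: Psi_neg Psi_nonneg algebra_simps ader_fun_mult[symmetric])
      next
        case 4
        have p: "((p \<noteq> odd_mode b) \<noteq> odd_mode a) = ((p \<noteq> odd_mode a) \<noteq> odd_mode b)" by auto
        let ?Q = "Psi w ((p \<noteq> odd_mode a) \<noteq> odd_mode b) (t + of_int (mode_wt a) + of_int (mode_wt b))"
        have e: "lsum (mode_bracket a b) (\<lambda>e. Psi (e # w) p t) =
          ?Q * lsum (mode_bracket a b) (\<lambda>e. gcoef e p t)"
          unfolding lsum_fun_mult[symmetric]
        proof (rule lsum_cong)
          fix e assume e: "e \<in> Poly_Mapping.keys (mode_bracket a b)"
          have "\<not> neg_mode e" using bracket_keys(3)[OF e] 4 by (auto simp: neg_mode_def)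
          moreover have "(p \<noteq> odd_mode e) = ((p \<noteq> odd_mode a) \<noteq> odd_mode b)"
            using bracket_keys(2)[OF e] by auto
          ultimately show "Psi (e # w) p t = ?Q * gcoef e p t"
            using bracket_keys(1)[OF e] by (simp add: Psi_nonneg add.assoc)
        qed
        have "Psi (b # a # w) p t = ?Q * (gcoef a (p \<noteq> odd_mode b) (t + of_int (mode_wt b)) * gcoef b p t)"
          using 4 p by (simp add: Psi_nonneg algebra_simps)
        moreover have "Psi (a # b # w) p t = ?Q * (gcoef b (p \<noteq> odd_mode a) (t + of_int (mode_wt a)) * gcoef a p t)"
          using 4 by (simp add: Psi_nonneg algebra_simps)
        ultimately show ?thesis
          unfolding Nil append_Nil e gcoef_rel[OF H(3,4) 4, of p t] by (simp add: algebra_simps)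
      qed
    qed
  qed
qed

lemma Psi_bracket:
  assumes "u \<in> lists B" "w \<in> lists B" "a \<in> B" "b \<in> B"
  shows "Psi (u @ b # a # w) p t =
    msign a b * Psi (u @ a # b # w) p t + lsum (mode_bracket a b) (\<lambda>e. Psi (u @ e # w) p t)"
  using respects_bracketD[OF Psi_rel assms refl] .

text \<open>The last letter acts last, and the image of a negative mode has no ground-state
  component. Along the recursion the last letter may turn into a bracket of two negative modes, so
  all negative letters are treated at once.\<close>

lemma Psi_snoc_neg: "neg_mode a \<Longrightarrow> Psi (u @ [a]) p t = 0"
proof (induction "length u" arbitrary: u a p t rule: less_induct)
  case less
  show ?case
  proof (cases u)
    case Nil
    then show ?thesis using less.prems by (simp add: Psi_neg)
  next
    case (Cons x u')
    show ?thesis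
    proof (cases "neg_mode x")
      case False
      then show ?thesis using Cons less by (simp add: Psi_nonneg)
    next
      case True
      have "ader x (v @ [a]) g = 0" if "\<And>v' e. length v' = length v \<Longrightarrow> neg_mode e \<Longrightarrow> g (v' @ [e]) = 0" for v g
        using that
      proof (induction v arbitrary: g)
        case Nil
        have "lsum (mode_bracket a x) (\<lambda>e. g [e]) = lsum (mode_bracket a x) (\<lambda>e. 0)"
          using Nil[of "[]"] neg_bracket_keys[OF less.prems True] by (intro lsum_cong) simp
        then show ?case by simp
      next
        case (Cons y v)
        have 1: "g (e # v @ [a]) = 0" for e
          using Cons.prems[of "e # v" a] less.prems by simp
        have 2: "g (y # v' @ [e]) = 0" if "length v' = length v" "neg_mode e" for v' e
          using Cons.prems[of "y # v'" e] that by simp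
        show ?case using 1 2 by (simp add: Cons.IH)
      qed
      then show ?thesis using Cons True less(1) by (simp add: Psi_neg)
    qed
  qed
qed

text \<open>Sums, products and integer translations preserve polynomials. The label \<open>p\<close>
  is kept apart from \<open>t\<close> so that each structure constant is a single polynomial in
  \<open>t\<close>.\<close>

lemma Psi_poly: "\<exists>P. \<forall>t. Psi w p t = poly P t"
proof -
  have ader: "\<exists>P. \<forall>t. ader a w (\<lambda>u. g u t) = poly P t"
    if g: "\<And>u. \<exists>P. \<forall>t. g u t = poly P t" for a w and g :: "mode list \<Rightarrow> complex \<Rightarrow> complex"
  proof -
    obtain P where P: "\<And>u t. g u t = poly (P u) t" using g by metis
    show ?thesis unfolding P
    proof (induction w arbitrary: P)
      case Nil
      have "\<forall>t. ader a [] (\<lambda>u. poly (P u) t) = poly 0 t" by simp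
      then show ?case by blast
    next
      case (Cons b w)
      obtain Q where Q: "\<forall>t. ader a w (\<lambda>u. poly (P (b # u)) t) = poly Q t"
        using Cons.IH[of "\<lambda>u. P (b # u)"] by blast
      have "\<forall>t. ader a (b # w) (\<lambda>u. poly (P u) t) =
        poly ((\<Sum>e\<in>Poly_Mapping.keys (mode_bracket b a). smult (Poly_Mapping.lookup (mode_bracket b a) e) (P (e # w)))
          + smult (msign b a) Q) t"
        using Q by (simp add: lsum_def poly_sum)
      then show ?case by blast
    qed
  qed
  have "\<exists>P. \<forall>t. psi n w p t = poly P t" for n w p
  proof (induction n arbitrary: w p)
    case 0
    have "\<forall>t. psi 0 w p t = poly 1 t" by simp
    then show ?case by blast
  next
    case (Suc n)
    show ?case
    proof (cases "neg_mode (hd w)")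
      case True
      then show ?thesis using ader[of "\<lambda>u t. psi n u p t" "hd w" "tl w"] Suc by simp
    next
      case False
      obtain P where P: "\<And>t. psi n (tl w) (p \<noteq> odd_mode (hd w)) t = poly P t" using Suc by metis
      have "\<exists>Q. \<forall>t. gcoef (hd w) p t = poly Q t"
      proof (cases "hd w")
        case (Mode g m)
        show ?thesis
        proof (cases "m = 0")
          case True
          then show ?thesis using Mode c_poly[of g p] by (simp add: gcoef_def)
        next
          case False
          then have "\<forall>t. gcoef (hd w) p t = poly 0 t" using Mode by (simp add: gcoef_def)
          then show ?thesis by blast
        qed
      next
        case Cent
        then have "\<forall>t. gcoef (hd w) p t = poly [:k:] t" by (simp add: gcoef_def)
        then show ?thesis by blast
      next
        case L0
        then have "\<forall>t. gcoef (hd w) p t = poly [:\<Delta>:] t" by (simp add: gcoef_def)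
        then show ?thesis by blast
      qed
      then obtain Q where Q: "\<And>t. gcoef (hd w) p t = poly Q t" by blast
      have "\<forall>t. psi (Suc n) w p t = poly (P \<circ>\<^sub>p [:of_int (mode_wt (hd w)), 1:] * Q) t"
        by (simp only: psi.simps False if_False P Q) (simp add: poly_pcompose add.commute)
      then show ?thesis by blast
    qed
  qed
  then show ?thesis unfolding Psi_def by blast
qed

end

section \<open>Free modules on words and ground states\<close>

interpretation pm: vector_space "scale :: complex \<Rightarrow> ('i \<Rightarrow>\<^sub>0 complex) \<Rightarrow> ('i \<Rightarrow>\<^sub>0 complex)"
  by unfold_locales (auto intro!: poly_mapping_eqI simp: lookup_add algebra_simps)

lemma lookup_lin_ext: "Poly_Mapping.lookup (lin_ext b u) x = lsum u (\<lambda>i. Poly_Mapping.lookup (b i) x)"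
  by (simp add: lin_ext_def lsum_def lookup_sum)

lemma lin_ext_add: "lin_ext b (u + v) = lin_ext b u + lin_ext b v"
  by (rule poly_mapping_eqI) (simp add: lookup_lin_ext lookup_add lsum_add)

lemma lin_ext_scale: "lin_ext b (scale c u) = scale c (lin_ext b u)"
  by (rule poly_mapping_eqI) (simp add: lookup_lin_ext lsum_scale)

lemma lin_ext_zero [simp]: "lin_ext b 0 = 0"
  by (simp add: lin_ext_def)

lemma lin_ext_uminus: "lin_ext b (- u) = - lin_ext b u"
  by (rule poly_mapping_eqI) (simp add: lookup_lin_ext lsum_uminus)

lemma lin_ext_diff: "lin_ext b (u - v) = lin_ext b u - lin_ext b v"
  by (rule poly_mapping_eqI) (simp add: lookup_lin_ext lookup_minus lsum_diff)

lemma lin_ext_single [simp]: "lin_ext b (Poly_Mapping.single i c) = scale c (b i)"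
  by (rule poly_mapping_eqI) (simp add: lookup_lin_ext)

lemma lin_ext_bvec [simp]: "lin_ext b (bvec i) = b i"
  by (simp add: bvec_def)

lemma lin_ext_lin_ext: "lin_ext f (lin_ext b u) = lin_ext (\<lambda>i. lin_ext f (b i)) u"
  by (rule poly_mapping_eqI) (simp add: lookup_lin_ext lsum_lin_ext)

lemma lookup_bvec: "Poly_Mapping.lookup (bvec i) j = (if i = j then 1 else 0)"
  by (simp add: bvec_def lookup_single when_def)

lemma lin_ext_id: "lin_ext bvec u = u"
proof (rule poly_mapping_eqI)
  fix x
  have "lsum u (\<lambda>i. Poly_Mapping.lookup (bvec i) x) = lsum u (\<lambda>i. if i = x then 1 else 0)"
    by (simp add: lookup_bvec)
  also have "\<dots> = Poly_Mapping.lookup u x"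
    by (auto simp: lsum_def in_keys_iff if_distrib cong: if_cong)
  finally show "Poly_Mapping.lookup (lin_ext bvec u) x = Poly_Mapping.lookup u x"
    by (simp add: lookup_lin_ext)
qed

lemma scale_as_single: "scale c (bvec i) = Poly_Mapping.single i c"
  by (rule poly_mapping_eqI) (simp add: lookup_bvec lookup_single when_def)

lemma lin_ext_subspace:
  assumes "pm.subspace K" "\<And>i. i \<in> Poly_Mapping.keys u \<Longrightarrow> b i \<in> K"
  shows "lin_ext b u \<in> K"
  unfolding lin_ext_def using assms by (intro pm.subspace_sum pm.subspace_scale) auto

lemma lin_ext_diff_fun: "lin_ext (\<lambda>i. f i - g i) u = lin_ext f u - lin_ext g u"
  by (simp add: lin_ext_def pm.scale_right_diff_distrib sum_subtractf)

lemma lin_ext_scale_fun: "lin_ext (\<lambda>i. scale c (f i)) u = scale c (lin_ext f u)"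
  by (simp add: lin_ext_def pm.scale_sum_right mult.commute)

lemma subspace_span_of: "pm.subspace (span_of X)"
  unfolding pm.subspace_def span_of_def
  by (auto dest!: subsetD[OF Poly_Mapping.keys_add] subsetD[OF keys_scale])

lemma bvec_in_span_of [simp]: "bvec i \<in> span_of X \<longleftrightarrow> i \<in> X"
  by (simp add: bvec_def span_of_def)

lemma span_of_subset:
  assumes "pm.subspace K" "\<And>i. i \<in> X \<Longrightarrow> bvec i \<in> K"
  shows "span_of X \<subseteq> K"
proof
  fix u assume "u \<in> span_of X"
  then have "lin_ext bvec u \<in> K" using assms by (intro lin_ext_subspace) (auto simp: span_of_def)
  then show "u \<in> K" by (simp add: lin_ext_id)
qed

lemma span_of_mono: "X \<subseteq> Y \<Longrightarrow> span_of X \<subseteq> span_of Y"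
  by (auto simp: span_of_def)

definition restrict_to :: "'i set \<Rightarrow> ('i \<Rightarrow>\<^sub>0 complex) \<Rightarrow> ('i \<Rightarrow>\<^sub>0 complex)" where
  "restrict_to S = lin_ext (\<lambda>i. if i \<in> S then bvec i else 0)"

lemma lookup_restrict_to: "Poly_Mapping.lookup (restrict_to S u) i = (if i \<in> S then Poly_Mapping.lookup u i else 0)"
proof -
  have "Poly_Mapping.lookup (restrict_to S u) i = (if i \<in> S then Poly_Mapping.lookup (lin_ext bvec u) i else 0)"
    unfolding restrict_to_def lookup_lin_ext lsum_def
    by (auto intro!: sum.cong sum.neutral simp: lookup_bvec)
  then show ?thesis by (simp add: lin_ext_id)
qed

lemma keys_restrict_to: "Poly_Mapping.keys (restrict_to S u) = Poly_Mapping.keys u \<inter> S"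
  by (auto simp: in_keys_iff lookup_restrict_to split: if_splits)

lemma restrict_to_compl: "restrict_to S u + restrict_to (- S) u = u"
  by (rule poly_mapping_eqI) (simp add: lookup_add lookup_restrict_to)

lemma lsum_restrict_to: "lsum (restrict_to S u) g = lsum u (\<lambda>i. if i \<in> S then g i else 0)"
  unfolding restrict_to_def lsum_lin_ext by (rule lsum_cong) auto

definition word_wt :: "mode list \<Rightarrow> int" where
  "word_wt w = sum_list (map mode_wt w)"

definition word_deg :: "mode list \<Rightarrow> rat" where
  "word_deg w = sum_list (map mode_deg w)"

lemma word_wt_simps [simp]: "word_wt [] = 0" "word_wt (a # w) = mode_wt a + word_wt w"
  "word_wt (u @ w) = word_wt u + word_wt w" "word_wt (rev w) = word_wt w"
  by (simp_all add: word_wt_def rev_map[symmetric] sum_list_rev)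

lemma word_deg_simps [simp]: "word_deg [] = 0" "word_deg (a # w) = mode_deg a + word_deg w"
  "word_deg (u @ w) = word_deg u + word_deg w" "word_deg (rev w) = word_deg w"
  by (simp_all add: word_deg_def rev_map[symmetric] sum_list_rev)

text \<open>Words are now in the usual order, the head acting last, as in \<open>free_rep\<close>;
  each later \<open>rev\<close> passes to the order used by \<open>Psi\<close>.\<close>

type_synonym fvec = "(mode list \<times> complex) \<Rightarrow>\<^sub>0 complex"

definition opr :: "mode \<Rightarrow> fvec \<Rightarrow> fvec" where
  "opr a = lin_ext (\<lambda>(w, \<mu>). bvec (a # w, \<mu>))"

lemma opr_simps: "opr a (u + v) = opr a u + opr a v" "opr a (scale z u) = scale z (opr a u)"
  "opr a (u - v) = opr a u - opr a v" "opr a 0 = 0" "opr a (bvec (w, \<mu>)) = bvec (a # w, \<mu>)"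
  by (simp_all add: opr_def lin_ext_add lin_ext_scale lin_ext_diff)

lemma opr_lin_ext: "opr a (lin_ext b u) = lin_ext (\<lambda>i. opr a (b i)) u"
  by (simp add: opr_def lin_ext_lin_ext)

definition bropr :: "mode \<Rightarrow> mode \<Rightarrow> fvec \<Rightarrow> fvec" where
  "bropr a b u = lin_ext (\<lambda>e. opr e u) (mode_bracket a b)"

lemma bropr_h: "bropr (Mode Gh 0) a u = scale (of_int (mode_wt a)) (opr a u)"
proof (cases a)
  case (Mode g n)
  have "osp_bracket Gh g = Poly_Mapping.single g (of_int (osp_wt g))" by (cases g) auto
  then show ?thesis using Mode
    by (simp add: bropr_def lin_ext_add lin_ext_scale)
qed (auto simp: bropr_def)

lemma bropr_L0: "bropr L0 a u = scale (- of_rat (mode_deg a)) (opr a u)"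
  by (cases a) (auto simp: bropr_def)

text \<open>Up to scalars the adjoint action of \<open>f_0\<close> sends e to h to f to 0 and x to y
  to 0. There is no central term, since the index of \<open>f_0\<close> is 0.\<close>

lemma bropr_f: "bropr (Mode Gf 0) a u = (case a of
    Mode Ge n \<Rightarrow> scale (-1) (opr (Mode Gh n) u) | Mode Gh n \<Rightarrow> scale 2 (opr (Mode Gf n) u)
  | Mode Gx n \<Rightarrow> scale (-1) (opr (Mode Gy n) u) | _ \<Rightarrow> 0)"
proof (cases a)
  case (Mode g n)
  then show ?thesis
    by (cases g) (auto simp: bropr_def lin_ext_add lin_ext_scale lin_ext_uminus)
qed (auto simp: bropr_def)

section \<open>Homogeneity of the pairing in the degree\<close>

context current_algebra
begin

definition neg_words :: "mode list set" where
  "neg_words = lists {a \<in> B. neg_mode a}"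

lemma ader_deg_zero:
  "(\<And>u. word_deg u = mode_deg a + word_deg w \<Longrightarrow> length u = length w \<Longrightarrow> g u = 0) \<Longrightarrow> ader a w g = 0"
proof (induction w arbitrary: g)
  case (Cons b w)
  have "lsum (mode_bracket b a) (\<lambda>e. g (e # w)) = lsum (mode_bracket b a) (\<lambda>e. 0)"
    by (rule lsum_cong) (auto intro!: Cons.prems dest: bracket_keys(3))
  moreover have "ader a w (\<lambda>u. g (b # u)) = 0"
    by (rule Cons.IH) (auto intro!: Cons.prems)
  ultimately show ?case by simp
qed simp

text \<open>Supercommuting preserves the total degree, and a nonnegative current that does not
  annihilate a ground state has degree 0.\<close>

lemma Psi_deg: "word_deg w \<noteq> 0 \<Longrightarrow> Psi w p t = 0"
proof (induction "length w" arbitrary: w p t rule: less_induct)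
  case less
  show ?case
  proof (cases w)
    case Nil
    then show ?thesis using less by simp
  next
    case (Cons a v)
    show ?thesis
    proof (cases "neg_mode a")
      case True
      then show ?thesis unfolding Cons Psi_neg[OF True]
        by (intro ader_deg_zero less(1)) (use less(2) Cons in auto)
    next
      case False
      show ?thesis
      proof (cases "mode_deg a = 0")
        case True
        then have "Psi v p' t' = 0" for p' t' using less Cons by auto
        then show ?thesis using Cons False by (simp add: Psi_nonneg)
      next
        case False': False
        then have "gcoef a p t = 0" by (cases a) (auto simp: gcoef_def)
        then show ?thesis using Cons False by (simp add: Psi_nonneg)
      qed
    qed
  qed
qed

end

text \<open>There is one ground vector for each weight in \<open>I\<close>. \<open>Ev\<close>
  records which weights carry even vectors, while \<open>pl\<close> is the label handed to
  \<open>c\<close>; they are separate because an even vector may have to carry the label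
  \<open>True\<close>. By \<open>c_exit\<close> the set \<open>I\<close> can be truncated, as at the
  top of a highest-weight chain.\<close>

locale ground_states = current_algebra +
  fixes I Ev :: "complex set" and pl :: "complex \<Rightarrow> bool"
  assumes pl: "\<mu> \<in> I \<Longrightarrow> Mode g 0 \<in> basis A \<Longrightarrow> \<mu> + of_int (osp_wt g) \<in> I \<Longrightarrow>
      pl (\<mu> + of_int (osp_wt g)) = (pl \<mu> \<noteq> odd_osp g)"
    and c_exit: "\<mu> \<in> I \<Longrightarrow> Mode g 0 \<in> basis A \<Longrightarrow> \<mu> + of_int (osp_wt g) \<notin> I \<Longrightarrow> c g (pl \<mu>) \<mu> = 0"
    and Ev: "\<mu> \<in> I \<Longrightarrow> \<mu> + of_int j \<in> Ev \<longleftrightarrow> (\<mu> \<in> Ev \<longleftrightarrow> even j)"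
begin

section \<open>Matrix elements, the radical and the ideals of the free module\<close>

definition FI :: "fvec set" where
  "FI = span_of (lists B \<times> I)"

text \<open>The coefficient of the ground state of weight \<mu>' in the image of \<open>u\<close>
  under \<open>w\<close>; the test on weights singles out the keys that can contribute.\<close>

definition mel :: "mode list \<Rightarrow> fvec \<Rightarrow> complex \<Rightarrow> complex" where
  "mel w u \<mu>' = lsum u (\<lambda>(W, \<mu>).
     if \<mu> + of_int (word_wt w + word_wt W) = \<mu>' then Psi (rev W @ rev w) (pl \<mu>) \<mu> else 0)"

text \<open>No word brings such a vector back to a nonzero ground component. It will turn out to be
  the preimage of the largest graded submodule without ground states.\<close>

definition Rad :: "fvec set" where
  "Rad = {u \<in> FI. \<forall>w\<in>lists B. \<forall>\<mu>'. mel w u \<mu>' = 0}"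

definition gvec :: "complex \<Rightarrow> fvec" where
  "gvec \<mu> = (if \<mu> \<in> I then bvec ([], \<mu>) else 0)"

text \<open>Such subspaces play the part of kernels of maps onto modules generated by ground states
  with the given structure constants. Relaxed Verma modules, their quotients and simple
  highest-weight modules are compared through these kernels, so that no map between the modules
  themselves has to be built.\<close>

definition ideal :: "fvec set \<Rightarrow> bool" where
  "ideal K \<longleftrightarrow> pm.subspace K \<and> K \<subseteq> FI \<and> (\<forall>a\<in>B. \<forall>u\<in>K. opr a u \<in> K) \<and>
     (\<forall>a\<in>B. \<forall>b\<in>B. \<forall>u\<in>FI. opr a (opr b u) - scale (msign a b) (opr b (opr a u)) - bropr a b u \<in> K) \<and>
     (\<forall>a\<in>B. \<forall>\<mu>\<in>I. \<not> neg_mode a \<longrightarrow>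
        bvec ([a], \<mu>) - scale (gcoef a (pl \<mu>) \<mu>) (gvec (\<mu> + of_int (mode_wt a))) \<in> K)"

lemma FI_subspace: "pm.subspace FI"
  unfolding FI_def by (rule subspace_span_of)

lemma bvec_FI: "w \<in> lists B \<Longrightarrow> \<mu> \<in> I \<Longrightarrow> bvec (w, \<mu>) \<in> FI"
  by (simp add: FI_def)

lemma FI_opr:
  assumes "a \<in> B" "u \<in> FI"
  shows "opr a u \<in> FI"
proof -
  have "Poly_Mapping.keys u \<subseteq> lists B \<times> I" using assms(2) by (simp add: FI_def span_of_def)
  then show ?thesis unfolding opr_def using assms(1)
    by (intro lin_ext_subspace FI_subspace) (auto simp: FI_def)
qed

lemma FI_bropr: "a \<in> B \<Longrightarrow> b \<in> B \<Longrightarrow> u \<in> FI \<Longrightarrow> bropr a b u \<in> FI"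
  unfolding bropr_def using closed_A
  by (intro lin_ext_subspace FI_subspace FI_opr) (auto simp: bracket_closed_def)

lemma gvec_FI: "gvec \<mu> \<in> FI"
  using FI_subspace by (auto simp: gvec_def bvec_FI pm.subspace_def)

lemma idealD:
  assumes "ideal K"
  shows "pm.subspace K" "K \<subseteq> FI" "a \<in> B \<Longrightarrow> u \<in> K \<Longrightarrow> opr a u \<in> K"
    "a \<in> B \<Longrightarrow> b \<in> B \<Longrightarrow> u \<in> FI \<Longrightarrow> opr a (opr b u) - scale (msign a b) (opr b (opr a u)) - bropr a b u \<in> K"
    "a \<in> B \<Longrightarrow> \<mu> \<in> I \<Longrightarrow> \<not> neg_mode a \<Longrightarrow>
        bvec ([a], \<mu>) - scale (gcoef a (pl \<mu>) \<mu>) (gvec (\<mu> + of_int (mode_wt a))) \<in> K"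
  using assms unfolding ideal_def by blast+

lemma mel_simps: "mel w (u + v) \<mu>' = mel w u \<mu>' + mel w v \<mu>'" "mel w (scale z u) \<mu>' = z * mel w u \<mu>'"
  "mel w (u - v) \<mu>' = mel w u \<mu>' - mel w v \<mu>'" "mel w 0 \<mu>' = 0"
  by (simp_all add: mel_def lsum_add lsum_scale lsum_diff)

lemma mel_lin_ext: "mel w (lin_ext b u) \<mu>' = lsum u (\<lambda>i. mel w (b i) \<mu>')"
  by (simp add: mel_def lsum_lin_ext)

lemma mel_bvec: "mel w (bvec (W, \<mu>)) \<mu>' =
   (if \<mu> + of_int (word_wt w + word_wt W) = \<mu>' then Psi (rev W @ rev w) (pl \<mu>) \<mu> else 0)"
  by (simp add: mel_def)

lemma mel_expand: "mel w u \<mu>' = lsum u (\<lambda>i. mel w (bvec i) \<mu>')"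
  by (simp add: mel_def)

lemma mel_opr: "mel w (opr a u) \<mu>' = mel (w @ [a]) u \<mu>'"
  unfolding opr_def mel_lin_ext mel_expand[of _ u]
  by (rule lsum_cong) (auto simp: mel_bvec algebra_simps)

lemma lsum_zeroI: "(\<And>i. i \<in> Poly_Mapping.keys u \<Longrightarrow> g i = 0) \<Longrightarrow> lsum u g = 0"
  using lsum_cong[of u g "\<lambda>_. 0"] by simp

lemma RadI: "u \<in> FI \<Longrightarrow> (\<And>w \<mu>'. w \<in> lists B \<Longrightarrow> mel w u \<mu>' = 0) \<Longrightarrow> u \<in> Rad"
  by (simp add: Rad_def)

lemma RadD: "u \<in> Rad \<Longrightarrow> w \<in> lists B \<Longrightarrow> mel w u \<mu>' = 0" "u \<in> Rad \<Longrightarrow> u \<in> FI"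
  by (simp_all add: Rad_def)

lemma bvec_notin_Rad: "bvec ([], \<mu>) \<notin> Rad"
proof
  assume "bvec ([], \<mu>) \<in> Rad"
  then have "mel [] (bvec ([], \<mu>)) \<mu> = 0" by (rule RadD) simp
  then show False by (simp add: mel_bvec)
qed

text \<open>Closure under \<open>opr\<close> holds because a letter can be moved from the vector to
  the test word; the commutation relations are \<open>Psi_bracket\<close>. With
  \<open>bvec_notin_Rad\<close> this provides a quotient of the free module in which basis ground
  vectors are nonzero.\<close>

lemma Rad_ideal: "ideal Rad"
  unfolding ideal_def
proof (intro conjI ballI impI)
  show "pm.subspace Rad"
    using FI_subspace unfolding pm.subspace_def Rad_def by (auto simp: mel_simps)
  show "Rad \<subseteq> FI" by (auto simp: Rad_def)
  show "opr a u \<in> Rad" if "a \<in> B" "u \<in> Rad" for a u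
    using that by (intro RadI FI_opr) (simp_all add: mel_opr RadD)
  show "opr a (opr b u) - scale (msign a b) (opr b (opr a u)) - bropr a b u \<in> Rad"
    if H: "a \<in> B" "b \<in> B" "u \<in> FI" for a b u
  proof (rule RadI)
    show "opr a (opr b u) - scale (msign a b) (opr b (opr a u)) - bropr a b u \<in> FI"
      using H FI_subspace by (intro pm.subspace_diff pm.subspace_scale FI_opr FI_bropr) auto
    fix w \<mu>' assume w: "w \<in> lists B"
    let ?g = "\<lambda>X i. mel X (bvec i) \<mu>'"
    have "mel w (opr a (opr b u) - scale (msign a b) (opr b (opr a u)) - bropr a b u) \<mu>' =
       mel (w @ [a, b]) u \<mu>' - msign a b * mel (w @ [b, a]) u \<mu>'
         - lsum (mode_bracket a b) (\<lambda>e. mel (w @ [e]) u \<mu>')"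
      by (simp add: mel_simps mel_opr bropr_def mel_lin_ext)
    also have "\<dots> = lsum u (\<lambda>i. ?g (w @ [a, b]) i - msign a b * ?g (w @ [b, a]) i
        - lsum (mode_bracket a b) (\<lambda>e. ?g (w @ [e]) i))"
    proof -
      have d: "lsum u (\<lambda>i. f i - h i) = lsum u f - lsum u h" for f h
        using lsum_fun_add[of u f "\<lambda>i. - h i"] by (simp add: lsum_fun_uminus)
      show ?thesis
        unfolding mel_expand[of _ u] d lsum_fun_mult lsum_swap[of u] by simp
    qed
    also have "\<dots> = 0"
    proof (rule lsum_zeroI, clarify)
      fix W \<mu> assume "(W, \<mu>) \<in> Poly_Mapping.keys u"
      then have W: "W \<in> lists B" using H(3) by (auto simp: FI_def span_of_def)
      have rW: "rev W \<in> lists B" and rw: "rev w \<in> lists B"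
        using W w by (auto simp: in_lists_conv_set)
      let ?C = "\<mu> + of_int (word_wt w + mode_wt a + mode_wt b + word_wt W) = \<mu>'"
      have "lsum (mode_bracket a b) (\<lambda>e. mel (w @ [e]) (bvec (W, \<mu>)) \<mu>') =
          lsum (mode_bracket a b) (\<lambda>e. (if ?C then 1 else 0) * Psi (rev W @ e # rev w) (pl \<mu>) \<mu>)"
        by (rule lsum_cong) (auto simp: mel_bvec bracket_keys(1) algebra_simps)
      then have e: "lsum (mode_bracket a b) (\<lambda>e. mel (w @ [e]) (bvec (W, \<mu>)) \<mu>') =
          (if ?C then 1 else 0) * lsum (mode_bracket a b) (\<lambda>e. Psi (rev W @ e # rev w) (pl \<mu>) \<mu>)"
        by (simp only: lsum_fun_mult)
      show "mel (w @ [a, b]) (bvec (W, \<mu>)) \<mu>' - msign a b * mel (w @ [b, a]) (bvec (W, \<mu>)) \<mu>'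
         - lsum (mode_bracket a b) (\<lambda>e. mel (w @ [e]) (bvec (W, \<mu>)) \<mu>') = 0"
        unfolding e using Psi_bracket[OF rW rw H(1,2), of "pl \<mu>" \<mu>]
        by (simp add: mel_bvec algebra_simps)
    qed
    finally show "mel w (opr a (opr b u) - scale (msign a b) (opr b (opr a u)) - bropr a b u) \<mu>' = 0" .
  qed
  show "bvec ([a], \<mu>) - scale (gcoef a (pl \<mu>) \<mu>) (gvec (\<mu> + of_int (mode_wt a))) \<in> Rad"
    if H: "a \<in> B" "\<mu> \<in> I" "\<not> neg_mode a" for a \<mu>
  proof (rule RadI)
    show "bvec ([a], \<mu>) - scale (gcoef a (pl \<mu>) \<mu>) (gvec (\<mu> + of_int (mode_wt a))) \<in> FI"
      using H by (intro pm.subspace_diff pm.subspace_scale FI_subspace gvec_FI bvec_FI) auto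
    fix w \<mu>' assume w: "w \<in> lists B"
    \<comment> \<open>Wherever the structure constant is nonzero, the label at the new weight agrees
      with the flip built into \<open>Psi\<close>; if the weight leaves \<open>I\<close>, the
      constant vanishes.\<close>
    have "\<mu> + of_int (mode_wt a) \<in> I \<Longrightarrow> gcoef a (pl \<mu>) \<mu> \<noteq> 0 \<Longrightarrow>
        pl (\<mu> + of_int (mode_wt a)) = (pl \<mu> \<noteq> odd_mode a)"
      using pl[of \<mu>] H by (cases a) (auto simp: gcoef_def split: if_splits)
    moreover have "\<mu> + of_int (mode_wt a) \<notin> I \<Longrightarrow> gcoef a (pl \<mu>) \<mu> = 0"
      using c_exit[of \<mu>] H by (cases a) (auto simp: gcoef_def)
    ultimately show "mel w (bvec ([a], \<mu>) - scale (gcoef a (pl \<mu>) \<mu>) (gvec (\<mu> + of_int (mode_wt a)))) \<mu>' = 0"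
      by (cases "gcoef a (pl \<mu>) \<mu> = 0"; cases "\<mu> + of_int (mode_wt a) \<in> I")
        (simp_all add: mel_simps mel_bvec gvec_def Psi_nonneg[OF H(3)] algebra_simps)
  qed
qed

lemma ideal_Int: "ideal K \<Longrightarrow> ideal K' \<Longrightarrow> ideal (K \<inter> K')"
  unfolding ideal_def by (auto intro: pm.subspace_inter)

section \<open>Reduction to negative words\<close>

lemma neg_words_sub: "W \<in> neg_words \<Longrightarrow> W \<in> lists B"
  by (auto simp: neg_words_def)

lemma neg_words_Cons [simp]: "a # W \<in> neg_words \<longleftrightarrow> a \<in> B \<and> neg_mode a \<and> W \<in> neg_words"
  by (auto simp: neg_words_def)

lemma neg_words_deg: "W \<in> neg_words \<Longrightarrow> W \<noteq> [] \<Longrightarrow> word_deg W < 0"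
proof (induction W)
  case (Cons a W)
  then have "word_deg W \<le> 0" by (cases "W = []") auto
  with Cons show ?case by (auto simp: neg_mode_def)
qed simp

text \<open>The easy half of Poincare-Birkhoff-Witt, with letters left unordered and no independence
  claimed: a nonnegative letter is moved to the right until it reaches the ground state.\<close>

lemma neg_spanning:
  assumes K: "ideal K" and u: "u \<in> FI"
  obtains v where "v \<in> span_of (neg_words \<times> I)" "u - v \<in> K"
proof -
  note KD = idealD[OF K]
  let ?FN = "span_of (neg_words \<times> I)"
  define Sp where "Sp = {u. \<exists>v\<in>?FN. u - v \<in> K}"
  have FN: "pm.subspace ?FN" by (rule subspace_span_of)
  have FNSp: "u \<in> Sp" if "u \<in> ?FN" for u
    using that KD(1) unfolding Sp_def by (intro CollectI bexI[of _ u]) (auto simp: pm.subspace_def)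
  have Sp: "pm.subspace Sp"
    unfolding pm.subspace_def
  proof (intro conjI ballI allI)
    show "0 \<in> Sp" using FN by (intro FNSp) (auto simp: pm.subspace_def)
    fix x y z assume "x \<in> Sp"
    then obtain x' where x': "x' \<in> ?FN" "x - x' \<in> K" by (auto simp: Sp_def)
    have "scale z x - scale z x' \<in> K"
      using pm.subspace_scale[OF KD(1) x'(2), of z] by (simp add: pm.scale_right_diff_distrib)
    then show "scale z x \<in> Sp" using x' FN by (auto simp: Sp_def pm.subspace_def)
    assume "y \<in> Sp"
    then obtain y' where y': "y' \<in> ?FN" "y - y' \<in> K" by (auto simp: Sp_def)
    have "x + y - (x' + y') \<in> K"
      using pm.subspace_add[OF KD(1) x'(2) y'(2)] by (simp add: algebra_simps)
    then show "x + y \<in> Sp" using x' y' FN by (auto simp: Sp_def pm.subspace_def)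
  qed
  have SpK: "x \<in> Sp" if xy: "y \<in> Sp" "x - y \<in> K" for x y
  proof -
    obtain v where "v \<in> ?FN" "y - v \<in> K" using xy by (auto simp: Sp_def)
    moreover from this have "x - v \<in> K" using pm.subspace_add[OF KD(1) xy(2), of "y - v"] by simp
    ultimately show ?thesis by (auto simp: Sp_def)
  qed
  have FNneg: "opr a v \<in> ?FN" if "a \<in> B" "neg_mode a" "v \<in> ?FN" for a v
  proof -
    have "Poly_Mapping.keys v \<subseteq> neg_words \<times> I" using that(3) by (simp add: span_of_def)
    then show ?thesis unfolding opr_def using that(1,2)
      by (intro lin_ext_subspace FN) auto
  qed
  have Spneg: "opr a v \<in> Sp" if a: "a \<in> B" "neg_mode a" "v \<in> Sp" for a v
  proof -
    obtain v' where v': "v' \<in> ?FN" "v - v' \<in> K" using a by (auto simp: Sp_def)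
    have "opr a v - opr a v' \<in> K" using KD(3)[OF a(1) v'(2)] by (simp add: opr_simps)
    then show ?thesis using FNneg[OF a(1,2) v'(1)] by (auto simp: Sp_def)
  qed
  \<comment> \<open>The letter \<open>a\<close> is generalised because an exchange with
    \<open>b\<close> leaves a bracket, whose letters may have any degree and act on the shorter
    word.\<close>
  have words: "opr a (bvec (W, \<mu>)) \<in> Sp" if "a \<in> B" "W \<in> neg_words" "\<mu> \<in> I" for a W \<mu>
    using that
  proof (induction W arbitrary: a)
    case Nil
    show ?case
    proof (cases "neg_mode a")
      case True
      then show ?thesis using Nil by (intro Spneg FNSp) auto
    next
      case False
      have "gvec (\<mu> + of_int (mode_wt a)) \<in> Sp"
        using Sp by (auto simp: gvec_def neg_words_def pm.subspace_def intro!: FNSp)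
      then have "scale (gcoef a (pl \<mu>) \<mu>) (gvec (\<mu> + of_int (mode_wt a))) \<in> Sp"
        using Sp by (auto simp: pm.subspace_def)
      from SpK[OF this KD(5)[OF Nil(1,3) False]] show ?thesis by (simp add: opr_simps)
    qed
  next
    case (Cons b W)
    have b: "b \<in> B" "neg_mode b" "W \<in> neg_words" using Cons.prems by auto
    let ?x = "bvec (W, \<mu>)"
    have IH: "opr e ?x \<in> Sp" if "e \<in> B" for e using Cons that by auto
    have "bropr a b ?x \<in> Sp" unfolding bropr_def
      using closed_A Cons.prems(1) b by (intro lin_ext_subspace Sp IH) (auto simp: bracket_closed_def)
    moreover have "scale (msign a b) (opr b (opr a ?x)) \<in> Sp"
      using Spneg[OF b(1,2) IH[OF Cons.prems(1)]] Sp by (auto simp: pm.subspace_def)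
    ultimately have "scale (msign a b) (opr b (opr a ?x)) + bropr a b ?x \<in> Sp"
      using Sp by (auto simp: pm.subspace_def)
    moreover have "opr a (opr b ?x) - (scale (msign a b) (opr b (opr a ?x)) + bropr a b ?x) \<in> K"
      using KD(4)[OF Cons.prems(1) b(1) bvec_FI[OF neg_words_sub[OF b(3)] that(3)]]
      by (simp add: algebra_simps)
    ultimately have "opr a (opr b ?x) \<in> Sp" by (rule SpK)
    then show ?case by (simp add: opr_simps)
  qed
  have opSp: "opr a u \<in> Sp" if a: "a \<in> B" "u \<in> Sp" for a u
  proof -
    obtain v where v: "v \<in> ?FN" "u - v \<in> K" using a by (auto simp: Sp_def)
    have "lin_ext (\<lambda>i. opr a (bvec i)) v \<in> Sp"
    proof (rule lin_ext_subspace[OF Sp])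
      fix i assume "i \<in> Poly_Mapping.keys v"
      then have "i \<in> neg_words \<times> I" using v(1) by (auto simp: span_of_def)
      then show "opr a (bvec i) \<in> Sp" using words[OF a(1)] by auto
    qed
    then have "opr a v \<in> Sp" by (metis opr_lin_ext lin_ext_id)
    moreover have "opr a u - opr a v \<in> K" using KD(3)[OF a(1) v(2)] by (simp add: opr_simps)
    ultimately show ?thesis by (rule SpK)
  qed
  have "bvec (W, \<mu>) \<in> Sp" if "W \<in> lists B" "\<mu> \<in> I" for W \<mu>
    using that
  proof (induction W)
    case Nil
    then show ?case by (intro FNSp) (auto simp: neg_words_def)
  next
    case (Cons a W)
    then have "opr a (bvec (W, \<mu>)) \<in> Sp" by (intro opSp) auto
    then show ?case by (simp add: opr_simps)
  qed
  then have "FI \<subseteq> Sp" unfolding FI_def by (intro span_of_subset Sp) auto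
  then show ?thesis using u that by (auto simp: Sp_def)
qed

section \<open>Separation of ground states by the diagonal operators\<close>

definition ev :: "mode \<Rightarrow> mode list \<times> complex \<Rightarrow> complex" where
  "ev T i = (if T = L0 then \<Delta> - of_rat (word_deg (fst i)) else snd i + of_int (word_wt (fst i)))"

lemma opr_ev:
  assumes K: "ideal K" and T: "T \<in> {L0, Mode Gh 0}" and i: "i \<in> lists B \<times> I"
  shows "opr T (bvec i) - scale (ev T i) (bvec i) \<in> K"
proof -
  note KD = idealD[OF K]
  obtain W \<mu> where i_eq: "i = (W, \<mu>)" by (cases i)
  have W: "W \<in> lists B" and \<mu>: "\<mu> \<in> I" using i i_eq by auto
  have TB: "T \<in> B" using T basis_A by auto
  show ?thesis using W unfolding i_eq
  proof (induction W)
    case Nil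
    have "T = L0 \<or> T = Mode Gh 0" using T by auto
    then show ?case
      using KD(5)[OF TB \<mu>] \<mu>
      by (elim disjE) (simp_all add: opr_simps ev_def neg_mode_def gcoef_def c_Gh gvec_def)
  next
    case (Cons a W)
    then have a: "a \<in> B" and IH: "opr T (bvec (W, \<mu>)) - scale (ev T (W, \<mu>)) (bvec (W, \<mu>)) \<in> K"
      and W: "W \<in> lists B" by auto
    let ?x = "bvec (W, \<mu>)"
    let ?d = "if T = L0 then - of_rat (mode_deg a) else of_int (mode_wt a) :: complex"
    have ms: "msign T a = 1" using T by (auto simp: msign_def)
    have br: "bropr T a ?x = scale ?d (opr a ?x)" using T by (auto simp: bropr_h bropr_L0)
    have 1: "opr T (opr a ?x) - opr a (opr T ?x) - scale ?d (opr a ?x) \<in> K"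
      using KD(4)[OF TB a bvec_FI[OF W \<mu>]] by (simp add: ms br)
    have 2: "opr a (opr T ?x) - scale (ev T (W, \<mu>)) (opr a ?x) \<in> K"
      using KD(3)[OF a IH] by (simp add: opr_simps)
    have e: "ev T (a # W, \<mu>) = ev T (W, \<mu>) + ?d"
      by (auto simp: ev_def of_rat_add)
    have "opr T (opr a ?x) - scale (ev T (a # W, \<mu>)) (opr a ?x) \<in> K"
      unfolding e using pm.subspace_add[OF KD(1) 1 2] by (simp add: pm.scale_left_distrib algebra_simps)
    then show ?case by (simp add: opr_simps)
  qed
qed

text \<open>
  Applying suitable factors \<open>T - z\<close> with \<open>T\<close> one of the diagonal operators isolates the coefficient of
  a single ground state, modulo \<open>K\<close>.
\<close>

definition factors :: "(mode \<times> complex) list \<Rightarrow> fvec \<Rightarrow> fvec" where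
  "factors ls u = foldr (\<lambda>(T, z) u. opr T u - scale z u) ls u"

lemma factors_bvec:
  assumes K: "ideal K" and ls: "\<forall>(T, z)\<in>set ls. T \<in> {L0, Mode Gh 0}" and i: "i \<in> lists B \<times> I"
  shows "factors ls (bvec i) - scale (\<Prod>(T, z)\<leftarrow>ls. ev T i - z) (bvec i) \<in> K"
  using ls
proof (induction ls)
  case Nil
  then show ?case using idealD(1)[OF K] by (simp add: factors_def pm.subspace_def)
next
  case (Cons l ls)
  note KD = idealD[OF K]
  obtain T z where l: "l = (T, z)" by (cases l)
  have T: "T \<in> {L0, Mode Gh 0}" using Cons.prems l by auto
  then have TB: "T \<in> B" using basis_A by auto
  let ?r = "\<Prod>(T, z)\<leftarrow>ls. ev T i - z"
  have IH: "factors ls (bvec i) - scale ?r (bvec i) \<in> K" using Cons by auto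
  have 1: "opr T (factors ls (bvec i)) - scale ?r (opr T (bvec i)) \<in> K"
    using KD(3)[OF TB IH] by (simp add: opr_simps)
  have 2: "scale ?r (opr T (bvec i)) - scale (?r * ev T i) (bvec i) \<in> K"
    using pm.subspace_scale[OF KD(1) opr_ev[OF K T i], of ?r] by (simp add: pm.scale_right_diff_distrib)
  have 3: "scale (- z) (factors ls (bvec i)) + scale (z * ?r) (bvec i) \<in> K"
    using pm.subspace_scale[OF KD(1) IH, of "- z"] by (simp add: pm.scale_right_diff_distrib)
  have "opr T (factors ls (bvec i)) - scale z (factors ls (bvec i)) - scale ((ev T i - z) * ?r) (bvec i) \<in> K"
    using pm.subspace_add[OF KD(1) pm.subspace_add[OF KD(1) 1 2] 3]
    by (simp add: algebra_simps pm.scale_left_diff_distrib)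
  then show ?case by (simp add: l factors_def)
qed

lemma factors_linear: "factors ls (u + v) = factors ls u + factors ls v"
  "factors ls (scale z u) = scale z (factors ls u)" "factors ls 0 = 0"
  by (induction ls) (auto simp: factors_def opr_simps pm.scale_right_diff_distrib pm.scale_right_distrib mult.commute)

lemma factors_sum: "factors ls (\<Sum>i\<in>S. f i) = (\<Sum>i\<in>S. factors ls (f i))"
  by (induction S rule: infinite_finite_induct) (auto simp: factors_linear)

lemma factors_lin_ext: "factors ls (lin_ext b u) = lin_ext (\<lambda>i. factors ls (b i)) u"
  by (simp add: lin_ext_def factors_sum factors_linear)

lemma factors_closed: "ideal K \<Longrightarrow> \<forall>(T, z)\<in>set ls. T \<in> {L0, Mode Gh 0} \<Longrightarrow> u \<in> K \<Longrightarrow> factors ls u \<in> K"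
proof (induction ls)
  case (Cons l ls)
  obtain T z where l: "l = (T, z)" by (cases l)
  have "T \<in> B" using Cons.prems l basis_A by auto
  with Cons show ?case using idealD[OF Cons.prems(1)]
    by (simp add: l factors_def pm.subspace_diff pm.subspace_scale)
qed (simp add: factors_def)

lemma ground_coeff:
  assumes K: "ideal K" and v: "v \<in> span_of (neg_words \<times> I)" "v \<in> K" and \<mu>: "\<mu> \<in> I"
    and n: "bvec ([], \<mu>) \<notin> K"
  shows "Poly_Mapping.lookup v ([], \<mu>) = 0"
proof -
  note KD = idealD[OF K]
  let ?keys = "Poly_Mapping.keys v - {([], \<mu>)}"
  obtain js where js: "set js = ?keys" using finite_list[of ?keys] by auto
  \<comment> \<open>A nonempty negative word has an \<open>L0\<close>-eigenvalue other than
    \<Delta>, and another ground state has another \<open>h_0\<close>-eigenvalue. So each remaining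
    key contributes a factor that kills it and acts on the chosen ground state by a nonzero
    scalar.\<close>
  define ls where "ls = map (\<lambda>(W, \<nu>). if W = [] then (Mode Gh 0, \<nu>) else (L0, \<Delta> - of_rat (word_deg W))) js"
  have ls: "\<forall>(T, z)\<in>set ls. T \<in> {L0, Mode Gh 0}" by (auto simp: ls_def split: if_splits)
  define r where "r i = (\<Prod>(T, z)\<leftarrow>ls. ev T i - z)" for i
  have r0: "r i = 0" if "i \<in> ?keys" for i
  proof -
    obtain W \<nu> where i: "i = (W, \<nu>)" by (cases i)
    have "(if W = [] then (Mode Gh 0, \<nu>) else (L0, \<Delta> - of_rat (word_deg W))) \<in> set ls"
      using that js i by (force simp: ls_def)
    then have "(0::complex) \<in> set (map (\<lambda>(T, z). ev T i - z) ls)"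
      by (force simp: ev_def i image_iff split: if_splits)
    then show ?thesis unfolding r_def by (simp add: prod_list_zero_iff)
  qed
  have r1: "r ([], \<mu>) \<noteq> 0"
  proof
    assume "r ([], \<mu>) = 0"
    then obtain T z where Tz: "(T, z) \<in> set ls" "ev T ([], \<mu>) = z"
      unfolding r_def by (auto simp: prod_list_zero_iff)
    then obtain W \<nu> where W: "(W, \<nu>) \<in> ?keys"
      "(T, z) = (if W = [] then (Mode Gh 0, \<nu>) else (L0, \<Delta> - of_rat (word_deg W)))"
      using js by (auto simp: ls_def)
    have "W \<in> neg_words" using W(1) v(1) by (auto simp: span_of_def)
    then show False using W Tz neg_words_deg[of W] by (auto simp: ev_def split: if_splits)
  qed
  have f: "factors ls v \<in> K" using factors_closed[OF K ls v(2)] .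
  have "lin_ext (\<lambda>i. factors ls (bvec i) - scale (r i) (bvec i)) v \<in> K"
    using v(1) unfolding r_def
    by (intro lin_ext_subspace KD(1) factors_bvec[OF K ls]) (auto simp: span_of_def dest: neg_words_sub)
  then have "factors ls v - lin_ext (\<lambda>i. scale (r i) (bvec i)) v \<in> K"
    by (simp only: lin_ext_diff_fun factors_lin_ext[symmetric] lin_ext_id)
  then have "lin_ext (\<lambda>i. scale (r i) (bvec i)) v \<in> K"
    using pm.subspace_diff[OF KD(1) f] by fastforce
  moreover have "lin_ext (\<lambda>i. scale (r i) (bvec i)) v =
      scale (r ([], \<mu>) * Poly_Mapping.lookup v ([], \<mu>)) (bvec ([], \<mu>))"
  proof (rule poly_mapping_eqI)
    fix x
    have "lsum v (\<lambda>i. r i * Poly_Mapping.lookup (bvec i) x) = lsum v (\<lambda>i. r x * Poly_Mapping.lookup (bvec i) x)"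
      by (rule lsum_cong) (simp add: lookup_bvec)
    also have "\<dots> = r x * Poly_Mapping.lookup v x"
      by (simp only: lsum_fun_mult lookup_lin_ext[symmetric] lin_ext_id)
    also have "\<dots> = (if x = ([], \<mu>) then r x * Poly_Mapping.lookup v x else 0)"
      using r0[of x] by (auto simp: in_keys_iff)
    finally show "Poly_Mapping.lookup (lin_ext (\<lambda>i. scale (r i) (bvec i)) v) x =
       Poly_Mapping.lookup (scale (r ([], \<mu>) * Poly_Mapping.lookup v ([], \<mu>)) (bvec ([], \<mu>))) x"
      by (auto simp: lookup_lin_ext lookup_bvec)
  qed
  ultimately have *: "scale (r ([], \<mu>) * Poly_Mapping.lookup v ([], \<mu>)) (bvec ([], \<mu>)) \<in> K" by simp
  show ?thesis
  proof (rule ccontr)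
    assume "Poly_Mapping.lookup v ([], \<mu>) \<noteq> 0"
    then have "scale (1 / (r ([], \<mu>) * Poly_Mapping.lookup v ([], \<mu>)))
       (scale (r ([], \<mu>) * Poly_Mapping.lookup v ([], \<mu>)) (bvec ([], \<mu>))) = bvec ([], \<mu>)"
      using r1 by simp
    then show False using pm.subspace_scale[OF KD(1) *] n by metis
  qed
qed

text \<open>A nonempty negative word ends, in the order of \<open>Psi\<close>, with its outermost
  negative letter, so \<open>Psi_snoc_neg\<close> leaves only the coefficient of the empty
  word.\<close>

lemma mel_neg_span:
  assumes "v \<in> span_of (neg_words \<times> I)"
  shows "mel [] v \<mu> = Poly_Mapping.lookup v ([], \<mu>)"
proof -
  have "mel [] v \<mu> = lsum v (\<lambda>i. Poly_Mapping.lookup (bvec i) ([], \<mu>))"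
    unfolding mel_expand[of _ v]
  proof (rule lsum_cong, clarify)
    fix W \<nu> assume "(W, \<nu>) \<in> Poly_Mapping.keys v"
    then have "W \<in> neg_words" using assms by (auto simp: span_of_def)
    then show "mel [] (bvec (W, \<nu>)) \<mu> = Poly_Mapping.lookup (bvec (W, \<nu>)) ([], \<mu>)"
      by (cases W) (auto simp: mel_bvec lookup_bvec Psi_snoc_neg)
  qed
  also have "\<dots> = Poly_Mapping.lookup v ([], \<mu>)"
    by (simp add: lookup_lin_ext[symmetric] lin_ext_id)
  finally show ?thesis .
qed

text \<open>If some word gave a vector of \<open>K\<close> a nonzero ground component, closure of
  \<open>K\<close> under the letters and \<open>ground_coeff\<close> would put a basis ground vector
  into \<open>K\<close>. Thus \<open>Rad\<close> is the largest ideal avoiding these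
  vectors.\<close>

lemma ideal_le_Rad:
  assumes K: "ideal K" and n: "\<And>\<mu>. \<mu> \<in> I \<Longrightarrow> bvec ([], \<mu>) \<notin> K"
  shows "K \<subseteq> Rad"
proof
  fix u assume u: "u \<in> K"
  have "mel w u \<mu> = 0" if "w \<in> lists B" for w \<mu>
    using that u
  proof (induction w arbitrary: u rule: rev_induct)
    case Nil
    \<comment> \<open>Reduction modulo the intersection keeps the reduced vector in \<open>K\<close>
      and changes its matrix elements by those of a vector of \<open>Rad\<close>, that is, not at
      all.\<close>
    have KR: "ideal (K \<inter> Rad)" using ideal_Int[OF K Rad_ideal] .
    have "u \<in> FI" using Nil idealD(2)[OF K] by auto
    then obtain v where v: "v \<in> span_of (neg_words \<times> I)" "u - v \<in> K \<inter> Rad"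
      by (rule neg_spanning[OF KR])
    have "v \<in> K" using pm.subspace_diff[OF idealD(1)[OF K] Nil(2), of "u - v"] v by simp
    have "Poly_Mapping.lookup v ([], \<mu>) = 0"
    proof (cases "\<mu> \<in> I")
      case True
      show ?thesis using ground_coeff[OF K v(1) \<open>v \<in> K\<close> True n[OF True]] .
    next
      case False
      then have "([], \<mu>) \<notin> Poly_Mapping.keys v" using v(1) by (auto simp: span_of_def)
      then show ?thesis by (simp add: in_keys_iff)
    qed
    moreover have "mel [] (u - v) \<mu> = 0" using v(2) by (intro RadD) auto
    ultimately show ?case using mel_neg_span[OF v(1), of \<mu>] by (simp add: mel_simps)
  next
    case (snoc a w)
    then show ?case using idealD(3)[OF K, of a u] by (simp add: mel_opr[symmetric])
  qed
  then show "u \<in> Rad" using u idealD(2)[OF K] by (intro RadI) auto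
qed

section \<open>Selection rules of the pairing for weight and degree\<close>

lemma mel_restrict:
  "mel w (restrict_to {(W, \<mu>). \<mu> + of_int (word_wt W) \<in> T} u) \<mu>' =
     (if \<mu>' - of_int (word_wt w) \<in> T then mel w u \<mu>' else 0)"
  unfolding mel_def lsum_restrict_to
  by (auto intro!: lsum_cong lsum_zeroI simp: algebra_simps split: prod.splits)

text \<open>Matrix elements separate the total weight, so cutting \<open>u\<close> down to a set of
  weights keeps or erases each of them. With the set of even weights this makes images of
  \<open>Rad\<close> graded.\<close>

lemma Rad_restrict:
  assumes "u \<in> Rad"
  shows "restrict_to {(W, \<mu>). \<mu> + of_int (word_wt W) \<in> T} u \<in> Rad"
proof (rule RadI)
  show "restrict_to {(W, \<mu>). \<mu> + of_int (word_wt W) \<in> T} u \<in> FI"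
    using RadD(2)[OF assms] by (auto simp: FI_def span_of_def keys_restrict_to)
qed (use assms in \<open>auto simp: mel_restrict dest: RadD\<close>)

lemma mel_h:
  assumes u: "u \<in> FI" and w: "w \<in> lists B"
  shows "mel w (opr (Mode Gh 0) u) \<mu>' = (\<mu>' - of_int (word_wt w)) * mel w u \<mu>'"
proof -
  have "mel w (opr (Mode Gh 0) u) \<mu>' = lsum u (\<lambda>i. mel w (opr (Mode Gh 0) (bvec i)) \<mu>')"
    by (metis mel_lin_ext opr_lin_ext lin_ext_id)
  also have "\<dots> = lsum u (\<lambda>i. (\<mu>' - of_int (word_wt w)) * mel w (bvec i) \<mu>')"
  proof (rule lsum_cong)
    fix i assume "i \<in> Poly_Mapping.keys u"
    then have i: "i \<in> lists B \<times> I" using u by (auto simp: FI_def span_of_def)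
    have "mel w (opr (Mode Gh 0) (bvec i) - scale (ev (Mode Gh 0) i) (bvec i)) \<mu>' = 0"
      using opr_ev[OF Rad_ideal _ i] w by (intro RadD) auto
    then show "mel w (opr (Mode Gh 0) (bvec i)) \<mu>' = (\<mu>' - of_int (word_wt w)) * mel w (bvec i) \<mu>'"
      by (cases i) (auto simp: mel_simps ev_def mel_bvec split: if_splits)
  qed
  also have "\<dots> = (\<mu>' - of_int (word_wt w)) * mel w u \<mu>'"
    unfolding mel_expand[of _ u] by (simp add: lsum_fun_mult)
  finally show ?thesis .
qed

text \<open>The eigenvalue is expressed through the test word rather than through the keys of
  \<open>u\<close>; both agree because nonzero matrix elements have total degree 0.\<close>

lemma mel_L0:
  assumes u: "u \<in> FI" and w: "w \<in> lists B"
  shows "mel w (opr L0 u) \<mu>' = (\<Delta> + of_rat (word_deg w)) * mel w u \<mu>'"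
proof -
  have "mel w (opr L0 u) \<mu>' = lsum u (\<lambda>i. mel w (opr L0 (bvec i)) \<mu>')"
    by (metis mel_lin_ext opr_lin_ext lin_ext_id)
  also have "\<dots> = lsum u (\<lambda>i. (\<Delta> + of_rat (word_deg w)) * mel w (bvec i) \<mu>')"
  proof (rule lsum_cong)
    fix i assume "i \<in> Poly_Mapping.keys u"
    then have i: "i \<in> lists B \<times> I" using u by (auto simp: FI_def span_of_def)
    obtain W \<nu> where i_eq: "i = (W, \<nu>)" by (cases i)
    have "mel w (opr L0 (bvec i) - scale (ev L0 i) (bvec i)) \<mu>' = 0"
      using opr_ev[OF Rad_ideal _ i] w by (intro RadD) auto
    then have *: "mel w (opr L0 (bvec i)) \<mu>' = (\<Delta> - of_rat (word_deg W)) * mel w (bvec i) \<mu>'"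
      by (simp add: mel_simps ev_def i_eq)
    show "mel w (opr L0 (bvec i)) \<mu>' = (\<Delta> + of_rat (word_deg w)) * mel w (bvec i) \<mu>'"
    proof (cases "word_deg W + word_deg w = 0")
      case True
      then have "word_deg w = - word_deg W" by simp
      then show ?thesis unfolding * by (simp add: of_rat_minus)
    next
      case False
      then have "mel w (bvec i) \<mu>' = 0" by (simp add: i_eq mel_bvec Psi_deg)
      then show ?thesis unfolding * by simp
    qed
  qed
  also have "\<dots> = (\<Delta> + of_rat (word_deg w)) * mel w u \<mu>'"
    unfolding mel_expand[of _ u] by (simp add: lsum_fun_mult)
  finally show ?thesis .
qed

text \<open>
  Local nilpotency of the adjoint action of \<open>f\<^sub>0\<close> makes the set of vectors killed modulo \<open>Rad\<close> by a
  power of \<open>f\<^sub>0\<close> an ideal; it contains no ground state, so it is \<open>Rad\<close>.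
\<close>

lemma f_injective:
  assumes f: "\<And>\<mu>. \<mu> \<in> I \<Longrightarrow> \<mu> - 2 \<in> I \<and> c Gf (pl \<mu>) \<mu> \<noteq> 0"
    and u: "u \<in> FI" "opr (Mode Gf 0) u \<in> Rad"
  shows "u \<in> Rad"
proof -
  let ?f = "opr (Mode Gf 0)"
  have fB: "Mode Gf 0 \<in> B" using basis_A by auto
  note RD = idealD[OF Rad_ideal]
  define N where "N = {u \<in> FI. \<exists>s. (?f ^^ s) u \<in> Rad}"
  have fpow: "(?f ^^ s) u \<in> Rad" if "u \<in> Rad" for s u
    using that by (induction s) (auto intro: RD(3) fB)
  have fadd: "(?f ^^ s) (u + v) = (?f ^^ s) u + (?f ^^ s) v" for s u v
    by (induction s) (auto simp: opr_simps)
  have fdiff: "(?f ^^ s) (u - v) = (?f ^^ s) u - (?f ^^ s) v" for s u v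
    by (induction s) (auto simp: opr_simps)
  have fscale: "(?f ^^ s) (scale z u) = scale z ((?f ^^ s) u)" for s z u
    by (induction s) (auto simp: opr_simps)
  have RadN: "u \<in> N" if "u \<in> Rad" for u
    using that RadD(2) by (auto simp: N_def intro: exI[of _ 0])
  have N: "pm.subspace N"
    unfolding pm.subspace_def
  proof (intro conjI ballI allI)
    show "0 \<in> N" using RD(1) by (intro RadN) (auto simp: pm.subspace_def)
    fix x y z assume x: "x \<in> N"
    then obtain s where "(?f ^^ s) x \<in> Rad" by (auto simp: N_def)
    then have "(?f ^^ s) (scale z x) \<in> Rad" using RD(1) by (simp add: fscale pm.subspace_scale)
    then show "scale z x \<in> N" using x FI_subspace by (auto simp: N_def pm.subspace_scale)
    assume y: "y \<in> N"
    obtain s t where st: "(?f ^^ s) x \<in> Rad" "(?f ^^ t) y \<in> Rad" using x y by (auto simp: N_def)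
    have "(?f ^^ (t + s)) x \<in> Rad" "(?f ^^ (s + t)) y \<in> Rad"
      using fpow[OF st(1), of t] fpow[OF st(2), of s] by (simp_all add: funpow_add)
    then have "(?f ^^ (s + t)) (x + y) \<in> Rad" using RD(1)
      by (simp add: fadd pm.subspace_add add.commute[of t s])
    then show "x + y \<in> N" using x y FI_subspace by (auto simp: N_def pm.subspace_def)
  qed
  have Nf: "u \<in> N" if u: "?f u \<in> N" "u \<in> FI" for u
  proof -
    obtain s where "(?f ^^ s) (?f u) \<in> Rad" using u by (auto simp: N_def)
    then have "(?f ^^ Suc s) u \<in> Rad" by (simp add: funpow_swap1)
    then show ?thesis using u unfolding N_def by blast
  qed
  \<comment> \<open>Induction on the power of \<open>f_0\<close> that kills \<open>u\<close>. Modulo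
    \<open>Rad\<close>, f_0 a u is a f_0 u + [f_0, a] u, where f_0 u is killed by one power less and
    the bracket term lies in \<open>N\<close> by assumption.\<close>
  have step: "opr a u \<in> N" if a: "a \<in> B" and br: "\<And>u. u \<in> N \<Longrightarrow> bropr (Mode Gf 0) a u \<in> N" and u: "u \<in> N" for a u
  proof -
    have "opr a u \<in> N" if "(?f ^^ s) u \<in> Rad" "u \<in> FI" for s u
      using that
    proof (induction s arbitrary: u)
      case 0
      then show ?case using RD(3)[OF a] by (intro RadN) simp
    next
      case (Suc s)
      have "msign (Mode Gf 0) a = 1" by (simp add: msign_def)
      then have r: "?f (opr a u) - (opr a (?f u) + bropr (Mode Gf 0) a u) \<in> N"
        using RD(4)[OF fB a Suc.prems(2)] by (intro RadN) (simp add: algebra_simps)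
      have "(?f ^^ s) (?f u) \<in> Rad" using Suc.prems by (simp add: funpow_swap1)
      then have 1: "opr a (?f u) \<in> N" using Suc.IH FI_opr[OF fB Suc.prems(2)] by blast
      have "u \<in> N" using Suc.prems unfolding N_def by blast
      then have 2: "bropr (Mode Gf 0) a u \<in> N" by (rule br)
      have "?f (opr a u) \<in> N"
        using pm.subspace_add[OF N r pm.subspace_add[OF N 1 2]] by simp
      then show ?case using FI_opr[OF a Suc.prems(2)] by (rule Nf)
    qed
    then show ?thesis using u by (auto simp: N_def)
  qed
  have zero: "0 \<in> N" using N by (auto simp: pm.subspace_def)
  have brB: "e \<in> B" if "Mode g n \<in> B" "e \<in> Poly_Mapping.keys (mode_bracket (Mode Gf 0) (Mode g n))" for e g n
    using that closed_A fB unfolding bracket_closed_def by blast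
  \<comment> \<open>The order of the generators follows the adjoint action of \<open>f_0\<close>
    backwards: f and y commute with \<open>f_0\<close>, x and h are sent to multiples of these, and
    e to a multiple of h.\<close>
  have Gf: "opr (Mode Gf n) u \<in> N" if "Mode Gf n \<in> B" "u \<in> N" for n u
    using that by (intro step) (simp_all add: bropr_f zero)
  have Gy: "opr (Mode Gy n) u \<in> N" if "Mode Gy n \<in> B" "u \<in> N" for n u
    using that by (intro step) (simp_all add: bropr_f zero)
  have Gx: "opr (Mode Gx n) u \<in> N" if "Mode Gx n \<in> B" "u \<in> N" for n u
  proof (rule step[OF that(1) _ that(2)])
    have "Mode Gy n \<in> B" using brB[OF that(1), of "Mode Gy n"] by (simp add: bvec_def in_keys_iff lookup_add lookup_single)
    then show "bropr (Mode Gf 0) (Mode Gx n) u \<in> N" if "u \<in> N" for u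
      using Gy that N by (simp only: bropr_f mode.case osp.case pm.subspace_scale)
  qed
  have Gh: "opr (Mode Gh n) u \<in> N" if "Mode Gh n \<in> B" "u \<in> N" for n u
  proof (rule step[OF that(1) _ that(2)])
    have "Mode Gf n \<in> B" using brB[OF that(1), of "Mode Gf n"] by (simp add: bvec_def in_keys_iff lookup_add lookup_single)
    then show "bropr (Mode Gf 0) (Mode Gh n) u \<in> N" if "u \<in> N" for u
      using Gf that N by (simp only: bropr_f mode.case osp.case pm.subspace_scale)
  qed
  have Ge: "opr (Mode Ge n) u \<in> N" if "Mode Ge n \<in> B" "u \<in> N" for n u
  proof (rule step[OF that(1) _ that(2)])
    have "Mode Gh n \<in> B" using brB[OF that(1), of "Mode Gh n"] by (simp add: bvec_def in_keys_iff lookup_add lookup_single)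
    then show "bropr (Mode Gf 0) (Mode Ge n) u \<in> N" if "u \<in> N" for u
      using Gh that N by (simp only: bropr_f mode.case osp.case pm.subspace_scale)
  qed
  have act: "opr a u \<in> N" if "a \<in> B" "u \<in> N" for a u
  proof (cases a)
    case (Mode g n)
    then show ?thesis using that Ge Gh Gf Gx Gy by (cases g) auto
  next
    case Cent
    then show ?thesis using that by (intro step) (simp_all add: bropr_f zero)
  next
    case L0
    then show ?thesis using that by (intro step) (simp_all add: bropr_f zero)
  qed
  have "ideal N"
    unfolding ideal_def using N act RadN RD by (auto simp: N_def)
  \<comment> \<open>By the hypothesis on \<open>c Gf\<close>, every power of \<open>f_0\<close>
    sends a ground vector to a nonzero multiple of another one modulo \<open>Rad\<close>.\<close>
  moreover have "bvec ([], \<mu>) \<notin> N" if "\<mu> \<in> I" for \<mu>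
  proof
    assume "bvec ([], \<mu>) \<in> N"
    then obtain s where "(?f ^^ s) (bvec ([], \<mu>)) \<in> Rad" by (auto simp: N_def)
    then show False using that
    proof (induction s arbitrary: \<mu>)
      case 0
      then show ?case using bvec_notin_Rad by simp
    next
      case (Suc s)
      let ?z = "c Gf (pl \<mu>) \<mu>"
      have "?f (bvec ([], \<mu>)) - scale ?z (bvec ([], \<mu> - 2)) \<in> Rad"
        using RD(5)[OF fB Suc.prems(2)] f[OF Suc.prems(2)]
        by (simp add: opr_simps gvec_def gcoef_def neg_mode_def)
      from fpow[OF this, of s]
      have 1: "(?f ^^ s) (?f (bvec ([], \<mu>))) - scale ?z ((?f ^^ s) (bvec ([], \<mu> - 2))) \<in> Rad"
        by (simp add: fdiff fscale)
      have "(?f ^^ s) (?f (bvec ([], \<mu>))) \<in> Rad" using Suc.prems(1) by (simp add: funpow_swap1)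
      from pm.subspace_diff[OF RD(1) this 1] have "scale ?z ((?f ^^ s) (bvec ([], \<mu> - 2))) \<in> Rad" by simp
      from pm.subspace_scale[OF RD(1) this, of "1 / ?z"]
      have "(?f ^^ s) (bvec ([], \<mu> - 2)) \<in> Rad" using f[OF Suc.prems(2)] by simp
      then show ?case using Suc.IH f[OF Suc.prems(2)] by blast
    qed
  qed
  ultimately have "N \<subseteq> Rad" by (rule ideal_le_Rad)
  moreover have "u \<in> N" using Nf[OF RadN[OF u(2)] u(1)] .
  ultimately show ?thesis by blast
qed

end

section \<open>Ranks of families depending polynomially on a parameter\<close>

interpretation fn: vector_space "\<lambda>(c::complex) (f :: 'i \<Rightarrow> complex) i. c * f i"
  by unfold_locales (auto simp: fun_eq_iff algebra_simps)

lemma fun_sum_apply: "(\<Sum>j\<in>S. f j) i = (\<Sum>j\<in>S. f j i)" for f :: "'j \<Rightarrow> 'i \<Rightarrow> complex"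
  by (induction S rule: infinite_finite_induct) auto

text \<open>Families rather than sets: two columns may coincide at special values of the parameter,
  and this has to count as dependence.\<close>

definition indep_family :: "'j set \<Rightarrow> ('j \<Rightarrow> 'i \<Rightarrow> complex) \<Rightarrow> bool" where
  "indep_family J f \<longleftrightarrow> (\<forall>a. (\<forall>i. (\<Sum>j\<in>J. a j * f j i) = 0) \<longrightarrow> (\<forall>j\<in>J. a j = 0))"

lemma indep_familyD: "indep_family J f \<Longrightarrow> (\<And>i. (\<Sum>j\<in>J. a j * f j i) = 0) \<Longrightarrow> j \<in> J \<Longrightarrow> a j = 0"
  unfolding indep_family_def by blast

lemma indep_family_independent:
  assumes J: "finite J" and f: "indep_family J f"
  shows "inj_on f J" "\<not> fn.dependent (f ` J)"
proof -
  show inj: "inj_on f J"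
  proof (rule inj_onI, rule ccontr)
    fix j j' assume H: "j \<in> J" "j' \<in> J" "f j = f j'" "j \<noteq> j'"
    let ?a = "\<lambda>x. (if x = j then 1 else 0) - (if x = j' then 1 else 0 :: complex)"
    have "(\<Sum>x\<in>J. ?a x * f x i) = 0" for i
      using J H by (simp add: left_diff_distrib sum_subtractf if_distrib[of "\<lambda>z. z * _"] cong: if_cong)
    from indep_familyD[OF f this H(1)] H(4) show False by simp
  qed
  show "\<not> fn.dependent (f ` J)"
  proof (rule fn.independent_if_scalars_zero)
    fix u x assume H: "(\<Sum>x\<in>f ` J. (\<lambda>i. u x * x i)) = 0" "x \<in> f ` J"
    then obtain j where j: "j \<in> J" "x = f j" by auto
    have "(\<Sum>j\<in>J. u (f j) * f j i) = 0" for i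
      using fun_cong[OF H(1), of i] by (simp add: fun_sum_apply sum.reindex[OF inj])
    from indep_familyD[OF f this j(1)] j(2) show "u x = 0" by simp
  qed (use J in simp)
qed

lemma independent_indep_family:
  assumes J: "finite J" and inj: "inj_on f J" and f: "\<not> fn.dependent (f ` J)"
  shows "indep_family J f"
  unfolding indep_family_def
proof (intro allI impI ballI)
  fix a j assume a: "\<forall>i. (\<Sum>j\<in>J. a j * f j i) = 0" and j: "j \<in> J"
  let ?u = "\<lambda>x. a (the_inv_into J f x)"
  have "(\<Sum>x\<in>f ` J. (\<lambda>i. ?u x * x i)) = 0"
  proof
    fix i
    have "(\<Sum>x\<in>f ` J. (\<lambda>i. ?u x * x i)) i = (\<Sum>j\<in>J. ?u (f j) * f j i)"
      by (simp add: fun_sum_apply sum.reindex[OF inj])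
    also have "\<dots> = (\<Sum>j\<in>J. a j * f j i)"
      by (rule sum.cong) (auto simp: the_inv_into_f_f[OF inj])
    finally show "(\<Sum>x\<in>f ` J. (\<lambda>i. ?u x * x i)) i = 0 i" using a by simp
  qed
  from fn.independentD[OF f _ subset_refl this, of "f j"] J j show "a j = 0"
    by (simp add: the_inv_into_f_f[OF inj])
qed

lemma indep_family_card_le_dim:
  assumes J: "finite J" "indep_family J f" and S: "f ` J \<subseteq> fn.span S" "finite S"
  shows "card J \<le> fn.dim S"
proof -
  obtain T where T: "T \<subseteq> S" "S \<subseteq> fn.span T" "card T = fn.dim S"
    by (rule fn.basis_exists)
  have "finite T" using T(1) S(2) finite_subset by blast
  have "fn.span S \<subseteq> fn.span T" using T(2) by (simp add: fn.span_minimal)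
  then have "card (f ` J) \<le> card T"
    using fn.independent_span_bound[OF \<open>finite T\<close> indep_family_independent(2)[OF J]] S(1) by blast
  then show ?thesis using T(3) card_image[OF indep_family_independent(1)[OF J]] by simp
qed

lemma dim_attained:
  assumes J: "finite J"
  obtains J0 where "J0 \<subseteq> J" "indep_family J0 f" "card J0 = fn.dim (f ` J)"
proof -
  obtain T where T: "T \<subseteq> f ` J" "\<not> fn.dependent T" "card T = fn.dim (f ` J)"
    by (rule fn.basis_exists)
  then obtain J0 where J0: "J0 \<subseteq> J" "inj_on f J0" "T = f ` J0" by (metis subset_image_inj)
  have "finite J0" using J J0(1) finite_subset by blast
  then show ?thesis
    using that[of J0] J0 T independent_indep_family[of J0 f] by (simp add: card_image)
qed

lemma indep_family_subset:
  assumes "finite J" "indep_family J f" "J' \<subseteq> J"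
  shows "indep_family J' f"
  unfolding indep_family_def
proof (intro allI impI ballI)
  fix a j assume a: "\<forall>i. (\<Sum>j\<in>J'. a j * f j i) = 0" and j: "j \<in> J'"
  have "(\<Sum>j\<in>J. (if j \<in> J' then a j else 0) * f j i) = 0" for i
  proof -
    have "(\<Sum>j\<in>J. (if j \<in> J' then a j else 0) * f j i) = (\<Sum>j\<in>J'. (if j \<in> J' then a j else 0) * f j i)"
      by (rule sum.mono_neutral_right) (use assms in auto)
    also have "\<dots> = (\<Sum>j\<in>J'. a j * f j i)" by (rule sum.cong) auto
    finally show ?thesis using a by simp
  qed
  from indep_familyD[OF assms(2) this, of j] j assms(3) show "a j = 0" by auto
qed

text \<open>Gaussian elimination with polynomial entries: a pivot nonzero at one point vanishes only finitely often.\<close>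

lemma indep_family_cofinite:
  fixes P :: "'j \<Rightarrow> 'i \<Rightarrow> complex poly"
  assumes "finite J" "indep_family J (\<lambda>j i. poly (P j i) t0)"
  shows "finite {t. \<not> indep_family J (\<lambda>j i. poly (P j i) t)}"
  using assms
proof (induction J arbitrary: P rule: finite_induct)
  case empty
  then show ?case by (simp add: indep_family_def)
next
  case (insert j0 J)
  have "\<exists>i0. poly (P j0 i0) t0 \<noteq> 0"
  proof (rule ccontr)
    assume "\<not> ?thesis"
    then have "(\<Sum>j\<in>insert j0 J. (if j = j0 then 1 else 0) * poly (P j i) t0) = 0" for i
      using insert.hyps by (simp add: if_distrib[of "\<lambda>z. z * _"] cong: if_cong)
    from indep_familyD[OF insert.prems this, of j0] show False by simp
  qed
  then obtain i0 where i0: "poly (P j0 i0) t0 \<noteq> 0" by blast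
  \<comment> \<open>Elimination without division: multiplying by the pivot keeps the entries
    polynomial, so that the induction applies to the remaining columns.\<close>
  define Q where "Q j i = P j0 i0 * P j i - P j i0 * P j0 i" for j i
  have Q: "(\<Sum>j\<in>J. a j * poly (Q j i) t) =
     poly (P j0 i0) t * (\<Sum>j\<in>J. a j * poly (P j i) t) - (\<Sum>j\<in>J. a j * poly (P j i0) t) * poly (P j0 i) t"
    for a i t
    by (simp add: Q_def right_diff_distrib sum_subtractf sum_distrib_left sum_distrib_right algebra_simps)
  have "indep_family J (\<lambda>j i. poly (Q j i) t0)"
    unfolding indep_family_def
  proof (intro allI impI ballI)
    fix a j assume a: "\<forall>i. (\<Sum>j\<in>J. a j * poly (Q j i) t0) = 0" and j: "j \<in> J"
    \<comment> \<open>A relation between columns of \<open>Q\<close> lifts to columns of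
      \<open>P\<close> after multiplication by the pivot; the coefficient of \<open>j0\<close> is
      read off from row \<open>i0\<close>.\<close>
    let ?b = "\<lambda>j. if j = j0 then - (\<Sum>j\<in>J. a j * poly (P j i0) t0) else poly (P j0 i0) t0 * a j"
    have "(\<Sum>j\<in>insert j0 J. ?b j * poly (P j i) t0) = 0" for i
    proof -
      have "(\<Sum>j\<in>J. ?b j * poly (P j i) t0) = poly (P j0 i0) t0 * (\<Sum>j\<in>J. a j * poly (P j i) t0)"
        unfolding sum_distrib_left by (rule sum.cong) (use insert.hyps in auto)
      then show ?thesis using insert.hyps a[rule_format, of i] Q[of a i t0] by simp
    qed
    moreover have "j \<noteq> j0" using j insert.hyps by auto
    ultimately show "a j = 0" using indep_familyD[OF insert.prems, of ?b j] j i0 by simp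
  qed
  then have fin: "finite {t. \<not> indep_family J (\<lambda>j i. poly (Q j i) t)}" by (rule insert.IH)
  have "P j0 i0 \<noteq> 0" using i0 by auto
  then have fin0: "finite {t. poly (P j0 i0) t = 0}" by (rule poly_roots_finite)
  have "indep_family (insert j0 J) (\<lambda>j i. poly (P j i) t)"
    if t: "indep_family J (\<lambda>j i. poly (Q j i) t)" "poly (P j0 i0) t \<noteq> 0" for t
    unfolding indep_family_def
  proof (intro allI impI)
    fix a assume a: "\<forall>i. (\<Sum>j\<in>insert j0 J. a j * poly (P j i) t) = 0"
    have a': "(\<Sum>j\<in>J. a j * poly (P j i) t) = - a j0 * poly (P j0 i) t" for i
      using a[rule_format, of i] insert.hyps by (simp add: eq_neg_iff_add_eq_0 add.commute)
    have "(\<Sum>j\<in>J. a j * poly (Q j i) t) = 0" for i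
      unfolding Q a' by (simp add: algebra_simps)
    then have J0: "\<forall>j\<in>J. a j = 0" using indep_familyD[OF t(1)] by blast
    then have "a j0 * poly (P j0 i0) t = 0" using a'[of i0] by simp
    then show "\<forall>j\<in>insert j0 J. a j = 0" using J0 t(2) by auto
  qed
  then have "{t. \<not> indep_family (insert j0 J) (\<lambda>j i. poly (P j i) t)} \<subseteq>
     {t. \<not> indep_family J (\<lambda>j i. poly (Q j i) t)} \<union> {t. poly (P j0 i0) t = 0}" by blast
  then show ?case using fin fin0 finite_subset by blast
qed

text \<open>The generic rank is the largest rank attained, which exists since ranks are at most the
  number of columns. A subfamily independent where the maximum occurs stays independent outside a
  finite set.\<close>

lemma generic_rank:
  fixes C :: "complex \<Rightarrow> 'j \<Rightarrow> 'i \<Rightarrow> complex"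
  assumes J: "finite J" and C: "\<And>j i. j \<in> J \<Longrightarrow> \<exists>P. \<forall>t. C t j i = poly P t"
  obtains r where "\<And>t. fn.dim (C t ` J) \<le> r" "finite {t. fn.dim (C t ` J) \<noteq> r}"
proof -
  obtain P where P: "\<And>j i t. j \<in> J \<Longrightarrow> C t j i = poly (P j i) t" using C by metis
  have bound: "fn.dim (C t ` J) \<le> card J" for t
  proof -
    have "fn.dim (C t ` J) \<le> card (C t ` J)" using J by (intro fn.dim_le_card) (auto intro: fn.span_base)
    then show ?thesis using card_image_le[OF J, of "C t"] by linarith
  qed
  define r where "r = Max (range (\<lambda>t. fn.dim (C t ` J)))"
  have fin: "finite (range (\<lambda>t. fn.dim (C t ` J)))"
    by (rule finite_subset[of _ "{..card J}"]) (use bound in auto)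
  have le: "fn.dim (C t ` J) \<le> r" for t unfolding r_def using fin by simp
  have "r \<in> range (\<lambda>t. fn.dim (C t ` J))" unfolding r_def using fin by (intro Max_in) auto
  then obtain t0 where t0: "r = fn.dim (C t0 ` J)" by auto
  obtain J0 where J0: "J0 \<subseteq> J" "indep_family J0 (C t0)" "card J0 = r"
    using dim_attained[OF J, of "C t0"] t0 by metis
  have fJ0: "finite J0" using J J0(1) finite_subset by blast
  have eq: "indep_family J0 (C t) \<longleftrightarrow> indep_family J0 (\<lambda>j i. poly (P j i) t)" for t
  proof -
    have "(\<Sum>j\<in>J0. a j * C t j i) = (\<Sum>j\<in>J0. a j * poly (P j i) t)" for a i
      using P J0(1) by (intro sum.cong) auto
    then show ?thesis by (simp add: indep_family_def)
  qed
  have "finite {t. \<not> indep_family J0 (C t)}"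
    using indep_family_cofinite[OF fJ0] J0(2) unfolding eq by blast
  moreover have "{t. fn.dim (C t ` J) \<noteq> r} \<subseteq> {t. \<not> indep_family J0 (C t)}"
  proof clarify
    fix t assume "fn.dim (C t ` J) \<noteq> r" "indep_family J0 (C t)"
    moreover from this(2) have "card J0 \<le> fn.dim (C t ` J)"
      using J0(1) J by (intro indep_family_card_le_dim[OF fJ0]) (auto intro: fn.span_base)
    ultimately show False using le[of t] J0(3) by simp
  qed
  ultimately have "finite {t. fn.dim (C t ` J) \<noteq> r}" using finite_subset by blast
  with le show ?thesis by (rule that)
qed


section \<open>Modules over the complex numbers\<close>

lemma complex_ring_simps [simp]:
  "carrier complex_ring = UNIV" "x \<otimes>\<^bsub>complex_ring\<^esub> y = x * y" "\<one>\<^bsub>complex_ring\<^esub> = 1"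
  "\<zero>\<^bsub>complex_ring\<^esub> = 0" "x \<oplus>\<^bsub>complex_ring\<^esub> y = x + y"
  by (simp_all add: complex_ring_def)

lemma cring_complex_ring: "cring complex_ring"
proof (rule cringI)
  show "abelian_group complex_ring"
    by (rule abelian_groupI) (auto intro: exI[of _ "- _"] simp: algebra_simps add_eq_0_iff2)
  show "comm_monoid complex_ring"
    by (rule comm_monoidI) (auto simp: algebra_simps)
qed (simp add: algebra_simps)

locale cmodule = Module.module complex_ring M for M (structure)
begin

lemma cs [simp]: "x \<in> carrier M \<Longrightarrow> z \<odot> x \<in> carrier M" for z
  by (rule smult_closed) simp_all

lemma cs_ldistr: "x \<in> carrier M \<Longrightarrow> (y + z) \<odot> x = y \<odot> x \<oplus> z \<odot> x"
  using smult_l_distr[of y z x] by simp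

lemma cs_rdistr: "x \<in> carrier M \<Longrightarrow> y \<in> carrier M \<Longrightarrow> z \<odot> (x \<oplus> y) = z \<odot> x \<oplus> z \<odot> y"
  using smult_r_distr[of z x y] by simp

lemma cs_assoc: "x \<in> carrier M \<Longrightarrow> (y * z) \<odot> x = y \<odot> (z \<odot> x)"
  using smult_assoc1[of y z x] by simp

lemma cs_one [simp]: "x \<in> carrier M \<Longrightarrow> 1 \<odot> x = x"
  using smult_one[of x] by simp

lemma cs_zero [simp]: "x \<in> carrier M \<Longrightarrow> 0 \<odot> x = \<zero>" "z \<odot> \<zero> = \<zero>"
  using smult_l_null[of x] smult_r_null[of z] by simp_all

lemma minus_eq_cs: "x \<in> carrier M \<Longrightarrow> \<ominus> x = (-1) \<odot> x"
proof -
  assume x: "x \<in> carrier M"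
  have "(-1) \<odot> x \<oplus> x = (-1 + 1) \<odot> x" using x by (simp only: cs_ldistr cs_one)
  then have "(-1) \<odot> x \<oplus> x = \<zero>" using x by simp
  then show ?thesis using x by (metis cs minus_equality)
qed

lemma submodule_iff:
  "submodule N complex_ring M \<longleftrightarrow>
     N \<subseteq> carrier M \<and> \<zero> \<in> N \<and> (\<forall>x\<in>N. \<forall>y\<in>N. x \<oplus> y \<in> N) \<and> (\<forall>z. \<forall>x\<in>N. z \<odot> x \<in> N)"
proof
  assume N: "submodule N complex_ring M"
  have z: "\<zero> \<in> N" using subgroup.one_closed[OF submodule.axioms(1)[OF N]] by simp
  show "N \<subseteq> carrier M \<and> \<zero> \<in> N \<and> (\<forall>x\<in>N. \<forall>y\<in>N. x \<oplus> y \<in> N) \<and> (\<forall>z. \<forall>x\<in>N. z \<odot> x \<in> N)"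
    using submoduleE(1,4,5)[OF N] z by auto
next
  assume N: "N \<subseteq> carrier M \<and> \<zero> \<in> N \<and> (\<forall>x\<in>N. \<forall>y\<in>N. x \<oplus> y \<in> N) \<and> (\<forall>z. \<forall>x\<in>N. z \<odot> x \<in> N)"
  then show "submodule N complex_ring M"
    using minus_eq_cs by (intro submoduleI) (auto simp: subset_iff)
qed

end

lemma cmoduleI: "Module.module complex_ring M \<Longrightarrow> cmodule M"
  by (simp add: cmodule_def)

text \<open>Weaker than \<open>super_module\<close>: neither bracket relations nor a parity
  decomposition are asked for. This is the notion that fits \<open>free_rep\<close>, where these
  appear only after passing to the quotient.\<close>

definition lin_rep :: "'g salg \<Rightarrow> ('g, 'v) rep \<Rightarrow> bool" where
  "lin_rep A M \<longleftrightarrow> Module.module complex_ring M \<and>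
     (\<forall>a\<in>basis A. \<forall>v\<in>carrier M. act M a v \<in> carrier M \<and>
       (\<forall>w\<in>carrier M. act M a (v \<oplus>\<^bsub>M\<^esub> w) = act M a v \<oplus>\<^bsub>M\<^esub> act M a w) \<and>
       (\<forall>z. act M a (z \<odot>\<^bsub>M\<^esub> v) = z \<odot>\<^bsub>M\<^esub> act M a v))"

lemma lin_repD:
  assumes "lin_rep A M"
  shows "cmodule M" "a \<in> basis A \<Longrightarrow> v \<in> carrier M \<Longrightarrow> act M a v \<in> carrier M"
    "a \<in> basis A \<Longrightarrow> v \<in> carrier M \<Longrightarrow> w \<in> carrier M \<Longrightarrow> act M a (v \<oplus>\<^bsub>M\<^esub> w) = act M a v \<oplus>\<^bsub>M\<^esub> act M a w"
    "a \<in> basis A \<Longrightarrow> v \<in> carrier M \<Longrightarrow> act M a (z \<odot>\<^bsub>M\<^esub> v) = z \<odot>\<^bsub>M\<^esub> act M a v"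
  using assms by (auto simp: lin_rep_def cmodule_def)

locale rep_quotient =
  fixes A :: "'g salg" and M :: "('g, 'v) rep" and N :: "'v set"
  assumes M: "lin_rep A M" and N: "subrep A M N"
begin

interpretation cmodule M using lin_repD(1)[OF M] .

lemma N_sub: "submodule N complex_ring M" and N_act: "a \<in> basis A \<Longrightarrow> v \<in> N \<Longrightarrow> act M a v \<in> N"
  using N by (auto simp: subrep_def)

lemma N_facts: "N \<subseteq> carrier M" "\<zero>\<^bsub>M\<^esub> \<in> N" "x \<in> N \<Longrightarrow> y \<in> N \<Longrightarrow> x \<oplus>\<^bsub>M\<^esub> y \<in> N" "x \<in> N \<Longrightarrow> z \<odot>\<^bsub>M\<^esub> x \<in> N"
  using N_sub unfolding submodule_iff by auto

interpretation abelian_subgroup N M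
  using submodule.axioms(1)[OF N_sub] abelian_group_axioms
  by (intro abelian_subgroupI3) (auto simp: additive_subgroup_def)

abbreviation proj :: "'v \<Rightarrow> 'v set" where "proj v \<equiv> N +>\<^bsub>M\<^esub> v"

lemma proj_eq_iff:
  assumes "v \<in> carrier M" "w \<in> carrier M"
  shows "proj v = proj w \<longleftrightarrow> v \<oplus>\<^bsub>M\<^esub> (-1) \<odot>\<^bsub>M\<^esub> w \<in> N"
proof
  assume "proj v = proj w"
  then have "v \<in> proj w" using a_rcos_self[OF assms(1)] by simp
  then show "v \<oplus>\<^bsub>M\<^esub> (-1) \<odot>\<^bsub>M\<^esub> w \<in> N"
    using a_rcos_module_imp[OF assms(2), of v] assms minus_eq_cs by simp
next
  assume "v \<oplus>\<^bsub>M\<^esub> (-1) \<odot>\<^bsub>M\<^esub> w \<in> N"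
  then have "v \<in> proj w" using a_rcos_module_rev[OF assms(2,1)] assms minus_eq_cs by simp
  then show "proj v = proj w" using a_repr_independence'[OF _ assms(2)] by simp
qed

lemma proj_mem: "v \<in> carrier M \<Longrightarrow> x \<in> proj v \<Longrightarrow> x \<in> carrier M \<and> proj x = proj v"
  using a_r_coset_subset_G[OF N_facts(1), of v] a_repr_independence'[of x v] by blast

text \<open>The operations of \<open>quotient_rep\<close> are unions over all representatives of a
  coset; linearity and stability of \<open>N\<close> make all members of the union equal.\<close>

lemma proj_well_defined:
  assumes v: "v \<in> carrier M" and F: "\<And>x. x \<in> carrier M \<Longrightarrow> F x \<in> carrier M"
    "\<And>x y. x \<in> carrier M \<Longrightarrow> y \<in> carrier M \<Longrightarrow> F (x \<oplus>\<^bsub>M\<^esub> y) = F x \<oplus>\<^bsub>M\<^esub> F y"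
    "\<And>z x. x \<in> carrier M \<Longrightarrow> F (z \<odot>\<^bsub>M\<^esub> x) = z \<odot>\<^bsub>M\<^esub> F x" "\<And>x. x \<in> N \<Longrightarrow> F x \<in> N"
  shows "(\<Union>x\<in>proj v. proj (F x)) = proj (F v)"
proof -
  have *: "proj (F x) = proj (F v)" if "x \<in> proj v" for x
  proof -
    have x: "x \<in> carrier M" "proj x = proj v" using proj_mem[OF v that] by auto
    then have "F (x \<oplus>\<^bsub>M\<^esub> (-1) \<odot>\<^bsub>M\<^esub> v) \<in> N" using proj_eq_iff v F(4) by blast
    then have "F x \<oplus>\<^bsub>M\<^esub> (-1) \<odot>\<^bsub>M\<^esub> F v \<in> N" using F x v by simp
    then show ?thesis using proj_eq_iff F x v by blast
  qed
  show ?thesis by (rule UN_constant_eq[OF a_rcos_self[OF v]]) (use * in blast)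
qed

abbreviation "Q \<equiv> quotient_rep M N"

lemma carrier_Q: "carrier Q = proj ` carrier M"
  by (auto simp: quotient_rep_def A_RCOSETS_def')

lemma zero_Q: "\<zero>\<^bsub>Q\<^esub> = N" "\<zero>\<^bsub>Q\<^esub> = proj \<zero>\<^bsub>M\<^esub>"
  using N_facts(1) by (simp_all add: quotient_rep_def)

lemma proj_add: "v \<in> carrier M \<Longrightarrow> w \<in> carrier M \<Longrightarrow> proj v \<oplus>\<^bsub>Q\<^esub> proj w = proj (v \<oplus>\<^bsub>M\<^esub> w)"
  by (simp add: quotient_rep_def a_rcos_sum)

lemma proj_smult: "v \<in> carrier M \<Longrightarrow> z \<odot>\<^bsub>Q\<^esub> proj v = proj (z \<odot>\<^bsub>M\<^esub> v)"
proof -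
  assume v: "v \<in> carrier M"
  have "z \<odot>\<^bsub>M\<^esub> (y \<odot>\<^bsub>M\<^esub> x) = y \<odot>\<^bsub>M\<^esub> (z \<odot>\<^bsub>M\<^esub> x)" if "x \<in> carrier M" for x y
    using that by (simp add: cs_assoc[symmetric] mult.commute)
  then show ?thesis
    using proj_well_defined[OF v, of "\<lambda>x. z \<odot>\<^bsub>M\<^esub> x"] N_facts by (simp add: quotient_rep_def cs_rdistr)
qed

lemma proj_act: "a \<in> basis A \<Longrightarrow> v \<in> carrier M \<Longrightarrow> act Q a (proj v) = proj (act M a v)"
  using proj_well_defined[of v "act M a"] lin_repD[OF M] N_act by (simp add: quotient_rep_def)

lemma proj_zero_iff: "v \<in> carrier M \<Longrightarrow> proj v = \<zero>\<^bsub>Q\<^esub> \<longleftrightarrow> v \<in> N"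
  using proj_eq_iff[of v "\<zero>\<^bsub>M\<^esub>"] by (simp add: zero_Q(2))

lemma proj_carrier: "v \<in> carrier M \<Longrightarrow> proj v \<in> carrier Q"
  by (simp add: carrier_Q)

lemma evens_odds_Q: "evens Q = proj ` evens M" "odds Q = proj ` odds M"
  by (simp_all add: quotient_rep_def)

lemma lin_rep_Q: "lin_rep A Q"
proof -
  have ab: "abelian_group Q"
  proof (rule abelian_groupI)
    show "\<zero>\<^bsub>Q\<^esub> \<in> carrier Q" unfolding zero_Q(2) by (rule proj_carrier) simp
    fix x assume "x \<in> carrier Q"
    then obtain v where v: "v \<in> carrier M" "x = proj v" by (auto simp: carrier_Q)
    show "\<zero>\<^bsub>Q\<^esub> \<oplus>\<^bsub>Q\<^esub> x = x" unfolding zero_Q(2) v(2) using v(1) by (simp add: proj_add)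
    show "\<exists>y\<in>carrier Q. y \<oplus>\<^bsub>Q\<^esub> x = \<zero>\<^bsub>Q\<^esub>"
      unfolding zero_Q(2) v(2) using v(1)
      by (intro bexI[of _ "proj (\<ominus>\<^bsub>M\<^esub> v)"] proj_carrier) (simp_all add: proj_add l_neg)
    fix y assume "y \<in> carrier Q"
    then obtain w where w: "w \<in> carrier M" "y = proj w" by (auto simp: carrier_Q)
    show "x \<oplus>\<^bsub>Q\<^esub> y \<in> carrier Q" unfolding v(2) w(2) using v(1) w(1) by (simp add: proj_add proj_carrier)
    show "x \<oplus>\<^bsub>Q\<^esub> y = y \<oplus>\<^bsub>Q\<^esub> x" unfolding v(2) w(2) using v(1) w(1) by (simp add: proj_add a_comm)
    fix z assume "z \<in> carrier Q"
    then obtain u where u: "u \<in> carrier M" "z = proj u" by (auto simp: carrier_Q)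
    show "x \<oplus>\<^bsub>Q\<^esub> y \<oplus>\<^bsub>Q\<^esub> z = x \<oplus>\<^bsub>Q\<^esub> (y \<oplus>\<^bsub>Q\<^esub> z)"
      unfolding v(2) w(2) u(2) using v(1) w(1) u(1) by (simp add: proj_add a_assoc)
  qed
  have "Module.module complex_ring Q"
    by (rule moduleI[OF cring_complex_ring ab])
      (auto simp: carrier_Q proj_add proj_smult cs_ldistr cs_rdistr cs_assoc)
  then show ?thesis unfolding lin_rep_def
    using lin_repD[OF M] by (auto simp: carrier_Q proj_add proj_smult proj_act)
qed

end


section \<open>Dimensions of images\<close>

definition lin_map :: "('x \<Rightarrow>\<^sub>0 complex) set \<Rightarrow> ('g, 'v) rep \<Rightarrow> (('x \<Rightarrow>\<^sub>0 complex) \<Rightarrow> 'v) \<Rightarrow> bool" where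
  "lin_map U M \<theta> \<longleftrightarrow> cmodule M \<and> pm.subspace U \<and> (\<forall>u\<in>U. \<theta> u \<in> carrier M) \<and>
     (\<forall>u\<in>U. \<forall>v\<in>U. \<theta> (u + v) = \<theta> u \<oplus>\<^bsub>M\<^esub> \<theta> v) \<and> (\<forall>u\<in>U. \<forall>z. \<theta> (scale z u) = z \<odot>\<^bsub>M\<^esub> \<theta> u)"

lemma lin_mapD:
  assumes "lin_map U M \<theta>"
  shows "cmodule M" "pm.subspace U" "u \<in> U \<Longrightarrow> \<theta> u \<in> carrier M"
    "u \<in> U \<Longrightarrow> v \<in> U \<Longrightarrow> \<theta> (u + v) = \<theta> u \<oplus>\<^bsub>M\<^esub> \<theta> v" "u \<in> U \<Longrightarrow> \<theta> (scale z u) = z \<odot>\<^bsub>M\<^esub> \<theta> u"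
    "\<theta> 0 = \<zero>\<^bsub>M\<^esub>"
proof -
  show *: "cmodule M" "pm.subspace U" "u \<in> U \<Longrightarrow> \<theta> u \<in> carrier M"
    "u \<in> U \<Longrightarrow> v \<in> U \<Longrightarrow> \<theta> (u + v) = \<theta> u \<oplus>\<^bsub>M\<^esub> \<theta> v" "u \<in> U \<Longrightarrow> \<theta> (scale z u) = z \<odot>\<^bsub>M\<^esub> \<theta> u" for u v z
    using assms by (auto simp: lin_map_def)
  have 0: "0 \<in> U" using *(2) by (simp add: pm.subspace_def)
  then have "\<theta> (scale 0 0) = 0 \<odot>\<^bsub>M\<^esub> \<theta> 0" by (rule *(5))
  then show "\<theta> 0 = \<zero>\<^bsub>M\<^esub>" using cmodule.cs_zero(1)[OF *(1) *(3)[OF 0]] by simp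
qed

lemma lin_map_sum:
  assumes \<theta>: "lin_map U M \<theta>" and S: "finite S" and u: "\<And>x. x \<in> S \<Longrightarrow> u x \<in> U"
  shows "\<theta> (\<Sum>x\<in>S. scale (z x) (u x)) = (\<Oplus>\<^bsub>M\<^esub>x\<in>S. z x \<odot>\<^bsub>M\<^esub> \<theta> (u x))"
  using S u
proof (induction S rule: finite_induct)
  case empty
  then show ?case using lin_mapD(1,6)[OF \<theta>] by (simp add: abelian_monoid.finsum_empty[OF abelian_group.axioms(1)] cmodule_def Module.module_def)
next
  case (insert x S)
  interpret cmodule M using lin_mapD(1)[OF \<theta>] .
  have "(\<Sum>x\<in>S. scale (z x) (u x)) \<in> U"
    using insert.prems lin_mapD(2)[OF \<theta>] by (intro pm.subspace_sum pm.subspace_scale) auto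
  moreover have "scale (z x) (u x) \<in> U"
    using insert.prems lin_mapD(2)[OF \<theta>] by (intro pm.subspace_scale) auto
  ultimately show ?case
    using insert lin_mapD(3-5)[OF \<theta>] by (simp add: Pi_def)
qed

text \<open>As \<open>subspace_dim\<close> is a supremum over finite independent sets, there are two
  bounds to prove: an independent set in \<open>W\<close> lifts to an independent family of
  functions \<open>Lw u\<close>, and a maximal independent subfamily of the columns maps injectively
  to an independent set in \<open>W\<close>.\<close>

lemma subspace_dim_transfer:
  fixes M :: "('g, 'v) rep" and b :: "'j \<Rightarrow> ('x \<Rightarrow>\<^sub>0 complex)" and Lw :: "('x \<Rightarrow>\<^sub>0 complex) \<Rightarrow> ('i \<Rightarrow> complex)"
  assumes \<theta>: "lin_map U M \<theta>" and J: "finite J" and b: "\<And>j. j \<in> J \<Longrightarrow> b j \<in> U"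
    and Lw: "\<And>u v i. Lw (u + v) i = Lw u i + Lw v i" "\<And>z u i. Lw (scale z u) i = z * Lw u i"
    and ker: "\<And>u. u \<in> pm.span (b ` J) \<Longrightarrow> \<theta> u = \<zero>\<^bsub>M\<^esub> \<longleftrightarrow> (\<forall>i. Lw u i = 0)"
    and W: "W = \<theta> ` pm.span (b ` J)"
  shows "subspace_dim M W = enat (fn.dim ((\<lambda>j. Lw (b j)) ` J))"
proof -
  interpret cmodule M using lin_mapD(1)[OF \<theta>] .
  let ?S = "pm.span (b ` J)"
  have SU: "?S \<subseteq> U" using b lin_mapD(2)[OF \<theta>] by (intro pm.span_minimal) auto
  have Lw0: "Lw 0 i = 0" for i using Lw(2)[of 0 0 i] by simp
  have Lw_sum: "Lw (\<Sum>x\<in>S. scale (z x) (u x)) i = (\<Sum>x\<in>S. z x * Lw (u x) i)"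
    if "finite S" for S :: "'y set" and z u i
    using that by (induction S rule: finite_induct) (auto simp: Lw Lw0)
  have Lw_sum': "Lw (\<Sum>x\<in>S. scale (z x) (u x)) i = (\<Sum>x\<in>S. z x * Lw (u x) i)"
    if "finite S" for S :: "'v set" and z u i
    using that by (induction S rule: finite_induct) (auto simp: Lw Lw0)
  have Lw_sumJ: "Lw (\<Sum>x\<in>S. scale (z x) (u x)) i = (\<Sum>x\<in>S. z x * Lw (u x) i)"
    if "finite S" for S :: "'j set" and z u i
    using that by (induction S rule: finite_induct) (auto simp: Lw Lw0)
  have Lw_span: "Lw u \<in> fn.span ((\<lambda>j. Lw (b j)) ` J)" if "u \<in> ?S" for u
    using that
  proof (induction rule: pm.span_induct_alt)
    case base
    have "Lw 0 = 0" by (simp add: fun_eq_iff Lw0)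
    show ?case unfolding \<open>Lw 0 = 0\<close> by (rule fn.span_zero)
  next
    case (step z x y)
    then have "Lw x \<in> fn.span ((\<lambda>j. Lw (b j)) ` J)" by (auto intro: fn.span_base)
    then have "(\<lambda>i. z * Lw x i) + Lw y \<in> fn.span ((\<lambda>j. Lw (b j)) ` J)"
      using step by (intro fn.span_add fn.span_scale)
    moreover have "Lw (scale z x + y) = (\<lambda>i. z * Lw x i) + Lw y" by (simp add: fun_eq_iff Lw)
    ultimately show ?case by (simp only:)
  qed
  show ?thesis unfolding subspace_dim_def
  proof (rule antisym)
    show "(SUP B\<in>{B. finite B \<and> B \<subseteq> W \<and> lin_indep M B}. enat (card B)) \<le> enat (fn.dim ((\<lambda>j. Lw (b j)) ` J))"
    proof (rule SUP_least)
      fix B assume "B \<in> {B. finite B \<and> B \<subseteq> W \<and> lin_indep M B}"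
      then have B: "finite B" "B \<subseteq> W" "lin_indep M B" by auto
      have "\<forall>x\<in>B. \<exists>u\<in>?S. \<theta> u = x" using B(2) W by auto
      then obtain u where u: "\<And>x. x \<in> B \<Longrightarrow> u x \<in> ?S" "\<And>x. x \<in> B \<Longrightarrow> \<theta> (u x) = x" by metis
      have "indep_family B (\<lambda>x. Lw (u x))"
        unfolding indep_family_def
      proof (intro allI impI)
        fix z assume z: "\<forall>i. (\<Sum>x\<in>B. z x * Lw (u x) i) = 0"
        let ?s = "\<Sum>x\<in>B. scale (z x) (u x)"
        have "?s \<in> ?S" using u(1) by (intro pm.span_sum pm.span_scale)
        then have "\<theta> ?s = \<zero>\<^bsub>M\<^esub>" using ker[of ?s] z Lw_sum'[OF B(1)] by simp
        then have "(\<Oplus>\<^bsub>M\<^esub>x\<in>B. z x \<odot>\<^bsub>M\<^esub> \<theta> (u x)) = \<zero>\<^bsub>M\<^esub>"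
          using lin_map_sum[OF \<theta> B(1) subsetD[OF SU u(1)], where z = z] by simp
        moreover have "(\<Oplus>\<^bsub>M\<^esub>x\<in>B. z x \<odot>\<^bsub>M\<^esub> \<theta> (u x)) = (\<Oplus>\<^bsub>M\<^esub>x\<in>B. z x \<odot>\<^bsub>M\<^esub> x)"
          using u B(2) W SU lin_mapD(3)[OF \<theta>] by (intro finsum_cong') (auto simp: Pi_def subset_iff)
        ultimately show "\<forall>x\<in>B. z x = 0" using B(1,3) unfolding lin_indep_def by (metis subset_refl)
      qed
      then have "card B \<le> fn.dim ((\<lambda>j. Lw (b j)) ` J)"
        using B(1) J Lw_span u(1) by (intro indep_family_card_le_dim) auto
      then show "enat (card B) \<le> enat (fn.dim ((\<lambda>j. Lw (b j)) ` J))" by simp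
    qed
    obtain J0 where J0: "J0 \<subseteq> J" "indep_family J0 (\<lambda>j. Lw (b j))" "card J0 = fn.dim ((\<lambda>j. Lw (b j)) ` J)"
      by (rule dim_attained[OF J])
    have fJ0: "finite J0" using J J0(1) finite_subset by blast
    have bS: "b j \<in> ?S" if "j \<in> J0" for j using that J0(1) by (auto intro: pm.span_base)
    have inj: "inj_on (\<lambda>j. \<theta> (b j)) J0"
    proof (rule inj_onI)
      fix j j' assume H: "j \<in> J0" "j' \<in> J0" "\<theta> (b j) = \<theta> (b j')"
      have U: "b j \<in> U" "b j' \<in> U" "scale (-1) (b j') \<in> U"
        using H bS SU pm.subspace_scale[OF lin_mapD(2)[OF \<theta>], of "b j'" "-1"] by blast+
      have "\<theta> (b j + scale (-1) (b j')) = \<theta> (b j') \<oplus>\<^bsub>M\<^esub> \<ominus>\<^bsub>M\<^esub> \<theta> (b j')"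
        unfolding lin_mapD(4)[OF \<theta> U(1,3)] lin_mapD(5)[OF \<theta> U(2)] minus_eq_cs[OF lin_mapD(3)[OF \<theta> U(2)]] H(3) ..
      also have "\<dots> = \<zero>\<^bsub>M\<^esub>" using lin_mapD(3)[OF \<theta> U(2)] by (rule r_neg)
      finally have "\<forall>i. Lw (b j + scale (-1) (b j')) i = 0"
        using ker[OF pm.span_add[OF bS[OF H(1)] pm.span_scale[OF bS[OF H(2)]]]] by blast
      then have "Lw (b j) i = Lw (b j') i" for i
        unfolding Lw by (simp add: eq_neg_iff_add_eq_0 flip: eq_iff_diff_eq_0)
      then have "Lw (b j) = Lw (b j')" by blast
      then show "j = j'" using inj_onD[OF indep_family_independent(1)[OF fJ0 J0(2)]] H by blast
    qed
    let ?B = "(\<lambda>j. \<theta> (b j)) ` J0"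
    have "lin_indep M ?B"
      unfolding lin_indep_def
    proof (intro allI impI, elim conjE)
      fix F z assume F: "finite F" "F \<subseteq> ?B" "(\<Oplus>\<^bsub>M\<^esub>v\<in>F. z v \<odot>\<^bsub>M\<^esub> v) = \<zero>\<^bsub>M\<^esub>"
      then obtain J1 where J1: "J1 \<subseteq> J0" "F = (\<lambda>j. \<theta> (b j)) ` J1" by (meson subset_imageE)
      have fJ1: "finite J1" using fJ0 J1(1) finite_subset by blast
      have injJ1: "inj_on (\<lambda>j. \<theta> (b j)) J1" using inj J1(1) inj_on_subset by blast
      have bU: "b j \<in> U" if "j \<in> J1" for j using that J1(1) bS SU by auto
      let ?s = "\<Sum>j\<in>J1. scale (z (\<theta> (b j))) (b j)"
      have "\<theta> ?s = (\<Oplus>\<^bsub>M\<^esub>j\<in>J1. z (\<theta> (b j)) \<odot>\<^bsub>M\<^esub> \<theta> (b j))"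
        using fJ1 bU by (intro lin_map_sum[OF \<theta>])
      also have "\<dots> = (\<Oplus>\<^bsub>M\<^esub>v\<in>F. z v \<odot>\<^bsub>M\<^esub> v)"
        unfolding J1(2) using lin_mapD(3)[OF \<theta>] bU injJ1
        by (subst finsum_reindex) (auto simp: Pi_def)
      finally have "\<theta> ?s = \<zero>\<^bsub>M\<^esub>" using F(3) by simp
      moreover have "?s \<in> ?S" using bS J1(1) by (intro pm.span_sum pm.span_scale) auto
      ultimately have "(\<Sum>j\<in>J1. z (\<theta> (b j)) * Lw (b j) i) = 0" for i
        using ker[of ?s] Lw_sumJ[OF fJ1, of "\<lambda>j. z (\<theta> (b j))" b i] by simp
      from indep_familyD[OF indep_family_subset[OF fJ0 J0(2) J1(1)] this]
      show "\<forall>v\<in>F. z v = 0" unfolding J1(2) by auto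
    qed
    moreover have "?B \<subseteq> W" using bS W by auto
    moreover have "card ?B = fn.dim ((\<lambda>j. Lw (b j)) ` J)" using card_image[OF inj] J0(3) by simp
    ultimately show "enat (fn.dim ((\<lambda>j. Lw (b j)) ` J)) \<le>
        (SUP B\<in>{B. finite B \<and> B \<subseteq> W \<and> lin_indep M B}. enat (card B))"
      using fJ0 by (intro SUP_upper2[of ?B]) auto
  qed
qed

text \<open>An injective operator carries finite independent sets to independent sets of the same
  size, so the comparison also makes sense for infinite dimensions.\<close>

lemma subspace_dim_mono:
  fixes M :: "('g, 'v) rep"
  assumes M: "cmodule M" and W: "W \<subseteq> carrier M" and F: "\<And>x. x \<in> W \<Longrightarrow> F x \<in> W'"
    and FM: "\<And>x. x \<in> carrier M \<Longrightarrow> F x \<in> carrier M"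
    and lin: "\<And>x y. x \<in> carrier M \<Longrightarrow> y \<in> carrier M \<Longrightarrow> F (x \<oplus>\<^bsub>M\<^esub> y) = F x \<oplus>\<^bsub>M\<^esub> F y"
      "\<And>z x. x \<in> carrier M \<Longrightarrow> F (z \<odot>\<^bsub>M\<^esub> x) = z \<odot>\<^bsub>M\<^esub> F x"
    and inj: "\<And>x. x \<in> carrier M \<Longrightarrow> F x = \<zero>\<^bsub>M\<^esub> \<Longrightarrow> x = \<zero>\<^bsub>M\<^esub>"
  shows "subspace_dim M W \<le> subspace_dim M W'"
  unfolding subspace_dim_def
proof (rule SUP_least)
  interpret cmodule M by (rule M)
  fix B assume "B \<in> {B. finite B \<and> B \<subseteq> W \<and> lin_indep M B}"
  then have B: "finite B" "B \<subseteq> W" "lin_indep M B" by auto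
  have BM: "x \<in> carrier M" if "x \<in> B" for x using that B W by auto
  have inj': "inj_on F (carrier M)"
  proof (rule inj_onI)
    fix x y assume H: "x \<in> carrier M" "y \<in> carrier M" "F x = F y"
    have "F (x \<oplus>\<^bsub>M\<^esub> (-1) \<odot>\<^bsub>M\<^esub> y) = F y \<oplus>\<^bsub>M\<^esub> \<ominus>\<^bsub>M\<^esub> F y"
      using H FM by (simp add: lin minus_eq_cs)
    also have "\<dots> = \<zero>\<^bsub>M\<^esub>" using FM H by (simp add: r_neg)
    finally have "x \<oplus>\<^bsub>M\<^esub> (-1) \<odot>\<^bsub>M\<^esub> y = \<zero>\<^bsub>M\<^esub>"
      by (rule inj[rotated]) (simp add: H)
    then have "x \<oplus>\<^bsub>M\<^esub> \<ominus>\<^bsub>M\<^esub> y = \<zero>\<^bsub>M\<^esub>" using H minus_eq_cs by simp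
    then show "x = y" using H by (metis a_inv_closed l_neg minus_equality minus_minus)
  qed
  have F0: "F \<zero>\<^bsub>M\<^esub> = \<zero>\<^bsub>M\<^esub>" using lin(2)[of "\<zero>\<^bsub>M\<^esub>" 0] FM[of "\<zero>\<^bsub>M\<^esub>"] by simp
  have Fsum: "F (\<Oplus>\<^bsub>M\<^esub>x\<in>S. z x \<odot>\<^bsub>M\<^esub> x) = (\<Oplus>\<^bsub>M\<^esub>x\<in>S. z x \<odot>\<^bsub>M\<^esub> F x)"
    if "finite S" "S \<subseteq> carrier M" for S z
    using that
  proof (induction S rule: finite_induct)
    case (insert x S)
    then have "(\<lambda>x. z x \<odot>\<^bsub>M\<^esub> x) \<in> S \<rightarrow> carrier M" "(\<lambda>x. z x \<odot>\<^bsub>M\<^esub> F x) \<in> S \<rightarrow> carrier M"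
      using FM by (auto simp: Pi_def)
    with insert show ?case using FM by (simp add: lin)
  qed (simp add: F0)
  have "lin_indep M (F ` B)"
    unfolding lin_indep_def
  proof (intro allI impI, elim conjE)
    fix G z assume G: "finite G" "G \<subseteq> F ` B" "(\<Oplus>\<^bsub>M\<^esub>v\<in>G. z v \<odot>\<^bsub>M\<^esub> v) = \<zero>\<^bsub>M\<^esub>"
    then obtain B1 where B1: "B1 \<subseteq> B" "G = F ` B1" by (meson subset_imageE)
    have fB1: "finite B1" using B(1) B1(1) finite_subset by blast
    have B1M: "B1 \<subseteq> carrier M" using B1 BM by auto
    have injB1: "inj_on F B1" using inj' B1M inj_on_subset by blast
    have "(\<Oplus>\<^bsub>M\<^esub>v\<in>G. z v \<odot>\<^bsub>M\<^esub> v) = (\<Oplus>\<^bsub>M\<^esub>x\<in>B1. z (F x) \<odot>\<^bsub>M\<^esub> F x)"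
      unfolding B1(2) using FM B1M injB1 by (subst finsum_reindex) (auto simp: Pi_def)
    also have "\<dots> = F (\<Oplus>\<^bsub>M\<^esub>x\<in>B1. z (F x) \<odot>\<^bsub>M\<^esub> x)" using Fsum[OF fB1 B1M] by simp
    finally have "F (\<Oplus>\<^bsub>M\<^esub>x\<in>B1. z (F x) \<odot>\<^bsub>M\<^esub> x) = \<zero>\<^bsub>M\<^esub>" using G(3) by simp
    moreover have "(\<Oplus>\<^bsub>M\<^esub>x\<in>B1. z (F x) \<odot>\<^bsub>M\<^esub> x) \<in> carrier M"
      using B1M by (intro finsum_closed) auto
    ultimately have "(\<Oplus>\<^bsub>M\<^esub>x\<in>B1. z (F x) \<odot>\<^bsub>M\<^esub> x) = \<zero>\<^bsub>M\<^esub>" using inj by blast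
    then have "\<forall>x\<in>B1. z (F x) = 0" 
      using B(3) fB1 B1(1) unfolding lin_indep_def by (elim allE[of _ B1] allE[of _ "\<lambda>x. z (F x)"]) auto
    then show "\<forall>v\<in>G. z v = 0" unfolding B1(2) by auto
  qed
  moreover have "card (F ` B) = card B" using inj' BM by (intro card_image inj_on_subset[OF inj']) auto
  moreover have "F ` B \<subseteq> W'" using B F by auto
  ultimately show "enat (card B) \<le> (SUP B\<in>{B. finite B \<and> B \<subseteq> W' \<and> lin_indep M B}. enat (card B))"
    using B(1) by (intro SUP_upper2[of "F ` B"]) auto
qed

section \<open>String functions as ranks\<close>

context current_algebra
begin

text \<open>The column of \<open>W\<close> in the Gram matrix of the weight space of weight \<nu>.
  The ground state to which \<open>W\<close> is applied has weight \<nu> minus the weight of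
  \<open>W\<close>, so for a fixed \<open>pf\<close> the entries are polynomials in \<nu>. Lists
  that are not words in the basis give zero rows.\<close>

definition col :: "(mode list \<Rightarrow> bool) \<Rightarrow> complex \<Rightarrow> mode list \<Rightarrow> mode list \<Rightarrow> complex" where
  "col pf \<nu> W w = (if w \<in> lists B then Psi (rev W @ rev w) (pf W) (\<nu> - of_int (word_wt W)) else 0)"

definition level_words :: "complex \<Rightarrow> mode list set" where
  "level_words n = {W \<in> neg_words. \<Delta> - of_rat (word_deg W) = n}"

lemma neg_mode_half: "a \<in> B \<Longrightarrow> neg_mode a \<Longrightarrow> mode_deg a \<le> - 1/2"
proof (cases a)
  case (Mode g n)
  assume a: "a \<in> B" "neg_mode a"
  then have n: "n < 0" "2 * n \<in> \<int>" using Mode half_int_A by (auto simp: neg_mode_def)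
  then obtain i where i: "2 * n = of_int i" by (auto elim: Ints_cases)
  with n(1) have "i < 0" by (metis of_int_less_0_iff mult_less_0_iff zero_less_numeral not_less_iff_gr_or_eq)
  then have "(of_int i :: rat) \<le> -1" by linarith
  with i show ?thesis using Mode by simp
qed (auto simp: neg_mode_def)

lemma neg_words_length: "W \<in> neg_words \<Longrightarrow> of_nat (length W) \<le> - 2 * word_deg W"
proof (induction W)
  case (Cons a W)
  then show ?case using neg_mode_half[of a] by (auto simp: neg_words_def)
qed simp

lemma neg_words_deg_le: "W \<in> neg_words \<Longrightarrow> word_deg W \<le> 0"
  using neg_words_length[of W] of_nat_0_le_iff[of "length W", where 'a = rat] by linarith

lemma neg_words_letter: "W \<in> neg_words \<Longrightarrow> a \<in> set W \<Longrightarrow> word_deg W \<le> mode_deg a"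
proof (induction W)
  case (Cons b W)
  have W: "W \<in> neg_words" and b: "mode_deg b < 0" using Cons.prems(1) by (auto simp: neg_words_def neg_mode_def)
  show ?case
  proof (cases "a = b")
    case True
    then show ?thesis using neg_words_deg_le[OF W] by simp
  next
    case False
    then show ?thesis using Cons W b by auto
  qed
qed simp

text \<open>Indices are multiples of 1/2, so length and letters of a negative word are bounded by
  its degree. Finiteness of a level is what allows a generic rank to be attached to it.\<close>

lemma finite_level_words: "finite (level_words n)"
proof (cases "level_words n = {}")
  case False
  then obtain W0 where W0: "W0 \<in> level_words n" by blast
  define d where "d = word_deg W0"
  have deg: "word_deg W = d" if "W \<in> level_words n" for W
  proof -
    have "of_rat (word_deg W) = (of_rat d :: complex)"
      using that W0 unfolding level_words_def d_def by (auto simp: algebra_simps)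
    then show ?thesis by (simp only: of_rat_eq_iff)
  qed
  obtain N :: nat where N: "- 2 * d \<le> of_nat N" using real_arch_simple by blast
  \<comment> \<open>The index of a letter is minus half of a natural number, at most
    \<open>N\<close> because \<open>N\<close> bounds twice the total degree in absolute
    value.\<close>
  let ?L = "(\<lambda>(g, i). Mode g (- of_nat i / 2)) ` ({Ge, Gh, Gf, Gx, Gy} \<times> {..N})"
  have "level_words n \<subseteq> {W. set W \<subseteq> ?L \<and> length W \<le> N}"
  proof (intro subsetI CollectI conjI)
    fix W assume W: "W \<in> level_words n"
    then have Wn: "W \<in> neg_words" by (simp add: level_words_def)
    have "of_nat (length W) \<le> (of_nat N :: rat)" using neg_words_length[OF Wn] deg[OF W] N by simp
    then show "length W \<le> N" by simp
    fix a assume a: "a \<in> set W"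
    then have aB: "a \<in> B" "neg_mode a" using Wn by (auto simp: neg_words_def)
    then obtain g m where m: "a = Mode g m" by (cases a) (auto simp: neg_mode_def)
    have "2 * m \<in> \<int>" "m < 0" using aB m half_int_A by (auto simp: neg_mode_def)
    then obtain i where i: "2 * m = of_int i" by (auto elim: Ints_cases)
    have "d \<le> m" using neg_words_letter[OF Wn a] deg[OF W] m by simp
    then have "of_int (- i) \<le> (of_nat N :: rat)" using i N by simp
    then have le: "- i \<le> int N" by (metis of_int_le_iff of_int_of_nat_eq)
    have "i < 0" using i \<open>m < 0\<close> by (metis of_int_less_0_iff mult_less_0_iff zero_less_numeral not_less_iff_gr_or_eq)
    then have "m = - of_nat (nat (- i)) / 2" using i by simp
    moreover have "nat (- i) \<in> {..N}" using le by simp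
    moreover have "g \<in> {Ge, Gh, Gf, Gx, Gy}" by (cases g) auto
    ultimately show "a \<in> ?L" using m by (intro image_eqI[of _ _ "(g, nat (- i))"]) auto
  qed
  moreover have "finite {W. set W \<subseteq> ?L \<and> length W \<le> N}" by (rule finite_lists_length_le) simp
  ultimately show ?thesis by (rule finite_subset)
qed simp

text \<open>Words of one level lower the weight by a bounded amount. Far below the top of a
  highest-weight module the truncation of the weight support is therefore invisible.\<close>

lemma level_words_wt_bound: "\<exists>N :: nat. \<forall>W\<in>level_words n. - word_wt W \<le> int N"
proof -
  have "finite ((\<lambda>W. nat (- word_wt W)) ` level_words n)" using finite_level_words by simp
  then obtain N where N: "\<And>x. x \<in> (\<lambda>W. nat (- word_wt W)) ` level_words n \<Longrightarrow> x \<le> N"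
    by (meson finite_nat_set_iff_bounded_le)
  have "- word_wt W \<le> int N" if "W \<in> level_words n" for W
    using N[OF imageI[OF that]] by linarith
  then show ?thesis by blast
qed

lemma col_rank:
  assumes "J \<subseteq> level_words n"
  obtains r where "\<And>t. fn.dim (col pf t ` J) \<le> r" "finite {t. fn.dim (col pf t ` J) \<noteq> r}"
proof -
  have J: "finite J" using finite_level_words assms by (rule rev_finite_subset)
  have "\<exists>P. \<forall>t. col pf t W w = poly P t" for W w
  proof (cases "w \<in> lists B")
    case True
    obtain P where P: "\<And>t. Psi (rev W @ rev w) (pf W) t = poly P t" using Psi_poly by blast
    have "\<forall>t. col pf t W w = poly (P \<circ>\<^sub>p [:- of_int (word_wt W), 1:]) t"
      using True by (simp add: col_def P poly_pcompose)
    then show ?thesis by blast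
  next
    case False
    then have "\<forall>t. col pf t W w = poly 0 t" by (simp add: col_def)
    then show ?thesis by blast
  qed
  then obtain r where "\<And>t. fn.dim (col pf t ` J) \<le> r" "finite {t. fn.dim (col pf t ` J) \<noteq> r}"
    using generic_rank[OF J, of "col pf"] by metis
  then show ?thesis by (rule that)
qed

end

section \<open>Modules presented by words on ground states; weight spaces as ranks\<close>

context ground_states
begin

text \<open>The module is the free module modulo \<open>K\<close>, through a chosen map. Relaxed
  Verma modules are presented by their own kernel \<open>K0\<close>, relaxed quotients and simple
  highest-weight modules by \<open>Rad\<close>.\<close>

definition presents :: "(mode, 'v) rep \<Rightarrow> (fvec \<Rightarrow> 'v) \<Rightarrow> fvec set \<Rightarrow> bool" where
  "presents M \<theta> K \<longleftrightarrow> lin_rep A M \<and> lin_map FI M \<theta> \<and>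
     (\<forall>a\<in>B. \<forall>u\<in>FI. \<theta> (opr a u) = act M a (\<theta> u)) \<and> \<theta> ` FI = carrier M \<and>
     (\<forall>u\<in>FI. \<theta> u = \<zero>\<^bsub>M\<^esub> \<longleftrightarrow> u \<in> K)"

lemma presentsD:
  assumes "presents M \<theta> K"
  shows "lin_rep A M" "lin_map FI M \<theta>" "a \<in> B \<Longrightarrow> u \<in> FI \<Longrightarrow> \<theta> (opr a u) = act M a (\<theta> u)"
    "\<theta> ` FI = carrier M" "u \<in> FI \<Longrightarrow> \<theta> u = \<zero>\<^bsub>M\<^esub> \<longleftrightarrow> u \<in> K" "cmodule M"
    "u \<in> FI \<Longrightarrow> v \<in> FI \<Longrightarrow> \<theta> (u + v) = \<theta> u \<oplus>\<^bsub>M\<^esub> \<theta> v" "u \<in> FI \<Longrightarrow> \<theta> (scale z u) = z \<odot>\<^bsub>M\<^esub> \<theta> u"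
    "u \<in> FI \<Longrightarrow> \<theta> u \<in> carrier M"
proof -
  show "lin_rep A M" "lin_map FI M \<theta>" "a \<in> B \<Longrightarrow> u \<in> FI \<Longrightarrow> \<theta> (opr a u) = act M a (\<theta> u)"
    "\<theta> ` FI = carrier M" "u \<in> FI \<Longrightarrow> \<theta> u = \<zero>\<^bsub>M\<^esub> \<longleftrightarrow> u \<in> K" for a u
    using assms unfolding presents_def by blast+
  note L = lin_mapD[OF \<open>lin_map FI M \<theta>\<close>]
  show "cmodule M" "u \<in> FI \<Longrightarrow> v \<in> FI \<Longrightarrow> \<theta> (u + v) = \<theta> u \<oplus>\<^bsub>M\<^esub> \<theta> v"
    "u \<in> FI \<Longrightarrow> \<theta> (scale z u) = z \<odot>\<^bsub>M\<^esub> \<theta> u" "u \<in> FI \<Longrightarrow> \<theta> u \<in> carrier M"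
    by (fact L)+
qed

lemma presents_eq_iff:
  assumes P: "presents M \<theta> K" and u: "u \<in> FI" "v \<in> FI"
  shows "\<theta> u = \<theta> v \<longleftrightarrow> u - v \<in> K"
proof -
  interpret cmodule M using presentsD(6)[OF P] .
  have uv: "u - v \<in> FI" "scale (-1) v \<in> FI" using u FI_subspace by (blast intro: pm.subspace_diff pm.subspace_scale)+
  have "\<theta> u = \<theta> (u - v) \<oplus>\<^bsub>M\<^esub> \<theta> v" using presentsD(7)[OF P uv(1) u(2)] by simp
  moreover have c: "\<theta> u \<in> carrier M" "\<theta> v \<in> carrier M" "\<theta> (u - v) \<in> carrier M" using presentsD(9)[OF P] u uv by auto
  ultimately have "\<theta> u = \<theta> v \<longleftrightarrow> \<theta> (u - v) = \<zero>\<^bsub>M\<^esub>" by simp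
  then show ?thesis using presentsD(5)[OF P uv(1)] by simp
qed

lemma presents_eigen:
  assumes P: "presents M \<theta> K" and u: "u \<in> FI" and a: "a \<in> B"
  shows "act M a (\<theta> u) = z \<odot>\<^bsub>M\<^esub> \<theta> u \<longleftrightarrow> opr a u - scale z u \<in> K"
proof -
  have "opr a u \<in> FI" "scale z u \<in> FI"
    using u a FI_opr FI_subspace by (auto simp: pm.subspace_scale)
  then show ?thesis using presents_eq_iff[OF P] presentsD(3)[OF P a u] presentsD(8)[OF P u] by metis
qed

definition weight_words :: "complex \<Rightarrow> complex \<Rightarrow> mode list set" where
  "weight_words \<nu> n = {W \<in> level_words n. \<nu> - of_int (word_wt W) \<in> I}"

text \<open>The weight space is spanned by negative words of the right level, each applied to the
  one ground state that fits, and a combination vanishes exactly if its matrix elements do. For the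
  harder inclusion, keys of wrong weight or level are discarded from a representative by negative
  words.\<close>

lemma string_function_rank:
  assumes P: "presents M \<theta> Rad"
  shows "string_function M \<nu> n =
    enat (fn.dim (col (\<lambda>W. pl (\<nu> - of_int (word_wt W))) \<nu> ` weight_words \<nu> n))"
proof -
  let ?J = "weight_words \<nu> n"
  define b where "b W = (bvec (W, \<nu> - of_int (word_wt W)) :: fvec)" for W
  define Lw where "Lw u w = (if w \<in> lists B then mel w u (\<nu> + of_int (word_wt w)) else 0)" for u w
  let ?h = "Mode Gh 0"
  have hB: "?h \<in> B" and LB: "L0 \<in> B" using basis_A by auto
  have J: "finite ?J" using finite_level_words by (rule rev_finite_subset) (auto simp: weight_words_def)
  have neg: "W \<in> neg_words" "\<nu> - of_int (word_wt W) \<in> I" "\<Delta> - of_rat (word_deg W) = n" if "W \<in> ?J" for W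
    using that by (auto simp: weight_words_def level_words_def)
  have bFI: "b W \<in> FI" if "W \<in> ?J" for W
    using neg[OF that] neg_words_sub by (auto simp: b_def intro: bvec_FI)
  let ?S = "pm.span (b ` ?J)"
  have SFI: "?S \<subseteq> FI" using bFI FI_subspace by (intro pm.span_minimal) auto
  note RD = idealD[OF Rad_ideal]
  \<comment> \<open>For vectors of the single weight \<nu> each test word has only one possible
    target weight, so rows can be indexed by words alone.\<close>
  have other: "mel w u \<mu>' = 0" if "u \<in> ?S" "\<mu>' \<noteq> \<nu> + of_int (word_wt w)" for u w \<mu>'
    using that(1)
  proof (induction rule: pm.span_induct_alt)
    case (step z x y)
    then show ?case using that(2) by (auto simp: mel_simps mel_bvec b_def)
  qed (simp add: mel_simps)
  have ker: "\<theta> u = \<zero>\<^bsub>M\<^esub> \<longleftrightarrow> (\<forall>w. Lw u w = 0)" if "u \<in> ?S" for u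
  proof -
    have "\<theta> u = \<zero>\<^bsub>M\<^esub> \<longleftrightarrow> u \<in> Rad" using that SFI presentsD(5)[OF P] by blast
    also have "\<dots> \<longleftrightarrow> (\<forall>w. Lw u w = 0)"
      using that SFI other[OF that] unfolding Rad_def Lw_def by (smt (verit) mem_Collect_eq subsetD)
    finally show ?thesis .
  qed
  have W: "weight_space M \<nu> n = \<theta> ` ?S"
  proof (rule equalityI; rule subsetI)
    fix x assume "x \<in> \<theta> ` ?S"
    then obtain u where u: "u \<in> ?S" "x = \<theta> u" by auto
    have "opr T u - scale z u \<in> Rad" if "T = L0 \<and> z = n \<or> T = ?h \<and> z = \<nu>" for T z
      using u(1)
    proof (induction rule: pm.span_induct_alt)
      case base
      then show ?case using RD(1) by (simp add: opr_simps pm.subspace_0)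
    next
      case (step y w u)
      then obtain W where W: "W \<in> ?J" "w = b W" by auto
      have "(W, \<nu> - of_int (word_wt W)) \<in> lists B \<times> I" using neg[OF W(1)] neg_words_sub by auto
      from opr_ev[OF Rad_ideal _ this, of T] have "opr T w - scale z w \<in> Rad"
        using that neg(3)[OF W(1)] by (auto simp: ev_def W(2) b_def)
      from pm.subspace_add[OF RD(1) pm.subspace_scale[OF RD(1) this, of y] step(2)]
      show ?case by (simp add: opr_simps algebra_simps)
    qed
    then show "x \<in> weight_space M \<nu> n"
      using u SFI presents_eigen[OF P _ hB] presents_eigen[OF P _ LB] presentsD(9)[OF P]
      by (auto simp: weight_space_def eigenspace_def)
  next
    fix x assume x: "x \<in> weight_space M \<nu> n"
    then obtain u where u: "u \<in> FI" "x = \<theta> u"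
      using presentsD(4)[OF P] by (auto simp: weight_space_def eigenspace_def)
    obtain v where v: "v \<in> span_of (neg_words \<times> I)" "u - v \<in> Rad"
      by (rule neg_spanning[OF Rad_ideal u(1)])
    have vFI: "v \<in> FI" using v(1) neg_words_sub by (auto simp: span_of_def FI_def)
    have xv: "x = \<theta> v" using presents_eq_iff[OF P u(1) vFI] v(2) u(2) by simp
    have h: "opr ?h v - scale \<nu> v \<in> Rad" and L: "opr L0 v - scale n v \<in> Rad"
      using x presents_eigen[OF P vFI hB] presents_eigen[OF P vFI LB] by (auto simp: xv weight_space_def eigenspace_def)
    define S where "S = {(W, \<mu>). \<mu> + of_int (word_wt W) = \<nu> \<and> \<Delta> - of_rat (word_deg W) = n}"
    let ?v = "restrict_to S v"
    have "?v = lin_ext bvec ?v" by (simp add: lin_ext_id)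
    moreover have "lin_ext bvec ?v \<in> ?S"
    proof (intro lin_ext_subspace pm.subspace_span pm.span_base)
      fix i assume "i \<in> Poly_Mapping.keys ?v"
      then have i: "i \<in> neg_words \<times> I" "i \<in> S" using v(1) by (auto simp: keys_restrict_to span_of_def)
      obtain W \<mu> where iW: "i = (W, \<mu>)" by (cases i)
      have m: "\<mu> = \<nu> - of_int (word_wt W)" using i iW by (auto simp: S_def algebra_simps)
      then have "W \<in> ?J" using i iW by (auto simp: S_def weight_words_def level_words_def)
      then show "bvec i \<in> b ` ?J" unfolding iW m b_def by blast
    qed
    ultimately have vS: "?v \<in> ?S" by simp
    \<comment> \<open>The eigenvalue equations make the matrix elements of \<open>v\<close> vanish
      outside the right weight and degree, and the discarded keys have no matrix elements
      inside.\<close>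
    have "v - ?v \<in> Rad"
    proof (rule RadI)
      show "v - ?v \<in> FI" using vFI vS SFI FI_subspace by (auto intro: pm.subspace_diff)
      fix w \<mu>' assume w: "w \<in> lists B"
      have vv: "mel w ?v \<mu>' = lsum v (\<lambda>i. if i \<in> S then mel w (bvec i) \<mu>' else 0)"
        by (simp add: mel_expand[of _ ?v] lsum_restrict_to)
      have z: "mel w v \<mu>' = 0" if "\<mu>' - of_int (word_wt w) \<noteq> \<nu> \<or> \<Delta> + of_rat (word_deg w) \<noteq> n"
      proof -
        have "(\<mu>' - of_int (word_wt w) - \<nu>) * mel w v \<mu>' = 0"
          using RadD(1)[OF h w] by (simp add: mel_simps mel_h[OF vFI w] algebra_simps)
        moreover have "(\<Delta> + of_rat (word_deg w) - n) * mel w v \<mu>' = 0"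
          using RadD(1)[OF L w] by (simp add: mel_simps mel_L0[OF vFI w] algebra_simps)
        ultimately show ?thesis using that by auto
      qed
      have m: "mel w (bvec (W, \<mu>)) \<mu>' = 0"
        if "\<mu>' - of_int (word_wt w) \<noteq> \<mu> + of_int (word_wt W) \<or> word_deg w + word_deg W \<noteq> 0" for W \<mu>
        using that Psi_deg[of "rev W @ rev w"] by (auto simp: mel_bvec algebra_simps)
      show "mel w (v - ?v) \<mu>' = 0"
      proof (cases "\<mu>' - of_int (word_wt w) \<noteq> \<nu> \<or> \<Delta> + of_rat (word_deg w) \<noteq> n")
        case True
        have "mel w (bvec (W, \<mu>)) \<mu>' = 0" if "(W, \<mu>) \<in> S" for W \<mu>
        proof (rule m, rule ccontr)
          assume "\<not> (\<mu>' - of_int (word_wt w) \<noteq> \<mu> + of_int (word_wt W) \<or> word_deg w + word_deg W \<noteq> 0)"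
          moreover then have "word_deg w = - word_deg W" by simp
          ultimately show False using True \<open>(W, \<mu>) \<in> S\<close> by (auto simp: S_def of_rat_minus)
        qed
        then have "mel w ?v \<mu>' = 0" unfolding vv by (intro lsum_zeroI) auto
        then show ?thesis using z[OF True] by (simp add: mel_simps)
      next
        case False
        have "mel w (bvec (W, \<mu>)) \<mu>' = 0" if "(W, \<mu>) \<notin> S" for W \<mu>
        proof (rule m, rule ccontr)
          assume "\<not> (\<mu>' - of_int (word_wt w) \<noteq> \<mu> + of_int (word_wt W) \<or> word_deg w + word_deg W \<noteq> 0)"
          moreover then have "word_deg w = - word_deg W" by simp
          ultimately show False using False \<open>(W, \<mu>) \<notin> S\<close> by (auto simp: S_def of_rat_minus)
        qed
        then have "mel w ?v \<mu>' = mel w v \<mu>'" unfolding vv mel_expand[of _ v] by (intro lsum_cong) auto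
        then show ?thesis by (simp add: mel_simps)
      qed
    qed
    then have "x = \<theta> ?v" using presents_eq_iff[OF P vFI] vS SFI xv by blast
    then show "x \<in> \<theta> ` ?S" using vS by blast
  qed
  have "string_function M \<nu> n = enat (fn.dim ((\<lambda>W. Lw (b W)) ` ?J))"
    unfolding string_function_def
    by (rule subspace_dim_transfer[OF presentsD(2)[OF P] J bFI _ _ ker W]) (auto simp: Lw_def mel_simps)
  moreover have "Lw (b W) = col (\<lambda>W. pl (\<nu> - of_int (word_wt W))) \<nu> W" for W
    by (auto simp: fun_eq_iff Lw_def col_def b_def mel_bvec)
  ultimately show ?thesis by simp
qed

text \<open>\<open>f_0\<close> commutes with \<open>L0\<close> and is injective modulo
  \<open>Rad\<close>, so it embeds a weight space into a lower one. For \<open>y_0\<close>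
  injectivity is inherited, since y_0 y_0 = -f_0.\<close>

lemma string_function_f_mono:
  assumes P: "presents M \<theta> Rad" and f: "\<And>\<mu>. \<mu> \<in> I \<Longrightarrow> \<mu> - 2 \<in> I \<and> c Gf (pl \<mu>) \<mu> \<noteq> 0"
    and y: "a = Mode Gf 0 \<or> a = Mode Gy 0 \<and> a \<in> B"
  shows "string_function M \<nu> n \<le> string_function M (\<nu> + of_int (mode_wt a)) n"
  unfolding string_function_def
proof (rule subspace_dim_mono[where F = "act M a"])
  interpret cmodule M using presentsD(6)[OF P] .
  note LR = lin_repD[OF presentsD(1)[OF P]]
  note RD = idealD[OF Rad_ideal]
  have aB: "a \<in> B" using y basis_A by auto
  show "cmodule M" by (rule presentsD(6)[OF P])
  show "weight_space M \<nu> n \<subseteq> carrier M" by (auto simp: weight_space_def eigenspace_def)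
  show "act M a x \<in> carrier M" if "x \<in> carrier M" for x using LR aB that by simp
  show "act M a (x \<oplus>\<^bsub>M\<^esub> x') = act M a x \<oplus>\<^bsub>M\<^esub> act M a x'" if "x \<in> carrier M" "x' \<in> carrier M" for x x'
    using LR aB that by simp
  show "act M a (z \<odot>\<^bsub>M\<^esub> x) = z \<odot>\<^bsub>M\<^esub> act M a x" if "x \<in> carrier M" for x z using LR aB that by simp
  have finj: "u \<in> Rad" if "u \<in> FI" "opr (Mode Gf 0) u \<in> Rad" for u
    using f_injective[OF f that] .
  have ainj: "u \<in> Rad" if u: "u \<in> FI" "opr a u \<in> Rad" for u
    using y
  proof
    assume a: "a = Mode Gy 0 \<and> a \<in> B"
    \<comment> \<open>From {y, y} = -2f: applied to \<open>u\<close>, this expresses f_0 u through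
      y_0 y_0 u, which lies in \<open>Rad\<close>.\<close>
    have "bropr a a u = scale (-2) (opr (Mode Gf 0) u)"
      using a by (simp add: bropr_def lin_ext_add lin_ext_uminus lin_ext_scale)
    moreover have "opr a (opr a u) \<in> Rad" using RD(3)[OF aB u(2)] .
    moreover from this have "scale (msign a a) (opr a (opr a u)) \<in> Rad" using RD(1) by (simp add: pm.subspace_scale)
    ultimately have "scale (-2) (opr (Mode Gf 0) u) \<in> Rad"
      using pm.subspace_diff[OF RD(1) pm.subspace_diff[OF RD(1)] RD(4)[OF aB aB u(1)]] by fastforce
    from pm.subspace_scale[OF RD(1) this, of "-1/2"] have "opr (Mode Gf 0) u \<in> Rad" by simp
    then show ?thesis using finj u(1) by blast
  qed (use finj u in blast)
  show "x = \<zero>\<^bsub>M\<^esub>" if x: "x \<in> carrier M" "act M a x = \<zero>\<^bsub>M\<^esub>" for x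
  proof -
    obtain u where u: "u \<in> FI" "x = \<theta> u" using presentsD(4)[OF P] x(1) by auto
    have "opr a u \<in> Rad"
      using x(2) presentsD(3)[OF P aB u(1)] presentsD(5)[OF P FI_opr[OF aB u(1)]] u(2) by simp
    then show ?thesis using ainj[OF u(1)] presentsD(5)[OF P u(1)] u(2) by simp
  qed
  show "act M a x \<in> weight_space M (\<nu> + of_int (mode_wt a)) n" if x: "x \<in> weight_space M \<nu> n" for x
  proof -
    obtain u where u: "u \<in> FI" "x = \<theta> u"
      using presentsD(4)[OF P] x by (auto simp: weight_space_def eigenspace_def)
    have TB: "Mode Gh 0 \<in> B" "L0 \<in> B" using basis_A by auto
    have ms: "msign (Mode Gh 0) a = 1" "msign L0 a = 1" by (auto simp: msign_def)
    have "opr (Mode Gh 0) u - scale \<nu> u \<in> Rad" "opr L0 u - scale n u \<in> Rad"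
      using x presents_eigen[OF P u(1)] TB by (auto simp: u(2) weight_space_def eigenspace_def)
    then have 1: "opr a (opr (Mode Gh 0) u) - scale \<nu> (opr a u) \<in> Rad" "opr a (opr L0 u) - scale n (opr a u) \<in> Rad"
      using RD(3)[OF aB] by (fastforce simp: opr_simps)+
    have d: "mode_deg a = 0" using y by auto
    have "opr (Mode Gh 0) (opr a u) - scale (\<nu> + of_int (mode_wt a)) (opr a u) \<in> Rad"
      using pm.subspace_add[OF RD(1) RD(4)[OF TB(1) aB u(1)] 1(1)]
      by (simp add: ms bropr_h pm.scale_left_distrib algebra_simps)
    moreover have "opr L0 (opr a u) - scale n (opr a u) \<in> Rad"
      using pm.subspace_add[OF RD(1) RD(4)[OF TB(2) aB u(1)] 1(2)]
      by (simp add: ms bropr_L0 d)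
    ultimately show ?thesis
      using presents_eigen[OF P FI_opr[OF aB u(1)]] TB presentsD(3)[OF P aB u(1)]
        presentsD(9)[OF P FI_opr[OF aB u(1)]] u(2)
      by (simp add: weight_space_def eigenspace_def)
  qed
qed

end

section \<open>Relaxed modules\<close>

context ground_states
begin

lemma presents_quotient:
  assumes P: "presents M \<theta> K" and N: "subrep A M N"
  shows "presents (quotient_rep M N) (\<lambda>u. N +>\<^bsub>M\<^esub> \<theta> u) {u \<in> FI. \<theta> u \<in> N}"
proof -
  interpret q: rep_quotient A M N using presentsD(1)[OF P] N by unfold_locales
  note PD = presentsD[OF P]
  show ?thesis unfolding presents_def lin_map_def
    using PD q.lin_rep_Q lin_repD(1)[OF q.lin_rep_Q] FI_subspace PD(4)[symmetric]
    by (auto simp: q.proj_carrier q.proj_add q.proj_smult q.proj_act q.proj_zero_iff q.carrier_Q)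
qed

text \<open>The relations lie in the preimage because they lie in the kernel \<open>K\<close>
  already.\<close>

lemma preimage_ideal:
  assumes P: "presents M \<theta> K" and K: "ideal K" and N: "subrep A M N"
  shows "ideal {u \<in> FI. \<theta> u \<in> N}"
proof -
  note PD = presentsD[OF P] and KD = idealD[OF K]
  interpret cmodule M by (rule PD(6))
  have Nf: "N \<subseteq> carrier M" "\<zero>\<^bsub>M\<^esub> \<in> N" "\<And>x y. x \<in> N \<Longrightarrow> y \<in> N \<Longrightarrow> x \<oplus>\<^bsub>M\<^esub> y \<in> N" "\<And>z x. x \<in> N \<Longrightarrow> z \<odot>\<^bsub>M\<^esub> x \<in> N"
    "\<And>a x. a \<in> B \<Longrightarrow> x \<in> N \<Longrightarrow> act M a x \<in> N"
    using N unfolding subrep_def submodule_iff by auto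
  let ?P = "{u \<in> FI. \<theta> u \<in> N}"
  have KP: "u \<in> ?P" if "u \<in> K" for u
    using that KD(2) PD(5)[of u] Nf(2) by auto
  have "pm.subspace ?P"
    unfolding pm.subspace_def
  proof (intro conjI ballI allI)
    show "0 \<in> ?P" using KD(1) by (intro KP) (rule pm.subspace_0)
    fix x y z assume "x \<in> ?P"
    then show "scale z x \<in> ?P" using PD(8) Nf(4) FI_subspace pm.subspace_scale by auto
    assume "y \<in> ?P"
    with \<open>x \<in> ?P\<close> show "x + y \<in> ?P" using PD(7) Nf(3) FI_subspace pm.subspace_add by auto
  qed
  then show ?thesis unfolding ideal_def
    using KP KD(4,5) FI_opr PD(3) Nf(5) by auto
qed

lemma factors_eigen:
  assumes K: "ideal K" and u: "u \<in> FI" and e: "opr L0 u - scale \<Delta> u \<in> K"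
    and ls: "\<And>T z. (T, z) \<in> set ls \<Longrightarrow> T = L0"
  shows "factors ls u - scale (\<Prod>(T, z)\<leftarrow>ls. \<Delta> - z) u \<in> K"
  using ls
proof (induction ls)
  case Nil
  then show ?case using idealD(1)[OF K] by (simp add: factors_def pm.subspace_0)
next
  case (Cons l ls)
  note KD = idealD[OF K]
  obtain z where l: "l = (L0, z)" using Cons.prems[of "fst l" "snd l"] by (cases l) auto
  have TB: "L0 \<in> B" using basis_A by auto
  let ?r = "\<Prod>(T, z)\<leftarrow>ls. \<Delta> - z"
  have IH: "factors ls u - scale ?r u \<in> K" using Cons by auto
  have 1: "opr L0 (factors ls u) - scale ?r (opr L0 u) \<in> K"
    using KD(3)[OF TB IH] by (simp add: opr_simps)
  have 2: "scale ?r (opr L0 u) - scale (?r * \<Delta>) u \<in> K"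
    using pm.subspace_scale[OF KD(1) e, of ?r] by (simp add: pm.scale_right_diff_distrib)
  have 3: "scale (- z) (factors ls u) + scale (z * ?r) u \<in> K"
    using pm.subspace_scale[OF KD(1) IH, of "- z"] by (simp add: pm.scale_right_diff_distrib)
  have "opr L0 (factors ls u) - scale z (factors ls u) - scale ((\<Delta> - z) * ?r) u \<in> K"
    using pm.subspace_add[OF KD(1) pm.subspace_add[OF KD(1) 1 2] 3]
    by (simp add: algebra_simps pm.scale_left_diff_distrib)
  then show ?case by (simp add: l factors_def)
qed

text \<open>Modulo \<open>K\<close> a vector of \<open>Rad\<close> is a combination of nonempty
  negative words, whose \<open>L0\<close>-eigenvalues all differ from \<Delta>. The product of the
  corresponding factors kills it but multiplies a vector of eigenvalue \<Delta> by a nonzero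
  scalar.\<close>

lemma Rad_ground_trivial:
  assumes K: "ideal K" and KR: "K \<subseteq> Rad" and u: "u \<in> Rad" "opr L0 u - scale \<Delta> u \<in> K"
  shows "u \<in> K"
proof -
  note KD = idealD[OF K]
  have LB: "L0 \<in> B" using basis_A by auto
  obtain v where v: "v \<in> span_of (neg_words \<times> I)" "u - v \<in> K"
    by (rule neg_spanning[OF K RadD(2)[OF u(1)]])
  have vR: "v \<in> Rad" using pm.subspace_diff[OF idealD(1)[OF Rad_ideal] u(1), of "u - v"] v(2) KR by auto
  have v0: "Poly_Mapping.lookup v ([], \<mu>) = 0" for \<mu>
    using mel_neg_span[OF v(1), of \<mu>] RadD(1)[OF vR, of "[]"] by simp
  have "opr L0 (u - v) - scale \<Delta> (u - v) \<in> K"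
    using pm.subspace_diff[OF KD(1) KD(3)[OF LB v(2)] pm.subspace_scale[OF KD(1) v(2)]] .
  from pm.subspace_diff[OF KD(1) u(2) this] have e: "opr L0 v - scale \<Delta> v \<in> K"
    by (simp add: opr_simps pm.scale_right_diff_distrib algebra_simps)
  obtain js where js: "set js = Poly_Mapping.keys v" using finite_list[of "Poly_Mapping.keys v"] by auto
  define ls where "ls = map (\<lambda>i. (L0, ev L0 i)) js"
  have ls: "\<forall>(T, z)\<in>set ls. T \<in> {L0, Mode Gh 0}" by (auto simp: ls_def)
  have f: "factors ls (bvec i) \<in> K" if i: "i \<in> Poly_Mapping.keys v" for i
  proof -
    have iB: "i \<in> lists B \<times> I" using i v(1) neg_words_sub by (auto simp: span_of_def)
    have "(0::complex) \<in> set (map (\<lambda>(T, z). ev T i - z) ls)"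
      using i js by (force simp: ls_def)
    then have "(\<Prod>(T, z)\<leftarrow>ls. ev T i - z) = 0" by (simp add: prod_list_zero_iff)
    then show ?thesis using factors_bvec[OF K ls iB] by simp
  qed
  have "lin_ext (\<lambda>i. factors ls (bvec i)) v \<in> K"
    by (intro lin_ext_subspace KD(1) f)
  then have "factors ls v \<in> K" by (simp only: factors_lin_ext[symmetric] lin_ext_id)
  moreover have "factors ls v - scale (\<Prod>(T, z)\<leftarrow>ls. \<Delta> - z) v \<in> K"
    by (rule factors_eigen[OF K RadD(2)[OF vR] e]) (auto simp: ls_def)
  ultimately have *: "scale (\<Prod>(T, z)\<leftarrow>ls. \<Delta> - z) v \<in> K"
    using pm.subspace_diff[OF KD(1)] by fastforce
  have "(\<Prod>(T, z)\<leftarrow>ls. \<Delta> - z) \<noteq> 0"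
  proof
    assume "(\<Prod>(T, z)\<leftarrow>ls. \<Delta> - z) = 0"
    then obtain i where i: "i \<in> Poly_Mapping.keys v" "ev L0 i = \<Delta>"
      using js by (auto simp: prod_list_zero_iff ls_def)
    obtain W \<mu> where iW: "i = (W, \<mu>)" by (cases i)
    have "W \<in> neg_words" using i v(1) iW by (auto simp: span_of_def)
    moreover have "W \<noteq> []" using i(1) v0[of \<mu>] iW by (auto simp: in_keys_iff)
    ultimately show False using neg_words_deg[of W] i(2) iW by (simp add: ev_def)
  qed
  then have "v \<in> K" using pm.subspace_scale[OF KD(1) *, of "1 / (\<Prod>(T, z)\<leftarrow>ls. \<Delta> - z)"] by simp
  then show ?thesis using pm.subspace_add[OF KD(1) v(2), of v] by simp
qed

text \<open>The parity of a word on a ground state is read from its total weight instead of counting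
  odd letters; in this form \<open>Rad_restrict\<close> applies to it.\<close>

definition even_idx :: "(mode list \<times> complex) set" where
  "even_idx = {(W, \<mu>). \<mu> + of_int (word_wt W) \<in> Ev}"

lemma image_submodule:
  assumes \<theta>: "lin_map FI M \<theta>" and U: "pm.subspace U" "U \<subseteq> FI"
  shows "submodule (\<theta> ` U) complex_ring M"
proof -
  note LD = lin_mapD[OF \<theta>]
  interpret cmodule M by (rule LD(1))
  show ?thesis unfolding submodule_iff
  proof (intro conjI ballI allI)
    show "\<theta> ` U \<subseteq> carrier M" using LD(3) U by auto
    show "\<zero>\<^bsub>M\<^esub> \<in> \<theta> ` U" using pm.subspace_0[OF U(1)] LD(6) by force
    fix x y z assume "x \<in> \<theta> ` U"
    then obtain u where u: "u \<in> U" "x = \<theta> u" by auto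
    show "z \<odot>\<^bsub>M\<^esub> x \<in> \<theta> ` U"
      using u U LD(5)[of u z] pm.subspace_scale[OF U(1) u(1), of z] by force
    assume "y \<in> \<theta> ` U"
    then obtain v where v: "v \<in> U" "y = \<theta> v" by auto
    show "x \<oplus>\<^bsub>M\<^esub> y \<in> \<theta> ` U"
      using u v U LD(4)[of u v] pm.subspace_add[OF U(1) u(1) v(1)] by force
  qed
qed

text \<open>As parity is determined by the weight, restriction to the even weights and to their
  complement splits each vector into homogeneous parts within \<open>U\<close>.\<close>

lemma graded_image:
  assumes \<theta>: "lin_map FI M \<theta>" and U: "pm.subspace U" "U \<subseteq> FI"
    and split: "\<And>u T. u \<in> U \<Longrightarrow> restrict_to {(W, \<mu>). \<mu> + of_int (word_wt W) \<in> T} u \<in> U"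
    and act: "\<And>a u. a \<in> B \<Longrightarrow> u \<in> U \<Longrightarrow> act M a (\<theta> u) \<in> \<theta> ` U"
    and ev: "submodule (evens M) complex_ring M" "submodule (odds M) complex_ring M"
    and par: "\<And>W \<mu>. W \<in> lists B \<Longrightarrow> \<mu> \<in> I \<Longrightarrow>
      \<theta> (bvec (W, \<mu>)) \<in> (if (W, \<mu>) \<in> even_idx then evens M else odds M)"
  shows "graded_subrep A M (\<theta> ` U)"
proof -
  note LD = lin_mapD[OF \<theta>]
  interpret cmodule M by (rule LD(1))
  have sub: "submodule (\<theta> ` U) complex_ring M" by (rule image_submodule[OF \<theta> U])
  have pre: "pm.subspace {u \<in> FI. \<theta> u \<in> X}" if X: "submodule X complex_ring M" for X
    unfolding pm.subspace_def
  proof (intro conjI ballI allI)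
    have Xf: "\<zero>\<^bsub>M\<^esub> \<in> X" "\<And>x y. x \<in> X \<Longrightarrow> y \<in> X \<Longrightarrow> x \<oplus>\<^bsub>M\<^esub> y \<in> X" "\<And>z x. x \<in> X \<Longrightarrow> z \<odot>\<^bsub>M\<^esub> x \<in> X"
      using X unfolding submodule_iff by auto
    show "0 \<in> {u \<in> FI. \<theta> u \<in> X}" using pm.subspace_0[OF FI_subspace] LD(6) Xf by simp
    fix x y z assume x: "x \<in> {u \<in> FI. \<theta> u \<in> X}"
    then show "scale z x \<in> {u \<in> FI. \<theta> u \<in> X}"
      using pm.subspace_scale[OF FI_subspace] LD(5) Xf by simp
    assume "y \<in> {u \<in> FI. \<theta> u \<in> X}"
    with x show "x + y \<in> {u \<in> FI. \<theta> u \<in> X}"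
      using pm.subspace_add[OF FI_subspace] LD(4) Xf by simp
  qed
  have FI_par: "\<theta> u \<in> X" if "u \<in> FI" "Poly_Mapping.keys u \<subseteq> Y" "submodule X complex_ring M"
    and XY: "\<And>W \<mu>. W \<in> lists B \<Longrightarrow> \<mu> \<in> I \<Longrightarrow> (W, \<mu>) \<in> Y \<Longrightarrow> \<theta> (bvec (W, \<mu>)) \<in> X" for u X Y
  proof -
    have "span_of ((lists B \<times> I) \<inter> Y) \<subseteq> {u \<in> FI. \<theta> u \<in> X}"
    proof (rule span_of_subset[OF pre[OF that(3)]])
      fix i assume "i \<in> (lists B \<times> I) \<inter> Y"
      then obtain W \<mu> where i: "i = (W, \<mu>)" "W \<in> lists B" "\<mu> \<in> I" "(W, \<mu>) \<in> Y" by auto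
      then show "bvec i \<in> {u \<in> FI. \<theta> u \<in> X}"
        using XY[OF i(2,3,4)] bvec_FI[OF i(2,3)] by simp
    qed
    then show ?thesis using that(1,2) by (auto simp: FI_def span_of_def)
  qed
  have compl: "- even_idx = {(W, \<mu>). \<mu> + of_int (word_wt W) \<in> - Ev}" by (auto simp: even_idx_def)
  have "\<theta> ` U = (\<theta> ` U \<inter> evens M) <+>\<^bsub>M\<^esub> (\<theta> ` U \<inter> odds M)"
  proof (rule equalityI; rule subsetI)
    fix x assume "x \<in> \<theta> ` U"
    then obtain u where u: "u \<in> U" "x = \<theta> u" by auto
    let ?e = "restrict_to even_idx u" and ?o = "restrict_to (- even_idx) u"
    have e: "?e \<in> U" unfolding even_idx_def by (rule split[OF u(1)])
    have o: "?o \<in> U" unfolding compl by (rule split[OF u(1)])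
    have eo: "?e \<in> FI" "?o \<in> FI" using e o U(2) by auto
    have "\<theta> ?e \<in> evens M"
    proof (rule FI_par[OF eo(1) _ ev(1)])
      show "Poly_Mapping.keys ?e \<subseteq> even_idx" by (simp add: keys_restrict_to)
      show "\<theta> (bvec (W, \<mu>)) \<in> evens M" if "W \<in> lists B" "\<mu> \<in> I" "(W, \<mu>) \<in> even_idx" for W \<mu>
        using par[OF that(1,2)] that(3) by simp
    qed
    moreover have "\<theta> ?o \<in> odds M"
    proof (rule FI_par[OF eo(2) _ ev(2)])
      show "Poly_Mapping.keys ?o \<subseteq> - even_idx" by (simp add: keys_restrict_to)
      show "\<theta> (bvec (W, \<mu>)) \<in> odds M" if "W \<in> lists B" "\<mu> \<in> I" "(W, \<mu>) \<in> - even_idx" for W \<mu>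
        using par[OF that(1,2)] that(3) by simp
    qed
    moreover have "x = \<theta> ?e \<oplus>\<^bsub>M\<^esub> \<theta> ?o"
      using LD(4)[OF eo] u(2) by (simp add: restrict_to_compl)
    ultimately show "x \<in> (\<theta> ` U \<inter> evens M) <+>\<^bsub>M\<^esub> (\<theta> ` U \<inter> odds M)"
      using e o by (auto simp: set_add_def')
  next
    fix x assume "x \<in> (\<theta> ` U \<inter> evens M) <+>\<^bsub>M\<^esub> (\<theta> ` U \<inter> odds M)"
    then show "x \<in> \<theta> ` U" using sub unfolding submodule_iff by (auto simp: set_add_def')
  qed
  with sub act show ?thesis by (auto simp: graded_subrep_def subrep_def)
qed

lemma Rad_graded:
  assumes P: "presents M \<theta> K"
    and ev: "submodule (evens M) complex_ring M" "submodule (odds M) complex_ring M"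
    and par: "\<And>W \<mu>. W \<in> lists B \<Longrightarrow> \<mu> \<in> I \<Longrightarrow>
      \<theta> (bvec (W, \<mu>)) \<in> (if (W, \<mu>) \<in> even_idx then evens M else odds M)"
  shows "graded_subrep A M (\<theta> ` Rad)"
proof (rule graded_image[OF presentsD(2)[OF P] _ _ _ _ ev par])
  note RD = idealD[OF Rad_ideal]
  show "pm.subspace Rad" "Rad \<subseteq> FI" by (fact RD)+
  show "restrict_to {(W, \<mu>). \<mu> + of_int (word_wt W) \<in> T} u \<in> Rad" if "u \<in> Rad" for u T
    using Rad_restrict[OF that] .
  show "act M a (\<theta> u) \<in> \<theta> ` Rad" if "a \<in> B" "u \<in> Rad" for a u
    using presentsD(3)[OF P that(1) RadD(2)[OF that(2)]] RD(3)[OF that] by force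
qed

text \<open>The image of \<open>Rad\<close> belongs to the family by
  \<open>Rad_ground_trivial\<close>. Conversely, the preimage of a member is an ideal without basis
  ground vectors, since these map to nonzero vectors of eigenvalue \<Delta>. So the sum is attained
  by a largest member.\<close>

lemma radical_eq:
  assumes P: "presents M \<theta> K" and K: "ideal K" and g: "\<And>\<mu>. \<mu> \<in> I \<Longrightarrow> bvec ([], \<mu>) \<notin> K"
    and ev: "submodule (evens M) complex_ring M" "submodule (odds M) complex_ring M"
    and par: "\<And>W \<mu>. W \<in> lists B \<Longrightarrow> \<mu> \<in> I \<Longrightarrow>
      \<theta> (bvec (W, \<mu>)) \<in> (if (W, \<mu>) \<in> even_idx then evens M else odds M)"
  shows "subspace_sum M {N. graded_subrep A M N \<and> N \<inter> eigenspace M L0 \<Delta> = {\<zero>\<^bsub>M\<^esub>}} = \<theta> ` Rad"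
proof -
  note PD = presentsD[OF P] and RD = idealD[OF Rad_ideal] and KD = idealD[OF K]
  interpret cmodule M by (rule PD(6))
  let ?F = "{N. graded_subrep A M N \<and> N \<inter> eigenspace M L0 \<Delta> = {\<zero>\<^bsub>M\<^esub>}}"
  have LB: "L0 \<in> B" using basis_A by auto
  have KR: "K \<subseteq> Rad" using ideal_le_Rad[OF K g] .
  have "\<theta> ` Rad \<inter> eigenspace M L0 \<Delta> = {\<zero>\<^bsub>M\<^esub>}"
  proof (rule equalityI; rule subsetI)
    fix x assume "x \<in> \<theta> ` Rad \<inter> eigenspace M L0 \<Delta>"
    then obtain u where u: "u \<in> Rad" "x = \<theta> u" "act M L0 (\<theta> u) = \<Delta> \<odot>\<^bsub>M\<^esub> \<theta> u"
      by (auto simp: eigenspace_def)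
    then have "opr L0 u - scale \<Delta> u \<in> K" using presents_eigen[OF P RadD(2) LB] by blast
    from Rad_ground_trivial[OF K KR u(1) this] show "x \<in> {\<zero>\<^bsub>M\<^esub>}"
      using PD(5)[OF RadD(2)[OF u(1)]] u(2) by simp
  next
    fix x assume "x \<in> {\<zero>\<^bsub>M\<^esub>}"
    then have x: "x = \<theta> 0" using lin_mapD(6)[OF PD(2)] by simp
    have z: "0 \<in> FI" using pm.subspace_0[OF FI_subspace] .
    have "act M L0 (\<theta> 0) = \<Delta> \<odot>\<^bsub>M\<^esub> \<theta> 0"
      unfolding presents_eigen[OF P z LB] using pm.subspace_0[OF KD(1)] by (simp add: opr_simps)
    then show "x \<in> \<theta> ` Rad \<inter> eigenspace M L0 \<Delta>"
      using x pm.subspace_0[OF RD(1)] PD(9)[OF z] by (auto simp: eigenspace_def)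
  qed
  then have inF: "\<theta> ` Rad \<in> ?F" using Rad_graded[OF P ev par] by blast
  have max: "N \<subseteq> \<theta> ` Rad" if N: "N \<in> ?F" for N
  proof
    fix x assume x: "x \<in> N"
    have sub: "subrep A M N" and int: "N \<inter> eigenspace M L0 \<Delta> = {\<zero>\<^bsub>M\<^esub>}"
      using N by (auto simp: graded_subrep_def)
    let ?P = "{u \<in> FI. \<theta> u \<in> N}"
    have "?P \<subseteq> Rad"
    proof (rule ideal_le_Rad[OF preimage_ideal[OF P K sub]])
      fix \<mu> assume \<mu>: "\<mu> \<in> I"
      have b: "bvec ([], \<mu>) \<in> FI" using \<mu> by (intro bvec_FI) auto
      have "opr L0 (bvec ([], \<mu>)) - scale \<Delta> (bvec ([], \<mu>)) \<in> K"
        using opr_ev[OF K, of L0 "([], \<mu>)"] \<mu> by (simp add: ev_def)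
      then have "\<theta> (bvec ([], \<mu>)) \<in> eigenspace M L0 \<Delta>"
        using presents_eigen[OF P b LB] PD(9)[OF b] by (simp add: eigenspace_def)
      then show "bvec ([], \<mu>) \<notin> ?P" using int PD(5)[OF b] g[OF \<mu>] by auto
    qed
    moreover have "x \<in> carrier M" using x sub by (auto simp: subrep_def submodule_iff)
    then obtain u where "u \<in> FI" "x = \<theta> u" unfolding PD(4)[symmetric] by (rule imageE)
    ultimately show "x \<in> \<theta> ` Rad" using x by auto
  qed
  have sub: "submodule (\<theta> ` Rad) complex_ring M" using image_submodule[OF PD(2) RD(1,2)] .
  show ?thesis unfolding subspace_sum_def
  proof (rule equalityI)
    show "\<Inter> {N. submodule N complex_ring M \<and> \<Union> ?F \<subseteq> N} \<subseteq> \<theta> ` Rad"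
      by (rule Inter_lower, rule CollectI, rule conjI[OF sub], rule Union_least, rule max)
    show "\<theta> ` Rad \<subseteq> \<Inter> {N. submodule N complex_ring M \<and> \<Union> ?F \<subseteq> N}"
    proof (rule Inter_greatest)
      fix N assume "N \<in> {N. submodule N complex_ring M \<and> \<Union> ?F \<subseteq> N}"
      then have "\<Union> ?F \<subseteq> N" by (rule CollectE) (rule conjunct2)
      with Union_upper[OF inF] show "\<theta> ` Rad \<subseteq> N" by (rule order_trans)
    qed
  qed
qed

lemma presents_radical_quotient:
  assumes P: "presents M \<theta> K" and K: "ideal K" and g: "\<And>\<mu>. \<mu> \<in> I \<Longrightarrow> bvec ([], \<mu>) \<notin> K"
    and N: "subrep A M (\<theta> ` Rad)"
  shows "presents (quotient_rep M (\<theta> ` Rad)) (\<lambda>u. (\<theta> ` Rad) +>\<^bsub>M\<^esub> \<theta> u) Rad"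
proof -
  have KR: "K \<subseteq> Rad" using ideal_le_Rad[OF K g] .
  have "{u \<in> FI. \<theta> u \<in> \<theta> ` Rad} = Rad"
  proof (rule equalityI; rule subsetI)
    fix u assume "u \<in> {u \<in> FI. \<theta> u \<in> \<theta> ` Rad}"
    then obtain v where v: "u \<in> FI" "v \<in> Rad" "\<theta> u = \<theta> v" by auto
    then have "u - v \<in> Rad" using presents_eq_iff[OF P v(1) RadD(2)[OF v(2)]] KR by auto
    from pm.subspace_add[OF idealD(1)[OF Rad_ideal] this v(2)] show "u \<in> Rad" by simp
  qed (use RadD in auto)
  then show ?thesis using presents_quotient[OF P N] by simp
qed

end


section \<open>The induced module\<close>

locale relaxed = ground_states +
  fixes V :: "(osp, complex \<Rightarrow>\<^sub>0 complex) rep"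
  assumes V_carrier: "carrier V = span_of I" and V_add: "\<And>v w. v \<oplus>\<^bsub>V\<^esub> w = v + w" and V_zero: "\<zero>\<^bsub>V\<^esub> = 0"
    and V_smult: "\<And>z v. z \<odot>\<^bsub>V\<^esub> v = scale z v" and V_evens: "evens V = span_of (I \<inter> Ev)" and V_odds: "odds V = span_of (I - Ev)"
    and V_act: "Mode g 0 \<in> basis A \<Longrightarrow> v \<in> span_of I \<Longrightarrow>
       act V g v = lin_ext (\<lambda>\<mu>. scale (c g (pl \<mu>) \<mu>) (bvec (\<mu> + of_int (osp_wt g)))) v"
    and V_closed: "Mode g 0 \<in> basis A \<Longrightarrow> v \<in> span_of I \<Longrightarrow> act V g v \<in> span_of I"
begin

abbreviation "V' \<equiv> extend_rep k \<Delta> V"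
abbreviation "F \<equiv> free_rep A V'"
abbreviation "rels \<equiv> induction_relations A (nonneg_modes A) V'"

definition IF :: "((mode list \<times> (complex \<Rightarrow>\<^sub>0 complex)) \<Rightarrow>\<^sub>0 complex) set" where
  "IF = \<Inter> {N. subrep A F N \<and> rels \<subseteq> N}"

lemma F_simps: "carrier F = span_of (lists B \<times> span_of I)" "\<zero>\<^bsub>F\<^esub> = 0" "x \<oplus>\<^bsub>F\<^esub> y = x + y" "z \<odot>\<^bsub>F\<^esub> x = scale z x"
  "act F a = lin_ext (\<lambda>(w, v). bvec (a # w, v))"
  by (simp_all add: free_rep_def extend_rep_def V_carrier)

lemma V'_simps: "carrier V' = span_of I" "\<zero>\<^bsub>V'\<^esub> = 0" "v \<oplus>\<^bsub>V'\<^esub> w = v + w" "z \<odot>\<^bsub>V'\<^esub> v = scale z v"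
  "evens V' = span_of (I \<inter> Ev)" "odds V' = span_of (I - Ev)"
  by (simp_all add: extend_rep_def V_carrier V_add V_zero V_smult V_evens V_odds)

lemma nonneg_iff: "a \<in> nonneg_modes A \<longleftrightarrow> a \<in> B \<and> \<not> neg_mode a"
  using basis_A by (cases a) (auto simp: nonneg_modes_def neg_mode_def)

lemma V'_act:
  assumes a: "a \<in> B" "\<not> neg_mode a" and v: "v \<in> span_of I"
  shows "act V' a v = lin_ext (\<lambda>\<mu>. scale (gcoef a (pl \<mu>) \<mu>) (bvec (\<mu> + of_int (mode_wt a)))) v"
    "act V' a v \<in> span_of I"
proof -
  have Z: "lin_ext (\<lambda>i. 0) v = (0 :: complex \<Rightarrow>\<^sub>0 complex)" by (rule poly_mapping_eqI) (simp add: lookup_lin_ext)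
  show "act V' a v = lin_ext (\<lambda>\<mu>. scale (gcoef a (pl \<mu>) \<mu>) (bvec (\<mu> + of_int (mode_wt a)))) v"
  proof (cases a)
    case (Mode g n)
    then show ?thesis using V_act[of g v] a v
      by (auto simp: extend_rep_def gcoef_def V_zero Z)
  qed (simp_all add: extend_rep_def gcoef_def V_smult lin_ext_scale_fun lin_ext_id)
  show "act V' a v \<in> span_of I"
  proof (cases a)
    case (Mode g n)
    then show ?thesis using V_closed[of g v] a v pm.subspace_0[OF subspace_span_of[of I]]
      by (auto simp: extend_rep_def V_zero)
  qed (use v in \<open>simp_all add: extend_rep_def V_smult pm.subspace_scale[OF subspace_span_of]\<close>)
qed

lemma F_module: "Module.module complex_ring F"
proof (rule moduleI[OF cring_complex_ring])
  note S = subspace_span_of[of "lists B \<times> span_of I"]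
  show "abelian_group F"
  proof (rule abelian_groupI)
    fix x assume "x \<in> carrier F"
    then show "\<exists>y\<in>carrier F. y \<oplus>\<^bsub>F\<^esub> x = \<zero>\<^bsub>F\<^esub>"
      using pm.subspace_neg[OF S] by (intro bexI[of _ "- x"]) (auto simp: F_simps)
  qed (auto simp: F_simps algebra_simps pm.subspace_0[OF S] pm.subspace_add[OF S])
qed (auto simp: F_simps subspace_span_of pm.subspace_scale pm.scale_left_distrib pm.scale_right_distrib)

lemma F_act_closed:
  assumes a: "a \<in> B" and x: "x \<in> span_of (lists B \<times> span_of I)"
  shows "act F a x \<in> span_of (lists B \<times> span_of I)"
proof -
  have "Poly_Mapping.keys x \<subseteq> lists B \<times> span_of I" using x by (simp add: span_of_def[of "lists B \<times> span_of I"])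
  then show ?thesis unfolding F_simps using a by (intro lin_ext_subspace subspace_span_of) auto
qed

lemma F_lin_rep: "lin_rep A F"
  unfolding lin_rep_def using F_module F_act_closed
  by (auto simp: F_simps lin_ext_add lin_ext_scale)

lemma F_submodule_iff: "submodule N complex_ring F \<longleftrightarrow> pm.subspace N \<and> N \<subseteq> carrier F"
  unfolding cmodule.submodule_iff[OF cmoduleI[OF F_module]]
  by (auto simp: F_simps pm.subspace_def)

lemma rels_carrier: "rels \<subseteq> carrier F"
proof -
  note S = subspace_span_of[of "lists B \<times> span_of I"]
  have b: "bvec (w, v) \<in> carrier F" if "w \<in> lists B" "v \<in> span_of I" for w v
    using that by (simp add: F_simps)
  have d: "x - y \<in> carrier F" if "x \<in> carrier F" "y \<in> carrier F" for x y
    using that pm.subspace_diff[OF S] by (simp add: F_simps)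
  have s: "scale z x \<in> carrier F" if "x \<in> carrier F" for x z
    using that pm.subspace_scale[OF S] by (simp add: F_simps)
  have l: "lin_ext (\<lambda>e. bvec (e # w, v)) (mode_bracket a a') \<in> carrier F"
    if "a \<in> B" "a' \<in> B" "w \<in> lists B" "v \<in> span_of I" for a a' w v
    using that closed_A unfolding F_simps(1)
    by (intro lin_ext_subspace S) (auto simp: bracket_closed_def)
  note SI = subspace_span_of[of I]
  show ?thesis
    unfolding induction_relations_def V'_simps bracket_A
    by (auto intro!: d b s l V'_act pm.subspace_add[OF SI] pm.subspace_scale[OF SI] simp: nonneg_iff)
qed

lemma IF_subrep: "subrep A F IF"
proof -
  have "subrep A F (carrier F)"
    unfolding subrep_def F_submodule_iff using F_act_closed subspace_span_of by (auto simp: F_simps)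
  then have "IF \<subseteq> carrier F" using rels_carrier unfolding IF_def by blast
  moreover have "pm.subspace IF"
    unfolding IF_def by (rule pm.subspace_Inter) (auto simp: subrep_def F_submodule_iff)
  ultimately show ?thesis
    unfolding subrep_def F_submodule_iff IF_def by (auto simp: subrep_def)
qed

lemma IF_facts: "pm.subspace IF" "IF \<subseteq> span_of (lists B \<times> span_of I)" "a \<in> B \<Longrightarrow> x \<in> IF \<Longrightarrow> act F a x \<in> IF" "rels \<subseteq> IF"
  using IF_subrep unfolding subrep_def F_submodule_iff by (auto simp: F_simps(1) IF_def)

text \<open>\<open>free_rep\<close> has a generator for every vector of the ground module,
  \<open>FI\<close> only for its weight basis. \<open>emb\<close> and \<open>ret\<close> translate;
  they are inverse to each other modulo the induction relations.\<close>

definition emb :: "fvec \<Rightarrow> ((mode list \<times> (complex \<Rightarrow>\<^sub>0 complex)) \<Rightarrow>\<^sub>0 complex)" where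
  "emb = lin_ext (\<lambda>(w, \<mu>). bvec (w, bvec \<mu>))"

definition ret :: "((mode list \<times> (complex \<Rightarrow>\<^sub>0 complex)) \<Rightarrow>\<^sub>0 complex) \<Rightarrow> fvec" where
  "ret = lin_ext (\<lambda>(w, v). lin_ext (\<lambda>\<mu>. bvec (w, \<mu>)) v)"

lemma ret_emb: "ret (emb u) = u"
proof -
  have "ret (emb u) = lin_ext (\<lambda>i. bvec i) u"
    unfolding ret_def emb_def lin_ext_lin_ext by (simp add: case_prod_beta)
  then show ?thesis by (simp add: lin_ext_id)
qed

lemma emb_lin_ext: "emb (lin_ext b u) = lin_ext (\<lambda>i. emb (b i)) u"
  by (simp add: emb_def lin_ext_lin_ext)

lemma emb_opr: "emb (opr a u) = act F a (emb u)"
  unfolding emb_def opr_def F_simps lin_ext_lin_ext by (simp add: case_prod_beta)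

lemma ret_act: "ret (act F a x) = opr a (ret x)"
  unfolding ret_def opr_def F_simps by (simp add: lin_ext_lin_ext case_prod_beta)

lemma emb_carrier: "u \<in> FI \<Longrightarrow> emb u \<in> span_of (lists B \<times> span_of I)"
  unfolding emb_def by (intro lin_ext_subspace subspace_span_of) (auto simp: FI_def span_of_def[of "lists B \<times> I"])

lemma ret_bvec_FI: "w \<in> lists B \<Longrightarrow> v \<in> span_of I \<Longrightarrow> lin_ext (\<lambda>\<mu>. bvec (w, \<mu>)) v \<in> FI"
  by (intro lin_ext_subspace FI_subspace) (auto simp: span_of_def intro: bvec_FI)

lemma ret_FI: "x \<in> span_of (lists B \<times> span_of I) \<Longrightarrow> ret x \<in> FI"
  unfolding ret_def
  by (rule lin_ext_subspace[OF FI_subspace])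
    (auto simp: span_of_def[of "lists B \<times> span_of I"] intro!: ret_bvec_FI)

lemma IF_rel_add: "v \<in> span_of I \<Longrightarrow> v' \<in> span_of I \<Longrightarrow> bvec ([], v + v') - bvec ([], v) - bvec ([], v') \<in> IF"
  by (rule subsetD[OF IF_facts(4)]) (auto simp: induction_relations_def V'_simps)

lemma IF_rel_scale: "v \<in> span_of I \<Longrightarrow> bvec ([], scale z v) - scale z (bvec ([], v)) \<in> IF"
  by (rule subsetD[OF IF_facts(4)]) (auto simp: induction_relations_def V'_simps)

lemma IF_rel_act: "a \<in> B \<Longrightarrow> \<not> neg_mode a \<Longrightarrow> v \<in> span_of I \<Longrightarrow> bvec ([a], v) - bvec ([], act V' a v) \<in> IF"
  by (rule subsetD[OF IF_facts(4)]) (auto simp: induction_relations_def V'_simps nonneg_iff)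

lemma IF_rel_bracket: "a \<in> B \<Longrightarrow> b \<in> B \<Longrightarrow> w \<in> lists B \<Longrightarrow> v \<in> span_of I \<Longrightarrow>
    bvec (a # b # w, v) - scale (msign a b) (bvec (b # a # w, v)) - lin_ext (\<lambda>e. bvec (e # w, v)) (mode_bracket a b) \<in> IF"
proof (rule subsetD[OF IF_facts(4)])
  assume H: "a \<in> B" "b \<in> B" "w \<in> lists B" "v \<in> span_of I"
  have s: "super_sign A a b = msign a b" by (simp add: super_sign_def msign_def is_odd_A)
  show "bvec (a # b # w, v) - scale (msign a b) (bvec (b # a # w, v)) - lin_ext (\<lambda>e. bvec (e # w, v)) (mode_bracket a b) \<in> rels"
    unfolding induction_relations_def V'_simps bracket_A
    by (rule UnI2, rule CollectI, rule exI[of _ a], rule exI[of _ b], rule exI[of _ w], rule exI[of _ v])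
      (simp add: H s)
qed

text \<open>Linearity in the ground vector is imposed for the empty word only; for longer words it
  follows by applying their letters.\<close>

lemma emb_ret: "x \<in> span_of (lists B \<times> span_of I) \<Longrightarrow> x - emb (ret x) \<in> IF"
proof -
  let ?Y = "\<lambda>w. {v \<in> span_of I. bvec (w, v) - lin_ext (\<lambda>\<mu>. bvec (w, bvec \<mu>)) v \<in> IF}"
  note SI = subspace_span_of[of I]
  have nil: "v \<in> ?Y []" if "v \<in> span_of I" for v
  proof -
    have "span_of I \<subseteq> ?Y []"
    proof (rule span_of_subset)
      show "bvec \<mu> \<in> ?Y []" if "\<mu> \<in> I" for \<mu> using that pm.subspace_0[OF IF_facts(1)] by simp
      show "pm.subspace (?Y [])"
        unfolding pm.subspace_def
      proof (intro conjI ballI allI)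
        show "0 \<in> ?Y []" using IF_rel_scale[of 0 0] pm.subspace_0[OF SI] by simp
        fix x y z assume x: "x \<in> ?Y []"
        then have "scale z (bvec ([], x) - lin_ext (\<lambda>\<mu>. bvec ([], bvec \<mu>)) x) \<in> IF"
          by (intro pm.subspace_scale IF_facts) auto
        from pm.subspace_add[OF IF_facts(1) IF_rel_scale[of x z] this] x
        have "bvec ([], scale z x) - scale z (lin_ext (\<lambda>\<mu>. bvec ([], bvec \<mu>)) x) \<in> IF"
          by (simp add: pm.scale_right_diff_distrib)
        then show "scale z x \<in> ?Y []" using x pm.subspace_scale[OF SI]
          by (simp add: lin_ext_scale pm.scale_right_diff_distrib)
        assume y: "y \<in> ?Y []"
        have "bvec ([], x + y) - bvec ([], x) - bvec ([], y) \<in> IF" using IF_rel_add x y by simp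
        moreover have "bvec ([], x) - lin_ext (\<lambda>\<mu>. bvec ([], bvec \<mu>)) x + (bvec ([], y) - lin_ext (\<lambda>\<mu>. bvec ([], bvec \<mu>)) y) \<in> IF"
          using x y by (intro pm.subspace_add IF_facts) auto
        ultimately have "(bvec ([], x + y) - bvec ([], x) - bvec ([], y)) + (bvec ([], x) - lin_ext (\<lambda>\<mu>. bvec ([], bvec \<mu>)) x + (bvec ([], y) - lin_ext (\<lambda>\<mu>. bvec ([], bvec \<mu>)) y)) \<in> IF"
          by (rule pm.subspace_add[OF IF_facts(1)])
        then show "x + y \<in> ?Y []" using x y pm.subspace_add[OF SI]
          by (simp add: lin_ext_add algebra_simps)
      qed
    qed
    then show ?thesis using that by blast
  qed
  have word: "bvec (w, v) - lin_ext (\<lambda>\<mu>. bvec (w, bvec \<mu>)) v \<in> IF" if "w \<in> lists B" "v \<in> span_of I" for w v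
    using that
  proof (induction w)
    case Nil
    then show ?case using nil by blast
  next
    case (Cons a w)
    then have "act F a (bvec (w, v) - lin_ext (\<lambda>\<mu>. bvec (w, bvec \<mu>)) v) \<in> IF" by (intro IF_facts) auto
    then show ?case by (simp add: F_simps lin_ext_diff lin_ext_lin_ext)
  qed
  assume x: "x \<in> span_of (lists B \<times> span_of I)"
  have "lin_ext (\<lambda>i. bvec i - emb (ret (bvec i))) x \<in> IF"
  proof (rule lin_ext_subspace[OF IF_facts(1)])
    fix i assume "i \<in> Poly_Mapping.keys x"
    then have i: "i \<in> lists B \<times> span_of I" using x by (auto simp: span_of_def[of "lists B \<times> span_of I"])
    obtain w v where iw: "i = (w, v)" by (cases i)
    have "emb (ret (bvec i)) = lin_ext (\<lambda>\<mu>. bvec (w, bvec \<mu>)) v"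
      unfolding iw ret_def emb_def by (simp add: lin_ext_lin_ext)
    then show "bvec i - emb (ret (bvec i)) \<in> IF" using word[of w v] i iw by simp
  qed
  moreover have "lin_ext (\<lambda>i. emb (ret (bvec i))) x = emb (ret x)"
  proof -
    have "lin_ext (\<lambda>i. emb (ret (bvec i))) x = emb (ret (lin_ext bvec x))"
      unfolding emb_def ret_def lin_ext_lin_ext ..
    then show ?thesis by (simp add: lin_ext_id)
  qed
  ultimately show ?thesis by (simp add: lin_ext_diff_fun lin_ext_id)
qed

definition K0 :: "fvec set" where
  "K0 = {u \<in> FI. emb u \<in> IF}"

lemma K0_ideal: "ideal K0"
  unfolding ideal_def
proof (intro conjI ballI impI)
  have S: "u - v \<in> IF" if "u \<in> IF" "v \<in> IF" for u v using that IF_facts(1) by (rule pm.subspace_diff[rotated 1])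
  show "pm.subspace K0"
    using FI_subspace IF_facts(1) unfolding pm.subspace_def K0_def emb_def
    by (auto simp: lin_ext_add lin_ext_scale)
  show "K0 \<subseteq> FI" by (auto simp: K0_def)
  show "opr a u \<in> K0" if "a \<in> B" "u \<in> K0" for a u
    using that IF_facts(3) FI_opr by (simp add: K0_def emb_opr)
  show "opr a (opr b u) - scale (msign a b) (opr b (opr a u)) - bropr a b u \<in> K0"
    if ab: "a \<in> B" "b \<in> B" and u: "u \<in> FI" for a b u
  proof -
    let ?r = "\<lambda>u. opr a (opr b u) - scale (msign a b) (opr b (opr a u)) - bropr a b u"
    have "?r u \<in> FI"
      using ab u FI_subspace by (intro pm.subspace_diff pm.subspace_scale FI_opr FI_bropr) auto
    moreover have "emb (?r u) = lin_ext (\<lambda>i. emb (?r (bvec i))) u"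
    proof -
      have "lin_ext (\<lambda>i. bropr a b (bvec i)) u = bropr a b (lin_ext bvec u)"
        by (rule poly_mapping_eqI)
          (simp add: bropr_def lookup_lin_ext opr_lin_ext lsum_swap[of u])
      then have "lin_ext (\<lambda>i. ?r (bvec i)) u = ?r u"
        by (simp add: lin_ext_diff_fun lin_ext_scale_fun opr_lin_ext[symmetric] lin_ext_id)
      then have "emb (?r u) = emb (lin_ext (\<lambda>i. ?r (bvec i)) u)" by (simp only:)
      then show ?thesis by (simp only: emb_lin_ext)
    qed
    moreover have "lin_ext (\<lambda>i. emb (?r (bvec i))) u \<in> IF"
    proof (rule lin_ext_subspace[OF IF_facts(1)])
      fix i assume "i \<in> Poly_Mapping.keys u"
      then have i: "i \<in> lists B \<times> I" using u by (auto simp: FI_def span_of_def)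
      obtain w \<mu> where iw: "i = (w, \<mu>)" by (cases i)
      have "emb (?r (bvec i)) = bvec (a # b # w, bvec \<mu>) - scale (msign a b) (bvec (b # a # w, bvec \<mu>))
          - lin_ext (\<lambda>e. bvec (e # w, bvec \<mu>)) (mode_bracket a b)"
        by (simp add: iw emb_def opr_simps bropr_def lin_ext_diff lin_ext_scale lin_ext_lin_ext)
      then show "emb (?r (bvec i)) \<in> IF" using IF_rel_bracket[OF ab, of w "bvec \<mu>"] i iw by simp
    qed
    ultimately show ?thesis by (simp add: K0_def)
  qed
  show "bvec ([a], \<mu>) - scale (gcoef a (pl \<mu>) \<mu>) (gvec (\<mu> + of_int (mode_wt a))) \<in> K0"
    if a: "a \<in> B" "\<not> neg_mode a" and \<mu>: "\<mu> \<in> I" for a \<mu>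
  proof -
    let ?z = "gcoef a (pl \<mu>) \<mu>" and ?\<nu> = "\<mu> + of_int (mode_wt a)"
    have act: "act V' a (bvec \<mu>) = scale ?z (bvec ?\<nu>)" using V'_act(1)[OF a, of "bvec \<mu>"] \<mu> by simp
    have 1: "bvec ([a], bvec \<mu>) - bvec ([], scale ?z (bvec ?\<nu>)) \<in> IF"
      using IF_rel_act[OF a, of "bvec \<mu>"] \<mu> act by simp
    \<comment> \<open>If the new weight leaves \<open>I\<close>, closedness of the ground module
      forces the scalar to be 0, in accordance with the value 0 of \<open>gvec\<close>
      there.\<close>
    have "bvec ([], scale ?z (bvec ?\<nu>)) - scale ?z (emb (gvec ?\<nu>)) \<in> IF"
    proof (cases "?z = 0")
      case True
      then show ?thesis using IF_rel_scale[of 0 0] pm.subspace_0[OF subspace_span_of[of I]] by simp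
    next
      case False
      have "scale ?z (bvec ?\<nu>) \<in> span_of I" using V'_act(2)[OF a, of "bvec \<mu>"] \<mu> act by simp
      from pm.subspace_scale[OF subspace_span_of this, of "1 / ?z"] have "?\<nu> \<in> I" using False by simp
      then show ?thesis using IF_rel_scale[of "bvec ?\<nu>" ?z] by (simp add: gvec_def emb_def)
    qed
    from pm.subspace_add[OF IF_facts(1) 1 this]
    have "emb (bvec ([a], \<mu>) - scale ?z (gvec ?\<nu>)) \<in> IF"
      by (simp add: emb_def lin_ext_diff lin_ext_scale)
    moreover have "bvec ([a], \<mu>) - scale ?z (gvec ?\<nu>) \<in> FI"
      using a \<mu> by (intro pm.subspace_diff pm.subspace_scale FI_subspace gvec_FI bvec_FI) auto
    ultimately show ?thesis by (simp add: K0_def)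
  qed
qed

text \<open>All defining relations of the induced module hold modulo \<open>Rad\<close>, so it maps
  onto the free module modulo \<open>Rad\<close>. This map keeps the induced module from
  collapsing.\<close>

lemma IF_ret_Rad: "x \<in> IF \<Longrightarrow> ret x \<in> Rad"
proof -
  note RD = idealD[OF Rad_ideal]
  let ?N = "{x \<in> span_of (lists B \<times> span_of I). ret x \<in> Rad}"
  note S = subspace_span_of[of "lists B \<times> span_of I"]
  have N: "pm.subspace ?N"
    using S RD(1) unfolding pm.subspace_def ret_def by (auto simp: lin_ext_add lin_ext_scale)
  have "subrep A F ?N"
    unfolding subrep_def F_submodule_iff using N F_act_closed RD(3)
    by (auto simp: F_simps(1) ret_act)
  moreover have "rels \<subseteq> ?N"
  proof
    fix x assume x: "x \<in> rels"
    have c: "x \<in> span_of (lists B \<times> span_of I)" using rels_carrier x by (auto simp: F_simps(1))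
    have Z: "0 \<in> Rad" using pm.subspace_0[OF RD(1)] .
    have "ret x \<in> Rad"
      using x unfolding induction_relations_def V'_simps Un_iff
    proof (elim disjE CollectE exE conjE)
      fix a v assume x: "x = bvec ([a], v) - bvec ([], act V' a v)" "a \<in> nonneg_modes A" "v \<in> span_of I"
      then have a: "a \<in> B" "\<not> neg_mode a" by (auto simp: nonneg_iff)
      have "ret x = lin_ext (\<lambda>\<mu>. bvec ([a], \<mu>) - scale (gcoef a (pl \<mu>) \<mu>) (bvec ([], \<mu> + of_int (mode_wt a)))) v"
        unfolding x(1) V'_act(1)[OF a x(3)] ret_def
        by (simp add: lin_ext_diff lin_ext_lin_ext lin_ext_diff_fun lin_ext_scale)
      also have "\<dots> \<in> Rad"
      proof (rule lin_ext_subspace[OF RD(1)])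
        fix \<mu> assume "\<mu> \<in> Poly_Mapping.keys v"
        then have \<mu>: "\<mu> \<in> I" using x(3) by (auto simp: span_of_def)
        have "gcoef a (pl \<mu>) \<mu> = 0" if "\<mu> + of_int (mode_wt a) \<notin> I"
          using c_exit[of \<mu>] \<mu> a that by (cases a) (auto simp: gcoef_def)
        then show "bvec ([a], \<mu>) - scale (gcoef a (pl \<mu>) \<mu>) (bvec ([], \<mu> + of_int (mode_wt a))) \<in> Rad"
          using RD(5)[OF a(1) \<mu> a(2)] by (auto simp: gvec_def split: if_splits)
      qed
      finally show ?thesis .
    next
      fix a b w v
      assume x: "x = bvec (a # b # w, v) - scale (super_sign A a b) (bvec (b # a # w, v))
        - lin_ext (\<lambda>c. bvec (c # w, v)) (bracket A a b)" "a \<in> B" "b \<in> B" "w \<in> lists B" "v \<in> span_of I"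
      let ?u = "lin_ext (\<lambda>\<mu>. bvec (w, \<mu>)) v"
      have s: "super_sign A a b = msign a b" by (simp add: super_sign_def msign_def is_odd_A)
      have "ret x = opr a (opr b ?u) - scale (msign a b) (opr b (opr a ?u)) - bropr a b ?u"
        unfolding x(1) ret_def s bracket_A
        by (simp add: lin_ext_diff lin_ext_scale lin_ext_lin_ext opr_lin_ext opr_simps bropr_def)
      then show ?thesis using RD(4)[OF x(2,3) ret_bvec_FI[OF x(4,5)]] by simp
    qed (auto simp: ret_def lin_ext_add lin_ext_diff lin_ext_scale Z)
    then show "x \<in> ?N" using c by simp
  qed
  ultimately have "IF \<subseteq> ?N" unfolding IF_def by blast
  then show "x \<in> IF \<Longrightarrow> ret x \<in> Rad" by blast
qed

text \<open>Ground vectors survive in the induced module because they survive modulo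
  \<open>Rad\<close>.\<close>

lemma K0_ground: "bvec ([], \<mu>) \<notin> K0"
proof
  assume "bvec ([], \<mu>) \<in> K0"
  then have "ret (emb (bvec ([], \<mu>))) \<in> Rad" using IF_ret_Rad by (simp add: K0_def)
  then show False using bvec_notin_Rad by (simp add: ret_emb)
qed

abbreviation "M0 \<equiv> relaxed_verma A k \<Delta> V"

lemma M0_eq: "M0 = quotient_rep F IF"
  by (simp add: relaxed_verma_def induced_rep_def IF_def)

definition theta0 :: "fvec \<Rightarrow> ((mode list \<times> (complex \<Rightarrow>\<^sub>0 complex)) \<Rightarrow>\<^sub>0 complex) set" where
  "theta0 u = IF +>\<^bsub>F\<^esub> emb u"

sublocale q: rep_quotient A F IF
  using F_lin_rep IF_subrep by unfold_locales

lemma theta0_ret: "x \<in> carrier F \<Longrightarrow> IF +>\<^bsub>F\<^esub> x = theta0 (ret x)"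
  unfolding theta0_def
  using q.proj_eq_iff[of x "emb (ret x)"] emb_ret[of x] emb_carrier[OF ret_FI, of x] by (simp add: F_simps)

lemma M0_presents: "presents M0 theta0 K0"
proof -
  have e: "emb u \<in> carrier F" if "u \<in> FI" for u using emb_carrier[OF that] by (simp add: F_simps)
  have "theta0 ` FI = carrier M0"
    using theta0_ret ret_FI e unfolding M0_eq q.carrier_Q by (auto simp: theta0_def F_simps(1))
  moreover have "\<forall>u\<in>FI. theta0 u = \<zero>\<^bsub>M0\<^esub> \<longleftrightarrow> u \<in> K0"
    using e q.proj_zero_iff unfolding M0_eq theta0_def K0_def by auto
  moreover have "lin_map FI M0 theta0"
    unfolding lin_map_def M0_eq theta0_def
    using FI_subspace e lin_repD(1)[OF q.lin_rep_Q]
    by (auto simp: q.proj_carrier q.proj_add q.proj_smult F_simps(3,4) emb_def lin_ext_add lin_ext_scale)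
  moreover have "\<forall>a\<in>B. \<forall>u\<in>FI. theta0 (opr a u) = act M0 a (theta0 u)"
    using e unfolding M0_eq theta0_def by (auto simp: q.proj_act emb_opr)
  ultimately show ?thesis unfolding presents_def using q.lin_rep_Q by (simp add: M0_eq)
qed

lemma even_word_wt: "even (word_wt w) \<longleftrightarrow> \<not> odd_word A w"
  by (induction w) (auto simp: odd_word_def is_odd_A even_mode_wt)

lemma even_idx_iff: "\<mu> \<in> I \<Longrightarrow> (w, \<mu>) \<in> even_idx \<longleftrightarrow> (\<mu> \<in> Ev \<longleftrightarrow> \<not> odd_word A w)"
  using Ev[of \<mu> "word_wt w"] even_word_wt[of w] by (simp add: even_idx_def)

lemma F_evens: "evens F = span_of {(w, v). w \<in> lists B \<and> v \<in> (if odd_word A w then span_of (I - Ev) else span_of (I \<inter> Ev))}"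
  "odds F = span_of {(w, v). w \<in> lists B \<and> v \<in> (if odd_word A w then span_of (I \<inter> Ev) else span_of (I - Ev))}"
  unfolding V'_simps(5,6)[symmetric] by (simp_all add: free_rep_def)

lemma span_of_parts: "span_of (I - Ev) \<subseteq> span_of I" "span_of (I \<inter> Ev) \<subseteq> span_of I"
  by (auto simp: span_of_def)

lemma F_parts_sub: "evens F \<subseteq> span_of (lists B \<times> span_of I)" "odds F \<subseteq> span_of (lists B \<times> span_of I)"
  unfolding F_evens using span_of_parts by (intro span_of_mono; auto split: if_splits)+

lemma M0_parity:
  "submodule (evens M0) complex_ring M0" "submodule (odds M0) complex_ring M0"
  "W \<in> lists B \<Longrightarrow> \<mu> \<in> I \<Longrightarrow> theta0 (bvec (W, \<mu>)) \<in> (if (W, \<mu>) \<in> even_idx then evens M0 else odds M0)"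
proof -
  interpret Q: cmodule M0 using presentsD(6)[OF M0_presents] .
  have sub: "submodule (q.proj ` X) complex_ring M0" if X: "pm.subspace X" "X \<subseteq> carrier F" for X
    unfolding Q.submodule_iff
  proof (intro conjI ballI allI)
    show "q.proj ` X \<subseteq> carrier M0" using X by (auto simp: M0_eq q.proj_carrier)
    show "\<zero>\<^bsub>M0\<^esub> \<in> q.proj ` X" using pm.subspace_0[OF X(1)] unfolding M0_eq q.zero_Q(2) by (simp add: F_simps)
    fix x y z assume "x \<in> q.proj ` X"
    then obtain u where u: "u \<in> X" "x = q.proj u" by auto
    have uF: "u \<in> carrier F" using u X by auto
    show "z \<odot>\<^bsub>M0\<^esub> x \<in> q.proj ` X"
      using q.proj_smult[OF uF, of z] pm.subspace_scale[OF X(1) u(1), of z] u(2) by (auto simp: M0_eq F_simps(4))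
    assume "y \<in> q.proj ` X"
    then obtain v where v: "v \<in> X" "y = q.proj v" by auto
    have vF: "v \<in> carrier F" using v X by auto
    show "x \<oplus>\<^bsub>M0\<^esub> y \<in> q.proj ` X"
      using q.proj_add[OF uF vF] pm.subspace_add[OF X(1) u(1) v(1)] u(2) v(2) by (auto simp: M0_eq F_simps(3))
  qed
  show "submodule (evens M0) complex_ring M0" unfolding M0_eq q.evens_odds_Q
    using sub[of "evens F"] span_of_parts subspace_span_of unfolding M0_eq F_evens F_simps(1)
    by (fastforce intro!: span_of_mono split: if_splits)
  show "submodule (odds M0) complex_ring M0" unfolding M0_eq q.evens_odds_Q
    using sub[of "odds F"] span_of_parts subspace_span_of unfolding M0_eq F_evens F_simps(1)
    by (fastforce intro!: span_of_mono split: if_splits)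
  show "theta0 (bvec (W, \<mu>)) \<in> (if (W, \<mu>) \<in> even_idx then evens M0 else odds M0)" if "W \<in> lists B" "\<mu> \<in> I"
    using that unfolding M0_eq q.evens_odds_Q theta0_def even_idx_iff[OF that(2)]
    by (auto simp: emb_def F_evens)
qed

section \<open>The quotient by the radical and the parities of its weights\<close>

abbreviation "E \<equiv> relaxed_quotient A k \<Delta> V"

definition thetaE :: "fvec \<Rightarrow> ((mode list \<times> (complex \<Rightarrow>\<^sub>0 complex)) \<Rightarrow>\<^sub>0 complex) set set" where
  "thetaE u = (theta0 ` Rad) +>\<^bsub>M0\<^esub> theta0 u"

lemma E_eq: "E = quotient_rep M0 (theta0 ` Rad)"
  unfolding relaxed_quotient_def Let_def
  using radical_eq[OF M0_presents K0_ideal K0_ground M0_parity] by simp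

lemma Rad_subrep: "subrep A M0 (theta0 ` Rad)"
  using Rad_graded[OF M0_presents M0_parity] by (simp add: graded_subrep_def)

lemma E_presents: "presents E thetaE Rad"
  unfolding E_eq thetaE_def[abs_def]
  by (rule presents_radical_quotient[OF M0_presents K0_ideal K0_ground Rad_subrep])

text \<open>A homogeneous vector of the double quotient has a representative in
  \<open>free_rep\<close> built from homogeneous pairs, and \<open>ret\<close> spreads each of these
  over keys of one parity.\<close>

lemma E_parity:
  assumes "x \<in> (if b then evens E else odds E)"
  obtains u where "u \<in> FI" "\<forall>i\<in>Poly_Mapping.keys u. i \<in> even_idx \<longleftrightarrow> b" "x = thetaE u"
proof -
  interpret r: rep_quotient A M0 "theta0 ` Rad"
    using presentsD(1)[OF M0_presents] Rad_subrep by unfold_locales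
  have "evens E = (\<lambda>x. theta0 ` Rad +>\<^bsub>M0\<^esub> x) ` evens M0" "odds E = (\<lambda>x. theta0 ` Rad +>\<^bsub>M0\<^esub> x) ` odds M0"
    unfolding E_eq by (fact r.evens_odds_Q)+
  moreover have "evens M0 = q.proj ` evens F" "odds M0 = q.proj ` odds F"
    unfolding M0_eq by (fact q.evens_odds_Q)+
  ultimately obtain y where y: "y \<in> (if b then evens F else odds F)" "x = theta0 ` Rad +>\<^bsub>M0\<^esub> (IF +>\<^bsub>F\<^esub> y)"
    using assms by (cases b) auto
  have yF: "y \<in> span_of (lists B \<times> span_of I)"
    using y(1) F_parts_sub by (cases b) auto
  have "ret y \<in> span_of {i. i \<in> even_idx \<longleftrightarrow> b}" unfolding ret_def
  proof (rule lin_ext_subspace[OF subspace_span_of], clarify)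
    fix w v assume wv: "(w, v) \<in> Poly_Mapping.keys y"
    have w: "v \<in> (if odd_word A w = b then span_of (I - Ev) else span_of (I \<inter> Ev))"
      using y(1) wv by (cases b; cases "odd_word A w") (auto simp: F_evens span_of_def[of "{(w, v). _ w v}"])
    show "lin_ext (\<lambda>\<mu>. bvec (w, \<mu>)) v \<in> span_of {i. i \<in> even_idx \<longleftrightarrow> b}"
    proof (rule lin_ext_subspace[OF subspace_span_of])
      fix \<mu> assume "\<mu> \<in> Poly_Mapping.keys v"
      then have "\<mu> \<in> I" "\<mu> \<in> Ev \<longleftrightarrow> odd_word A w \<noteq> b"
        using w by (auto simp: span_of_def split: if_splits)
      then show "bvec (w, \<mu>) \<in> span_of {i. i \<in> even_idx \<longleftrightarrow> b}" by (auto simp: even_idx_iff)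
    qed
  qed
  then show ?thesis using that[of "ret y"] ret_FI[OF yF] y(2) theta0_ret[of y] yF
    by (auto simp: thetaE_def span_of_def F_simps(1))
qed

text \<open>A nonzero vector has a nonzero matrix element; the eigenvalue equation ties its target
  weight to \<nu>, and some key of \<open>u\<close> must contribute to it.\<close>

lemma E_weight_key:
  assumes u: "u \<in> FI" and h: "act E (Mode Gh 0) (thetaE u) = \<nu> \<odot>\<^bsub>E\<^esub> thetaE u" and nz: "thetaE u \<noteq> \<zero>\<^bsub>E\<^esub>"
  shows "\<exists>(W, \<mu>)\<in>Poly_Mapping.keys u. \<nu> = \<mu> + of_int (word_wt W)"
proof -
  have hB: "Mode Gh 0 \<in> B" using basis_A by auto
  have e: "opr (Mode Gh 0) u - scale \<nu> u \<in> Rad" using h presents_eigen[OF E_presents u hB] by simp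
  have "u \<notin> Rad" using nz presentsD(5)[OF E_presents u] by simp
  then obtain w \<mu>' where w: "w \<in> lists B" "mel w u \<mu>' \<noteq> 0" using u by (auto simp: Rad_def)
  have "(\<mu>' - of_int (word_wt w) - \<nu>) * mel w u \<mu>' = 0"
    using RadD(1)[OF e w(1)] by (simp add: mel_simps mel_h[OF u w(1)] algebra_simps)
  then have \<nu>: "\<nu> = \<mu>' - of_int (word_wt w)" using w(2) by simp
  have "\<exists>i\<in>Poly_Mapping.keys u. mel w (bvec i) \<mu>' \<noteq> 0"
    using w(2) lsum_zeroI[of u "\<lambda>i. mel w (bvec i) \<mu>'"] unfolding mel_expand[of w u] by blast
  then show ?thesis using \<nu> by (fastforce simp: mel_bvec split: if_splits)
qed

lemma E_weights:
  assumes "x \<in> (if b then evens E else odds E)" "act E (Mode Gh 0) x = \<nu> \<odot>\<^bsub>E\<^esub> x" "x \<noteq> \<zero>\<^bsub>E\<^esub>"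
  shows "\<nu> \<in> Ev \<longleftrightarrow> b" "\<exists>\<mu>\<in>I. \<exists>j::int. \<nu> = \<mu> + of_int j"
proof -
  obtain u where u: "u \<in> FI" "\<forall>i\<in>Poly_Mapping.keys u. i \<in> even_idx \<longleftrightarrow> b" "x = thetaE u"
    using E_parity[OF assms(1)] .
  obtain W \<mu> where W: "(W, \<mu>) \<in> Poly_Mapping.keys u" "\<nu> = \<mu> + of_int (word_wt W)"
    using E_weight_key[OF u(1)] assms(2,3) u(3) by blast
  then show "\<nu> \<in> Ev \<longleftrightarrow> b" using bspec[OF u(2) W(1)] by (simp add: even_idx_def)
  have "\<mu> \<in> I" using W(1) u(1) by (auto simp: FI_def span_of_def)
  then show "\<exists>\<mu>\<in>I. \<exists>j::int. \<nu> = \<mu> + of_int j" using W(2) by blast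
qed

lemma E_even_weights: "\<nu> \<in> even_weights E \<Longrightarrow> \<nu> \<in> Ev"
  using E_weights(1)[of _ True \<nu>] by (auto simp: even_weights_def eigenspace_def)

lemma E_odd_weights: "\<nu> \<in> odd_weights E \<Longrightarrow> \<nu> \<notin> Ev \<and> (\<exists>\<mu>\<in>I. \<exists>j::int. \<nu> = \<mu> + of_int j)"
  using E_weights[of _ False \<nu>] by (auto simp: odd_weights_def eigenspace_def)

end

section \<open>Simple highest-weight modules\<close>

definition lext :: "('g, 'v) rep \<Rightarrow> ('x \<Rightarrow> 'v) \<Rightarrow> ('x \<Rightarrow>\<^sub>0 complex) \<Rightarrow> 'v" where
  "lext M b u = (\<Oplus>\<^bsub>M\<^esub>i\<in>Poly_Mapping.keys u. Poly_Mapping.lookup u i \<odot>\<^bsub>M\<^esub> b i)"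

lemma lext_lin_map:
  assumes M: "cmodule M" and b: "\<And>i. i \<in> X \<Longrightarrow> b i \<in> carrier M"
  shows "lin_map (span_of X) M (lext M b)" "i \<in> X \<Longrightarrow> lext M b (bvec i) = b i"
proof -
  interpret cmodule M by (rule M)
  have sup: "lext M b u = (\<Oplus>\<^bsub>M\<^esub>i\<in>S. Poly_Mapping.lookup u i \<odot>\<^bsub>M\<^esub> b i)"
    if "finite S" "Poly_Mapping.keys u \<subseteq> S" "S \<subseteq> X" for u S
    unfolding lext_def using that b
    by (intro add.finprod_mono_neutral_cong_left) (auto simp: in_keys_iff Pi_def)
  have cl: "lext M b u \<in> carrier M" if "u \<in> span_of X" for u
    unfolding lext_def using that b by (intro finsum_closed) (auto simp: span_of_def)
  have add: "lext M b (u + v) = lext M b u \<oplus>\<^bsub>M\<^esub> lext M b v" if uv: "u \<in> span_of X" "v \<in> span_of X" for u v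
  proof -
    let ?S = "Poly_Mapping.keys u \<union> Poly_Mapping.keys v"
    have S: "finite ?S" "?S \<subseteq> X" using uv by (auto simp: span_of_def)
    have bS: "i \<in> ?S \<Longrightarrow> b i \<in> carrier M" for i using S(2) b by auto
    have k: "Poly_Mapping.keys (u + v) \<subseteq> ?S" by (rule Poly_Mapping.keys_add)
    have "lext M b (u + v) = (\<Oplus>\<^bsub>M\<^esub>i\<in>?S. Poly_Mapping.lookup u i \<odot>\<^bsub>M\<^esub> b i \<oplus>\<^bsub>M\<^esub> Poly_Mapping.lookup v i \<odot>\<^bsub>M\<^esub> b i)"
      unfolding sup[OF S(1) k S(2)] using bS by (intro finsum_cong') (auto simp: lookup_add cs_ldistr)
    also have "\<dots> = (\<Oplus>\<^bsub>M\<^esub>i\<in>?S. Poly_Mapping.lookup u i \<odot>\<^bsub>M\<^esub> b i) \<oplus>\<^bsub>M\<^esub> (\<Oplus>\<^bsub>M\<^esub>i\<in>?S. Poly_Mapping.lookup v i \<odot>\<^bsub>M\<^esub> b i)"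
      using bS by (intro finsum_addf) auto
    also have "\<dots> = lext M b u \<oplus>\<^bsub>M\<^esub> lext M b v"
      using sup[OF S(1) _ S(2)] by simp
    finally show ?thesis .
  qed
  have sc: "lext M b (scale z u) = z \<odot>\<^bsub>M\<^esub> lext M b u" if u: "u \<in> span_of X" for z u
  proof -
    let ?S = "Poly_Mapping.keys u"
    have S: "finite ?S" "?S \<subseteq> X" using u by (auto simp: span_of_def)
    have bS: "i \<in> ?S \<Longrightarrow> b i \<in> carrier M" for i using S(2) b by auto
    have "lext M b (scale z u) = (\<Oplus>\<^bsub>M\<^esub>i\<in>?S. z \<odot>\<^bsub>M\<^esub> (Poly_Mapping.lookup u i \<odot>\<^bsub>M\<^esub> b i))"
      unfolding sup[OF S(1) keys_scale S(2)] using bS by (intro finsum_cong') (auto simp: cs_assoc)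
    also have "\<dots> = z \<odot>\<^bsub>M\<^esub> lext M b u"
      unfolding lext_def using bS by (intro finsum_smult_ldistr[symmetric]) auto
    finally show ?thesis .
  qed
  show "lin_map (span_of X) M (lext M b)"
    unfolding lin_map_def using M subspace_span_of cl add sc by auto
  show "lext M b (bvec i) = b i" if "i \<in> X"
  proof -
    have "lext M b (bvec i) = (\<Oplus>\<^bsub>M\<^esub>i\<in>{i}. 1 \<odot>\<^bsub>M\<^esub> b i)"
      unfolding lext_def bvec_def using b[OF that] by (auto intro!: finsum_cong')
    then show ?thesis using b[OF that] by simp
  qed
qed

lemma lin_map_eqI:
  assumes f: "lin_map (span_of X) M f" and g: "lin_map (span_of X) M g"
    and eq: "\<And>i. i \<in> X \<Longrightarrow> f (bvec i) = g (bvec i)" and u: "u \<in> span_of X"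
  shows "f u = g u"
proof -
  have "pm.subspace {u \<in> span_of X. f u = g u}"
    using lin_mapD[OF f] lin_mapD[OF g] subspace_span_of[of X] unfolding pm.subspace_def by auto
  then have "span_of X \<subseteq> {u \<in> span_of X. f u = g u}"
    by (rule span_of_subset) (use eq in auto)
  then show ?thesis using u by auto
qed

lemma super_module_lin_rep: "super_module A M \<Longrightarrow> lin_rep A M"
  unfolding super_module_def lin_rep_def by blast

context current_algebra
begin

lemma super_module_bracket:
  assumes L: "super_module A L" and ab: "a \<in> B" "b \<in> B" and v: "v \<in> carrier L"
  shows "act L a (act L b v) =
    msign a b \<odot>\<^bsub>L\<^esub> act L b (act L a v) \<oplus>\<^bsub>L\<^esub> lext L (\<lambda>e. act L e v) (mode_bracket a b)"
proof -
  note LR = lin_repD[OF super_module_lin_rep[OF L]]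
  interpret cmodule L by (rule LR(1))
  let ?x = "act L a (act L b v)" and ?y = "msign a b \<odot>\<^bsub>L\<^esub> act L b (act L a v)"
  have s: "super_sign A a b = msign a b" by (simp add: super_sign_def msign_def is_odd_A)
  have eq: "?x \<ominus>\<^bsub>L\<^esub> ?y = lext L (\<lambda>e. act L e v) (mode_bracket a b)"
    using L ab v unfolding super_module_def lext_def bracket_A[symmetric] s[symmetric] by blast
  have c: "?x \<in> carrier L" "?y \<in> carrier L" using LR(2) ab v by auto
  have "?x = ?y \<oplus>\<^bsub>L\<^esub> (?x \<ominus>\<^bsub>L\<^esub> ?y)"
    using c a_lcomm[of ?y ?x "\<ominus>\<^bsub>L\<^esub> ?y"] by (simp add: a_minus_def r_neg)
  then show ?thesis using eq by simp
qed

end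

section \<open>Simple modules presented by the radical\<close>

context ground_states
begin

text \<open>The kernel \<open>K\<close> of the map from words on ground states is an ideal without
  basis ground vectors, hence inside \<open>Rad\<close>. Simplicity enters twice: the nonzero graded
  image is everything, and the image of \<open>Rad\<close>, which misses the ground vectors, is
  zero. So \<open>K\<close> equals \<open>Rad\<close>, with no knowledge of singular
  vectors.\<close>

lemma hw_presents:
  fixes L :: "(mode, 'v) rep"
  assumes L: "super_module A L" "simple_rep A L" and I: "I \<noteq> {}"
    and G: "\<And>\<mu>. \<mu> \<in> I \<Longrightarrow> G \<mu> \<in> (if \<mu> \<in> Ev then evens L else odds L)" "\<And>\<mu>. \<mu> \<in> I \<Longrightarrow> G \<mu> \<noteq> \<zero>\<^bsub>L\<^esub>"
    and act: "\<And>a \<mu>. a \<in> B \<Longrightarrow> \<not> neg_mode a \<Longrightarrow> \<mu> \<in> I \<Longrightarrow>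
      act L a (G \<mu>) = gcoef a (pl \<mu>) \<mu> \<odot>\<^bsub>L\<^esub> (if \<mu> + of_int (mode_wt a) \<in> I then G (\<mu> + of_int (mode_wt a)) else \<zero>\<^bsub>L\<^esub>)"
  shows "\<exists>\<theta>. presents L \<theta> Rad"
proof -
  have LR0: "lin_rep A L" by (rule super_module_lin_rep[OF L(1)])
  note LR = lin_repD[OF LR0]
  interpret cmodule L by (rule LR(1))
  have ev: "submodule (evens L) complex_ring L" "submodule (odds L) complex_ring L"
    using L(1) by (auto simp: super_module_def)
  have evc: "evens L \<subseteq> carrier L" "odds L \<subseteq> carrier L" using ev by (auto simp: submodule_iff)
  have Gc: "G \<mu> \<in> carrier L" if "\<mu> \<in> I" for \<mu> using G(1)[OF that] evc by (auto split: if_splits)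
  define b where "b i = foldr (act L) (fst i) (G (snd i))" for i
  have b: "b i \<in> carrier L" if "i \<in> lists B \<times> I" for i
  proof -
    have f: "foldr (act L) w (G \<mu>) \<in> carrier L" if "w \<in> lists B" "\<mu> \<in> I" for w \<mu>
      using that by (induction w) (auto simp: Gc LR(2))
    show ?thesis using f[of "fst i" "snd i"] that by (simp add: b_def mem_Times_iff)
  qed
  define \<theta> where "\<theta> = lext L b"
  have \<theta>: "lin_map FI L \<theta>" unfolding \<theta>_def FI_def by (rule lext_lin_map(1)[OF LR(1) b])
  note TD = lin_mapD[OF \<theta>]
  have \<theta>b: "\<theta> (bvec (w, \<mu>)) = foldr (act L) w (G \<mu>)" if "w \<in> lists B" "\<mu> \<in> I" for w \<mu>
  proof -
    have "\<theta> (bvec (w, \<mu>)) = b (w, \<mu>)"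
      unfolding \<theta>_def by (rule lext_lin_map(2)[OF LR(1), where X = "lists B \<times> I"]) (use b that in blast)+
    then show ?thesis by (simp add: b_def)
  qed
  have \<theta>act: "\<theta> (opr a u) = act L a (\<theta> u)" if a: "a \<in> B" and u: "u \<in> FI" for a u
    using u unfolding FI_def
  proof (rule lin_map_eqI[rotated -1])
    show "lin_map (span_of (lists B \<times> I)) L (\<lambda>u. \<theta> (opr a u))"
      using TD FI_opr[OF a] unfolding FI_def[symmetric] lin_map_def by (simp add: opr_simps)
    show "lin_map (span_of (lists B \<times> I)) L (\<lambda>u. act L a (\<theta> u))"
      using TD LR(2-4)[OF a] LR(1) unfolding FI_def[symmetric] lin_map_def by simp
    show "\<theta> (opr a (bvec i)) = act L a (\<theta> (bvec i))" if "i \<in> lists B \<times> I" for i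
      using that \<theta>b a by (cases i) (auto simp: opr_simps)
  qed
  define K where "K = {u \<in> FI. \<theta> u = \<zero>\<^bsub>L\<^esub>}"
  have par: "\<theta> (bvec (W, \<mu>)) \<in> (if (W, \<mu>) \<in> even_idx then evens L else odds L)"
    if "W \<in> lists B" "\<mu> \<in> I" for W \<mu>
    using that
  proof (induction W rule: list.induct)
    case Nil
    then show ?case using G(1)[of \<mu>] by (simp add: \<theta>b even_idx_def)
  next
    case (Cons a W)
    have flip: "(a # W, \<mu>) \<in> even_idx \<longleftrightarrow> ((W, \<mu>) \<in> even_idx \<longleftrightarrow> \<not> odd_mode a)"
      using Ev[OF Cons.prems(2), of "word_wt W"] Ev[OF Cons.prems(2), of "mode_wt a + word_wt W"] even_mode_wt[of a]
      by (auto simp: even_idx_def)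
    have a: "a \<in> B" "W \<in> lists B" using Cons.prems by auto
    have "\<forall>v\<in>evens L. act L a v \<in> (if odd_mode a then odds L else evens L)"
      "\<forall>v\<in>odds L. act L a v \<in> (if odd_mode a then evens L else odds L)"
      using L(1) a(1) unfolding super_module_def is_odd_A by blast+
    then have "act L a (\<theta> (bvec (W, \<mu>))) \<in> (if (a # W, \<mu>) \<in> even_idx then evens L else odds L)"
      using Cons.IH[OF a(2) Cons.prems(2)] flip by (auto split: if_splits)
    then show ?case using \<theta>b[OF a(2) Cons.prems(2)] \<theta>b[OF Cons.prems] by simp
  qed
  have add_scale_neg: "u + scale (-1) v = u - v" for u v :: fvec by simp
  have K: "ideal K" unfolding ideal_def
  proof (intro conjI ballI impI)
    show "pm.subspace K"
      using TD FI_subspace unfolding pm.subspace_def K_def by auto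
    show "K \<subseteq> FI" by (auto simp: K_def)
    have act0: "act L a \<zero>\<^bsub>L\<^esub> = \<zero>\<^bsub>L\<^esub>" if "a \<in> B" for a
      using LR(4)[OF that, of "\<zero>\<^bsub>L\<^esub>" 0] LR(2)[OF that, of "\<zero>\<^bsub>L\<^esub>"] by simp
    show "opr a u \<in> K" if "a \<in> B" "u \<in> K" for a u
      using that FI_opr act0 \<theta>act by (auto simp: K_def)
    show "opr a (opr b u) - scale (msign a b) (opr b (opr a u)) - bropr a b u \<in> K"
      if ab: "a \<in> B" "b \<in> B" and u: "u \<in> FI" for a b u
    proof -
      let ?x = "opr a (opr b u)" and ?y = "scale (msign a b) (opr b (opr a u)) + bropr a b u"
      have F: "?x \<in> FI" "scale (msign a b) (opr b (opr a u)) \<in> FI" "bropr a b u \<in> FI"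
        using ab u FI_opr FI_bropr pm.subspace_scale[OF FI_subspace] by auto
      have y: "?y \<in> FI" by (rule pm.subspace_add[OF FI_subspace F(2,3)])
      note F2 = y pm.subspace_diff[OF FI_subspace F(1) y] pm.subspace_scale[OF FI_subspace y, of "-1"]
      have "\<theta> (bropr a b u) = lext L (\<lambda>e. act L e (\<theta> u)) (mode_bracket a b)"
      proof -
        have e: "e \<in> B" if "e \<in> Poly_Mapping.keys (mode_bracket a b)" for e
          using closed_A ab that by (auto simp: bracket_closed_def)
        have "\<theta> (bropr a b u) = (\<Oplus>\<^bsub>L\<^esub>e\<in>Poly_Mapping.keys (mode_bracket a b). Poly_Mapping.lookup (mode_bracket a b) e \<odot>\<^bsub>L\<^esub> \<theta> (opr e u))"
          unfolding bropr_def lin_ext_def using e FI_opr u by (intro lin_map_sum[OF \<theta>]) auto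
        also have "\<dots> = lext L (\<lambda>e. act L e (\<theta> u)) (mode_bracket a b)"
          unfolding lext_def using e \<theta>act u LR(2) TD(3)[OF u] by (intro finsum_cong') auto
        finally show ?thesis .
      qed
      then have eq: "\<theta> ?x = \<theta> ?y"
        using super_module_bracket[OF L(1) ab TD(3)[OF u]] TD(4)[OF F(2,3)] TD(5)[OF FI_opr[OF ab(2) FI_opr[OF ab(1) u]]]
          \<theta>act ab u FI_opr by simp
      have "\<theta> (?x + scale (-1) ?y) = \<theta> ?x \<oplus>\<^bsub>L\<^esub> (-1) \<odot>\<^bsub>L\<^esub> \<theta> ?y"
        unfolding TD(4)[OF F(1) F2(3)] TD(5)[OF F2(1)] ..
      also have "\<dots> = \<zero>\<^bsub>L\<^esub>" unfolding eq using TD(3)[OF F2(1)] by (simp add: minus_eq_cs[symmetric] r_neg)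
      finally have "\<theta> (?x - ?y) = \<zero>\<^bsub>L\<^esub>" by (simp only: add_scale_neg)
      then show ?thesis using F2(2) by (simp add: K_def diff_diff_eq)
    qed
    show "bvec ([a], \<mu>) - scale (gcoef a (pl \<mu>) \<mu>) (gvec (\<mu> + of_int (mode_wt a))) \<in> K"
      if a: "a \<in> B" "\<not> neg_mode a" and \<mu>: "\<mu> \<in> I" for a \<mu>
    proof -
      let ?y = "scale (gcoef a (pl \<mu>) \<mu>) (gvec (\<mu> + of_int (mode_wt a)))"
      have x: "bvec ([a], \<mu>) \<in> FI" using a \<mu> by (intro bvec_FI) auto
      have y: "?y \<in> FI" by (rule pm.subspace_scale[OF FI_subspace gvec_FI])
      note F = x y pm.subspace_scale[OF FI_subspace y, of "-1"] pm.subspace_diff[OF FI_subspace x y]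
      have "\<theta> (gvec \<nu>) = (if \<nu> \<in> I then G \<nu> else \<zero>\<^bsub>L\<^esub>)" for \<nu>
        using \<theta>b[of "[]" \<nu>] TD(6) by (simp add: gvec_def)
      then have eq: "\<theta> (bvec ([a], \<mu>)) = \<theta> ?y"
        using \<theta>b[of "[a]" \<mu>] a \<mu> act[OF a \<mu>] TD(5)[OF gvec_FI] by simp
      have "\<theta> (bvec ([a], \<mu>) + scale (-1) ?y) = \<theta> (bvec ([a], \<mu>)) \<oplus>\<^bsub>L\<^esub> (-1) \<odot>\<^bsub>L\<^esub> \<theta> ?y"
        unfolding TD(4)[OF F(1,3)] TD(5)[OF F(2)] ..
      also have "\<dots> = \<zero>\<^bsub>L\<^esub>" unfolding eq using TD(3)[OF F(2)] by (simp add: minus_eq_cs[symmetric] r_neg)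
      finally have "\<theta> (bvec ([a], \<mu>) - ?y) = \<zero>\<^bsub>L\<^esub>" by (simp only: add_scale_neg)
      then show ?thesis using F(4) by (simp add: K_def)
    qed
  qed
  have ground: "bvec ([], \<mu>) \<notin> K" if "\<mu> \<in> I" for \<mu>
    using \<theta>b[of "[]" \<mu>] G(2)[OF that] that by (simp add: K_def)
  obtain \<mu>0 where \<mu>0: "\<mu>0 \<in> I" using I by blast
  have "graded_subrep A L (\<theta> ` FI)"
  proof (rule graded_image[OF \<theta> FI_subspace subset_refl _ _ ev par])
    show "restrict_to {(W, \<mu>). \<mu> + of_int (word_wt W) \<in> T} u \<in> FI" if "u \<in> FI" for u T
      using that by (auto simp: FI_def span_of_def keys_restrict_to)
    show "act L a (\<theta> u) \<in> \<theta> ` FI" if "a \<in> B" "u \<in> FI" for a u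
      using \<theta>act[OF that] FI_opr[OF that] by force
  qed
  moreover have "\<theta> ` FI \<noteq> {\<zero>\<^bsub>L\<^esub>}"
  proof
    assume "\<theta> ` FI = {\<zero>\<^bsub>L\<^esub>}"
    moreover have "\<theta> (bvec ([], \<mu>0)) \<in> \<theta> ` FI" using bvec_FI[of "[]" \<mu>0] \<mu>0 by simp
    ultimately show False using \<theta>b[of "[]" \<mu>0] G(2)[OF \<mu>0] \<mu>0 by simp
  qed
  ultimately have surj: "\<theta> ` FI = carrier L" using L(2) by (auto simp: simple_rep_def)
  have P: "presents L \<theta> K"
    unfolding presents_def using LR0 \<theta> \<theta>act surj by (auto simp: K_def)
  have KR: "K \<subseteq> Rad" using ideal_le_Rad[OF K ground] .
  have "\<theta> ` Rad = {\<zero>\<^bsub>L\<^esub>} \<or> \<theta> ` Rad = carrier L"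
    using L(2) Rad_graded[OF P ev par] by (auto simp: simple_rep_def)
  \<comment> \<open>If a ground vector had the same image as some \<open>r\<close> in
    \<open>Rad\<close>, the difference would lie in \<open>K\<close>, thus in \<open>Rad\<close>,
    and so would the ground vector.\<close>
  moreover have "\<theta> ` Rad \<noteq> carrier L"
  proof
    assume "\<theta> ` Rad = carrier L"
    then obtain r where r: "r \<in> Rad" "\<theta> (bvec ([], \<mu>0)) = \<theta> r"
      using TD(3)[OF bvec_FI[of "[]" \<mu>0]] \<mu>0 by fastforce
    have "bvec ([], \<mu>0) - r \<in> K"
      using presents_eq_iff[OF P bvec_FI[of "[]" \<mu>0] RadD(2)[OF r(1)]] r(2) \<mu>0 by simp
    then have "bvec ([], \<mu>0) \<in> Rad"
      using pm.subspace_add[OF idealD(1)[OF Rad_ideal] subsetD[OF KR] r(1)] by fastforce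
    then show False using bvec_notin_Rad by blast
  qed
  ultimately have "\<theta> ` Rad = {\<zero>\<^bsub>L\<^esub>}" by blast
  then have "Rad \<subseteq> K" using RadD(2) by (auto simp: K_def)
  with KR have "K = Rad" by blast
  then show ?thesis using P by blast
qed

end

lemma (in cmodule) cs_eq_zero:
  assumes "x \<in> carrier M" "z \<odot> x = \<zero>" "z \<noteq> 0"
  shows "x = \<zero>"
proof -
  have "x = (inverse z * z) \<odot> x" using assms(1,3) by simp
  also have "\<dots> = \<zero>" unfolding cs_assoc[OF assms(1)] assms(2) by simp
  finally show ?thesis .
qed

lemma lext_scale_bvec: "cmodule M \<Longrightarrow> b e \<in> carrier M \<Longrightarrow> lext M b (scale z (bvec e)) = z \<odot>\<^bsub>M\<^esub> b e"
  using lin_mapD(5)[OF lext_lin_map(1)[of M "{e}" b], of "bvec e" z] lext_lin_map(2)[of M "{e}" b e] by auto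

lemma lext_zeroI:
  assumes "cmodule M" "\<And>e. e \<in> Poly_Mapping.keys u \<Longrightarrow> b e = \<zero>\<^bsub>M\<^esub>"
  shows "lext M b u = \<zero>\<^bsub>M\<^esub>"
proof -
  interpret cmodule M by fact
  have "lext M b u = (\<Oplus>\<^bsub>M\<^esub>i\<in>Poly_Mapping.keys u. \<zero>\<^bsub>M\<^esub>)"
    unfolding lext_def using assms(2) by (intro finsum_cong') auto
  then show ?thesis by simp
qed

lemma lext_bvec: "cmodule M \<Longrightarrow> b e \<in> carrier M \<Longrightarrow> lext M b (bvec e) = b e"
  using lext_lin_map(2)[of M "{e}" b e] by auto

lemma lext_zero: "cmodule M \<Longrightarrow> lext M b 0 = \<zero>\<^bsub>M\<^esub>"
  by (rule lext_zeroI) auto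

lemma bracket_h: "mode_bracket (Mode Gh 0) a = scale (of_int (mode_wt a)) (bvec a)"
proof (cases a)
  case (Mode g n)
  have "osp_bracket Gh g = Poly_Mapping.single g (of_int (osp_wt g))" by (cases g) auto
  then show ?thesis using Mode by simp
qed auto

lemma bracket_L0: "mode_bracket L0 a = scale (- of_rat (mode_deg a)) (bvec a)"
  by (cases a) (auto simp: scale_as_single)

lemma bracket_zero_modes:
  "mode_bracket (Mode Ge 0) (Mode Gf 0) = scale 1 (bvec (Mode Gh 0))"
  "mode_bracket (Mode Gx 0) (Mode Gy 0) = scale 1 (bvec (Mode Gh 0))"
  "mode_bracket (Mode Gx 0) (Mode Gx 0) = scale 2 (bvec (Mode Ge 0))"
  "mode_bracket (Mode Gy 0) (Mode Gy 0) = scale (-2) (bvec (Mode Gf 0))"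
  by (simp_all add: lin_ext_uminus)

section \<open>Chains below a highest-weight vector and generic ranks\<close>

context current_algebra
begin

definition hw_vector :: "(mode, 'v) rep \<Rightarrow> complex \<Rightarrow> 'v \<Rightarrow> bool" where
  "hw_vector L m0 u \<longleftrightarrow> u \<in> evens L \<and> u \<noteq> \<zero>\<^bsub>L\<^esub> \<and>
     act L (Mode Gh 0) u = m0 \<odot>\<^bsub>L\<^esub> u \<and> act L L0 u = \<Delta> \<odot>\<^bsub>L\<^esub> u \<and>
     (\<forall>a n. Mode a n \<in> B \<and> n > 0 \<longrightarrow> act L (Mode a n) u = \<zero>\<^bsub>L\<^esub>) \<and>
     act L (Mode Ge 0) u = \<zero>\<^bsub>L\<^esub> \<and> (Mode Gx 0 \<in> B \<longrightarrow> act L (Mode Gx 0) u = \<zero>\<^bsub>L\<^esub>)"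

lemma simple_hw_repD:
  assumes "simple_hw_rep A k \<Delta> m0 L"
  obtains u where "hw_vector L m0 u" "super_module A L" "simple_rep A L" "\<forall>v\<in>carrier L. act L Cent v = k \<odot>\<^bsub>L\<^esub> v"
proof -
  have "\<exists>u. hw_vector L m0 u"
    using assms unfolding simple_hw_rep_def hw_vector_def
    by (elim conjE bexE, intro exI conjI) assumption+
  then show ?thesis using assms that by (auto simp: simple_hw_rep_def)
qed

text \<open>Treats \<open>f_0\<close> and \<open>y_0\<close> together. For positive modes all
  generators with the same index are handled at once, since commuting with a zero mode changes the
  generator but not the index.\<close>

lemma lowering_chain:
  assumes L: "super_module A L" and u: "hw_vector L m0 u"
    and d: "d \<in> B" "d = Mode Gf 0 \<or> d = Mode Gy 0"
  defines "G \<equiv> \<lambda>j. (act L d ^^ j) u"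
  shows "G j \<in> carrier L"
    "G j \<in> (if odd_mode d \<and> odd j then odds L else evens L)"
    "act L (Mode Gh 0) (G j) = (m0 + of_nat j * of_int (mode_wt d)) \<odot>\<^bsub>L\<^esub> G j"
    "act L L0 (G j) = \<Delta> \<odot>\<^bsub>L\<^esub> G j"
    "Mode g n \<in> B \<Longrightarrow> n > 0 \<Longrightarrow> act L (Mode g n) (G j) = \<zero>\<^bsub>L\<^esub>"
proof -
  note LR = lin_repD[OF super_module_lin_rep[OF L]]
  interpret cmodule L by (rule LR(1))
  have sub: "evens L \<subseteq> carrier L" "odds L \<subseteq> carrier L"
    using L unfolding super_module_def submodule_iff by auto
  have parity: "\<forall>v\<in>evens L. act L d v \<in> (if odd_mode d then odds L else evens L)"
      "\<forall>v\<in>odds L. act L d v \<in> (if odd_mode d then evens L else odds L)"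
    using L d(1) unfolding super_module_def is_odd_A by blast+
  have P: "G j \<in> (if odd_mode d \<and> odd j then odds L else evens L)" for j
  proof (induction j)
    case 0
    then show ?case using u by (simp add: G_def hw_vector_def)
  next
    case (Suc j)
    then show ?case using parity by (auto simp: G_def split: if_splits)
  qed
  then show "G j \<in> (if odd_mode d \<and> odd j then odds L else evens L)" .
  have G: "G j \<in> carrier L" for j using P[of j] sub by (auto split: if_splits)
  then show "G j \<in> carrier L" .
  have hB: "Mode Gh 0 \<in> B" "L0 \<in> B" using basis_A by auto
  have GS: "G (Suc j) = act L d (G j)" for j by (simp add: G_def)
  have deg: "mode_deg d = 0" using d by auto
  note br = super_module_bracket[OF L]
  show "act L (Mode Gh 0) (G j) = (m0 + of_nat j * of_int (mode_wt d)) \<odot>\<^bsub>L\<^esub> G j"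
  proof (induction j)
    case 0
    then show ?case using u by (simp add: G_def hw_vector_def)
  next
    case (Suc j)
    have "act L (Mode Gh 0) (G (Suc j)) =
      act L d (act L (Mode Gh 0) (G j)) \<oplus>\<^bsub>L\<^esub> of_int (mode_wt d) \<odot>\<^bsub>L\<^esub> G (Suc j)"
      unfolding GS br[OF hB(1) d(1) G] bracket_h
      using LR(2) d(1) hB G by (simp add: lext_scale_bvec[OF LR(1)] msign_def)
    also have "\<dots> = (m0 + of_nat j * of_int (mode_wt d) + of_int (mode_wt d)) \<odot>\<^bsub>L\<^esub> G (Suc j)"
      unfolding Suc using LR(4)[OF d(1) G] G[of "Suc j"] by (simp add: GS cs_ldistr)
    also have "m0 + of_nat j * of_int (mode_wt d) + of_int (mode_wt d) = m0 + of_nat (Suc j) * of_int (mode_wt d)"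
      by (simp add: algebra_simps)
    finally show ?case .
  qed
  show "act L L0 (G j) = \<Delta> \<odot>\<^bsub>L\<^esub> G j"
  proof (induction j)
    case 0
    then show ?case using u by (simp add: G_def hw_vector_def)
  next
    case (Suc j)
    have "act L L0 (G (Suc j)) = act L d (act L L0 (G j)) \<oplus>\<^bsub>L\<^esub> \<zero>\<^bsub>L\<^esub>"
      unfolding GS br[OF hB(2) d(1) G] bracket_L0
      using LR(2) d(1) hB G deg by (simp add: lext_zero[OF LR(1)] msign_def)
    then show ?case unfolding Suc using LR(4)[OF d(1) G] G[of "Suc j"] by (simp add: GS)
  qed
  show "act L (Mode g n) (G j) = \<zero>\<^bsub>L\<^esub>" if "Mode g n \<in> B" "n > 0"
    using that
  proof (induction j arbitrary: g)
    case 0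
    then show ?case using u by (simp add: G_def hw_vector_def)
  next
    case (Suc j)
    have "act L e (G j) = \<zero>\<^bsub>L\<^esub>" if e: "e \<in> Poly_Mapping.keys (mode_bracket (Mode g n) d)" for e
    proof -
      have "e \<in> B" using closed_A Suc.prems(1) d(1) e by (auto simp: bracket_closed_def)
      moreover have "mode_deg e = n" using bracket_keys(3)[OF e] deg by simp
      ultimately show ?thesis using Suc.IH Suc.prems(2) by (cases e) auto
    qed
    then have "lext L (\<lambda>e. act L e (G j)) (mode_bracket (Mode g n) d) = \<zero>\<^bsub>L\<^esub>"
      by (rule lext_zeroI[OF LR(1)])
    moreover have "act L d \<zero>\<^bsub>L\<^esub> = \<zero>\<^bsub>L\<^esub>" using LR(4)[OF d(1), of "\<zero>\<^bsub>L\<^esub>" 0] LR(2)[OF d(1), of "\<zero>\<^bsub>L\<^esub>"] by simp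
    ultimately show ?case
      unfolding GS br[OF Suc.prems(1) d(1) G] Suc.IH[OF Suc.prems] by simp
  qed
qed

definition rank_spec :: "(mode list \<Rightarrow> bool) \<Rightarrow> mode list set \<Rightarrow> nat \<Rightarrow> bool" where
  "rank_spec pf J r \<longleftrightarrow> (\<forall>t. fn.dim (col pf t ` J) \<le> r) \<and> finite {t. fn.dim (col pf t ` J) \<noteq> r}"

lemma rank_spec_exists: "J \<subseteq> level_words n \<Longrightarrow> \<exists>r. rank_spec pf J r"
  using col_rank[of J n pf] unfolding rank_spec_def by metis

lemma rank_spec_eventually:
  assumes "rank_spec pf J r" and "inj f"
  shows "\<forall>\<^sub>F m :: nat in sequentially. fn.dim (col pf (f m) ` J) = r"
proof -
  have "finite (f -` {t. fn.dim (col pf t ` J) \<noteq> r})"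
    using assms by (intro finite_vimageI) (auto simp: rank_spec_def)
  then show ?thesis
    unfolding cofinite_eq_sequentially[symmetric] eventually_cofinite by (simp add: vimage_def)
qed

text \<open>
  Every string function is at most the generic rank, equals it far up the weight support, and does
  not increase when the weight is raised.
\<close>

lemma rank_spec_constant:
  assumes r: "rank_spec pf J r" and s: "\<And>m :: nat. s (\<nu> + 2 * of_nat m) = enat (fn.dim (col pf (\<nu> + 2 * of_nat m) ` J))"
    and mono: "\<And>\<mu>. s (\<mu> + 2) \<le> s (\<mu> :: complex)"
  shows "s \<nu> = enat r"
proof -
  have "\<forall>\<^sub>F m :: nat in sequentially. fn.dim (col pf (\<nu> + 2 * of_nat m) ` J) = r"
    by (rule rank_spec_eventually[OF r]) (auto simp: inj_def)
  then obtain m :: nat where m: "fn.dim (col pf (\<nu> + 2 * of_nat m) ` J) = r"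
    using eventually_happens'[OF sequentially_bot] by blast
  have "s (\<nu> + 2 * of_nat m) \<le> s \<nu>" for m :: nat
  proof (induction m)
    case (Suc m)
    have "s (\<nu> + 2 * of_nat (Suc m)) \<le> s (\<nu> + 2 * of_nat m)"
      using mono[of "\<nu> + 2 * of_nat m"] by (simp add: algebra_simps)
    then show ?case using Suc by (rule order_trans)
  qed simp
  then have "enat r \<le> s \<nu>" using m s[of m] by metis
  moreover have "s \<nu> \<le> enat r" using s[of 0] r by (simp add: rank_spec_def)
  ultimately show ?thesis by (rule antisym[rotated])
qed

end

section \<open>Cosets of the root lattice\<close>

lemma weight_cosetsD:
  assumes "\<Lambda> \<in> weight_cosets"
  obtains \<mu>0 where "\<Lambda> = {\<mu>. \<exists>j::int. \<mu> = \<mu>0 + 2 * of_int j}"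
proof -
  obtain \<mu>0 where "\<Lambda> = {(\<mu>, \<nu>). \<exists>j::int. \<nu> - \<mu> = of_int j * alpha} `` {\<mu>0}"
    using assms unfolding weight_cosets_def quotient_def by auto
  then have "\<Lambda> = {\<mu>. \<exists>j::int. \<mu> = \<mu>0 + 2 * of_int j}"
    by (auto simp: alpha_def algebra_simps)
  then show ?thesis by (rule that)
qed

lemma coset_shift:
  fixes \<mu>0 :: complex
  assumes "\<mu> \<in> {\<mu>. \<exists>j::int. \<mu> = \<mu>0 + 2 * of_int j}"
  shows "\<mu> + of_int i \<in> {\<mu>. \<exists>j::int. \<mu> = \<mu>0 + 2 * of_int j} \<longleftrightarrow> even i"
proof -
  obtain j where j: "\<mu> = \<mu>0 + 2 * of_int j" using assms by auto
  show ?thesis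
  proof
    assume "even i"
    then obtain l where "i = 2 * l" by (elim evenE)
    then have "\<mu> + of_int i = \<mu>0 + 2 * of_int (j + l)" using j by simp
    then show "\<mu> + of_int i \<in> {\<mu>. \<exists>j::int. \<mu> = \<mu>0 + 2 * of_int j}" by blast
  next
    assume "\<mu> + of_int i \<in> {\<mu>. \<exists>j::int. \<mu> = \<mu>0 + 2 * of_int j}"
    then obtain l where "\<mu>0 + 2 * of_int j + of_int i = \<mu>0 + 2 * of_int l" using j by auto
    then have "of_int (2 * j + i) = (of_int (2 * l) :: complex)" by simp
    then have "2 * j + i = 2 * l" by (simp only: of_int_eq_iff)
    then show "even i" by presburger
  qed
qed

lemma weight_cosets_shift:
  assumes "\<Lambda> \<in> weight_cosets" "\<mu> \<in> \<Lambda>"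
  shows "\<mu> + of_int i \<in> \<Lambda> \<longleftrightarrow> even i"
  using weight_cosetsD[OF assms(1)] coset_shift assms(2) by metis


lemma weight_cosets_union_shift:
  assumes "\<Lambda> \<in> weight_cosets" "\<mu> \<in> \<Lambda> \<union> shift omega \<Lambda>"
  shows "\<mu> + of_int j \<in> \<Lambda> \<longleftrightarrow> (\<mu> \<in> \<Lambda> \<longleftrightarrow> even j)" "\<mu> + of_int j \<in> \<Lambda> \<union> shift omega \<Lambda>"
proof -
  note sh = weight_cosets_shift[OF assms(1)]
  have I: "\<nu> \<in> \<Lambda> \<union> shift omega \<Lambda> \<longleftrightarrow> \<nu> \<in> \<Lambda> \<or> \<nu> - 1 \<in> \<Lambda>" for \<nu>
    by (auto simp: shift_def omega_def alpha_def image_iff) (metis diff_add_cancel)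
  show Ev: "\<mu> + of_int j \<in> \<Lambda> \<longleftrightarrow> (\<mu> \<in> \<Lambda> \<longleftrightarrow> even j)" for j
  proof (cases "\<mu> \<in> \<Lambda>")
    case True
    then show ?thesis using sh by simp
  next
    case False
    then have "\<mu> - 1 \<in> \<Lambda>" using assms(2) I by blast
    from sh[OF this, of "j + 1"] show ?thesis using False by simp
  qed
  have e: "\<mu> + of_int j - 1 = \<mu> + of_int (j - 1)" by simp
  show "\<mu> + of_int j \<in> \<Lambda> \<union> shift omega \<Lambda>" unfolding I e using Ev[of j] Ev[of "j - 1"] by auto
qed


section \<open>Ground states forming an \<open>sl\<^sub>2\<close>-module\<close>

text \<open>The action on a dense module in terms of the Dynkin label \<open>t\<close>, for which
  (\<mu>, \<mu>+\<alpha>) is t(t+2)/2. A Verma module in the basis of powers of \<open>f_0\<close>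
  has the same constants, with \<open>q\<close> computed from its highest weight.\<close>

definition c_sl2 :: "complex \<Rightarrow> osp \<Rightarrow> bool \<Rightarrow> complex \<Rightarrow> complex" where
  "c_sl2 q g p t = (case g of Ge \<Rightarrow> (q - t * (t + 2) / 2) / 2 | Gh \<Rightarrow> t | Gf \<Rightarrow> 1 | _ \<Rightarrow> 0)"

text \<open>Common frame for \<open>affine_sl2\<close> and the Ramond algebra: odd modes of the
  latter have indices in Z+1/2, so the zero modes form \<open>sl_2\<close> in both.\<close>

locale sl2_type =
  fixes A :: "mode salg" and k \<Delta> q :: complex
  assumes is_odd_A: "is_odd A = odd_mode" and bracket_A: "bracket A = mode_bracket"
    and closed_A: "bracket_closed (basis A)"
    and basis_A: "Cent \<in> basis A" "L0 \<in> basis A" "Mode Gh 0 \<in> basis A" "Mode Gf 0 \<in> basis A" "Mode Ge 0 \<in> basis A"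
    and half_int_A: "Mode a n \<in> basis A \<Longrightarrow> 2 * n \<in> \<int>"
    and zero_even: "Mode g 0 \<in> basis A \<Longrightarrow> \<not> odd_osp g"

sublocale sl2_type \<subseteq> current_algebra A k \<Delta> "c_sl2 q"
proof
  show "\<exists>P. \<forall>t. c_sl2 q g p t = poly P t" for g p
  proof (cases g)
    case Ge
    have "\<forall>t. c_sl2 q g p t = poly [:q / 2, - 1/2, - 1/4:] t" unfolding c_sl2_def Ge by (simp add: field_simps)
    then show ?thesis by blast
  next
    case Gh
    have "\<forall>t. c_sl2 q g p t = poly [:0, 1:] t" unfolding c_sl2_def Gh by simp
    then show ?thesis by blast
  next
    case Gf
    have "\<forall>t. c_sl2 q g p t = poly 1 t" unfolding c_sl2_def Gf by simp
    then show ?thesis by blast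
  qed (auto simp: c_sl2_def intro: exI[of _ 0])
  show "c_sl2 q g (p \<noteq> odd_osp h) (t + of_int (osp_wt h)) * c_sl2 q h p t -
      (if odd_osp g \<and> odd_osp h then -1 else 1) * (c_sl2 q h (p \<noteq> odd_osp g) (t + of_int (osp_wt g)) * c_sl2 q g p t)
      = lsum (osp_bracket g h) (\<lambda>e. c_sl2 q e p t)"
    if "Mode g 0 \<in> basis A" "Mode h 0 \<in> basis A" for g h p t
    using zero_even[OF that(1)] zero_even[OF that(2)]
    by (cases g; cases h) (simp_all add: c_sl2_def field_simps)
qed (use is_odd_A bracket_A closed_A basis_A half_int_A in \<open>auto simp: c_sl2_def\<close>)

context sl2_type
begin

text \<open>Words of even weight lead from ground states in \<Lambda> to weights in \<Lambda>, words
  of odd weight to weights in \<Lambda>+\<omega>. Each family has its own generic rank, the source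
  of the two cases of R-stringiness.\<close>

definition parity_words :: "complex \<Rightarrow> bool \<Rightarrow> mode list set" where
  "parity_words n e = {W \<in> level_words n. even (word_wt W) = e}"

text \<open>Even zero modes shift by even integers and never leave a coset, so there is no end at
  which a structure constant must vanish.\<close>

lemma relaxed_dense:
  assumes "\<Lambda> \<in> weight_cosets"
  shows "relaxed A (c_sl2 q) \<Lambda> \<Lambda> (\<lambda>_. False) (dense_sl2 \<Lambda> q)"
proof
  note sh = weight_cosets_shift[OF assms]
  show "False = (False \<noteq> odd_osp g)" if "Mode g 0 \<in> basis A" for g using zero_even[OF that] by simp
  have cl: "\<mu> + of_int (osp_wt g) \<in> \<Lambda>" if "\<mu> \<in> \<Lambda>" "Mode g 0 \<in> basis A" for \<mu> g
    using sh[OF that(1)] even_osp_wt[of g] zero_even[OF that(2)] by simp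
  then show "c_sl2 q g False \<mu> = 0"
    if "\<mu> \<in> \<Lambda>" "Mode g 0 \<in> basis A" "\<mu> + of_int (osp_wt g) \<notin> \<Lambda>" for \<mu> g using that by blast
  show "\<mu> + of_int j \<in> \<Lambda> \<longleftrightarrow> (\<mu> \<in> \<Lambda> \<longleftrightarrow> even j)" if "\<mu> \<in> \<Lambda>" for \<mu> j using sh[OF that] that by simp
  show "carrier (dense_sl2 \<Lambda> q) = span_of \<Lambda>" "v \<oplus>\<^bsub>dense_sl2 \<Lambda> q\<^esub> w = v + w" "\<zero>\<^bsub>dense_sl2 \<Lambda> q\<^esub> = 0"
    "z \<odot>\<^bsub>dense_sl2 \<Lambda> q\<^esub> v = scale z v" for v w z by (simp_all add: dense_sl2_def)
  show "evens (dense_sl2 \<Lambda> q) = span_of (\<Lambda> \<inter> \<Lambda>)" "odds (dense_sl2 \<Lambda> q) = span_of (\<Lambda> - \<Lambda>)"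
    by (auto simp: dense_sl2_def span_of_def)
  show act: "act (dense_sl2 \<Lambda> q) g v = lin_ext (\<lambda>\<mu>. scale (c_sl2 q g False \<mu>) (bvec (\<mu> + of_int (osp_wt g)))) v"
    if "Mode g 0 \<in> basis A" for g v
  proof -
    have "dense_sl2_basis_act q g \<mu> = scale (c_sl2 q g False \<mu>) (bvec (\<mu> + of_int (osp_wt g)))" for \<mu>
      using zero_even[OF that] by (cases g) (simp_all add: dense_sl2_basis_act_def c_sl2_def wform_def alpha_def)
    then have "dense_sl2_basis_act q g = (\<lambda>\<mu>. scale (c_sl2 q g False \<mu>) (bvec (\<mu> + of_int (osp_wt g))))" ..
    then show ?thesis by (simp add: dense_sl2_def)
  qed
  show "act (dense_sl2 \<Lambda> q) g v \<in> span_of \<Lambda>" if "Mode g 0 \<in> basis A" "v \<in> span_of \<Lambda>" for g v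
  proof -
    have "Poly_Mapping.keys v \<subseteq> \<Lambda>" using that(2) by (simp add: span_of_def)
    then show ?thesis unfolding act[OF that(1)] using that(1) cl
      by (intro lin_ext_subspace subspace_span_of pm.subspace_scale[OF subspace_span_of]) auto
  qed
qed

text \<open>The contributing words are the same at all weights of the coset, so one family of
  polynomial columns governs the whole string and \<open>rank_spec_constant\<close> applies.\<close>

lemma string_E:
  assumes \<Lambda>: "\<Lambda> \<in> weight_cosets" and r: "rank_spec (\<lambda>_. False) (parity_words n e) r"
    and \<nu>: "\<nu> \<in> (if e then \<Lambda> else shift omega \<Lambda>)"
  shows "string_function (relaxed_quotient A k \<Delta> (dense_sl2 \<Lambda> q)) \<nu> n = enat r"
proof -
  interpret R: relaxed A k \<Delta> "c_sl2 q" \<Lambda> \<Lambda> "\<lambda>_. False" "dense_sl2 \<Lambda> q" by (rule relaxed_dense[OF \<Lambda>])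
  note sh = weight_cosets_shift[OF \<Lambda>]
  let ?s = "\<lambda>\<nu>. string_function (relaxed_quotient A k \<Delta> (dense_sl2 \<Lambda> q)) \<nu> n"
  have words: "R.weight_words \<nu> n = parity_words n e" if \<nu>: "\<nu> \<in> (if e then \<Lambda> else shift omega \<Lambda>)" for \<nu>
  proof -
    have "\<nu> - of_int (word_wt W) \<in> \<Lambda> \<longleftrightarrow> even (word_wt W) = e" for W
    proof (cases e)
      case True
      then show ?thesis using sh[of \<nu> "- word_wt W"] \<nu> by simp
    next
      case False
      then obtain \<mu> where \<mu>: "\<mu> \<in> \<Lambda>" "\<nu> = \<mu> + 1" using \<nu> by (auto simp: shift_def omega_def alpha_def)
      have eq: "\<nu> - of_int (word_wt W) = \<mu> + of_int (1 - word_wt W)" using \<mu>(2) by simp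
      show ?thesis unfolding eq sh[OF \<mu>(1)] using False by simp
    qed
    then show ?thesis by (auto simp: R.weight_words_def parity_words_def)
  qed
  have up: "\<nu> + 2 * of_nat m \<in> (if e then \<Lambda> else shift omega \<Lambda>)" for m
  proof (cases e)
    case True
    then show ?thesis using sh[of \<nu> "2 * int m"] \<nu> by simp
  next
    case False
    then obtain \<mu> where \<mu>: "\<mu> \<in> \<Lambda>" "\<nu> = \<mu> + 1" using \<nu> by (auto simp: shift_def omega_def alpha_def)
    then have "\<mu> + 2 * of_nat m \<in> \<Lambda>" using sh[OF \<mu>(1), of "2 * int m"] by simp
    then show ?thesis using \<mu>(2) False by (auto simp: shift_def omega_def alpha_def)
  qed
  have "?s (\<nu> + 2 * of_nat m) = enat (fn.dim (col (\<lambda>_. False) (\<nu> + 2 * of_nat m) ` parity_words n e))" for m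
    using R.string_function_rank[OF R.E_presents, of "\<nu> + 2 * of_nat m" n] words[OF up] by simp
  moreover have "?s (\<mu> + 2) \<le> ?s \<mu>" for \<mu>
  proof -
    have "\<mu> \<in> \<Lambda> \<Longrightarrow> \<mu> - 2 \<in> \<Lambda>" for \<mu> using sh[of \<mu> "-2"] by simp
    then show ?thesis
      using R.string_function_f_mono[OF R.E_presents, of "Mode Gf 0" "\<mu> + 2" n] by (simp add: c_sl2_def)
  qed
  ultimately show ?thesis by (rule rank_spec_constant[OF r])
qed

text \<open>Without odd generators every word has even weight, so words on the ground states never
  leave \<Lambda>.\<close>

lemma string_E_zero:
  assumes \<Lambda>: "\<Lambda> \<in> weight_cosets" and even: "\<And>a n. Mode a n \<in> basis A \<Longrightarrow> \<not> odd_osp a" and \<nu>: "\<nu> \<notin> \<Lambda>"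
  shows "string_function (relaxed_quotient A k \<Delta> (dense_sl2 \<Lambda> q)) \<nu> n = 0"
proof -
  interpret R: relaxed A k \<Delta> "c_sl2 q" \<Lambda> \<Lambda> "\<lambda>_. False" "dense_sl2 \<Lambda> q" by (rule relaxed_dense[OF \<Lambda>])
  have ev: "even (word_wt W)" if "W \<in> lists (basis A)" for W
    using that
  proof (induction W)
    case (Cons a W)
    then have "\<not> odd_mode a" using even by (cases a) auto
    then show ?case using Cons even_mode_wt[of a] by simp
  qed simp
  have "R.weight_words \<nu> n = {}"
  proof -
    have False if "W \<in> level_words n" "\<nu> - of_int (word_wt W) \<in> \<Lambda>" for W
    proof -
      have "even (word_wt W)" using that(1) ev by (auto simp: level_words_def neg_words_def)
      then have "\<nu> - of_int (word_wt W) + of_int (word_wt W) \<in> \<Lambda>"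
        using weight_cosets_shift[OF \<Lambda> that(2)] by blast
      then show False using \<nu> by simp
    qed
    then show ?thesis by (auto simp: R.weight_words_def)
  qed
  then show ?thesis 
    using R.string_function_rank[OF R.E_presents, of \<nu> n] fn.dim_eq_card_independent[OF fn.independent_empty]
    by (simp add: zero_enat_def)
qed

text \<open>As e_0 f_0^(j+1) u = (j+1)(m0 - j) f_0^j u and \<open>m0\<close> is not a natural
  number, no power of \<open>f_0\<close> kills \<open>u\<close>: the chain is a full Verma module,
  and the value of \<open>q\<close> gives it the constants \<open>c_sl2 q\<close>. For highest
  weight -\<mu>-\<alpha> the starting point \<open>m0 + 2\<close> is -\<mu>.\<close>

lemma string_L:
  fixes L :: "(mode, 'v) rep"
  assumes L: "simple_hw_rep A k \<Delta> m0 L" and q: "q = m0 * (m0 + 2) / 2" and m0: "m0 \<notin> \<nat>"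
    and r: "rank_spec (\<lambda>_. False) (parity_words n e) r"
  shows "(\<lambda>m. string_function L (m0 + 2 - 2 * of_nat m - (if e then 0 else 1)) n) \<longlonglongrightarrow> enat r"
proof -
  obtain u where u: "hw_vector L m0 u" and SL: "super_module A L" "simple_rep A L"
    and actC: "\<forall>v\<in>carrier L. act L Cent v = k \<odot>\<^bsub>L\<^esub> v"
    by (rule simple_hw_repD[OF L])
  note LR = lin_repD[OF super_module_lin_rep[OF SL(1)]]
  interpret cmodule L by (rule LR(1))
  let ?f = "Mode Gf 0" and ?e = "Mode Ge 0" and ?h = "Mode Gh 0"
  define G where "G j = (act L ?f ^^ j) u" for j
  note chain = lowering_chain[OF SL(1) u basis_A(4) disjI1[OF refl], folded G_def]
  have GS: "G (Suc j) = act L ?f (G j)" for j by (simp add: G_def)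
  have eG: "act L ?e (G (Suc j)) = (of_nat (Suc j) * (m0 - of_nat j)) \<odot>\<^bsub>L\<^esub> G j" for j
  proof (induction j)
    have e: "act L ?e (G (Suc j)) = act L ?f (act L ?e (G j)) \<oplus>\<^bsub>L\<^esub> (m0 - 2 * of_nat j) \<odot>\<^bsub>L\<^esub> G j" for j
      unfolding GS super_module_bracket[OF SL(1) basis_A(5,4) chain(1)] bracket_zero_modes
      using LR(2) basis_A chain(1,3)[of j]
      by (simp add: lext_bvec[OF LR(1)] msign_def mult.commute)
    {
      case 0
      have "act L ?e (G 0) = \<zero>\<^bsub>L\<^esub>" using u by (simp add: G_def hw_vector_def)
      moreover have "act L ?f \<zero>\<^bsub>L\<^esub> = \<zero>\<^bsub>L\<^esub>" using LR(4)[OF basis_A(4), of "\<zero>\<^bsub>L\<^esub>" 0] LR(2)[OF basis_A(4), of "\<zero>\<^bsub>L\<^esub>"] by simp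
      ultimately show ?case unfolding e using chain(1)[of 0] by simp
    next
      case (Suc j)
      have "act L ?e (G (Suc (Suc j))) = (of_nat (Suc j) * (m0 - of_nat j) + (m0 - 2 * of_nat (Suc j))) \<odot>\<^bsub>L\<^esub> G (Suc j)"
        unfolding e[of "Suc j"] Suc LR(4)[OF basis_A(4) chain(1)] GS[symmetric]
        using chain(1)[of "Suc j"] by (simp only: cs_ldistr)
      moreover have "of_nat (Suc j) * (m0 - of_nat j) + (m0 - 2 * of_nat (Suc j)) = of_nat (Suc (Suc j)) * (m0 - of_nat (Suc j))"
        by (simp add: algebra_simps)
      ultimately show ?case by simp
    }
  qed
  have G0: "G j \<noteq> \<zero>\<^bsub>L\<^esub>" for j
  proof (induction j)
    case 0
    then show ?case using u by (simp add: G_def hw_vector_def)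
  next
    case (Suc j)
    show ?case
    proof
      assume "G (Suc j) = \<zero>\<^bsub>L\<^esub>"
      then have z: "(of_nat (Suc j) * (m0 - of_nat j)) \<odot>\<^bsub>L\<^esub> G j = \<zero>\<^bsub>L\<^esub>"
        using eG[of j] LR(4)[OF basis_A(5), of "\<zero>\<^bsub>L\<^esub>" 0] LR(2)[OF basis_A(5), of "\<zero>\<^bsub>L\<^esub>"] by simp
      have nz: "of_nat (Suc j) * (m0 - of_nat j) \<noteq> 0" using m0 by (auto simp: Nats_def simp del: of_nat_Suc)
      show False using cs_eq_zero[OF chain(1) z nz] Suc by simp
    qed
  qed
  define I where "I = {m0 - 2 * of_nat j | j. True}"
  define Ev where "Ev = {\<mu>. \<exists>j::int. \<mu> = m0 + 2 * of_int j}"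
  have IEv: "\<mu> \<in> Ev" if \<mu>: "\<mu> \<in> I" for \<mu>
  proof -
    obtain j where "\<mu> = m0 - 2 * of_nat j" using \<mu> by (auto simp: I_def)
    then have "\<mu> = m0 + 2 * of_int (- int j)" by simp
    then show ?thesis unfolding Ev_def by blast
  qed
  have Imem: "m0 + of_int i \<in> I \<longleftrightarrow> even i \<and> i \<le> 0" for i
  proof
    assume "m0 + of_int i \<in> I"
    then obtain j where "of_int i = (- 2 * of_nat j :: complex)" by (auto simp: I_def)
    then have "of_int i = (of_int (- 2 * int j) :: complex)" by simp
    then have "i = - 2 * int j" by (simp only: of_int_eq_iff)
    then show "even i \<and> i \<le> 0" by simp
  next
    assume i: "even i \<and> i \<le> 0"
    then obtain l where l: "i = 2 * l" by (elim conjE evenE)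
    then have "m0 + of_int i = m0 - 2 * of_nat (nat (- l))" using i by simp
    then show "m0 + of_int i \<in> I" unfolding I_def by blast
  qed
  interpret L: ground_states A k \<Delta> "c_sl2 q" I Ev "\<lambda>_. False"
  proof
    show "False = (False \<noteq> odd_osp g)" if "Mode g 0 \<in> basis A" for g using zero_even[OF that] by simp
    show "\<mu> + of_int j \<in> Ev \<longleftrightarrow> (\<mu> \<in> Ev \<longleftrightarrow> even j)" if "\<mu> \<in> I" for \<mu> j
      using coset_shift[of \<mu> m0 j] IEv[OF that] by (simp add: Ev_def)
    show "c_sl2 q g False \<mu> = 0" if \<mu>: "\<mu> \<in> I" "Mode g 0 \<in> basis A" "\<mu> + of_int (osp_wt g) \<notin> I" for \<mu> g
    proof -
      obtain j where j: "\<mu> = m0 - 2 * of_nat j" using \<mu>(1) by (auto simp: I_def)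
      then have "\<mu> + of_int (osp_wt g) = m0 + of_int (osp_wt g - 2 * int j)" by simp
      then have "\<not> (even (osp_wt g - 2 * int j) \<and> osp_wt g - 2 * int j \<le> 0)" using \<mu>(3) Imem by metis
      \<comment> \<open>Only \<open>e_0\<close> at the top leaves the chain, and there its constant
        vanishes by the choice of \<open>q\<close>.\<close>
      then have "g = Ge \<and> j = 0" using zero_even[OF \<mu>(2)] by (cases g) auto
      then show ?thesis using j q by (simp add: c_sl2_def)
    qed
  qed
  \<comment> \<open>Recovers the position in the chain from the weight; rounding makes this a total
    function.\<close>
  define G' where "G' \<mu> = G (nat \<lfloor>Re (m0 - \<mu>) / 2\<rfloor>)" for \<mu>
  have G': "G' (m0 - 2 * of_nat j) = G j" for j by (simp add: G'_def)
  have "\<exists>\<theta>. L.presents L \<theta> L.Rad"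
  proof (rule L.hw_presents[OF SL])
    show "I \<noteq> {}" by (auto simp: I_def)
    show "G' \<mu> \<in> (if \<mu> \<in> Ev then evens L else odds L)" if "\<mu> \<in> I" for \<mu>
      using that IEv[OF that] chain(2) by (auto simp: I_def G')
    show "G' \<mu> \<noteq> \<zero>\<^bsub>L\<^esub>" if "\<mu> \<in> I" for \<mu> using that G0 by (auto simp: I_def G')
    show "act L a (G' \<mu>) = gcoef a False \<mu> \<odot>\<^bsub>L\<^esub>
        (if \<mu> + of_int (mode_wt a) \<in> I then G' (\<mu> + of_int (mode_wt a)) else \<zero>\<^bsub>L\<^esub>)"
      if a: "a \<in> basis A" "\<not> neg_mode a" and \<mu>: "\<mu> \<in> I" for a \<mu>
    proof -
      obtain j where j: "\<mu> = m0 - 2 * of_nat j" using \<mu> by (auto simp: I_def)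
      show ?thesis
      proof (cases a)
        case (Mode g n)
        show ?thesis
        proof (cases "n = 0")
          case False
          then have n: "n > 0" using a(2) Mode by (simp add: neg_mode_def)
          have tgt: "(if \<mu> + of_int (mode_wt a) \<in> I then G' (\<mu> + of_int (mode_wt a)) else \<zero>\<^bsub>L\<^esub>) \<in> carrier L"
            using chain(1) by (auto simp: I_def G')
          have "act L a (G' \<mu>) = \<zero>\<^bsub>L\<^esub>" using chain(5)[of g n j] a(1) n Mode by (simp add: j G')
          moreover have "gcoef a False \<mu> = 0" using n Mode by (simp add: gcoef_def)
          ultimately show ?thesis using cs_zero(1)[OF tgt] by simp
        next
          case True
          have g: "\<not> odd_osp g" using zero_even a(1) Mode True by simp
          consider "g = Gh" | "g = Gf" | "g = Ge" using g by (cases g) auto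
          then show ?thesis
          proof cases
            case 1
            have "act L ?h (G j) = \<mu> \<odot>\<^bsub>L\<^esub> G j" using chain(3)[of j] by (simp add: j mult.commute)
            then show ?thesis using 1 Mode True \<mu> by (simp add: j G' gcoef_def c_sl2_def)
          next
            case 2
            have "\<mu> - 2 = m0 - 2 * of_nat (Suc j)" by (simp add: j)
            then have "\<mu> - 2 \<in> I" "G' (\<mu> - 2) = G (Suc j)" using G' unfolding I_def by (blast, metis)
            then show ?thesis using Mode True 2 GS[of j] chain(1)[of "Suc j"]
              by (simp add: gcoef_def c_sl2_def) (simp add: j G')
          next
            case 3
            show ?thesis
            proof (cases j)
              case 0
              have "act L ?e (G 0) = \<zero>\<^bsub>L\<^esub>" using u by (simp add: G_def hw_vector_def)
              moreover have "m0 + 2 \<notin> I" using Imem[of 2] by simp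
              moreover have "G' m0 = G 0" using G'[of 0] by simp
              ultimately show ?thesis using Mode True 3 0 by (simp add: j)
            next
              case (Suc i)
              have m2: "\<mu> + 2 = m0 - 2 * of_nat i" by (simp add: j Suc)
              then have I2: "\<mu> + 2 \<in> I" "G' (\<mu> + 2) = G i" using G' unfolding I_def by (blast, metis)
              have "gcoef ?e False \<mu> = (q - \<mu> * (\<mu> + 2) / 2) / 2"
                by (simp add: gcoef_def c_sl2_def)
              also have "\<dots> = of_nat (Suc i) * (m0 - of_nat i)"
                unfolding q j Suc by (simp add: field_simps)
              finally have "gcoef ?e False \<mu> = of_nat (Suc i) * (m0 - of_nat i)" .
              then show ?thesis using Mode True 3 I2 eG[of i] G'[of j] Suc by (simp add: j)
            qed
          qed
        qed
      next
        case Cent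
        then show ?thesis using actC chain(1)[of j] \<mu> by (simp add: gcoef_def j G')
      next
        case L0
        then show ?thesis using chain(4)[of j] \<mu> by (simp add: gcoef_def j G')
      qed
    qed
  qed
  then obtain \<theta> where P: "L.presents L \<theta> L.Rad" by blast
  let ?\<nu> = "\<lambda>m :: nat. m0 + 2 - 2 * of_nat m - (if e then 0 else 1)"
  obtain N :: nat where N: "\<And>W. W \<in> level_words n \<Longrightarrow> - word_wt W \<le> int N"
    using level_words_wt_bound by blast
  \<comment> \<open>From here on no word of level \<open>n\<close> starts above the top of the
    chain, so the half-line \<open>I\<close> selects words by parity only, as a full coset
    would.\<close>
  have words: "L.weight_words (?\<nu> m) n = parity_words n e" if m: "m \<ge> N + 2" for m
  proof -
    have "?\<nu> m - of_int (word_wt W) \<in> I \<longleftrightarrow> even (word_wt W) = e" if "W \<in> level_words n" for W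
    proof -
      have "?\<nu> m - of_int (word_wt W) = m0 + of_int (2 - 2 * int m - (if e then 0 else 1) - word_wt W)" by simp
      then have "?\<nu> m - of_int (word_wt W) \<in> I \<longleftrightarrow>
          even (2 - 2 * int m - (if e then 0 else 1) - word_wt W) \<and> 2 - 2 * int m - (if e then 0 else 1) - word_wt W \<le> 0"
        by (simp only: Imem)
      moreover have "2 - 2 * int m - (if e then 0 else 1) - word_wt W \<le> 0" using N[OF that] m by auto
      ultimately show ?thesis by auto
    qed
    then show ?thesis by (auto simp: L.weight_words_def parity_words_def)
  qed
  have ev: "\<forall>\<^sub>F m in sequentially. fn.dim (col (\<lambda>_. False) (?\<nu> m) ` parity_words n e) = r"
    by (rule rank_spec_eventually[OF r]) (auto simp: inj_def)
  have "\<forall>\<^sub>F m in sequentially. string_function L (?\<nu> m) n = enat r"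
    using ev eventually_ge_at_top[of "N + 2"]
  proof eventually_elim
    case (elim m)
    then show ?case using L.string_function_rank[OF P, of "?\<nu> m" n] words[of m] by simp
  qed
  then show ?thesis by (rule tendsto_eventually)
qed

end

section \<open>Ground states forming an \<open>osp(1|2)\<close>-module\<close>

text \<open>With the sign (-1)^p before \<sigma>, the entry for \<open>Gx\<close> is \<beta>. That
  for \<open>Ge\<close> is the product of two consecutive values of it, because e = x^2, and the -1
  for \<open>Gf\<close> comes from f = -y^2.\<close>

definition c_NS :: "complex \<Rightarrow> osp \<Rightarrow> bool \<Rightarrow> complex \<Rightarrow> complex" where
  "c_NS \<sigma> g p t = (case g of
      Ge \<Rightarrow> ((t + 1 + (if p then -1 else 1) * \<sigma> + 1/2) / 2) * ((t - (if p then -1 else 1) * \<sigma> + 1/2) / 2)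
    | Gh \<Rightarrow> t
    | Gf \<Rightarrow> -1
    | Gx \<Rightarrow> (t - (if p then -1 else 1) * \<sigma> + 1/2) / 2
    | Gy \<Rightarrow> 1)"

section \<open>The affine algebras as instances\<close>

lemma bracket_closedI:
  assumes "Cent \<in> B"
    and "\<And>a b m n c. Mode a m \<in> B \<Longrightarrow> Mode b n \<in> B \<Longrightarrow> odd_osp c = (odd_osp a \<noteq> odd_osp b) \<Longrightarrow> Mode c (m + n) \<in> B"
  shows "bracket_closed B"
  unfolding bracket_closed_def
proof (intro ballI subsetI)
  fix a b e assume ab: "a \<in> B" "b \<in> B" and e: "e \<in> Poly_Mapping.keys (mode_bracket a b)"
  show "e \<in> B"
  proof (cases a)
    case a: (Mode x m)
    show ?thesis
    proof (cases b)
      case (Mode y n)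
      have "(\<exists>z\<in>Poly_Mapping.keys (osp_bracket x y). e = Mode z (m + n)) \<or> e = Cent"
        using bracket_Mode_keys[of e x m y n] e a Mode by auto
      then show ?thesis using assms ab a Mode osp_bracket_keys[of _ x y] by auto
    qed (use e ab a in \<open>auto split: if_splits\<close>)
  next
    case L0
    then show ?thesis using e ab by (cases b) (auto split: if_splits)
  qed (use e in auto)
qed

lemma affine_simps:
  "is_odd affine_sl2 = odd_mode" "bracket affine_sl2 = mode_bracket"
  "is_odd affine_NS = odd_mode" "bracket affine_NS = mode_bracket"
  "is_odd affine_R = odd_mode" "bracket affine_R = mode_bracket"
  "Mode a n \<in> basis affine_sl2 \<longleftrightarrow> \<not> odd_osp a \<and> n \<in> \<int>"
  "Mode a n \<in> basis affine_NS \<longleftrightarrow> n \<in> \<int>"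
  "Mode a n \<in> basis affine_R \<longleftrightarrow> (if odd_osp a then n - 1/2 \<in> \<int> else n \<in> \<int>)"
  "Cent \<in> basis affine_sl2" "Cent \<in> basis affine_NS" "Cent \<in> basis affine_R"
  "L0 \<in> basis affine_sl2" "L0 \<in> basis affine_NS" "L0 \<in> basis affine_R"
  by (auto simp: affine_sl2_def affine_NS_def affine_R_def)

lemma half_not_int: "- (1/2) \<notin> (\<int> :: rat set)"
proof
  assume "- (1/2) \<in> (\<int> :: rat set)"
  then obtain i where "- (1/2) = (of_int i :: rat)" by (elim Ints_cases)
  then have "of_int (2 * i) = (of_int (-1) :: rat)" by simp
  then have "2 * i = -1" by (simp only: of_int_eq_iff)
  then show False by presburger
qed

lemma half_shift: "n - 1/2 \<in> \<int> \<Longrightarrow> 2 * n \<in> (\<int> :: rat set)"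
proof -
  assume "n - 1/2 \<in> \<int>"
  then obtain i where "n - 1/2 = of_int i" by (elim Ints_cases)
  then have "2 * n = of_int (2 * i + 1)" by (simp add: algebra_simps)
  then show ?thesis by simp
qed

lemma sl2_type_sl2: "sl2_type affine_sl2"
proof
  show "bracket_closed (basis affine_sl2)" by (rule bracket_closedI) (auto simp: affine_simps)
qed (auto simp: affine_simps)

lemma sl2_type_R: "sl2_type affine_R"
proof
  show "bracket_closed (basis affine_R)"
  proof (rule bracket_closedI)
    fix a b m n c
    assume H: "Mode a m \<in> basis affine_R" "Mode b n \<in> basis affine_R" "odd_osp c = (odd_osp a \<noteq> odd_osp b)"
    have "m + n = (m - 1/2) + (n - 1/2) + 1" "m + n - 1/2 = (m - 1/2) + n" "m + n - 1/2 = m + (n - 1/2)"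
      by simp_all
    then show "Mode c (m + n) \<in> basis affine_R"
      using H unfolding affine_simps by (metis Ints_1 Ints_add)
  qed (simp add: affine_simps)
  show "2 * n \<in> \<int>" if "Mode a n \<in> basis affine_R" for a n
    using that half_shift[of n] by (auto simp: affine_simps split: if_splits)
  show "\<not> odd_osp g" if "Mode g 0 \<in> basis affine_R" for g
    using that half_not_int by (auto simp: affine_simps split: if_splits)
qed (auto simp: affine_simps)

section \<open>The Neveu-Schwarz sector\<close>

locale neveu_schwarz =
  fixes k \<Delta> \<sigma> :: complex

sublocale neveu_schwarz \<subseteq> current_algebra affine_NS k \<Delta> "c_NS \<sigma>"
proof
  show "bracket_closed (basis affine_NS)" by (rule bracket_closedI) (auto simp: affine_simps)
  show "\<exists>P. \<forall>t. c_NS \<sigma> g p t = poly P t" for g p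
  proof -
    define s :: complex where "s = (if p then -1 else 1)"
    have x: "\<forall>t. c_NS \<sigma> Gx p t = poly [:(1/2 - s * \<sigma>) / 2, 1/2:] t"
      by (simp add: c_NS_def s_def[symmetric] field_simps)
    have e: "\<forall>t. c_NS \<sigma> Ge p t = poly ([:(3/2 + s * \<sigma>) / 2, 1/2:] * [:(1/2 - s * \<sigma>) / 2, 1/2:]) t"
      unfolding poly_mult by (simp add: c_NS_def s_def[symmetric] field_simps)
    have h: "\<forall>t. c_NS \<sigma> Gh p t = poly [:0, 1:] t" by (simp add: c_NS_def)
    have f: "\<forall>t. c_NS \<sigma> Gf p t = poly (-1) t" by (simp add: c_NS_def)
    have y: "\<forall>t. c_NS \<sigma> Gy p t = poly 1 t" by (simp add: c_NS_def)
    show ?thesis by (cases g) (use x e h f y in blast)+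
  qed
  show "c_NS \<sigma> g (p \<noteq> odd_osp h) (t + of_int (osp_wt h)) * c_NS \<sigma> h p t -
      (if odd_osp g \<and> odd_osp h then -1 else 1) * (c_NS \<sigma> h (p \<noteq> odd_osp g) (t + of_int (osp_wt g)) * c_NS \<sigma> g p t)
      = lsum (osp_bracket g h) (\<lambda>e. c_NS \<sigma> e p t)" for g h p t
    by (cases g; cases h; cases p) (simp_all add: c_NS_def field_simps)
qed (auto simp: affine_simps c_NS_def)

context neveu_schwarz
begin

text \<open>The label of the ground state from which \<open>W\<close> leads to a weight of label
  \<open>b\<close>: words of odd weight change it. It does not involve \<nu>, as polynomiality of
  the columns requires.\<close>

definition pf :: "bool \<Rightarrow> mode list \<Rightarrow> bool" where
  "pf b W = (b \<noteq> odd (word_wt W))"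

text \<open>Here the label is the parity itself. It can be read from membership in \<Lambda> since
  \<Lambda> and \<Lambda>+\<omega> are disjoint.\<close>

lemma relaxed_dense:
  assumes "\<Lambda> \<in> weight_cosets"
  shows "relaxed affine_NS (c_NS \<sigma>) (\<Lambda> \<union> shift omega \<Lambda>) \<Lambda> (\<lambda>\<mu>. \<mu> \<notin> \<Lambda>) (dense_osp \<Lambda> \<sigma>)"
proof
  let ?I = "\<Lambda> \<union> shift omega \<Lambda>"
  note Ev = weight_cosets_union_shift(1)[OF assms] and cl = weight_cosets_union_shift(2)[OF assms]
  show "\<mu> + of_int j \<in> \<Lambda> \<longleftrightarrow> (\<mu> \<in> \<Lambda> \<longleftrightarrow> even j)" if "\<mu> \<in> ?I" for \<mu> j
    using Ev[OF that] .
  show "(\<mu> + of_int (osp_wt g) \<notin> \<Lambda>) = ((\<mu> \<notin> \<Lambda>) \<noteq> odd_osp g)" if "\<mu> \<in> ?I" for \<mu> g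
    using Ev[OF that, of "osp_wt g"] even_osp_wt[of g] by auto
  show "c_NS \<sigma> g (\<mu> \<notin> \<Lambda>) \<mu> = 0" if "\<mu> \<in> ?I" "\<mu> + of_int (osp_wt g) \<notin> ?I" for \<mu> g
    using that cl by blast
  have disj: "\<mu> - 1 \<in> \<Lambda> \<longleftrightarrow> \<mu> \<notin> \<Lambda>" if "\<mu> \<in> ?I" for \<mu> using Ev[OF that, of "-1"] by simp
  show "evens (dense_osp \<Lambda> \<sigma>) = span_of (?I \<inter> \<Lambda>)" by (simp add: dense_osp_def Int_absorb1)
  have "shift omega \<Lambda> = ?I - \<Lambda>"
  proof (rule equalityI; rule subsetI)
    fix \<mu> assume "\<mu> \<in> shift omega \<Lambda>"
    then have "\<mu> - 1 \<in> \<Lambda>" "\<mu> \<in> ?I" by (auto simp: shift_def omega_def alpha_def)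
    then show "\<mu> \<in> ?I - \<Lambda>" using disj by blast
  qed auto
  then show "odds (dense_osp \<Lambda> \<sigma>) = span_of (?I - \<Lambda>)" by (simp add: dense_osp_def)
  show "carrier (dense_osp \<Lambda> \<sigma>) = span_of ?I" "v \<oplus>\<^bsub>dense_osp \<Lambda> \<sigma>\<^esub> w = v + w" "\<zero>\<^bsub>dense_osp \<Lambda> \<sigma>\<^esub> = 0"
    "z \<odot>\<^bsub>dense_osp \<Lambda> \<sigma>\<^esub> v = scale z v" for v w z by (simp_all add: dense_osp_def)
  show act: "act (dense_osp \<Lambda> \<sigma>) g v = lin_ext (\<lambda>\<mu>. scale (c_NS \<sigma> g (\<mu> \<notin> \<Lambda>) \<mu>) (bvec (\<mu> + of_int (osp_wt g)))) v"
    if v: "v \<in> span_of ?I" for g v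
  proof -
    have cong: "lin_ext f v = lin_ext f' v" if "\<And>\<mu>. \<mu> \<in> ?I \<Longrightarrow> f \<mu> = f' \<mu>" for f f' :: "complex \<Rightarrow> (complex \<Rightarrow>\<^sub>0 complex)"
      unfolding lin_ext_def using that v by (intro sum.cong) (auto simp: span_of_def)
    have beta: "dense_osp_beta \<Lambda> \<sigma> \<mu> = c_NS \<sigma> Gx (\<mu> \<notin> \<Lambda>) \<mu>" for \<mu>
      by (simp add: dense_osp_beta_def c_NS_def wform_def alpha_def)
    have m1: "\<mu> + 1 \<in> \<Lambda> \<longleftrightarrow> \<mu> \<notin> \<Lambda>" if "\<mu> \<in> ?I" for \<mu> using Ev[OF that, of 1] by simp
    have om: "omega = 1" by (simp add: omega_def alpha_def)
    show ?thesis
    proof (cases g)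
      case Ge
      have "act (dense_osp \<Lambda> \<sigma>) g v =
          lin_ext (\<lambda>\<mu>. scale (dense_osp_beta \<Lambda> \<sigma> \<mu>) (scale (dense_osp_beta \<Lambda> \<sigma> (\<mu> + 1)) (bvec (\<mu> + 1 + 1)))) v"
        by (simp add: dense_osp_def Ge dense_osp_x_def lin_ext_lin_ext lin_ext_scale om)
      also have "\<dots> = lin_ext (\<lambda>\<mu>. scale (c_NS \<sigma> g (\<mu> \<notin> \<Lambda>) \<mu>) (bvec (\<mu> + of_int (osp_wt g)))) v"
      proof (rule cong)
        fix \<mu> assume \<mu>: "\<mu> \<in> ?I"
        have "c_NS \<sigma> Gx (\<mu> \<notin> \<Lambda>) \<mu> * c_NS \<sigma> Gx (\<mu> + 1 \<notin> \<Lambda>) (\<mu> + 1) = c_NS \<sigma> Ge (\<mu> \<notin> \<Lambda>) \<mu>"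
          using m1[OF \<mu>] by (simp add: c_NS_def)
        then show "scale (dense_osp_beta \<Lambda> \<sigma> \<mu>) (scale (dense_osp_beta \<Lambda> \<sigma> (\<mu> + 1)) (bvec (\<mu> + 1 + 1))) =
            scale (c_NS \<sigma> g (\<mu> \<notin> \<Lambda>) \<mu>) (bvec (\<mu> + of_int (osp_wt g)))"
          unfolding beta Ge by (simp add: add.assoc)
      qed
      finally show ?thesis .
    next
      case Gh
      then show ?thesis by (simp add: dense_osp_def c_NS_def wform_def alpha_def)
    next
      case Gf
      have "act (dense_osp \<Lambda> \<sigma>) g v = scale (-1) (lin_ext (\<lambda>\<mu>. bvec (\<mu> - 2)) v)"
        by (simp add: dense_osp_def Gf dense_osp_y_def lin_ext_lin_ext om diff_diff_eq)
      also have "\<dots> = lin_ext (\<lambda>\<mu>. scale (-1) (bvec (\<mu> - 2))) v"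
        by (simp only: lin_ext_scale_fun)
      finally show ?thesis by (simp add: c_NS_def Gf)
    next
      case Gx
      then show ?thesis by (simp add: dense_osp_def dense_osp_x_def beta om)
    next
      case Gy
      then show ?thesis by (simp add: dense_osp_def dense_osp_y_def om c_NS_def)
    qed
  qed
  show "act (dense_osp \<Lambda> \<sigma>) g v \<in> span_of ?I" if v: "v \<in> span_of ?I" for g v
  proof -
    have "Poly_Mapping.keys v \<subseteq> ?I" using v by (simp add: span_of_def)
    then show ?thesis unfolding act[OF v] using cl
      by (intro lin_ext_subspace subspace_span_of pm.subspace_scale[OF subspace_span_of]) auto
  qed
qed

text \<open>Even and odd target weights give two families of columns whose generic ranks might
  differ. Injectivity of \<open>y_0\<close>, which lowers the weight by \<omega> and so exchanges
  the two cases, bounds each rank by the other.\<close>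

lemma string_E:
  assumes \<Lambda>: "\<Lambda> \<in> weight_cosets" and r: "\<And>b. rank_spec (pf b) (level_words n) (r b)"
  shows "\<nu> \<in> \<Lambda> \<union> shift omega \<Lambda> \<Longrightarrow>
      string_function (relaxed_quotient affine_NS k \<Delta> (dense_osp \<Lambda> \<sigma>)) \<nu> n = enat (r False)"
    "r True = r False"
    "\<nu> \<notin> \<Lambda> \<union> shift omega \<Lambda> \<Longrightarrow>
      string_function (relaxed_quotient affine_NS k \<Delta> (dense_osp \<Lambda> \<sigma>)) \<nu> n = 0"
proof -
  let ?I = "\<Lambda> \<union> shift omega \<Lambda>"
  interpret R: relaxed affine_NS k \<Delta> "c_NS \<sigma>" ?I \<Lambda> "\<lambda>\<mu>. \<mu> \<notin> \<Lambda>" "dense_osp \<Lambda> \<sigma>"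
    by (rule relaxed_dense[OF \<Lambda>])
  let ?s = "\<lambda>\<nu>. string_function (relaxed_quotient affine_NS k \<Delta> (dense_osp \<Lambda> \<sigma>)) \<nu> n"
  note Ev = R.Ev and cl = weight_cosets_union_shift(2)[OF \<Lambda>]
  have cl': "\<mu> - of_int j \<in> ?I \<longleftrightarrow> \<mu> \<in> ?I" for \<mu> j
    using cl[of \<mu> "- j"] cl[of "\<mu> - of_int j" j] by auto
  have words: "R.weight_words \<nu> n = level_words n" if "\<nu> \<in> ?I" for \<nu>
    using that cl' by (simp add: R.weight_words_def)
  have rank: "?s \<nu> = enat (fn.dim (col (pf (\<nu> \<notin> \<Lambda>)) \<nu> ` level_words n))" if \<nu>: "\<nu> \<in> ?I" for \<nu>
  proof -
    have "(\<nu> - of_int (word_wt W) \<notin> \<Lambda>) = pf (\<nu> \<notin> \<Lambda>) W" for W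
      using Ev[OF \<nu>, of "- word_wt W"] by (auto simp: pf_def)
    then have "(\<lambda>W. \<nu> - of_int (word_wt W) \<notin> \<Lambda>) = pf (\<nu> \<notin> \<Lambda>)" ..
    then show ?thesis using R.string_function_rank[OF R.E_presents, of \<nu> n] words[OF \<nu>] by simp
  qed
  have f: "\<mu> \<in> ?I \<Longrightarrow> \<mu> - 2 \<in> ?I \<and> c_NS \<sigma> Gf (\<mu> \<notin> \<Lambda>) \<mu> \<noteq> 0" for \<mu>
    using cl'[of \<mu> 2] by (simp add: c_NS_def)
  have mono_f: "?s (\<mu> + 2) \<le> ?s \<mu>" for \<mu>
    using R.string_function_f_mono[OF R.E_presents f, of "Mode Gf 0" "\<mu> + 2" n] by simp
  have mono_y: "?s (\<mu> + 1) \<le> ?s \<mu>" for \<mu>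
    using R.string_function_f_mono[OF R.E_presents f, of "Mode Gy 0" "\<mu> + 1" n] by (simp add: affine_simps)
  have E: "?s \<nu> = enat (r (\<nu> \<notin> \<Lambda>))" if \<nu>: "\<nu> \<in> ?I" for \<nu>
  proof (rule rank_spec_constant[OF r[of "\<nu> \<notin> \<Lambda>"], where s = ?s])
    fix m :: nat
    have "\<nu> + 2 * of_nat m \<in> ?I" "\<nu> + 2 * of_nat m \<in> \<Lambda> \<longleftrightarrow> \<nu> \<in> \<Lambda>"
      using cl[OF \<nu>, of "2 * int m"] Ev[OF \<nu>, of "2 * int m"] by auto
    then show "?s (\<nu> + 2 * of_nat m) = enat (fn.dim (col (pf (\<nu> \<notin> \<Lambda>)) (\<nu> + 2 * of_nat m) ` level_words n))"
      using rank by simp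
  qed (rule mono_f)
  obtain \<mu>0 where \<mu>0: "\<mu>0 \<in> \<Lambda>" using weight_cosetsD[OF \<Lambda>] by (metis (mono_tags, lifting) mem_Collect_eq)
  have \<mu>1: "\<mu>0 + 1 \<in> ?I" "\<mu>0 + 1 \<notin> \<Lambda>" "\<mu>0 + 2 \<in> \<Lambda>"
    using cl[of \<mu>0 1] Ev[of \<mu>0 1] Ev[of \<mu>0 2] \<mu>0 by auto
  have "r False \<le> r True" using mono_y[of "\<mu>0 + 1"] E[of "\<mu>0 + 2"] E[of "\<mu>0 + 1"] \<mu>1 \<mu>0 by (simp add: add.assoc)
  moreover have "r True \<le> r False" using mono_y[of \<mu>0] E[of "\<mu>0 + 1"] E[of \<mu>0] \<mu>1 \<mu>0 by simp
  ultimately show eq: "r True = r False" by simp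
  show "?s \<nu> = enat (r False)" if "\<nu> \<in> ?I" using E[OF that] eq by (cases "\<nu> \<in> \<Lambda>") auto
  show "?s \<nu> = 0" if "\<nu> \<notin> ?I"
  proof -
    have "R.weight_words \<nu> n = {}" using that cl' by (auto simp: R.weight_words_def)
    then show ?thesis
      using R.string_function_rank[OF R.E_presents, of \<nu> n] fn.dim_eq_card_independent[OF fn.independent_empty]
      by (simp add: zero_enat_def)
  qed
qed

text \<open>The label \<open>p\<close> of the highest-weight vector is the one for which \<open>x\<^sub>0\<close> annihilates it.\<close>

lemma string_L:
  fixes L :: "(mode, 'v) rep"
  assumes L: "simple_hw_rep affine_NS k \<Delta> m0 L" and top: "c_NS \<sigma> Gx p m0 = 0"
    and nz: "\<And>j :: nat. j > 0 \<Longrightarrow> c_NS \<sigma> Gx (p \<noteq> odd j) (m0 - of_nat j) \<noteq> 0"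
    and r: "\<And>b. rank_spec (pf b) (level_words n) r"
  shows "(\<lambda>m. string_function L (m0 + of_int s - of_nat m) n) \<longlonglongrightarrow> enat r"
proof -
  let ?A = affine_NS
  obtain u where u: "hw_vector L m0 u" and SL: "super_module ?A L" "simple_rep ?A L"
    and actC: "\<forall>v\<in>carrier L. act L Cent v = k \<odot>\<^bsub>L\<^esub> v"
    by (rule simple_hw_repD[OF L])
  note LR = lin_repD[OF super_module_lin_rep[OF SL(1)]]
  interpret cmodule L by (rule LR(1))
  let ?e = "Mode Ge 0" and ?h = "Mode Gh 0" and ?f = "Mode Gf 0" and ?x = "Mode Gx 0" and ?y = "Mode Gy 0"
  have zB: "Mode g 0 \<in> basis ?A" for g by (simp add: affine_simps)
  define G where "G j = (act L ?y ^^ j) u" for j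
  note chain = lowering_chain[OF SL(1) u zB disjI2[OF refl], folded G_def]
  note br = super_module_bracket[OF SL(1)]
  have Gc: "G j \<in> carrier L" for j by (rule chain(1))
  have GS: "G (Suc j) = act L ?y (G j)" for j by (simp add: G_def)
  have hG: "act L ?h (G j) = (m0 - of_nat j) \<odot>\<^bsub>L\<^esub> G j" for j using chain(3)[of j] by simp
  \<comment> \<open>The factor in x_0 y_0^j u = cx(j) y_0^(j-1) u. Since {x, y} = h, the factors at
    j and j+1 add up to the weight of y_0^j u. By \<open>nz\<close> the factor is nonzero for
    positive j, so the chain never breaks.\<close>
  define cx where "cx j = c_NS \<sigma> Gx (p \<noteq> odd j) (m0 - of_nat j)" for j :: nat
  have cx0: "cx 0 = 0" using top by (simp add: cx_def)
  have cxS: "cx (Suc j) = (m0 - of_nat j) - cx j" for j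
    by (cases p; cases "odd j") (simp_all add: cx_def c_NS_def field_simps)
  have act0: "act L a \<zero>\<^bsub>L\<^esub> = \<zero>\<^bsub>L\<^esub>" if "a \<in> basis ?A" for a
    using LR(4)[OF that, of "\<zero>\<^bsub>L\<^esub>" 0] LR(2)[OF that, of "\<zero>\<^bsub>L\<^esub>"] by simp
  \<comment> \<open>The chain indexed by the height relative to the top and extended by zero above
    it, so that raising operators have a uniform target.\<close>
  define T where "T i = (if i \<le> 0 then G (nat (- i)) else \<zero>\<^bsub>L\<^esub>)" for i :: int
  have Tc: "T i \<in> carrier L" for i by (simp add: T_def Gc)
  have TG: "T (- int j) = G j" for j by (simp add: T_def)
  have xG: "act L ?x (G j) = cx j \<odot>\<^bsub>L\<^esub> T (1 - int j)" for j
  proof (induction j)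
    case 0
    then show ?case using u zB by (simp add: G_def hw_vector_def T_def)
  next
    case (Suc j)
    have "act L ?x (G (Suc j)) = (-1) \<odot>\<^bsub>L\<^esub> act L ?y (act L ?x (G j)) \<oplus>\<^bsub>L\<^esub> (m0 - of_nat j) \<odot>\<^bsub>L\<^esub> G j"
      using br[OF zB[of Gx] zB[of Gy] Gc[of j]] LR(2)[OF zB] Gc
      unfolding bracket_zero_modes by (simp add: GS lext_bvec[OF LR(1)] msign_def hG)
    also have "act L ?y (act L ?x (G j)) = cx j \<odot>\<^bsub>L\<^esub> G j"
    proof (cases j)
      case 0
      then show ?thesis unfolding Suc using Gc[of 0] by (simp add: cx0 Tc act0[OF zB])
    next
      case (Suc i)
      then have "T (1 - int j) = G i" using TG[of i] by simp
      then show ?thesis unfolding \<open>act L ?x (G j) = _\<close> using Gc[of i] Suc by (simp add: LR(4)[OF zB] GS)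
    qed
    also have "(-1) \<odot>\<^bsub>L\<^esub> (cx j \<odot>\<^bsub>L\<^esub> G j) \<oplus>\<^bsub>L\<^esub> (m0 - of_nat j) \<odot>\<^bsub>L\<^esub> G j = ((-1) * cx j + (m0 - of_nat j)) \<odot>\<^bsub>L\<^esub> G j"
      unfolding cs_ldistr[OF Gc] cs_assoc[OF Gc] ..
    also have "(-1) * cx j + (m0 - of_nat j) = cx (Suc j)" by (simp add: cxS)
    finally show ?case using TG[of j] by simp
  qed
  have sgn: "msign ?x ?x = -1" "msign ?y ?y = -1" by (simp_all add: msign_def)
  \<comment> \<open>The relation {x, x} = 2e appears in the form X = -X + 2E, with X = x_0 x_0 v and
    E = e_0 v; likewise for y with -f in place of e.\<close>
  have double: "E = X" if "X = (-1) \<odot>\<^bsub>L\<^esub> X \<oplus>\<^bsub>L\<^esub> 2 \<odot>\<^bsub>L\<^esub> E" "X \<in> carrier L" "E \<in> carrier L" for X E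
  proof -
    have "X \<oplus>\<^bsub>L\<^esub> X = 2 \<odot>\<^bsub>L\<^esub> E \<oplus>\<^bsub>L\<^esub> ((-1) \<odot>\<^bsub>L\<^esub> X \<oplus>\<^bsub>L\<^esub> X)"
      using that by (metis a_ac(1) a_ac(2) cs)
    also have "(-1) \<odot>\<^bsub>L\<^esub> X \<oplus>\<^bsub>L\<^esub> X = \<zero>\<^bsub>L\<^esub>" using that(2) by (simp add: minus_eq_cs[symmetric] l_neg)
    finally have "X \<oplus>\<^bsub>L\<^esub> X = 2 \<odot>\<^bsub>L\<^esub> E" using that(3) by simp
    moreover have "X \<oplus>\<^bsub>L\<^esub> X = 2 \<odot>\<^bsub>L\<^esub> X" using cs_ldistr[OF that(2), of 1 1] that(2) by simp
    ultimately have "(1/2) \<odot>\<^bsub>L\<^esub> (2 \<odot>\<^bsub>L\<^esub> X) = (1/2) \<odot>\<^bsub>L\<^esub> (2 \<odot>\<^bsub>L\<^esub> E)" by simp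
    then show ?thesis using that(2,3) by (simp add: cs_assoc[symmetric])
  qed
  \<comment> \<open>At \<open>j = 0\<close> the truncated difference \<open>j - 1\<close> is
    harmless because \<open>cx 0 = 0\<close>.\<close>
  have eG: "act L ?e (G j) = (cx j * cx (j - 1)) \<odot>\<^bsub>L\<^esub> T (2 - int j)" for j
  proof -
    have lx: "lext L (\<lambda>e. act L e (G j)) (scale 2 (bvec ?e)) = 2 \<odot>\<^bsub>L\<^esub> act L ?e (G j)"
      by (intro lext_scale_bvec LR(1,2) zB Gc)
    have "act L ?x (act L ?x (G j)) = (-1) \<odot>\<^bsub>L\<^esub> act L ?x (act L ?x (G j)) \<oplus>\<^bsub>L\<^esub> 2 \<odot>\<^bsub>L\<^esub> act L ?e (G j)"
      by (rule br[OF zB[of Gx] zB[of Gx] Gc[of j], unfolded bracket_zero_modes lx sgn])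
    then have "act L ?e (G j) = act L ?x (act L ?x (G j))" by (rule double) (intro LR(2) zB Gc)+
    also have "\<dots> = cx j \<odot>\<^bsub>L\<^esub> act L ?x (T (1 - int j))" unfolding xG by (rule LR(4)[OF zB Tc])
    also have "\<dots> = (cx j * cx (j - 1)) \<odot>\<^bsub>L\<^esub> T (2 - int j)"
    proof (cases j)
      case 0
      then show ?thesis by (simp add: cx0 Tc LR(2)[OF zB])
    next
      case (Suc i)
      then have "T (1 - int j) = G i" using TG[of i] by simp
      then show ?thesis using xG[of i] Suc Tc by (simp add: cs_assoc)
    qed
    finally show ?thesis .
  qed
  have fG: "act L ?f (G j) = (-1) \<odot>\<^bsub>L\<^esub> G (Suc (Suc j))" for j
  proof -
    have "lext L (\<lambda>e. act L e (G j)) (scale (-2) (bvec ?f)) = (-2) \<odot>\<^bsub>L\<^esub> act L ?f (G j)"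
      by (intro lext_scale_bvec LR(1,2) zB Gc)
    also have "\<dots> = 2 \<odot>\<^bsub>L\<^esub> ((-1) \<odot>\<^bsub>L\<^esub> act L ?f (G j))"
      using LR(2)[OF zB Gc] by (simp add: cs_assoc[symmetric])
    finally have lx: "lext L (\<lambda>e. act L e (G j)) (scale (-2) (bvec ?f)) = 2 \<odot>\<^bsub>L\<^esub> ((-1) \<odot>\<^bsub>L\<^esub> act L ?f (G j))" .
    have "G (Suc (Suc j)) = (-1) \<odot>\<^bsub>L\<^esub> G (Suc (Suc j)) \<oplus>\<^bsub>L\<^esub> 2 \<odot>\<^bsub>L\<^esub> ((-1) \<odot>\<^bsub>L\<^esub> act L ?f (G j))"
      unfolding GS by (rule br[OF zB[of Gy] zB[of Gy] Gc[of j], unfolded bracket_zero_modes lx sgn])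
    then have "(-1) \<odot>\<^bsub>L\<^esub> act L ?f (G j) = G (Suc (Suc j))" by (rule double) (intro cs LR(2) zB Gc)+
    then have "(-1) \<odot>\<^bsub>L\<^esub> ((-1) \<odot>\<^bsub>L\<^esub> act L ?f (G j)) = (-1) \<odot>\<^bsub>L\<^esub> G (Suc (Suc j))" by simp
    then show ?thesis using LR(2)[OF zB] Gc by (simp add: cs_assoc[symmetric])
  qed
  have G0: "G j \<noteq> \<zero>\<^bsub>L\<^esub>" for j
  proof (induction j)
    case 0
    then show ?case using u by (simp add: G_def hw_vector_def)
  next
    case (Suc j)
    show ?case
    proof
      assume "G (Suc j) = \<zero>\<^bsub>L\<^esub>"
      then have "cx (Suc j) \<odot>\<^bsub>L\<^esub> G j = \<zero>\<^bsub>L\<^esub>" using xG[of "Suc j"] act0[OF zB] TG[of j] by simp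
      moreover have "cx (Suc j) \<noteq> 0" using nz[of "Suc j"] by (simp add: cx_def)
      ultimately show False using cs_eq_zero[OF Gc] Suc by blast
    qed
  qed
  define I where "I = {m0 - of_nat j | j. True}"
  define Ev where "Ev = {\<mu>. \<exists>j::int. \<mu> = m0 + 2 * of_int j}"
  have m0Ev: "m0 + of_int i \<in> Ev \<longleftrightarrow> even i" for i
    unfolding Ev_def by (rule coset_shift) (auto intro: exI[of _ 0])
  have Ij: "\<exists>j. \<mu> = m0 - of_nat j" if "\<mu> \<in> I" for \<mu> using that by (auto simp: I_def)
  have shift: "m0 - of_nat j + of_int i = m0 + of_int (i - int j)" for i j by simp
  have Imem: "m0 + of_int i \<in> I \<longleftrightarrow> i \<le> 0" for i
  proof
    assume "m0 + of_int i \<in> I"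
    then obtain j where "m0 + of_int i = m0 - of_nat j" using Ij by blast
    then have "of_int i = (of_int (- int j) :: complex)" by simp
    then have "i = - int j" by (simp only: of_int_eq_iff)
    then show "i \<le> 0" by simp
  next
    assume "i \<le> 0"
    then have "m0 + of_int i = m0 - of_nat (nat (- i))" by simp
    then show "m0 + of_int i \<in> I" unfolding I_def by blast
  qed
  have jEv: "m0 - of_nat j \<in> Ev \<longleftrightarrow> even j" for j using m0Ev[of "- int j"] by simp
  \<comment> \<open>The parity of the chain vectors, flipped throughout if \<open>p\<close> holds:
    the highest-weight vector is even, but its label has to be \<open>p\<close>.\<close>
  define pl where "pl \<mu> = (p \<noteq> (\<mu> \<notin> Ev))" for \<mu>
  have plj: "pl (m0 - of_nat j) = (p \<noteq> odd j)" for j by (simp add: pl_def jEv)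
  have cGe: "c_NS \<sigma> Ge (p \<noteq> odd j) (m0 - of_nat j) = cx j * cx (j - 1)" for j
  proof (cases j)
    case 0
    then show ?thesis using top by (cases p) (simp_all add: cx0 c_NS_def)
  next
    case (Suc i)
    then show ?thesis by (cases p; cases "odd i") (simp_all add: cx_def c_NS_def field_simps)
  qed
  interpret L: ground_states ?A k \<Delta> "c_NS \<sigma>" I Ev pl
  proof
    fix \<mu> g i assume "\<mu> \<in> I"
    then obtain j where j: "\<mu> = m0 - of_nat j" using Ij by blast
    show Evi: "\<mu> + of_int i \<in> Ev \<longleftrightarrow> (\<mu> \<in> Ev \<longleftrightarrow> even i)" for i
      unfolding j shift m0Ev jEv by auto
    show "pl (\<mu> + of_int (osp_wt g)) = (pl \<mu> \<noteq> odd_osp g)"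
      unfolding pl_def using Evi[of "osp_wt g"] even_osp_wt[of g] by auto
    show "c_NS \<sigma> g (pl \<mu>) \<mu> = 0" if out: "\<mu> + of_int (osp_wt g) \<notin> I"
    proof -
      have "\<not> osp_wt g - int j \<le> 0" using out unfolding j shift Imem .
      then have g: "int j < osp_wt g" by simp
      show ?thesis
      proof (cases g)
        case Ge
        then have "j = 0 \<or> j = 1" using g by auto
        then show ?thesis using cx0 unfolding j plj Ge cGe by auto
      next
        case Gx
        then show ?thesis using cx0 g unfolding j plj cx_def by simp
      qed (use g in simp_all)
    qed
  qed
  define G' where "G' \<mu> = G (nat \<lfloor>Re (m0 - \<mu>)\<rfloor>)" for \<mu>
  have G': "G' (m0 - of_nat j) = G j" for j by (simp add: G'_def)
  have tgt: "(if m0 - of_nat j + of_int i \<in> I then G' (m0 - of_nat j + of_int i) else \<zero>\<^bsub>L\<^esub>) = T (i - int j)" for i j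
  proof (cases "i - int j \<le> 0")
    case True
    have e: "m0 - of_nat j + of_int i = m0 - of_nat (nat (int j - i))" using True by simp
    have I1: "m0 - of_nat j + of_int i \<in> I" unfolding shift Imem by (rule True)
    show ?thesis unfolding if_P[OF I1] unfolding e G' using True by (simp add: T_def)
  next
    case False
    then show ?thesis using Imem[of "i - int j"] unfolding shift by (simp add: T_def)
  qed
  have "\<exists>\<theta>. L.presents L \<theta> L.Rad"
  proof (rule L.hw_presents[OF SL])
    show "I \<noteq> {}" by (auto simp: I_def)
    show "G' \<mu> \<in> (if \<mu> \<in> Ev then evens L else odds L)" if \<mu>: "\<mu> \<in> I" for \<mu>
    proof -
      obtain j where j: "\<mu> = m0 - of_nat j" using Ij[OF \<mu>] by blast
      show ?thesis unfolding j G' jEv using chain(2)[of j] by (cases "even j") auto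
    qed
    show "G' \<mu> \<noteq> \<zero>\<^bsub>L\<^esub>" if "\<mu> \<in> I" for \<mu> using Ij[OF that] G0 G' by auto
    show "act L a (G' \<mu>) = gcoef a (pl \<mu>) \<mu> \<odot>\<^bsub>L\<^esub>
        (if \<mu> + of_int (mode_wt a) \<in> I then G' (\<mu> + of_int (mode_wt a)) else \<zero>\<^bsub>L\<^esub>)"
      if a: "a \<in> basis ?A" "\<not> neg_mode a" and \<mu>: "\<mu> \<in> I" for a \<mu>
    proof -
      obtain j where j: "\<mu> = m0 - of_nat j" using Ij[OF \<mu>] by blast
      have "act L a (G j) = gcoef a (p \<noteq> odd j) (m0 - of_nat j) \<odot>\<^bsub>L\<^esub> T (mode_wt a - int j)"
      proof (cases a)
        case (Mode g n')
        show ?thesis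
        proof (cases "n' = 0")
          case False
          then have n': "n' > 0" using a(2) Mode by (simp add: neg_mode_def)
          then show ?thesis using chain(5)[of g n' j] a(1) Mode Tc by (simp add: gcoef_def)
        next
          case True
          have gc: "gcoef a (p \<noteq> odd j) (m0 - of_nat j) = c_NS \<sigma> g (p \<noteq> odd j) (m0 - of_nat j)"
            using Mode True by (simp add: gcoef_def)
          show ?thesis
          proof (cases g)
            case Ge
            then show ?thesis unfolding gc using eG[of j] cGe[of j] Mode True by simp
          next
            case Gh
            then show ?thesis unfolding gc using hG[of j] Mode True by (simp add: c_NS_def TG)
          next
            case Gf
            have "T (- 2 - int j) = G (Suc (Suc j))" using TG[of "Suc (Suc j)"] by simp
            then show ?thesis unfolding gc using fG[of j] Mode True Gf by (simp add: c_NS_def)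
          next
            case Gx
            then show ?thesis unfolding gc using xG[of j] Mode True by (simp add: cx_def)
          next
            case Gy
            have "T (- 1 - int j) = G (Suc j)" using TG[of "Suc j"] by simp
            then show ?thesis unfolding gc using GS[of j] Mode True Gy Gc[of "Suc j"] by (simp add: c_NS_def)
          qed
        qed
      next
        case Cent
        then show ?thesis using actC Gc[of j] by (simp add: gcoef_def TG)
      next
        case L0
        then show ?thesis using chain(4)[of j] by (simp add: gcoef_def TG)
      qed
      then show ?thesis unfolding j G' tgt plj .
    qed
  qed
  then obtain \<theta> where P: "L.presents L \<theta> L.Rad" by blast
  let ?\<nu> = "\<lambda>m :: nat. m0 + of_int s - of_nat m"
  obtain N :: nat where N: "\<And>W. W \<in> level_words n \<Longrightarrow> - word_wt W \<le> int N"
    using level_words_wt_bound by blast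
  have \<nu>: "?\<nu> m - of_int (word_wt W) = m0 + of_int (s - int m - word_wt W)" for m W by simp
  have words: "L.weight_words (?\<nu> m) n = level_words n" if m: "m \<ge> N + nat s" for m
  proof -
    have "?\<nu> m - of_int (word_wt W) \<in> I" if "W \<in> level_words n" for W
      unfolding \<nu> Imem using N[OF that] m by linarith
    then show ?thesis by (auto simp: L.weight_words_def)
  qed
  \<comment> \<open>The label of the target weight alternates with \<open>m\<close>, so both
    families must become generic; the common rank \<open>r\<close> then gives a limit.\<close>
  have pls: "(\<lambda>W. pl (?\<nu> m - of_int (word_wt W))) = pf (p \<noteq> odd (s - int m))" for m
    unfolding pl_def \<nu> m0Ev by (auto simp: fun_eq_iff pf_def)
  have ev: "\<forall>\<^sub>F m in sequentially. fn.dim (col (pf b) (?\<nu> m) ` level_words n) = r" for b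
    by (rule rank_spec_eventually[OF r]) (auto simp: inj_def)
  have "\<forall>\<^sub>F m in sequentially. string_function L (?\<nu> m) n = enat r"
    using ev[of True] ev[of False] eventually_ge_at_top[of "N + nat s"]
  proof eventually_elim
    case (elim m)
    have "fn.dim (col (pf (p \<noteq> odd (s - int m))) (?\<nu> m) ` level_words n) = r"
      using elim(1,2) by (cases "p \<noteq> odd (s - int m)") auto
    then show ?case using L.string_function_rank[OF P, of "?\<nu> m" n] words[OF elim(3)] pls by simp
  qed
  then show ?thesis by (rule tendsto_eventually)
qed

end


section \<open>String functions of relaxed highest-weight modules\<close>

text \<open>The map t -> -t-2 exchanges the solutions, so -\<mu>-\<alpha> belongs to the same
  \<open>q\<close>. If this weight were a natural number j, the square root of 1+2q would be j+1,
  and j would be a solution of larger real part than \<mu> = -j-2, against maximality.\<close>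

lemma admissible_weight_top:
  assumes "admissible_weight q \<mu>"
  shows "q = (- \<mu> - 2) * ((- \<mu> - 2) + 2) / 2" "- \<mu> - 2 \<notin> \<nat>"
proof -
  have q: "\<mu> * (\<mu> + 2) / 2 = q" using assms by (simp add: admissible_weight_def wform_def alpha_def)
  then show "q = (- \<mu> - 2) * ((- \<mu> - 2) + 2) / 2" by (simp add: algebra_simps)
  show "- \<mu> - 2 \<notin> \<nat>"
  proof
    assume "- \<mu> - 2 \<in> \<nat>"
    then obtain j where "- \<mu> - 2 = of_nat j" by (elim Nats_cases)
    then have \<mu>: "\<mu> = - of_nat j - 2" by (metis add.inverse_inverse add_diff_cancel_left' diff_add_cancel minus_diff_eq uminus_add_conv_diff)
    have q': "q = of_nat j * (of_nat j + 2) / 2" using q unfolding \<mu> by (simp add: algebra_simps)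
    have "1 + 2 * q = (of_nat j + 1)\<^sup>2" unfolding q' by (simp add: power2_eq_square field_simps)
    then have "csqrt (1 + 2 * q) = of_nat j + 1" by (simp add: csqrt_square)
    then have "csqrt (1 + 2 * q) \<in> \<int>" by simp
    moreover have "wform (of_nat j) (of_nat j + alpha) = q" unfolding q' by (simp add: wform_def alpha_def)
    ultimately have "Re (of_nat j) \<le> Re \<mu>" using assms by (auto simp: admissible_weight_def)
    then show False by (simp add: \<mu>)
  qed
qed

theorem theorem1:
  fixes k \<Delta> q \<sigma> :: complex and \<Lambda> :: "complex set"
  assumes "\<Lambda> \<in> weight_cosets"
  shows
    "(stringy (E_sl2 k \<Delta> \<Lambda> q) \<and>
      (\<forall>\<mu>. admissible_weight q \<mu> \<longrightarrow>
        (\<forall>L :: (mode, 'a) rep. simple_hw_rep affine_sl2 k \<Delta> (- \<mu> - alpha) L \<longrightarrow>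
          (\<forall>\<nu>\<in>\<Lambda>.
            is_coeff_limit (\<lambda>m. string_function L (- \<mu> - of_nat m * alpha))
              (string_function (E_sl2 k \<Delta> \<Lambda> q) \<nu>))))) \<and>
     (stringy (E_NS k \<Delta> \<Lambda> \<sigma>) \<and>
      (let \<mu> = (\<sigma> - 1/2) * omega in
        (\<sigma> - 1/2 \<notin> \<int> \<or> \<sigma> - 1/2 \<in> \<int> \<and> Re \<sigma> > 0 \<longrightarrow>
          (\<forall>L :: (mode, 'b) rep. simple_hw_rep affine_NS k \<Delta> (- \<mu> - omega) L \<longrightarrow>
            (\<forall>\<nu> \<in> \<Lambda> \<union> shift omega \<Lambda>.
              is_coeff_limit (\<lambda>m. string_function L (- \<mu> - of_nat m * omega))
                (string_function (E_NS k \<Delta> \<Lambda> \<sigma>) \<nu>)))) \<and>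
        (\<sigma> - 1/2 \<in> \<int> \<and> Re \<sigma> < 0 \<longrightarrow>
          (\<forall>L :: (mode, 'b) rep. simple_hw_rep affine_NS k \<Delta> \<mu> L \<longrightarrow>
            (\<forall>\<nu> \<in> \<Lambda> \<union> shift omega \<Lambda>.
              is_coeff_limit (\<lambda>m. string_function L (\<mu> - of_nat m * omega))
                (string_function (E_NS k \<Delta> \<Lambda> \<sigma>) \<nu>)))))) \<and>
     (R_stringy (E_R k \<Delta> \<Lambda> q) \<and>
      (\<forall>\<mu>. admissible_weight q \<mu> \<longrightarrow>
        (\<forall>L :: (mode, 'c) rep. simple_hw_rep affine_R k \<Delta> (- \<mu> - 2 * omega) L \<longrightarrow>
          (\<forall>\<nu>\<in>\<Lambda>.
            is_coeff_limit (\<lambda>m. string_function L (- \<mu> - 2 * of_nat m * omega))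
              (string_function (E_R k \<Delta> \<Lambda> q) \<nu>)) \<and>
          (\<forall>\<nu>\<in>shift omega \<Lambda>.
            is_coeff_limit (\<lambda>m. string_function L (- \<mu> - (2 * of_nat m + 1) * omega))
              (string_function (E_R k \<Delta> \<Lambda> q) \<nu>)))))"
proof (intro conjI)
  note coset = assms
  interpret S: sl2_type affine_sl2 k \<Delta> q by (rule sl2_type_sl2)
  interpret R: sl2_type affine_R k \<Delta> q by (rule sl2_type_R)
  interpret N: neveu_schwarz k \<Delta> \<sigma> .
  have "\<forall>n e. \<exists>r. S.rank_spec (\<lambda>_. False) (S.parity_words n e) r"
    by (auto intro!: S.rank_spec_exists simp: S.parity_words_def)
  then obtain rS where rS: "\<And>n e. S.rank_spec (\<lambda>_. False) (S.parity_words n e) (rS n e)" by metis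
  have "\<forall>n e. \<exists>r. R.rank_spec (\<lambda>_. False) (R.parity_words n e) r"
    by (auto intro!: R.rank_spec_exists simp: R.parity_words_def)
  then obtain rR where rR: "\<And>n e. R.rank_spec (\<lambda>_. False) (R.parity_words n e) (rR n e)" by metis
  have "\<forall>n b. \<exists>r. N.rank_spec (N.pf b) (N.level_words n) r" by (auto intro!: N.rank_spec_exists)
  then obtain rN where rN: "\<And>n b. N.rank_spec (N.pf b) (N.level_words n) (rN n b)" by metis
  have om: "omega = 1" by (simp add: omega_def alpha_def)
  show "stringy (E_sl2 k \<Delta> \<Lambda> q)"
  proof -
    have zero: "string_function (E_sl2 k \<Delta> \<Lambda> q) \<nu> = (\<lambda>_. 0)" if "\<nu> \<notin> \<Lambda>" for \<nu>
      using S.string_E_zero[OF coset _ that] by (auto simp: E_sl2_def affine_simps fun_eq_iff)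
    have "string_function (E_sl2 k \<Delta> \<Lambda> q) \<nu> = (\<lambda>n. enat (rS n True))" if "\<nu> \<in> \<Lambda>" for \<nu>
      using S.string_E[OF coset rS, of \<nu> True] that by (auto simp: E_sl2_def fun_eq_iff)
    then show ?thesis using zero unfolding stringy_def by metis
  qed
  show "\<forall>\<mu>. admissible_weight q \<mu> \<longrightarrow>
        (\<forall>L :: (mode, 'a) rep. simple_hw_rep affine_sl2 k \<Delta> (- \<mu> - alpha) L \<longrightarrow>
          (\<forall>\<nu>\<in>\<Lambda>. is_coeff_limit (\<lambda>m. string_function L (- \<mu> - of_nat m * alpha))
              (string_function (E_sl2 k \<Delta> \<Lambda> q) \<nu>)))"
    unfolding is_coeff_limit_def
  proof (intro allI impI ballI)
    fix \<mu> \<nu> n and L :: "(mode, 'a) rep"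
    assume H: "admissible_weight q \<mu>" "simple_hw_rep affine_sl2 k \<Delta> (- \<mu> - alpha) L" "\<nu> \<in> \<Lambda>"
    note top = admissible_weight_top[OF H(1)]
    have "(\<lambda>m. string_function L (- \<mu> - 2 + 2 - 2 * of_nat m - (if True then 0 else 1)) n) \<longlonglongrightarrow> enat (rS n True)"
      using H(2) by (intro S.string_L[OF _ top rS]) (simp add: alpha_def)
    moreover have "string_function (E_sl2 k \<Delta> \<Lambda> q) \<nu> n = enat (rS n True)"
      using S.string_E[OF coset rS, of \<nu> True] H(3) by (simp add: E_sl2_def)
    ultimately show "(\<lambda>m. string_function L (- \<mu> - of_nat m * alpha) n)
        \<longlonglongrightarrow> string_function (E_sl2 k \<Delta> \<Lambda> q) \<nu> n" by (simp add: alpha_def mult.commute)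
  qed
  have EN: "string_function (E_NS k \<Delta> \<Lambda> \<sigma>) \<nu> n = enat (rN n False)" if "\<nu> \<in> \<Lambda> \<union> shift omega \<Lambda>" for \<nu> n
    using N.string_E(1)[OF coset rN that] by (simp add: E_NS_def)
  have rN': "N.rank_spec (N.pf b) (N.level_words n) (rN n False)" for n b
    using rN[of b n] N.string_E(2)[OF coset rN, of n] by (cases b) auto
  show "stringy (E_NS k \<Delta> \<Lambda> \<sigma>)"
  proof -
    have zero: "string_function (E_NS k \<Delta> \<Lambda> \<sigma>) \<nu> = (\<lambda>_. 0)" if "\<nu> \<notin> \<Lambda> \<union> shift omega \<Lambda>" for \<nu>
      using N.string_E(3)[OF coset rN that] by (auto simp: E_NS_def fun_eq_iff)
    have "string_function (E_NS k \<Delta> \<Lambda> \<sigma>) \<nu> = (\<lambda>n. enat (rN n False))" if "\<nu> \<in> \<Lambda> \<union> shift omega \<Lambda>" for \<nu>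
      using EN[OF that] by auto
    then show ?thesis using zero unfolding stringy_def by metis
  qed
  show "let \<mu> = (\<sigma> - 1/2) * omega in
        (\<sigma> - 1/2 \<notin> \<int> \<or> \<sigma> - 1/2 \<in> \<int> \<and> Re \<sigma> > 0 \<longrightarrow>
          (\<forall>L :: (mode, 'b) rep. simple_hw_rep affine_NS k \<Delta> (- \<mu> - omega) L \<longrightarrow>
            (\<forall>\<nu> \<in> \<Lambda> \<union> shift omega \<Lambda>.
              is_coeff_limit (\<lambda>m. string_function L (- \<mu> - of_nat m * omega))
                (string_function (E_NS k \<Delta> \<Lambda> \<sigma>) \<nu>)))) \<and>
        (\<sigma> - 1/2 \<in> \<int> \<and> Re \<sigma> < 0 \<longrightarrow>
          (\<forall>L :: (mode, 'b) rep. simple_hw_rep affine_NS k \<Delta> \<mu> L \<longrightarrow>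
            (\<forall>\<nu> \<in> \<Lambda> \<union> shift omega \<Lambda>.
              is_coeff_limit (\<lambda>m. string_function L (\<mu> - of_nat m * omega))
                (string_function (E_NS k \<Delta> \<Lambda> \<sigma>) \<nu>))))"
    unfolding Let_def is_coeff_limit_def
  proof (intro conjI allI impI ballI)
    fix \<nu> n and L :: "(mode, 'b) rep"
    assume \<sigma>: "\<sigma> - 1/2 \<notin> \<int> \<or> \<sigma> - 1/2 \<in> \<int> \<and> Re \<sigma> > 0"
      and L: "simple_hw_rep affine_NS k \<Delta> (- ((\<sigma> - 1/2) * omega) - omega) L"
      and \<nu>: "\<nu> \<in> \<Lambda> \<union> shift omega \<Lambda>"
    let ?m0 = "- \<sigma> - 1/2"
    have "- ((\<sigma> - 1/2) * omega) - omega = ?m0" by (simp add: om)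
    with L have L': "simple_hw_rep affine_NS k \<Delta> ?m0 L" by (simp only:)
    \<comment> \<open>The label \<open>True\<close> makes \<beta> vanish at the highest weight
      -\<sigma>-1/2. Further down its value is -j/2 for even j and -(2\<sigma>+j)/2 for odd j; the
      latter vanishes only for negative \<sigma> in Z+1/2, the excluded case.\<close>
    have nz: "c_NS \<sigma> Gx (True \<noteq> odd j) (?m0 - of_nat j) \<noteq> 0" if j: "j > 0" for j :: nat
    proof (cases "odd j")
      case True
      show ?thesis
      proof
        assume "c_NS \<sigma> Gx (True \<noteq> odd j) (?m0 - of_nat j) = 0"
        then have s: "2 * \<sigma> = - of_nat j" using True by (simp add: c_NS_def)
        obtain l where l: "j = 2 * l + 1" using True by (elim oddE)
        have "\<sigma> - 1/2 = (2 * \<sigma>) / 2 - 1/2" by simp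
        also have "\<dots> = - of_nat l - 1" unfolding s l by (simp add: field_simps)
        finally have "\<sigma> - 1/2 = - of_nat l - 1" .
        then have "\<sigma> - 1/2 \<in> \<int>" by simp
        moreover have "Re (2 * \<sigma>) = - real j" unfolding s by simp
        ultimately show False using \<sigma> j by simp
      qed
    next
      case False
      then show ?thesis using j by (simp add: c_NS_def)
    qed
    \<comment> \<open>The offset 1 moves from the highest weight -\<mu>-\<omega> to the start -\<mu>
      of the sequence.\<close>
    have "(\<lambda>m. string_function L (?m0 + of_int 1 - of_nat m) n) \<longlonglongrightarrow> enat (rN n False)"
      by (rule N.string_L[OF L' _ nz rN']) (simp add: c_NS_def)
    moreover have "?m0 + of_int 1 - of_nat m = - ((\<sigma> - 1/2) * omega) - of_nat m * omega" for m
      by (simp add: om)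
    ultimately show "(\<lambda>m. string_function L (- ((\<sigma> - 1/2) * omega) - of_nat m * omega) n)
        \<longlonglongrightarrow> string_function (E_NS k \<Delta> \<Lambda> \<sigma>) \<nu> n" using EN[OF \<nu>, of n] by simp
  next
    fix \<nu> n and L :: "(mode, 'b) rep"
    assume \<sigma>: "\<sigma> - 1/2 \<in> \<int> \<and> Re \<sigma> < 0"
      and L: "simple_hw_rep affine_NS k \<Delta> ((\<sigma> - 1/2) * omega) L"
      and \<nu>: "\<nu> \<in> \<Lambda> \<union> shift omega \<Lambda>"
    let ?m0 = "\<sigma> - 1/2"
    have L': "simple_hw_rep affine_NS k \<Delta> ?m0 L" using L by (simp add: om)
    \<comment> \<open>Now the label \<open>False\<close> makes \<beta> vanish at the highest weight
      \<sigma>-1/2. For odd j the value (2\<sigma>-j)/2 is nonzero since \<sigma> is negative; for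
      even j it is again -j/2.\<close>
    have nz: "c_NS \<sigma> Gx (False \<noteq> odd j) (?m0 - of_nat j) \<noteq> 0" if j: "j > 0" for j :: nat
    proof (cases "odd j")
      case True
      show ?thesis
      proof
        assume "c_NS \<sigma> Gx (False \<noteq> odd j) (?m0 - of_nat j) = 0"
        then have "2 * \<sigma> = of_nat j" using True by (simp add: c_NS_def)
        then have "Re (2 * \<sigma>) = real j" by simp
        then show False using \<sigma> by simp
      qed
    next
      case False
      then show ?thesis using j by (simp add: c_NS_def)
    qed
    have "(\<lambda>m. string_function L (?m0 + of_int 0 - of_nat m) n) \<longlonglongrightarrow> enat (rN n False)"
      by (rule N.string_L[OF L' _ nz rN']) (simp add: c_NS_def)
    then show "(\<lambda>m. string_function L ((\<sigma> - 1/2) * omega - of_nat m * omega) n)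
        \<longlonglongrightarrow> string_function (E_NS k \<Delta> \<Lambda> \<sigma>) \<nu> n" using EN[OF \<nu>, of n] by (simp add: om)
  qed
  have ER: "string_function (E_R k \<Delta> \<Lambda> q) \<nu> n = enat (rR n e)" if "\<nu> \<in> (if e then \<Lambda> else shift omega \<Lambda>)" for \<nu> n e
    using R.string_E[OF coset rR that] by (simp add: E_R_def)
  show "R_stringy (E_R k \<Delta> \<Lambda> q)"
  proof -
    interpret D: relaxed affine_R k \<Delta> "c_sl2 q" \<Lambda> \<Lambda> "\<lambda>_. False" "dense_sl2 \<Lambda> q"
      by (rule R.relaxed_dense[OF coset])
    have even: "string_function (E_R k \<Delta> \<Lambda> q) \<nu> = (\<lambda>n. enat (rR n True))"
      if "\<nu> \<in> even_weights (E_R k \<Delta> \<Lambda> q)" for \<nu>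
      using ER[of \<nu> True] D.E_even_weights[of \<nu>] that by (auto simp: E_R_def fun_eq_iff)
    \<comment> \<open>An odd weight is an integer translate of an element of \<Lambda> but lies
      outside \<Lambda>, hence in \<Lambda>+\<omega>.\<close>
    have odd: "string_function (E_R k \<Delta> \<Lambda> q) \<nu> = (\<lambda>n. enat (rR n False))"
      if \<nu>: "\<nu> \<in> odd_weights (E_R k \<Delta> \<Lambda> q)" for \<nu>
    proof -
      obtain \<mu> j where j: "\<mu> \<in> \<Lambda>" "\<nu> = \<mu> + of_int j" "\<nu> \<notin> \<Lambda>"
        using D.E_odd_weights[of \<nu>] \<nu> by (auto simp: E_R_def)
      then have "odd j" using weight_cosets_shift[OF coset j(1)] by simp
      then have "\<mu> + of_int (j - 1) \<in> \<Lambda>" unfolding weight_cosets_shift[OF coset j(1)] by simp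
      moreover have "\<nu> = \<mu> + of_int (j - 1) + 1" unfolding j(2) by simp
      ultimately have "\<nu> \<in> shift omega \<Lambda>" unfolding shift_def om by blast
      then show ?thesis using ER[of \<nu> False] by auto
    qed
    show ?thesis unfolding R_stringy_def using even odd by metis
  qed
  show "\<forall>\<mu>. admissible_weight q \<mu> \<longrightarrow>
        (\<forall>L :: (mode, 'c) rep. simple_hw_rep affine_R k \<Delta> (- \<mu> - 2 * omega) L \<longrightarrow>
          (\<forall>\<nu>\<in>\<Lambda>.
            is_coeff_limit (\<lambda>m. string_function L (- \<mu> - 2 * of_nat m * omega))
              (string_function (E_R k \<Delta> \<Lambda> q) \<nu>)) \<and>
          (\<forall>\<nu>\<in>shift omega \<Lambda>.
            is_coeff_limit (\<lambda>m. string_function L (- \<mu> - (2 * of_nat m + 1) * omega))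
              (string_function (E_R k \<Delta> \<Lambda> q) \<nu>)))"
    unfolding is_coeff_limit_def
  proof (intro allI impI ballI conjI)
    fix \<mu> \<nu> n and L :: "(mode, 'c) rep"
    assume H: "admissible_weight q \<mu>" "simple_hw_rep affine_R k \<Delta> (- \<mu> - 2 * omega) L"
    note top = admissible_weight_top[OF H(1)]
    \<comment> \<open>Both Ramond limits are taken in the same module, along strings starting at
      -\<mu> and at -\<mu>-\<omega>.\<close>
    have lim: "(\<lambda>m. string_function L (- \<mu> - 2 + 2 - 2 * of_nat m - (if e then 0 else 1)) n) \<longlonglongrightarrow> enat (rR n e)" for e
      using H(2) by (intro R.string_L[OF _ top rR]) (simp add: om)
    show "(\<lambda>m. string_function L (- \<mu> - 2 * of_nat m * omega) n)
        \<longlonglongrightarrow> string_function (E_R k \<Delta> \<Lambda> q) \<nu> n" if "\<nu> \<in> \<Lambda>"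
      using lim[of True] ER[of \<nu> True n] that by (simp add: om)
    show "(\<lambda>m. string_function L (- \<mu> - (2 * of_nat m + 1) * omega) n)
        \<longlonglongrightarrow> string_function (E_R k \<Delta> \<Lambda> q) \<nu> n" if "\<nu> \<in> shift omega \<Lambda>"
      using lim[of False] ER[of \<nu> False n] that by (simp add: om diff_diff_eq)
  qed
qed

end
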